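(* The class of locally standard $T$-pseudomanifolds includes the following spaces with torus actions: (1) complete toric varieties; in particular, projective toric varieties; (2) compact locally standard $T$-manifolds; in particular, locally standard torus manifolds and, more specifically, quasitoric manifolds; (3) quasitoric orbifolds; in particular, quasitoric manifolds; (4) moment-angle manifolds; (5) locally $k$-standard $T$-manifolds. That is, each such space, with its filtration by orbit dimension (for suitable integers $l,n$), is a locally standard $T$-pseudomanifold.
   Context: **Conventions.** $U(1)=\{z\in\mathbb C:|z|=1\}$, $\mathbb C^\times=\mathbb C\setminus\{0\}$, $T=T^m\cong U(1)^m$; a subtorus is a connected closed subgroup. A map $f$ between $T^m$-spaces is weakly $T$-equivariant if $f(tx)=\psi(t)f(x)$ for some automorphism $\psi$ of $T^m$. **Open cone.** For compact Hausdorff $L$, $\mathring c(L)=L\times[0,1)/(L\times\{0\})$; $\mathring c(\emptyset)$ is a point. **Filtration by orbit dimension.** Let $X$ be a second-countable compact Hausdorff space (not necessarily connected) with a continuous $T^m$-action, all of whose isotropy groups $T_x$ are subtori. Given integers $l\ge 0$, $0\le n\le m$, put $X_{l+2i+(m-n)}=X_{l+2i+1+(m-n)}=\{x\in X:\dim T(x)\le i+(m-n)\}$, where $T(x)$ is the orbit of $x$. The filtration by orbit dimension is $\mathfrak X: X=X_{l+m+n}\supset X_{l+2(n-1)+(m-n)}\supset\cdots\supset X_{l+2i+(m-n)}\supset\cdots\supset X_{l+(m-n)}\supset\emptyset$. Standing assumptions: (1) $(X,\mathfrak X)$ is a manifold stratified space, i.e. it is a stratified space (filtered by closed subspaces, satisfying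 the frontier condition: $S\cap\overline{S'}\neq\emptyset$ implies $S\subset\overline{S'}$ for strata $S,S'$) and $X_{l+2i+(m-n)}\setminus X_{l+2(i-1)+(m-n)}$ is an $(l+2i+(m-n))$-dimensional topological manifold (possibly empty) for each $i$; (2) $\{x:\dim T(x)\le (m-n)-1\}=\emptyset$; (3) $X_{l+m+n}\supsetneq X_{l+m+n-2}$ (there are free orbits). Strata are connected components of the successive differences. **Locally standard $T$-pseudomanifold.** An $(l+m+n)$-dimensional locally standard $T$-pseudomanifold $(X,\mathfrak X)$ is defined by induction on $l+n$. For $n=l=0$: $X$ is a (finite) disjoint union of copies of $T^m$ with the multiplication action. For $n,l\ge0$, $l+n\ne0$: (1) $X_{l+m+n}\setminus X_{l+m+n-2}$ is dense in $X$; (2) for any $x\in X_{l+2i+(m-n)}\setminus X_{l+2(i-1)+(m-n)}$ there is a triple $(U_x,L_x,\varphi_x)$ where (a) $U_x$ is a $T$-invariant open neighborhood of $x$; (b) $L_x$ is a $(2n-2i-1)$-dimensional compact locally standard $T_x$-pseudomanifold, possibly empty, with an action of $T_x\cong T^{n-i}$; (c) $\varphi_x:U_x\to O^l\times(\Omega\times U(1)^{m-n})\times\mathring c(L_x)$ is a weakly equivariant homeomorphism, with $O^l\subset\mathbb R^l$ contractible open, $\Omega\subset(\mathbb C^\times)^i$ open and $U(1)^i$-invariant, and $T^m$ acting on the target via an isomorphism $T^m\cong T^m/T_x\times T_x\cong U(1)^{i+(m-n)}\times T^{n-i}$, where $U(1)^{i+(m-n)}$ acts on $\Omega\times U(1)^{m-n}$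 by standard multiplication and $T_x$ acts on $\mathring c(L_x)$ through the $L_x$-factor, trivially on $[0,1)$. The cone is filtered by $(\mathring c(L_x))_{j+1}=\mathring c((L_x)_j)$, $-1\le j\le 2n-2i-1$. **The classes of spaces.** - A complete toric variety is a normal complete complex algebraic variety of complex dimension $n$ with an action of $(\mathbb C^\times)^n$ having a dense orbit (isomorphic to $(\mathbb C^\times)^n$), equivalently the toric variety of a complete fan in $\mathbb R^n$; it is regarded in the analytic topology with the action of the compact torus $T^n=U(1)^n\subset(\mathbb C^\times)^n$. - A locally standard $T$-manifold is a smooth, connected, closed, orientable $2m$-dimensional manifold with a locally standard $T^m$-action, i.e. one locally weakly equivariantly diffeomorphic to invariant open subsets of $\mathbb C^m$ with the coordinatewise action. A locally standard torus manifold is one with non-empty fixed point set. A quasitoric manifold of dimension $2n$ is a smooth $2n$-manifold with locally standard $T^n$-action whose orbit space is a simple convex polytope. - Quasitoric orbifolds: let $P$ be an $n$-dimensional simple polytope and $\mu$ a characteristic function, assigning to each facet $F_j$ a primitive vector $\mu_j\in\mathbb Z^n$ such that $\mu_{i_1},\dots,\mu_{i_k}$ are linearly independent over $\mathbb Z$ whenever $F_{i_1}\cap\dots\cap F_{i_k}\ne\emptyset$. For a face $F=F_{i_1}\cap\dots\cap F_{i_k}$ of codimension $k$ let $T_F\subset T^n$ be the $k$-dimensional subtorus generated by the circles $\{(e^{2\pi i\mu_{1j}x},\dots,e^{2\pi i\mu_{nj}x}):x\in\mathbb R\}$, $j=i_1,\dots,i_k$. A quasitoric orbifold is (up to $T^n$-equivariant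 homeomorphism) a space $P\times T^n/\sim$, where $(p,t)\sim(q,s)$ iff $p=q$ and $t^{-1}s\in T_F$ for the face $F$ with $p$ in its relative interior. - A moment-angle manifold over an $n$-dimensional simple polytope $P$ with $m$ facets $F_1,\dots,F_m$ is (up to $T^m$-equivariant homeomorphism) $P\times T^m/\sim$, where $(p,t)\sim(q,s)$ iff $p=q$ and $t^{-1}s$ lies in the coordinate subtorus $\{(t_1,\dots,t_m): t_j=1 \text{ if } p\notin F_j\}$. - A locally $k$-standard $T$-manifold is a smooth $(2n+k)$-dimensional manifold with a smooth effective $T^{n+k}$-action that is locally weakly equivariantly modeled on $\mathbb C^n\times U(1)^k$ with the standard coordinatewise $T^{n+k}$-action and whose orbit space is an $n$-dimensional simple polytope. *)

theory Defs
  imports "HOL-Analysis.Analysis" "HOL-Algebra.Group_Action" "HOL-Algebra.Generated_Groups" "Jordan_Normal_Form.Determinant"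
begin

section \<open>Compact tori and their actions\<close>

text \<open>
  Points of \<open>\<complex>\<^sup>m\<close> and of \<open>T\<^sup>m = U(1)\<^sup>m\<close> are functions on all of \<open>nat\<close>; every coordinate of
  index \<open>\<ge> m\<close> is frozen to the neutral value \<open>1\<close>.  Thus the coordinatewise product of functions is both
  the multiplication of the torus and its standard action.  The topology is the product topology
  of \<open>nat \<Rightarrow> complex\<close>, which restricts to the usual one.
\<close>

definition coord_mult :: "(nat \<Rightarrow> complex) \<Rightarrow> (nat \<Rightarrow> complex) \<Rightarrow> nat \<Rightarrow> complex"
  where "coord_mult s t = (\<lambda>i. s i * t i)"

definition torus :: "nat \<Rightarrow> (nat \<Rightarrow> complex) monoid"
  where "torus m =
    \<lparr>carrier = {t. (\<forall>i<m. cmod (t i) = 1) \<and> (\<forall>i\<ge>m. t i = 1)}, monoid.mult = coord_mult, one = (\<lambda>_. 1)\<rparr>"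

abbreviation torus_top :: "nat \<Rightarrow> (nat \<Rightarrow> complex) topology"
  where "torus_top m \<equiv> top_of_set (carrier (torus m))"

definition top_group_iso ::
    "('g::topological_space) monoid \<Rightarrow> ('h::topological_space) monoid \<Rightarrow> ('g \<Rightarrow> 'h) set"
  where "top_group_iso G H =
    {h \<in> iso G H. homeomorphic_map (top_of_set (carrier G)) (top_of_set (carrier H)) h}"

definition subtorus :: "nat \<Rightarrow> (nat \<Rightarrow> complex) set \<Rightarrow> bool"
  where "subtorus m S \<longleftrightarrow>
    subgroup S (torus m) \<and> closedin (torus_top m) S \<and> connected S"

type_synonym 'x taction = "(nat \<Rightarrow> complex) \<Rightarrow> 'x \<Rightarrow> 'x"

text \<open>The restriction is due to the library's convention that the maps of a group action are extensional.\<close>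

definition torus_action :: "nat \<Rightarrow> 'x topology \<Rightarrow> 'x taction \<Rightarrow> bool"
  where "torus_action m X act \<longleftrightarrow>
    group_action (torus m) (topspace X) (\<lambda>t. restrict (act t) (topspace X)) \<and>
    continuous_map (prod_topology (torus_top m) X) X (\<lambda>(t, x). act t x)"

definition T_invariant :: "nat \<Rightarrow> 'x taction \<Rightarrow> 'x set \<Rightarrow> bool"
  where "T_invariant m act U \<longleftrightarrow> (\<forall>t\<in>carrier (torus m). \<forall>x\<in>U. act t x \<in> U)"

definition weakly_equivariant ::
    "nat \<Rightarrow> 'x taction \<Rightarrow> 'y taction \<Rightarrow> 'x set \<Rightarrow> ('x \<Rightarrow> 'y) \<Rightarrow> bool"
  where "weakly_equivariant m act act' U f \<longleftrightarrow>
    (\<exists>\<psi>\<in>top_group_iso (torus m) (torus m).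
       \<forall>t\<in>carrier (torus m). \<forall>x\<in>U. f (act t x) = act' (\<psi> t) (f x))"

abbreviation T_orbit :: "nat \<Rightarrow> 'x taction \<Rightarrow> 'x \<Rightarrow> 'x set"
  where "T_orbit m act x \<equiv> Group_Action.orbit (torus m) act x"

definition topological_manifold :: "nat \<Rightarrow> 'x topology \<Rightarrow> bool"
  where "topological_manifold d X \<longleftrightarrow>
    Hausdorff_space X \<and> second_countable X \<and>
    (\<forall>x\<in>topspace X. \<exists>U V. openin X U \<and> x \<in> U \<and> openin (Euclidean_space d) V \<and>
       subtopology X U homeomorphic_space subtopology (Euclidean_space d) V)"

definition orbit_dim :: "nat \<Rightarrow> 'x topology \<Rightarrow> 'x taction \<Rightarrow> 'x \<Rightarrow> nat"
  where "orbit_dim m X act x =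
    (THE d. topological_manifold d (subtopology X (T_orbit m act x)))"


section \<open>Open cones\<close>

text \<open>
  The points of the open cone are the apex \<open>None\<close> and \<open>Some (y, s)\<close> with \<open>y \<in> L\<close>, \<open>0 < s < 1\<close>.  For
  nonempty \<open>L\<close> the topology is the quotient topology of \<open>L \<times> [0,1)\<close>; for empty \<open>L\<close> it is the one-point space.
\<close>

definition cone_proj :: "'l \<times> real \<Rightarrow> ('l \<times> real) option"
  where "cone_proj p = (if snd p = 0 then None else Some p)"

definition cone_set :: "'l set \<Rightarrow> ('l \<times> real) option set"
  where "cone_set S = insert None (Some ` (S \<times> {0<..<1}))"

definition open_cone :: "'l topology \<Rightarrow> ('l \<times> real) option topology"
  where "open_cone L = topology (\<lambda>W. W \<subseteq> cone_set (topspace L) \<and>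
    openin (prod_topology L (top_of_set {0..<1})) {p \<in> topspace L \<times> {0..<1}. cone_proj p \<in> W})"

lemma openin_open_cone:
  "openin (open_cone L) W \<longleftrightarrow> W \<subseteq> cone_set (topspace L) \<and>
    openin (prod_topology L (top_of_set {0..<1})) {p \<in> topspace L \<times> {0..<1}. cone_proj p \<in> W}"
proof -
  let ?Y = "prod_topology L (top_of_set {0..<1::real})"
  let ?A = "topspace L \<times> {0..<1::real}"
  let ?P = "\<lambda>W. W \<subseteq> cone_set (topspace L) \<and> openin ?Y {p \<in> ?A. cone_proj p \<in> W}"
  have "istopology ?P"
    unfolding istopology_def
  proof (intro conjI allI impI)
    fix S T assume S: "?P S" and T: "?P T"
    show "S \<inter> T \<subseteq> cone_set (topspace L)" using S by blast
    have "{p \<in> ?A. cone_proj p \<in> S \<inter> T} = {p \<in> ?A. cone_proj p \<in> S} \<inter> {p \<in> ?A. cone_proj p \<in> T}"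
      by blast
    then show "openin ?Y {p \<in> ?A. cone_proj p \<in> S \<inter> T}" using S T by (simp add: openin_Int)
  next
    fix K assume K: "\<forall>W\<in>K. ?P W"
    show "\<Union>K \<subseteq> cone_set (topspace L)" using K by blast
    have "{p \<in> ?A. cone_proj p \<in> \<Union>K} = (\<Union>W\<in>K. {p \<in> ?A. cone_proj p \<in> W})" by blast
    then show "openin ?Y {p \<in> ?A. cone_proj p \<in> \<Union>K}" using K by auto
  qed
  then show ?thesis unfolding open_cone_def by simp
qed

lemma topspace_open_cone: "topspace (open_cone L) = cone_set (topspace L)"
proof -
  have "{p \<in> topspace L \<times> {0..<1::real}. cone_proj p \<in> cone_set (topspace L)} = topspace L \<times> {0..<1}"
    by (auto simp: cone_proj_def cone_set_def)
  then have "openin (open_cone L) (cone_set (topspace L))"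
    by (simp add: openin_open_cone openin_prod_Times_iff)
  then have "cone_set (topspace L) \<subseteq> topspace (open_cone L)" by (rule openin_subset)
  moreover have "topspace (open_cone L) \<subseteq> cone_set (topspace L)"
    using openin_topspace[of "open_cone L"] unfolding openin_open_cone by blast
  ultimately show ?thesis by blast
qed

lemma quotient_map_cone_proj:
  assumes "topspace L \<noteq> {}"
  shows "quotient_map (prod_topology L (top_of_set {0..<1})) (open_cone L) cone_proj"
proof -
  have "cone_proj ` (topspace L \<times> {0..<1}) = cone_set (topspace L)"
  proof
    show "cone_proj ` (topspace L \<times> {0..<1}) \<subseteq> cone_set (topspace L)"
      by (auto simp: cone_proj_def cone_set_def)
    obtain y where y: "y \<in> topspace L" using assms by blast
    have "None \<in> cone_proj ` (topspace L \<times> {0..<1::real})"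
      by (rule image_eqI[of _ _ "(y, 0)"]) (simp_all add: cone_proj_def y)
    moreover have "Some p \<in> cone_proj ` (topspace L \<times> {0..<1})"
      if "p \<in> topspace L \<times> {0<..<1}" for p
      using that by (intro image_eqI[of _ _ p]) (auto simp: cone_proj_def)
    ultimately show "cone_set (topspace L) \<subseteq> cone_proj ` (topspace L \<times> {0..<1})"
      by (auto simp: cone_set_def)
  qed
  then show ?thesis
    by (auto simp: quotient_map_def topspace_open_cone openin_open_cone)
qed


section \<open>The filtration by orbit dimension\<close>

text \<open>
  This is \<open>X\<^sub>j\<close> for an arbitrary integer \<open>j\<close>: for \<open>j = l + 2i + (m-n)\<close> and \<open>j = l + 2i + 1 + (m-n)\<close> the
  bound on the orbit dimension is \<open>i + (m-n)\<close>.
\<close>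

definition orbit_filtration ::
    "nat \<Rightarrow> nat \<Rightarrow> nat \<Rightarrow> 'x topology \<Rightarrow> 'x taction \<Rightarrow> int \<Rightarrow> 'x set"
  where "orbit_filtration l n m X act j =
    {x \<in> topspace X. int (orbit_dim m X act x) \<le>
       (j - int l - (int m - int n)) div 2 + (int m - int n)}"

definition stratum_union ::
    "nat \<Rightarrow> nat \<Rightarrow> nat \<Rightarrow> 'x topology \<Rightarrow> 'x taction \<Rightarrow> nat \<Rightarrow> 'x set"
  where "stratum_union l n m X act i =
    orbit_filtration l n m X act (int l + 2 * int i + (int m - int n)) -
    orbit_filtration l n m X act (int l + 2 * (int i - 1) + (int m - int n))"

definition strata :: "nat \<Rightarrow> nat \<Rightarrow> nat \<Rightarrow> 'x topology \<Rightarrow> 'x taction \<Rightarrow> 'x set set"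
  where "strata l n m X act =
    (\<Union>i\<in>{..n}. connected_components_of (subtopology X (stratum_union l n m X act i)))"

definition manifold_stratified ::
    "nat \<Rightarrow> nat \<Rightarrow> nat \<Rightarrow> 'x topology \<Rightarrow> 'x taction \<Rightarrow> bool"
  where "manifold_stratified l n m X act \<longleftrightarrow>
    (\<forall>j. closedin X (orbit_filtration l n m X act j)) \<and>
    (\<forall>S\<in>strata l n m X act. \<forall>S'\<in>strata l n m X act.
       S \<inter> X closure_of S' \<noteq> {} \<longrightarrow> S \<subseteq> X closure_of S') \<and>
    (\<forall>i\<le>n. topological_manifold (l + 2 * i + (m - n))
       (subtopology X (stratum_union l n m X act i)))"

definition orbit_filtered_T_space ::
    "nat \<Rightarrow> nat \<Rightarrow> nat \<Rightarrow> 'x topology \<Rightarrow> 'x taction \<Rightarrow> bool"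
  where "orbit_filtered_T_space l n m X act \<longleftrightarrow>
    n \<le> m \<and> compact_space X \<and> Hausdorff_space X \<and> second_countable X \<and> torus_action m X act \<and>
    (\<forall>x\<in>topspace X. subtorus m (stabilizer (torus m) act x)) \<and>
    manifold_stratified l n m X act \<and>
    {x \<in> topspace X. int (orbit_dim m X act x) \<le> (int m - int n) - 1} = {} \<and>
    orbit_filtration l n m X act (int (l + m + n) - 2) \<subset>
      orbit_filtration l n m X act (int (l + m + n))"


section \<open>Locally standard T-pseudomanifolds\<close>

definition disjoint_tori :: "nat \<Rightarrow> 'x topology \<Rightarrow> 'x taction \<Rightarrow> bool"
  where "disjoint_tori m X act \<longleftrightarrow>
    (\<exists>(k::nat) h. homeomorphic_map (prod_topology (discrete_topology {..<k}) (torus_top m)) X h \<and>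
       (\<forall>a<k. \<forall>s\<in>carrier (torus m). \<forall>t\<in>carrier (torus m).
          h (a, coord_mult t s) = act t (h (a, s))))"

text \<open>Points of \<open>(\<complex>\<^sup>\<times>)\<^sup>i\<close>, with the same padding as for the torus.\<close>

definition Cstar_power :: "nat \<Rightarrow> (nat \<Rightarrow> complex) set"
  where "Cstar_power i = {z. (\<forall>j<i. z j \<noteq> 0) \<and> (\<forall>j\<ge>i. z j = 1)}"

text \<open>
  The action of \<open>U(1)\<^bsup>i+r\<^esup> \<times> T\<^bsup>k\<^esup>\<close> on \<open>\<real>\<^sup>l \<times> ((\<complex>\<^sup>\<times>)\<^sup>i \<times> U(1)\<^sup>r) \<times> c(L)\<close>: the first \<open>i\<close> coordinates
  of the first factor rotate \<open>(\<complex>\<^sup>\<times>)\<^sup>i\<close>, its last \<open>r\<close> coordinates rotate \<open>U(1)\<^sup>r\<close>.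
\<close>

definition local_model_action ::
    "nat \<Rightarrow> nat \<Rightarrow> 'l taction \<Rightarrow> (nat \<Rightarrow> complex) \<times> (nat \<Rightarrow> complex) \<Rightarrow>
     (nat \<Rightarrow> real) \<times> ((nat \<Rightarrow> complex) \<times> (nat \<Rightarrow> complex)) \<times> ('l \<times> real) option \<Rightarrow>
     (nat \<Rightarrow> real) \<times> ((nat \<Rightarrow> complex) \<times> (nat \<Rightarrow> complex)) \<times> ('l \<times> real) option"
  where "local_model_action i r actL = (\<lambda>(a, b) (p, (w, u), c).
     (p, ((\<lambda>j. if j < i then a j * w j else w j), (\<lambda>j. if j < r then a (i + j) * u j else u j)),
      map_option (\<lambda>(y, s). (actL b y, s)) c))"

text \<open>
  Links of points in the \<open>i\<close>-th stratum, together with their filtration \<open>FL\<close>; the parameter \<open>Q\<close> is the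
  predicate ``locally standard T-pseudomanifold''.  A link has dimension \<open>2n-2i-1\<close>, hence it is the
  empty space for \<open>i = n\<close>; for \<open>i < n\<close> the density of the free orbits forces it to be nonempty.
\<close>

definition pseudomanifold_link ::
    "(nat \<Rightarrow> nat \<Rightarrow> nat \<Rightarrow> 'l topology \<Rightarrow> 'l taction \<Rightarrow> bool) \<Rightarrow>
     nat \<Rightarrow> nat \<Rightarrow> 'l topology \<Rightarrow> 'l taction \<Rightarrow> (int \<Rightarrow> 'l set) \<Rightarrow> bool"
  where "pseudomanifold_link Q n i L actL FL \<longleftrightarrow>
    (i = n \<and> topspace L = {} \<and> FL = (\<lambda>_. {})) \<or>
    (i < n \<and> (\<exists>l' n'. l' + (n - i) + n' = 2 * n - 2 * i - 1 \<and> Q l' n' (n - i) L actL \<and>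
                FL = orbit_filtration l' n' (n - i) L actL))"

text \<open>
  The homomorphism \<open>\<Psi>\<close> is the composite \<open>T\<^sup>m \<cong> T\<^sup>m/T\<^sub>x \<times> T\<^sub>x \<cong> U(1)\<^bsup>i+(m-n)\<^esup> \<times> T\<^bsup>n-i\<^esup>\<close>.  The last clause
  says that the chart respects the filtrations, the open cone being filtered by the open cones on the
  members of the filtration of the link with degrees shifted by one.
\<close>

definition pseudomanifold_chart ::
    "nat \<Rightarrow> nat \<Rightarrow> nat \<Rightarrow> 'x topology \<Rightarrow> 'x taction \<Rightarrow> nat \<Rightarrow> 'x \<Rightarrow> 'x set \<Rightarrow>
     'l topology \<Rightarrow> 'l taction \<Rightarrow> (int \<Rightarrow> 'l set) \<Rightarrow>
     ('x \<Rightarrow> (nat \<Rightarrow> real) \<times> ((nat \<Rightarrow> complex) \<times> (nat \<Rightarrow> complex)) \<times> ('l \<times> real) option) \<Rightarrow> bool"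
  where "pseudomanifold_chart l n m X act i x U L actL FL \<phi> \<longleftrightarrow>
    openin X U \<and> x \<in> U \<and> T_invariant m act U \<and>
    (\<exists>D \<Omega> \<Psi>.
       openin (Euclidean_space l) D \<and> contractible_space (subtopology (Euclidean_space l) D) \<and>
       openin (top_of_set (Cstar_power i)) \<Omega> \<and> T_invariant i coord_mult \<Omega> \<and>
       \<Psi> \<in> top_group_iso (torus m) (torus (i + (m - n)) \<times>\<times> torus (n - i)) \<and>
       \<Psi> ` stabilizer (torus m) act x = {\<one>\<^bsub>torus (i + (m - n))\<^esub>} \<times> carrier (torus (n - i)) \<and>
       homeomorphic_map (subtopology X U)
         (prod_topology (subtopology (Euclidean_space l) D)
            (prod_topology (prod_topology (top_of_set \<Omega>) (torus_top (m - n))) (open_cone L))) \<phi> \<and>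
       weakly_equivariant m act (\<lambda>t. local_model_action i (m - n) actL (\<Psi> t)) U \<phi> \<and>
       (\<forall>j\<in>{-1..2 * int n - 2 * int i - 1}.
          \<phi> ` (U \<inter> orbit_filtration l n m X act (int l + 2 * int i + (int m - int n) + (j + 1))) =
          D \<times> (\<Omega> \<times> carrier (torus (m - n))) \<times> cone_set (FL j)))"

definition pseudomanifold_step ::
    "(nat \<Rightarrow> nat \<Rightarrow> nat \<Rightarrow> 'l topology \<Rightarrow> 'l taction \<Rightarrow> bool) \<Rightarrow>
     nat \<Rightarrow> nat \<Rightarrow> nat \<Rightarrow> 'x topology \<Rightarrow> 'x taction \<Rightarrow> bool"
  where "pseudomanifold_step Q l n m X act \<longleftrightarrow>
    orbit_filtered_T_space l n m X act \<and>
    (if n = 0 \<and> l = 0 then disjoint_tori m X act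
     else X closure_of (orbit_filtration l n m X act (int (l + m + n)) -
              orbit_filtration l n m X act (int (l + m + n) - 2)) = topspace X \<and>
       (\<forall>i\<le>n. \<forall>x\<in>stratum_union l n m X act i.
          \<exists>U L actL FL \<phi>. pseudomanifold_link Q n i L actL FL \<and>
            pseudomanifold_chart l n m X act i x U L actL FL \<phi>))"

lemma pseudomanifold_step_mono [mono]:
  assumes "\<And>l n m L actL. Q l n m L actL \<longrightarrow> Q' l n m L actL"
  shows "pseudomanifold_step Q l n m X act \<longrightarrow> pseudomanifold_step Q' l n m X act"
proof -
  have "pseudomanifold_link Q n i L actL FL \<Longrightarrow> pseudomanifold_link Q' n i L actL FL"
    for i L actL FL
    unfolding pseudomanifold_link_def using assms by blast
  then show ?thesis
    unfolding pseudomanifold_step_def if_bool_eq_conj by blast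
qed

text \<open>
  The recursion on \<open>l + n\<close>: the parameters of a link satisfy \<open>l' + n' = n - i - 1\<close>, so that the least
  fixed point is the recursively defined predicate.  HOL cannot quantify over all types, so links
  are carried by the type \<open>nat \<Rightarrow> real\<close> (with an arbitrary topology on a subset of it).  There is no loss
  of generality: by Urysohn's theorem every second countable compact Hausdorff space is homeomorphic to a
  subspace of the Hilbert cube.
\<close>

inductive link_pseudomanifold ::
    "nat \<Rightarrow> nat \<Rightarrow> nat \<Rightarrow> (nat \<Rightarrow> real) topology \<Rightarrow> (nat \<Rightarrow> real) taction \<Rightarrow> bool"
  where "pseudomanifold_step link_pseudomanifold l n m L actL \<Longrightarrow> link_pseudomanifold l n m L actL"

definition locally_standard_T_pseudomanifold ::
    "nat \<Rightarrow> nat \<Rightarrow> nat \<Rightarrow> 'x topology \<Rightarrow> 'x taction \<Rightarrow> bool"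
  where "locally_standard_T_pseudomanifold l n m X act \<longleftrightarrow>
    pseudomanifold_step link_pseudomanifold l n m X act"

lemma link_pseudomanifold_iff:
  "link_pseudomanifold l n m L actL \<longleftrightarrow> locally_standard_T_pseudomanifold l n m L actL"
  unfolding locally_standard_T_pseudomanifold_def by (subst link_pseudomanifold.simps) blast


section \<open>Toric varieties\<close>

text \<open>
  The standing data of this section are \<open>n\<close> and an injective enumeration \<open>e\<close> of \<open>n\<close> elements of the
  standard basis of a Euclidean space; \<open>\<real>\<^sup>n\<close> is their span.  (Taking a span rather than the whole space
  admits \<open>n = 0\<close>.)  The lattice \<open>\<int>\<^sup>n\<close> is identified with its dual by the inner product.
\<close>

definition coordinate_frame :: "nat \<Rightarrow> (nat \<Rightarrow> 'a::euclidean_space) \<Rightarrow> bool"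
  where "coordinate_frame n e \<longleftrightarrow> inj_on e {..<n} \<and> e ` {..<n} \<subseteq> Basis"

definition lattice_points :: "nat \<Rightarrow> (nat \<Rightarrow> 'a::euclidean_space) \<Rightarrow> 'a set"
  where "lattice_points n e = {v \<in> span (e ` {..<n}). \<forall>i<n. inner v (e i) \<in> \<int>}"

definition rational_cone :: "nat \<Rightarrow> (nat \<Rightarrow> 'a::euclidean_space) \<Rightarrow> 'a set \<Rightarrow> bool"
  where "rational_cone n e \<sigma> \<longleftrightarrow>
    (\<exists>G. finite G \<and> G \<subseteq> lattice_points n e \<and> \<sigma> = convex_cone hull G)"

definition strongly_convex_cone :: "'a::euclidean_space set \<Rightarrow> bool"
  where "strongly_convex_cone \<sigma> \<longleftrightarrow> \<sigma> \<inter> uminus ` \<sigma> = {0}"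

definition fan :: "nat \<Rightarrow> (nat \<Rightarrow> 'a::euclidean_space) \<Rightarrow> 'a set set \<Rightarrow> bool"
  where "fan n e \<Sigma> \<longleftrightarrow>
    finite \<Sigma> \<and> (\<forall>\<sigma>\<in>\<Sigma>. rational_cone n e \<sigma> \<and> strongly_convex_cone \<sigma>) \<and>
    (\<forall>\<sigma>\<in>\<Sigma>. \<forall>\<tau>. \<tau> face_of \<sigma> \<and> \<tau> \<noteq> {} \<longrightarrow> \<tau> \<in> \<Sigma>) \<and>
    (\<forall>\<sigma>\<in>\<Sigma>. \<forall>\<tau>\<in>\<Sigma>. (\<sigma> \<inter> \<tau>) face_of \<sigma> \<and> (\<sigma> \<inter> \<tau>) face_of \<tau>)"

definition complete_fan :: "nat \<Rightarrow> (nat \<Rightarrow> 'a::euclidean_space) \<Rightarrow> 'a set set \<Rightarrow> bool"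
  where "complete_fan n e \<Sigma> \<longleftrightarrow> fan n e \<Sigma> \<and> \<Union>\<Sigma> = span (e ` {..<n})"

definition dual_semigroup :: "nat \<Rightarrow> (nat \<Rightarrow> 'a::euclidean_space) \<Rightarrow> 'a set \<Rightarrow> 'a set"
  where "dual_semigroup n e \<sigma> = {u \<in> lattice_points n e. \<forall>v\<in>\<sigma>. 0 \<le> inner u v}"

text \<open>
  The closed points of the affine toric variety \<open>U\<^sub>\<sigma> = Spec \<complex>[S\<^sub>\<sigma>]\<close>, where \<open>S\<^sub>\<sigma>\<close> is the dual semigroup,
  are the homomorphisms from \<open>S\<^sub>\<sigma>\<close> to the multiplicative monoid \<open>\<complex>\<close>.  Evaluation at finitely many
  generators of \<open>S\<^sub>\<sigma>\<close> embeds \<open>U\<^sub>\<sigma>\<close> in some \<open>\<complex>\<^sup>N\<close>, so the analytic topology is that of pointwise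
  convergence.
\<close>

definition affine_toric_points :: "nat \<Rightarrow> (nat \<Rightarrow> 'a::euclidean_space) \<Rightarrow> 'a set \<Rightarrow> ('a \<Rightarrow> complex) set"
  where "affine_toric_points n e \<sigma> =
    {\<gamma> \<in> extensional (dual_semigroup n e \<sigma>). \<gamma> 0 = 1 \<and>
      (\<forall>u\<in>dual_semigroup n e \<sigma>. \<forall>u'\<in>dual_semigroup n e \<sigma>. \<gamma> (u + u') = \<gamma> u * \<gamma> u')}"

definition affine_toric_variety ::
    "nat \<Rightarrow> (nat \<Rightarrow> 'a::euclidean_space) \<Rightarrow> 'a set \<Rightarrow> ('a \<Rightarrow> complex) topology"
  where "affine_toric_variety n e \<sigma> =
    subtopology (product_topology (\<lambda>_. euclidean) (dual_semigroup n e \<sigma>)) (affine_toric_points n e \<sigma>)"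

definition torus_character ::
    "nat \<Rightarrow> (nat \<Rightarrow> 'a::euclidean_space) \<Rightarrow> 'a \<Rightarrow> (nat \<Rightarrow> complex) \<Rightarrow> complex"
  where "torus_character n e u t = (\<Prod>i<n. t i powi \<lfloor>inner u (e i)\<rfloor>)"

definition affine_toric_action ::
    "nat \<Rightarrow> (nat \<Rightarrow> 'a::euclidean_space) \<Rightarrow> 'a set \<Rightarrow> ('a \<Rightarrow> complex) taction"
  where "affine_toric_action n e \<sigma> t \<gamma> =
    (\<lambda>u\<in>dual_semigroup n e \<sigma>. torus_character n e u t * \<gamma> u)"

text \<open>
  The space \<open>X\<close> with its \<open>T\<^sup>n\<close>-action is, up to equivariant homeomorphism, obtained from the disjoint
  union of all \<open>U\<^sub>\<sigma>\<close> by gluing \<open>U\<^sub>\<sigma>\<close> and \<open>U\<^bsub>\<sigma>'\<^esub>\<close> along the common open subset \<open>U\<^bsub>\<sigma> \<inter> \<sigma>'\<^esub>\<close>, which is embedded by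
  restriction of homomorphisms.
\<close>

definition toric_variety_of_fan ::
    "nat \<Rightarrow> (nat \<Rightarrow> 'a::euclidean_space) \<Rightarrow> 'a set set \<Rightarrow> 'x topology \<Rightarrow> 'x taction \<Rightarrow> bool"
  where "toric_variety_of_fan n e \<Sigma> X act \<longleftrightarrow>
    torus_action n X act \<and>
    (\<exists>q. quotient_map (sum_topology (affine_toric_variety n e) \<Sigma>) X q \<and>
       (\<forall>\<sigma>\<in>\<Sigma>. \<forall>\<sigma>'\<in>\<Sigma>. \<forall>\<gamma>\<in>affine_toric_points n e \<sigma>. \<forall>\<gamma>'\<in>affine_toric_points n e \<sigma>'.
          q (\<sigma>, \<gamma>) = q (\<sigma>', \<gamma>') \<longleftrightarrow>
          (\<exists>\<delta>\<in>affine_toric_points n e (\<sigma> \<inter> \<sigma>').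
             restrict \<delta> (dual_semigroup n e \<sigma>) = \<gamma> \<and> restrict \<delta> (dual_semigroup n e \<sigma>') = \<gamma>')) \<and>
       (\<forall>t\<in>carrier (torus n). \<forall>\<sigma>\<in>\<Sigma>. \<forall>\<gamma>\<in>affine_toric_points n e \<sigma>.
          q (\<sigma>, affine_toric_action n e \<sigma> t \<gamma>) = act t (q (\<sigma>, \<gamma>))))"

definition complete_toric_variety ::
    "nat \<Rightarrow> (nat \<Rightarrow> 'a::euclidean_space) \<Rightarrow> 'a set set \<Rightarrow> 'x topology \<Rightarrow> 'x taction \<Rightarrow> bool"
  where "complete_toric_variety n e \<Sigma> X act \<longleftrightarrow>
    coordinate_frame n e \<and> complete_fan n e \<Sigma> \<and> toric_variety_of_fan n e \<Sigma> X act"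

definition full_lattice_polytope :: "nat \<Rightarrow> (nat \<Rightarrow> 'a::euclidean_space) \<Rightarrow> 'a set \<Rightarrow> bool"
  where "full_lattice_polytope n e P \<longleftrightarrow>
    polytope P \<and> P \<subseteq> span (e ` {..<n}) \<and> aff_dim P = int n \<and>
    (\<forall>v. {v} face_of P \<longrightarrow> v \<in> lattice_points n e)"

definition normal_fan :: "nat \<Rightarrow> (nat \<Rightarrow> 'a::euclidean_space) \<Rightarrow> 'a set \<Rightarrow> 'a set set"
  where "normal_fan n e P =
    {{u \<in> span (e ` {..<n}). \<forall>v\<in>F. \<forall>w\<in>P. inner u v \<le> inner u w} | F. F face_of P \<and> F \<noteq> {}}"

definition projective_toric_variety ::
    "nat \<Rightarrow> (nat \<Rightarrow> 'a::euclidean_space) \<Rightarrow> 'a set \<Rightarrow> 'x topology \<Rightarrow> 'x taction \<Rightarrow> bool"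
  where "projective_toric_variety n e P X act \<longleftrightarrow>
    coordinate_frame n e \<and> full_lattice_polytope n e P \<and>
    toric_variety_of_fan n e (normal_fan n e P) X act"


section \<open>Smooth manifolds\<close>

text \<open>As in \<^const>\<open>Euclidean_space\<close>, points of \<open>\<real>\<^sup>d\<close> are functions \<open>nat \<Rightarrow> real\<close> vanishing from \<open>d\<close> on.\<close>

definition partial_deriv :: "nat \<Rightarrow> ((nat \<Rightarrow> real) \<Rightarrow> real) \<Rightarrow> (nat \<Rightarrow> real) \<Rightarrow> real"
  where "partial_deriv i f x = deriv (\<lambda>h. f (x(i := h))) (x i)"

primrec Ck_on :: "nat \<Rightarrow> nat \<Rightarrow> (nat \<Rightarrow> real) set \<Rightarrow> ((nat \<Rightarrow> real) \<Rightarrow> real) \<Rightarrow> bool"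
  where
    "Ck_on 0 d S f \<longleftrightarrow> continuous_map (subtopology (Euclidean_space d) S) euclideanreal f"
  | "Ck_on (Suc k) d S f \<longleftrightarrow>
       continuous_map (subtopology (Euclidean_space d) S) euclideanreal f \<and>
       (\<forall>i<d. (\<forall>x\<in>S. (\<lambda>h. f (x(i := h))) field_differentiable (at (x i))) \<and>
              Ck_on k d S (partial_deriv i f))"

definition smooth_fun_on :: "nat \<Rightarrow> (nat \<Rightarrow> real) set \<Rightarrow> ((nat \<Rightarrow> real) \<Rightarrow> nat \<Rightarrow> real) \<Rightarrow> bool"
  where "smooth_fun_on d S f \<longleftrightarrow> (\<forall>k i. Ck_on k d S (\<lambda>x. f x i))"

type_synonym 'x chart = "'x set \<times> ('x \<Rightarrow> nat \<Rightarrow> real)"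

definition smooth_atlas :: "nat \<Rightarrow> 'x topology \<Rightarrow> 'x chart set \<Rightarrow> bool"
  where "smooth_atlas d X A \<longleftrightarrow>
    topspace X = (\<Union>(U, \<phi>)\<in>A. U) \<and>
    (\<forall>(U, \<phi>)\<in>A. openin X U \<and> openin (Euclidean_space d) (\<phi> ` U) \<and>
       homeomorphic_map (subtopology X U) (subtopology (Euclidean_space d) (\<phi> ` U)) \<phi>) \<and>
    (\<forall>(U, \<phi>)\<in>A. \<forall>(V, \<psi>)\<in>A. smooth_fun_on d (\<phi> ` (U \<inter> V)) (\<psi> \<circ> inv_into U \<phi>))"

definition smooth_manifold :: "nat \<Rightarrow> 'x topology \<Rightarrow> 'x chart set \<Rightarrow> bool"
  where "smooth_manifold d X A \<longleftrightarrow> Hausdorff_space X \<and> second_countable X \<and> smooth_atlas d X A"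

definition orientable_manifold :: "nat \<Rightarrow> 'x topology \<Rightarrow> 'x chart set \<Rightarrow> bool"
  where "orientable_manifold d X A \<longleftrightarrow>
    (\<exists>B. smooth_atlas d X B \<and> smooth_atlas d X (A \<union> B) \<and>
       (\<forall>(U, \<phi>)\<in>B. \<forall>(V, \<psi>)\<in>B. \<forall>x\<in>\<phi> ` (U \<inter> V).
          0 < Determinant.det
                (mat d d (\<lambda>(i, j). partial_deriv j (\<lambda>y. (\<psi> \<circ> inv_into U \<phi>) y i) x))))"

text \<open>Smoothness in charts; continuity of \<open>f\<close> is required separately where this is used.\<close>

definition smooth_map_on ::
    "nat \<Rightarrow> 'x chart set \<Rightarrow> 'x set \<Rightarrow> ('x \<Rightarrow> 'y) \<Rightarrow> 'y chart set \<Rightarrow> bool"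
  where "smooth_map_on d A U f B \<longleftrightarrow>
    (\<forall>(W, \<phi>)\<in>A. \<forall>(V, \<psi>)\<in>B.
       smooth_fun_on d (\<phi> ` {x \<in> W \<inter> U. f x \<in> V}) (\<psi> \<circ> f \<circ> inv_into W \<phi>))"

definition diffeo_on ::
    "nat \<Rightarrow> 'x topology \<Rightarrow> 'x chart set \<Rightarrow> 'x set \<Rightarrow> 'y topology \<Rightarrow> 'y chart set \<Rightarrow> 'y set \<Rightarrow>
     ('x \<Rightarrow> 'y) \<Rightarrow> bool"
  where "diffeo_on d X A U Y B V f \<longleftrightarrow>
    homeomorphic_map (subtopology X U) (subtopology Y V) f \<and>
    smooth_map_on d A U f B \<and> smooth_map_on d B V (inv_into U f) A"

definition product_atlas :: "nat \<Rightarrow> 'x chart set \<Rightarrow> 'y chart set \<Rightarrow> ('x \<times> 'y) chart set"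
  where "product_atlas d A B =
    {(U \<times> V, (\<lambda>(x, y) i. if i < d then \<phi> x i else \<psi> y (i - d))) | U \<phi> V \<psi>. (U, \<phi>) \<in> A \<and> (V, \<psi>) \<in> B}"

text \<open>
  \<open>\<complex>\<^sup>n \<times> U(1)\<^sup>k\<close>, padded by \<open>1\<close>; for \<open>n = 0\<close> this is the torus \<open>T\<^sup>k\<close>, for \<open>k = 0\<close> it is \<open>\<complex>\<^sup>n\<close>.  The
  charts are the local inverses of the parametrization by real and imaginary parts of the first \<open>n\<close>
  coordinates and arguments of the last \<open>k\<close> coordinates.
\<close>

definition standard_model :: "nat \<Rightarrow> nat \<Rightarrow> (nat \<Rightarrow> complex) set"
  where "standard_model n k =
    {z. (\<forall>j. n \<le> j \<and> j < n + k \<longrightarrow> cmod (z j) = 1) \<and> (\<forall>j\<ge>n + k. z j = 1)}"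

definition standard_param :: "nat \<Rightarrow> nat \<Rightarrow> (nat \<Rightarrow> real) \<Rightarrow> nat \<Rightarrow> complex"
  where "standard_param n k x = (\<lambda>j.
    if j < n then Complex (x (2 * j)) (x (2 * j + 1))
    else if j < n + k then cis (x (2 * n + (j - n)))
    else 1)"

definition standard_atlas :: "nat \<Rightarrow> nat \<Rightarrow> (nat \<Rightarrow> complex) chart set"
  where "standard_atlas n k =
    {(standard_param n k ` W, inv_into W (standard_param n k)) | W.
       openin (Euclidean_space (2 * n + k)) W \<and> inj_on (standard_param n k) W}"

definition smooth_torus_action :: "nat \<Rightarrow> 'x topology \<Rightarrow> 'x chart set \<Rightarrow> nat \<Rightarrow> 'x taction \<Rightarrow> bool"
  where "smooth_torus_action d X A m act \<longleftrightarrow>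
    torus_action m X act \<and>
    smooth_map_on (m + d) (product_atlas m (standard_atlas 0 m) A)
      (carrier (torus m) \<times> topspace X) (\<lambda>(t, x). act t x) A"

definition effective_action :: "nat \<Rightarrow> 'x topology \<Rightarrow> 'x taction \<Rightarrow> bool"
  where "effective_action m X act \<longleftrightarrow>
    (\<forall>t\<in>carrier (torus m). (\<forall>x\<in>topspace X. act t x = x) \<longrightarrow> t = \<one>\<^bsub>torus m\<^esub>)"

text \<open>The \<open>T\<^bsup>n+k\<^esup>\<close>-action is locally weakly equivariantly diffeomorphic to that on \<open>\<complex>\<^sup>n \<times> U(1)\<^sup>k\<close>.\<close>

definition locally_modelled ::
    "nat \<Rightarrow> nat \<Rightarrow> 'x topology \<Rightarrow> 'x chart set \<Rightarrow> 'x taction \<Rightarrow> bool"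
  where "locally_modelled n k X A act \<longleftrightarrow>
    (\<forall>x\<in>topspace X. \<exists>U V \<phi>.
       openin X U \<and> x \<in> U \<and> T_invariant (n + k) act U \<and>
       openin (top_of_set (standard_model n k)) V \<and> T_invariant (n + k) coord_mult V \<and>
       diffeo_on (2 * n + k) X A U (top_of_set (standard_model n k)) (standard_atlas n k) V \<phi> \<and>
       weakly_equivariant (n + k) act coord_mult U \<phi>)"

definition locally_standard_T_manifold ::
    "nat \<Rightarrow> 'x topology \<Rightarrow> 'x chart set \<Rightarrow> 'x taction \<Rightarrow> bool"
  where "locally_standard_T_manifold m X A act \<longleftrightarrow>
    smooth_manifold (2 * m) X A \<and> topspace X \<noteq> {} \<and> connected_space X \<and> compact_space X \<and>
    orientable_manifold (2 * m) X A \<and> torus_action m X act \<and> locally_modelled m 0 X A act"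

definition locally_standard_torus_manifold ::
    "nat \<Rightarrow> 'x topology \<Rightarrow> 'x chart set \<Rightarrow> 'x taction \<Rightarrow> bool"
  where "locally_standard_torus_manifold m X A act \<longleftrightarrow>
    locally_standard_T_manifold m X A act \<and>
    (\<exists>x\<in>topspace X. \<forall>t\<in>carrier (torus m). act t x = x)"


section \<open>Spaces over simple polytopes\<close>

definition simple_polytope :: "nat \<Rightarrow> 'p::euclidean_space set \<Rightarrow> bool"
  where "simple_polytope n P \<longleftrightarrow>
    polytope P \<and> aff_dim P = int n \<and>
    (\<forall>v. {v} face_of P \<longrightarrow> card {F. F facet_of P \<and> v \<in> F} = n)"

text \<open>
  The orbit space, which for an action modelled on \<open>\<complex>\<^sup>n \<times> U(1)\<^sup>k\<close> is a manifold with corners, is identified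
  with \<open>P\<close> as a manifold with corners: orbits of dimension \<open>d + k\<close> correspond to points in the relative
  interiors of \<open>d\<close>-dimensional faces.
\<close>

definition orbit_space_polytope ::
    "nat \<Rightarrow> nat \<Rightarrow> 'x topology \<Rightarrow> 'x taction \<Rightarrow> 'p::euclidean_space set \<Rightarrow> bool"
  where "orbit_space_polytope n k X act P \<longleftrightarrow>
    (\<exists>\<pi>. quotient_map X (top_of_set P) \<pi> \<and>
       (\<forall>x\<in>topspace X. \<forall>y\<in>topspace X. \<pi> x = \<pi> y \<longleftrightarrow> y \<in> T_orbit (n + k) act x) \<and>
       (\<forall>x\<in>topspace X. \<forall>F. F face_of P \<and> \<pi> x \<in> rel_interior F \<longrightarrow>
          int (orbit_dim (n + k) X act x) = aff_dim F + int k))"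

definition quasitoric_manifold ::
    "nat \<Rightarrow> 'p::euclidean_space set \<Rightarrow> 'x topology \<Rightarrow> 'x chart set \<Rightarrow> 'x taction \<Rightarrow> bool"
  where "quasitoric_manifold n P X A act \<longleftrightarrow>
    simple_polytope n P \<and> smooth_manifold (2 * n) X A \<and> torus_action n X act \<and>
    locally_modelled n 0 X A act \<and> orbit_space_polytope n 0 X act P"

definition locally_k_standard_T_manifold ::
    "nat \<Rightarrow> nat \<Rightarrow> 'p::euclidean_space set \<Rightarrow> 'x topology \<Rightarrow> 'x chart set \<Rightarrow> 'x taction \<Rightarrow> bool"
  where "locally_k_standard_T_manifold n k P X A act \<longleftrightarrow>
    simple_polytope n P \<and> smooth_manifold (2 * n + k) X A \<and>
    smooth_torus_action (2 * n + k) X A (n + k) act \<and> effective_action (n + k) X act \<and>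
    locally_modelled n k X A act \<and> orbit_space_polytope n k X act P"

definition characteristic_function ::
    "nat \<Rightarrow> 'p::euclidean_space set \<Rightarrow> ('p set \<Rightarrow> nat \<Rightarrow> int) \<Rightarrow> bool"
  where "characteristic_function n P \<mu> \<longleftrightarrow>
    (\<forall>F. F facet_of P \<longrightarrow> Gcd (\<mu> F ` {..<n}) = 1) \<and>
    (\<forall>\<F>. \<F> \<subseteq> {F. F facet_of P} \<and> \<Inter>\<F> \<noteq> {} \<longrightarrow>
       (\<forall>c :: 'p set \<Rightarrow> int. (\<forall>i<n. (\<Sum>F\<in>\<F>. c F * \<mu> F i) = 0) \<longrightarrow> (\<forall>F\<in>\<F>. c F = 0)))"

definition circle_subgroup :: "nat \<Rightarrow> (nat \<Rightarrow> int) \<Rightarrow> (nat \<Rightarrow> complex) set"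
  where "circle_subgroup n v =
    range (\<lambda>x::real. \<lambda>i. if i < n then cis (2 * pi * of_int (v i) * x) else 1)"

definition face_torus ::
    "nat \<Rightarrow> 'p::euclidean_space set \<Rightarrow> ('p set \<Rightarrow> nat \<Rightarrow> int) \<Rightarrow> 'p set \<Rightarrow> (nat \<Rightarrow> complex) set"
  where "face_torus n P \<mu> F =
    generate (torus n) (\<Union>G\<in>{G. G facet_of P \<and> F \<subseteq> G}. circle_subgroup n (\<mu> G))"

text \<open>
  \<open>X\<close> is, up to \<open>T\<^sup>m\<close>-equivariant homeomorphism, \<open>P \<times> T\<^sup>m / \<sim>\<close> with \<open>(p,t) \<sim> (q,s)\<close> iff \<open>p = q\<close> and
  \<open>t\<^bsup>-1\<^esup> s \<in> H p\<close>.
\<close>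

definition polytope_torus_quotient ::
    "nat \<Rightarrow> 'p::euclidean_space set \<Rightarrow> ('p \<Rightarrow> (nat \<Rightarrow> complex) set) \<Rightarrow> 'x topology \<Rightarrow> 'x taction \<Rightarrow> bool"
  where "polytope_torus_quotient m P H X act \<longleftrightarrow>
    torus_action m X act \<and>
    (\<exists>q. quotient_map (prod_topology (top_of_set P) (torus_top m)) X q \<and>
       (\<forall>p\<in>P. \<forall>p'\<in>P. \<forall>t\<in>carrier (torus m). \<forall>s\<in>carrier (torus m).
          q (p, t) = q (p', s) \<longleftrightarrow>
          p = p' \<and> (inv\<^bsub>torus m\<^esub> t) \<otimes>\<^bsub>torus m\<^esub> s \<in> H p) \<and>
       (\<forall>p\<in>P. \<forall>t\<in>carrier (torus m). \<forall>s\<in>carrier (torus m).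
          q (p, t \<otimes>\<^bsub>torus m\<^esub> s) = act t (q (p, s))))"

definition quasitoric_orbifold ::
    "nat \<Rightarrow> 'p::euclidean_space set \<Rightarrow> ('p set \<Rightarrow> nat \<Rightarrow> int) \<Rightarrow> 'x topology \<Rightarrow> 'x taction \<Rightarrow> bool"
  where "quasitoric_orbifold n P \<mu> X act \<longleftrightarrow>
    simple_polytope n P \<and> characteristic_function n P \<mu> \<and>
    polytope_torus_quotient n P
      (\<lambda>p. face_torus n P \<mu> (THE F. F face_of P \<and> p \<in> rel_interior F)) X act"

definition moment_angle_manifold ::
    "nat \<Rightarrow> nat \<Rightarrow> 'p::euclidean_space set \<Rightarrow> (nat \<Rightarrow> 'p set) \<Rightarrow> 'x topology \<Rightarrow> 'x taction \<Rightarrow> bool"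
  where "moment_angle_manifold n m P F X act \<longleftrightarrow>
    simple_polytope n P \<and> bij_betw F {..<m} {G. G facet_of P} \<and>
    polytope_torus_quotient m P
      (\<lambda>p. {t \<in> carrier (torus m). \<forall>j<m. p \<notin> F j \<longrightarrow> t j = 1}) X act"

end

theory Submission
 imports Defs "HOL-Homology.Homology" "HOL-Library.Function_Algebras"
begin

text \<open>
 With \<open>l = 0\<close> all spaces in question are locally of the form \<open>(\<complex>\<^sup>\<times>)\<^sup>i \<times> U(1)\<^bsup>m-n\<^esup> \<times> Hom(S, \<complex>)\<close>, where \<open>S\<close> is the
 monoid of lattice points in the dual of a full-dimensional pointed rational cone, so that \<open>Hom(S, \<complex>)\<close> is an
 affine toric variety with a fixed point.  A one-parameter subgroup from the interior of the cone contracts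
 \<open>Hom(S, \<complex>)\<close> to the fixed point and makes it the open cone over a compact level set of a proper height function.
 This link is a quotient of \<open>Hom(S, \<complex>)\<close> minus the fixed point by the flow, hence locally of the same form with
 \<open>n\<close> lowered by one, and induction on \<open>n\<close> applies.

 For quotients \<open>P \<times> T\<^sup>m / \<sim>\<close> the charts are polar coordinates on \<open>Hom(S, \<complex>)\<close> for a simplicial cone.  A toric variety is
 separated because two cones of the fan are separated by a character vanishing on their common face, and compact
 because the fan is complete.
\<close>

text \<open>The induction closes because \<open>toric_like\<close> is inherited by links: the link
  of a cone of dimension \<open>k\<close> keeps the torus of rank \<open>k\<close>, while its second
  parameter drops to \<open>k - 1\<close>. The difference is one circle. It arises because the slice
  to the flow takes one coordinate of non-zero degree and keeps only its phase; this is the source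
  of the factor \<open>torus (m - n)\<close> in the models. Topologies are matched by maps that are
  continuous, closed, and bijective or quotient; closedness comes from compactness or from a
  function with compact sublevel sets. Orbit dimension is a definite description over manifold
  dimensions, so orbits have to be exhibited as tori, and invariance of domain has to be invoked,
  before anything can be said about the filtration.\<close>

type_synonym cvec = "nat => complex"
type_synonym ivec = "nat => int"
type_synonym mono = "ivec => complex"

abbreviation Torus :: "nat => cvec set"
 where "Torus m \<equiv> carrier (torus m)"

section \<open>Tori and their actions\<close>

lemma in_torus_iff: "t \<in> Torus m \<longleftrightarrow> (\<forall>i<m. cmod (t i) = 1) \<and> (\<forall>i\<ge>m. t i = 1)"
 by (simp add: torus_def)

lemma torus_mult [simp]: "s \<otimes>\<^bsub>torus m\<^esub> t = coord_mult s t"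
 and torus_one [simp]: "\<one>\<^bsub>torus m\<^esub> = (%_. 1)"
 by (simp_all add: torus_def)

lemma torus_coord_mult: "s \<in> Torus m ==> t \<in> Torus m ==> coord_mult s t \<in> Torus m"
 by (simp add: in_torus_iff coord_mult_def norm_mult)

lemma torus_one_closed: "(%_. 1) \<in> Torus m"
 by (simp add: in_torus_iff)

lemma torus_inverse: "t \<in> Torus m ==> (%i. inverse (t i)) \<in> Torus m"
 by (simp add: in_torus_iff norm_inverse)

lemma torus_norm: "t \<in> Torus m ==> cmod (t i) = 1"
 by (cases "i < m") (auto simp: in_torus_iff)

lemma torus_nonzero: "t \<in> Torus m ==> t i \<noteq> 0"
 using torus_norm[of t m i] by auto

lemma torus_coord_inverse: "t \<in> Torus m ==> coord_mult (%i. inverse (t i)) t = (%_. 1)"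
 by (auto simp: coord_mult_def torus_nonzero)

lemma torus_group: "group (torus m)"
proof (rule groupI)
 fix x assume "x \<in> Torus m"
 thus "\<exists>y\<in>Torus m. y \<otimes>\<^bsub>torus m\<^esub> x = \<one>\<^bsub>torus m\<^esub>"
  by (intro bexI[of _ "%i. inverse (x i)"]) (simp_all add: torus_coord_inverse torus_inverse)
qed (simp_all add: torus_coord_mult torus_one_closed, auto simp: coord_mult_def mult.assoc)

lemma torus_m_inv: "t \<in> Torus m ==> inv\<^bsub>torus m\<^esub> t = (%i. inverse (t i))"
 using group.inv_equality[OF torus_group[of m], of "%i. inverse (t i)" t]
 by (simp add: torus_coord_inverse torus_inverse)

section \<open>Topology of the padded torus\<close>

lemma continuous_map_into_fun_iff:
 "continuous_map X euclidean f \<longleftrightarrow> (\<forall>i. continuous_map X euclidean (%x. f x i))"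
 by (metis continuous_map_componentwise_UNIV euclidean_product_topology)

lemma continuous_map_into_torus_iff:
 "continuous_map X (torus_top m) f \<longleftrightarrow>
  (\<forall>x\<in>topspace X. f x \<in> Torus m) \<and> (\<forall>i<m. continuous_map X euclidean (%x. f x i))"
 (is "?l \<longleftrightarrow> ?r")
proof
 assume ?l thus ?r
  unfolding continuous_map_in_subtopology by (subst (asm) continuous_map_into_fun_iff) auto
next
 assume r: ?r
 have "continuous_map X euclidean (%x. f x i)" for i
 proof (cases "i < m")
  case False
  hence "1 = f x i" if "x \<in> topspace X" for x using r that by (simp add: in_torus_iff)
  thus ?thesis by (rule continuous_map_eq[OF continuous_map_const[THEN iffD2], rotated]) simp_all
 qed (use r in auto)
 thus ?l using r by (auto simp: continuous_map_in_subtopology continuous_map_into_fun_iff)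
qed

lemma continuous_map_torus_proj [continuous_intros]:
 "continuous_map X (torus_top m) f ==> continuous_map X euclidean (%x. f x i)"
 unfolding continuous_map_in_subtopology by (subst (asm) continuous_map_into_fun_iff) auto

text \<open>As a product of circles and singletons the padded torus is accessible to Tychonoff's
  theorem and to its counterpart for connectedness.\<close>

lemma torus_PiE: "Torus m = PiE UNIV (%i. if i < m then sphere 0 1 else {1})"
 by (auto simp: in_torus_iff PiE_def Pi_def)

lemma compact_torus: "compact (Torus m)"
proof -
 have "compactin (product_topology (%_. euclidean :: complex topology) (UNIV :: nat set)) (Torus m)"
  unfolding torus_PiE by (subst compactin_PiE) auto
 thus ?thesis by (simp add: euclidean_product_topology)
qed

lemma connected_torus: "connected (Torus m)"
proof -
 have "connectedin (product_topology (%_. euclidean :: complex topology) (UNIV :: nat set)) (Torus m)"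
  unfolding torus_PiE by (subst connectedin_PiE) (auto simp: connected_sphere)
 thus ?thesis by (simp add: euclidean_product_topology)
qed

lemma second_countable_euclidean: "second_countable (euclidean :: 'a::second_countable_topology topology)"
proof -
 obtain B :: "'a set set" where B: "countable B" "\<And>C. C \<in> B ==> open C" "\<And>S. open S ==> \<exists>U. U \<subseteq> B \<and> S = \<Union>U"
  using univ_second_countable by metis
 have "\<exists>V\<in>B. x \<in> V \<and> V \<subseteq> S" if "open S" "x \<in> S" for S x
  using B(3)[OF that(1)] that by blast
 thus ?thesis unfolding second_countable_def using B by auto
qed

lemma second_countable_top_of_set: "second_countable (top_of_set (S :: 'a::second_countable_topology set))"
 by (simp add: second_countable_euclidean second_countable_subtopology)

lemma second_countable_prod_topology:
 assumes "second_countable X" "second_countable Y"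
 shows "second_countable (prod_topology X Y)"
proof -
 obtain A where A: "countable A" "\<And>V. V \<in> A ==> openin X V"
  "\<And>U x. openin X U ==> x \<in> U ==> \<exists>V\<in>A. x \<in> V \<and> V \<subseteq> U"
  using assms unfolding second_countable_def by metis
 obtain B where B: "countable B" "\<And>V. V \<in> B ==> openin Y V"
  "\<And>U x. openin Y U ==> x \<in> U ==> \<exists>V\<in>B. x \<in> V \<and> V \<subseteq> U"
  using assms unfolding second_countable_def by metis
 show ?thesis unfolding second_countable_def
 proof (intro exI[of _ "(%(V, W). V \<times> W) ` (A \<times> B)"] conjI allI impI ballI)
  show "countable ((%(V, W). V \<times> W) ` (A \<times> B))" using A B by blast
  show "openin (prod_topology X Y) V" if "V \<in> (%(V, W). V \<times> W) ` (A \<times> B)" for V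
   using that A B by (auto simp: openin_prod_Times_iff)
  fix U p assume U: "openin (prod_topology X Y) U \<and> p \<in> U"
  obtain x y where "p = (x, y)" by force
  moreover from this U obtain V W where "openin X V" "openin Y W" "x \<in> V" "y \<in> W" "V \<times> W \<subseteq> U"
   unfolding openin_prod_topology_alt by blast
  moreover obtain V' where "V' \<in> A" "x \<in> V'" "V' \<subseteq> V" using A calculation by blast
  moreover obtain W' where "W' \<in> B" "y \<in> W'" "W' \<subseteq> W" using B calculation by blast
  ultimately show "\<exists>V\<in>(%(V, W). V \<times> W) ` (A \<times> B). p \<in> V \<and> V \<subseteq> U"
   by (intro bexI[of _ "V' \<times> W'"]) auto
 qed
qed

text \<open>Replaces the library's action by extensional permutations with the usual pointwise
  axioms. In the converse direction bijectivity of \<open>act t\<close> comes from the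
  coordinatewise inverse of \<open>t\<close>.\<close>

lemma torus_action_iff:
 "torus_action m X act \<longleftrightarrow>
  (\<forall>t\<in>Torus m. \<forall>x\<in>topspace X. act t x \<in> topspace X) \<and>
  (\<forall>x\<in>topspace X. act (%_. 1) x = x) \<and>
  (\<forall>s\<in>Torus m. \<forall>t\<in>Torus m. \<forall>x\<in>topspace X.
    act (coord_mult s t) x = act s (act t x)) \<and>
  continuous_map (prod_topology (torus_top m) X) X (%(t, x). act t x)"
 (is "_ \<longleftrightarrow> ?r")
proof
 assume a: "torus_action m X act"
 interpret group_action "torus m" "topspace X" "%t. restrict (act t) (topspace X)"
  using a unfolding torus_action_def by blast
 have c: "act t x \<in> topspace X" if "t \<in> Torus m" "x \<in> topspace X" for t x
  using surj_prop[OF that(1)] that by auto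
 have "act (%_. 1) x = x" if "x \<in> topspace X" for x
  using id_eq_one that by (simp add: restrict_def) metis
 moreover have "act (coord_mult s t) x = act s (act t x)"
  if "s \<in> Torus m" "t \<in> Torus m" "x \<in> topspace X" for s t x
  using composition_rule that c by simp
 ultimately show ?r using a c unfolding torus_action_def by blast
next
 assume r: ?r
 interpret T: group "torus m" by (rule torus_group)
 have bij: "restrict (act t) (topspace X) \<in> Bij (topspace X)" if t: "t \<in> Torus m" for t
 proof -
  have "act (%i. inverse (t i)) (act t x) = x" "act t (act (%i. inverse (t i)) x) = x"
   if "x \<in> topspace X" for x
  proof -
   have "coord_mult t (%i. inverse (t i)) = (%_. 1)"
    using torus_coord_inverse[OF t] by (simp add: coord_mult_def mult.commute)
   thus "act (%i. inverse (t i)) (act t x) = x" "act t (act (%i. inverse (t i)) x) = x"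
    using r t that torus_inverse[OF t] torus_coord_inverse by metis+
  qed
  hence "bij_betw (act t) (topspace X) (topspace X)"
   using r t torus_inverse
   by (intro bij_betw_byWitness[where f' = "act (%i. inverse (t i))"]) auto
  thus ?thesis by (auto simp: Bij_def)
 qed
 have "group_hom (torus m) (BijGroup (topspace X)) (%t. restrict (act t) (topspace X))"
 proof (intro group_hom.intro group_hom_axioms.intro homI)
  show "restrict (act t) (topspace X) \<in> carrier (BijGroup (topspace X))" if "t \<in> Torus m" for t
   using bij[OF that] by (simp add: BijGroup_def)
  show "restrict (act (s \<otimes>\<^bsub>torus m\<^esub> t)) (topspace X) =
   restrict (act s) (topspace X) \<otimes>\<^bsub>BijGroup (topspace X)\<^esub> restrict (act t) (topspace X)"
   if "s \<in> Torus m" "t \<in> Torus m" for s t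
   using bij that r by (auto simp: BijGroup_def compose_def)
 qed (simp_all add: torus_group group_BijGroup)
 thus "torus_action m X act" unfolding torus_action_def
  using r by (auto intro: group_action.intro)
qed

lemma
 assumes "torus_action m X act"
 shows torus_action_closed: "t \<in> Torus m ==> x \<in> topspace X ==> act t x \<in> topspace X"
  and torus_action_one: "x \<in> topspace X ==> act (%_. 1) x = x"
  and torus_action_mult: "s \<in> Torus m ==> t \<in> Torus m ==> x \<in> topspace X ==>
   act (coord_mult s t) x = act s (act t x)"
  and torus_action_continuous: "continuous_map (prod_topology (torus_top m) X) X (%(t, x). act t x)"
 using assms unfolding torus_action_iff by blast+

lemma torus_action_continuous_compose:
 assumes "torus_action m X act" "continuous_map Z (torus_top m) f" "continuous_map Z X g"
 shows "continuous_map Z X (%z. act (f z) (g z))"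
 using continuous_map_compose[OF continuous_map_pairedI[OF assms(2,3)] torus_action_continuous[OF assms(1)]]
 by (simp add: o_def)

lemma torus_action_inverse:
 assumes "torus_action m X act" "t \<in> Torus m" "x \<in> topspace X"
 shows "act (%i. inverse (t i)) (act t x) = x"
 using torus_action_mult[OF assms(1) torus_inverse[OF assms(2)] assms(2,3)] torus_action_one[OF assms(1,3)]
  torus_coord_inverse[OF assms(2)] by simp

lemma orbit_conv_image: "T_orbit m act x = (%t. act t x) ` Torus m"
 unfolding orbit_def by auto

lemma top_group_isoD:
 assumes "F \<in> top_group_iso G H"
 shows "F \<in> iso G H" "homeomorphic_map (top_of_set (carrier G)) (top_of_set (carrier H)) F"
  "bij_betw F (carrier G) (carrier H)" "continuous_on (carrier G) F"
  "\<And>x y. x \<in> carrier G ==> y \<in> carrier G ==> F (x \<otimes>\<^bsub>G\<^esub> y) = F x \<otimes>\<^bsub>H\<^esub> F y"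
 using assms homeomorphic_imp_continuous_map[of "top_of_set (carrier G)" "top_of_set (carrier H)" F]
 by (auto simp: top_group_iso_def iso_def hom_mult)

lemma torus_top_group_isoI:
 assumes "\<And>t. t \<in> Torus m ==> \<Psi> t \<in> carrier H"
  and "\<And>s t. s \<in> Torus m ==> t \<in> Torus m ==> \<Psi> (coord_mult s t) = \<Psi> s \<otimes>\<^bsub>H\<^esub> \<Psi> t"
  and "continuous_on (Torus m) \<Psi>" "continuous_on (carrier H) \<Phi>"
  and "\<And>h. h \<in> carrier H ==> \<Phi> h \<in> Torus m"
  and "\<And>t. t \<in> Torus m ==> \<Phi> (\<Psi> t) = t" "\<And>h. h \<in> carrier H ==> \<Psi> (\<Phi> h) = h"
 shows "\<Psi> \<in> top_group_iso (torus m) H"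
proof -
 have "homeomorphic_maps (torus_top m) (top_of_set (carrier H)) \<Psi> \<Phi>"
  using assms by (simp add: homeomorphic_maps_def)
 moreover have "bij_betw \<Psi> (Torus m) (carrier H)"
  using assms by (intro bij_betw_byWitness[where f' = \<Phi>]) auto
 ultimately show ?thesis using assms
  by (auto simp: top_group_iso_def iso_def hom_def homeomorphic_map_maps)
qed

lemma top_group_iso_one:
 assumes "F \<in> top_group_iso (torus m) (torus p \<times>\<times> torus q)"
 shows "F (%_. 1) = ((%_. 1), (%_. 1))"
proof -
 have "F \<in> hom (torus m) (torus p \<times>\<times> torus q)"
  using top_group_isoD[OF assms] by (simp add: iso_def)
 from hom_one[OF this torus_group DirProd_group[OF torus_group torus_group]]
 show ?thesis by simp
qed

lemma compact_map_homeomorphic_map: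
 assumes "compact_space X" "Hausdorff_space Y" "continuous_map X Y f" "f ` topspace X = topspace Y"
  "inj_on f (topspace X)"
 shows "homeomorphic_map X Y f"
 using assms by (intro bijective_closed_imp_homeomorphic_map continuous_imp_closed_map_gen)
  (auto simp: Hausdorff_imp_kc_space)

text \<open>The last hypothesis says that under \<open>F\<close> the stabilizer of \<open>x\<close>
  is the second factor. The first factor then maps bijectively and continuously onto the orbit, and
  a continuous bijection from a compact to a Hausdorff space is a homeomorphism.\<close>

lemma orbit_homeomorphic_torus:
 assumes act: "torus_action m X act" and H: "Hausdorff_space X" and x: "x \<in> topspace X"
  and iso: "F \<in> top_group_iso (torus m) (torus p \<times>\<times> torus q)"
  and eq: "\<And>s t. s \<in> Torus m ==> t \<in> Torus m ==>
   act s x = act t x \<longleftrightarrow> fst (F s) = fst (F t)"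
 shows "torus_top p homeomorphic_space subtopology X (T_orbit m act x)"
proof -
 obtain P where P: "homeomorphic_maps (torus_top m) (top_of_set (Torus p \<times> Torus q)) F P"
  using top_group_isoD[OF iso] unfolding homeomorphic_map_maps by auto
 define f where "f = (%a. act (P (a, %_. 1)) x)"
 have in1: "P (a, b) \<in> Torus m" if "a \<in> Torus p" "b \<in> Torus q" for a b
  using P that by (auto simp: homeomorphic_maps_def)
 have inv: "F (P (a, b)) = (a, b)" if "a \<in> Torus p" "b \<in> Torus q" for a b
  using P that by (auto simp: homeomorphic_maps_def)
 have F1: "fst (F t) \<in> Torus p" if "t \<in> Torus m" for t
 proof -
  have "F t \<in> Torus p \<times> Torus q"
   using P that unfolding homeomorphic_maps_def by auto
  thus ?thesis by auto
 qed
 have "continuous_map (torus_top p) (torus_top m) (%a. P (a, %_. 1))"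
 proof -
  have "continuous_map (torus_top p) (top_of_set (Torus p \<times> Torus q)) (%a. (a, %_. 1))"
   unfolding prod_topology_subtopology_eu[symmetric]
   by (intro continuous_map_pairedI) (auto simp: torus_one_closed)
  thus ?thesis
   using P continuous_map_compose unfolding homeomorphic_maps_def o_def by fast
 qed
 hence cf: "continuous_map (torus_top p) X f"
  unfolding f_def by (rule torus_action_continuous_compose[OF act]) (use x in auto)
 have im: "f ` Torus p = T_orbit m act x"
 proof
  show "f ` Torus p \<subseteq> T_orbit m act x"
   unfolding f_def orbit_conv_image using in1 torus_one_closed by blast
  show "T_orbit m act x \<subseteq> f ` Torus p"
  proof (clarsimp simp: orbit_conv_image)
   fix t assume t: "t \<in> Torus m"
   show "act t x \<in> f ` Torus p" using eq[OF t in1[OF F1[OF t] torus_one_closed]] inv[OF F1[OF t] torus_one_closed] F1[OF t] unfolding f_def by simp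
  qed
 qed
 have orb: "T_orbit m act x \<subseteq> topspace X"
  unfolding orbit_conv_image using torus_action_closed[OF act] x by auto
 have "inj_on f (Torus p)"
  by rule (metis eq f_def fst_conv in1 inv torus_one_closed)
 hence "homeomorphic_map (torus_top p) (subtopology X (T_orbit m act x)) f"
  using im cf orb H by (intro compact_map_homeomorphic_map)
   (auto simp: compact_space_subtopology compact_torus Hausdorff_space_subtopology continuous_map_in_subtopology)
 thus ?thesis by (rule homeomorphic_map_imp_homeomorphic_space)
qed

section \<open>Dimension\<close>

lemma in_Cstar_power_iff: "z \<in> Cstar_power i \<longleftrightarrow> (\<forall>j<i. z j \<noteq> 0) \<and> (\<forall>j\<ge>i. z j = 1)"
 by (simp add: Cstar_power_def)

lemma continuous_map_into_Cstar_iff: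
 "continuous_map X (top_of_set (Cstar_power m)) f \<longleftrightarrow>
  (\<forall>x\<in>topspace X. f x \<in> Cstar_power m) \<and> (\<forall>i<m. continuous_map X euclidean (%x. f x i))"
 (is "?l \<longleftrightarrow> ?r")
proof
 assume ?l thus ?r
  unfolding continuous_map_in_subtopology by (subst (asm) continuous_map_into_fun_iff) auto
next
 assume r: ?r
 have "continuous_map X euclidean (%x. f x i)" for i
 proof (cases "i < m")
  case False
  hence "1 = f x i" if "x \<in> topspace X" for x using r that by (simp add: in_Cstar_power_iff)
  thus ?thesis by (rule continuous_map_eq[OF continuous_map_const[THEN iffD2], rotated]) simp_all
 qed (use r in auto)
 thus ?l using r by (auto simp: continuous_map_in_subtopology continuous_map_into_fun_iff)
qed

lemma continuous_map_Cstar_proj [continuous_intros]: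
 "continuous_map X (top_of_set (Cstar_power m)) f ==> continuous_map X euclidean (%x. f x i)"
 unfolding continuous_map_in_subtopology by (subst (asm) continuous_map_into_fun_iff) auto

lemma Hausdorff_top_of_set: "Hausdorff_space (top_of_set (S :: 'a::metric_space set))"
 by (simp add: Hausdorff_space_subtopology)

text \<open>Logarithmic coordinates centred at \<open>(w0, u0)\<close>. Dividing by the centre and
  demanding positive real part keeps the quotient off the branch cut of \<open>Ln\<close>. The real
  coordinates are ordered as \<open>i\<close> logarithms of moduli, the \<open>i\<close>
  corresponding arguments, and \<open>r\<close> angles; only the last \<open>i + r\<close> are
  bounded.\<close>

lemma Cstar_torus_chart:
 fixes i r :: nat
 assumes w0: "w0 \<in> Cstar_power i" and u0: "u0 \<in> Torus r"
 defines "M \<equiv> prod_topology (top_of_set (Cstar_power i)) (torus_top r)"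
  and "U \<equiv> {(w, u) \<in> Cstar_power i \<times> Torus r.
   (\<forall>j<i. 0 < Re (w j / w0 j)) \<and> (\<forall>j<r. 0 < Re (u j / u0 j))}"
  and "V \<equiv> {x \<in> topspace (Euclidean_space (2 * i + r)). \<forall>l<2 * i + r. i \<le> l --> \<bar>x l\<bar> < pi / 2}"
 shows "openin M U" "(w0, u0) \<in> U" "openin (Euclidean_space (2 * i + r)) V"
  "subtopology M U homeomorphic_space subtopology (Euclidean_space (2 * i + r)) V"
proof -
 have w0n: "j < i ==> w0 j \<noteq> 0" for j using w0 by (simp add: in_Cstar_power_iff)
 have u0n: "u0 j \<noteq> 0" for j using u0 torus_nonzero by blast
 have tM: "topspace M = Cstar_power i \<times> Torus r" by (simp add: M_def)
 have c1: "continuous_map M euclidean (%p. fst p j)" for j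
  unfolding M_def by (rule continuous_map_Cstar_proj[OF continuous_map_fst])
 have c2: "continuous_map M euclidean (%p. snd p j)" for j
  unfolding M_def by (rule continuous_map_torus_proj[OF continuous_map_snd])
 have dv: "continuous_map M euclidean (%p. g p / c)" if "continuous_map M euclidean g" "c \<noteq> 0" for g :: "_ => complex" and c
  using continuous_map_compose[OF that(1), of euclidean "%z. z / c"] that
  by (simp add: o_def continuous_on_divide)
 have Reo: "openin M {p \<in> topspace M. 0 < Re (g p)}" if "continuous_map M euclidean g" for g
 proof -
  show ?thesis using openin_continuous_map_preimage[OF that, of "{z. 0 < Re z}"] by (simp add: open_halfspace_Re_gt)
 qed
 have "U = (topspace M \<inter> (\<Inter>j\<in>{..<i}. {p \<in> topspace M. 0 < Re (fst p j / w0 j)})) \<inter>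
   (topspace M \<inter> (\<Inter>j\<in>{..<r}. {p \<in> topspace M. 0 < Re (snd p j / u0 j)}))"
  unfolding U_def tM by auto
 moreover have "openin M \<dots>"
  by (intro openin_Int openin_Int_Inter) (auto intro!: Reo dv c1 c2 w0n u0n)
 ultimately show U: "openin M U" by simp
 show "(w0, u0) \<in> U" using w0 u0 w0n u0n by (auto simp: U_def)
 have pc: "continuous_map (Euclidean_space d) euclideanreal (%x. x l)" for d l
  unfolding Euclidean_space_def by (intro continuous_map_from_subtopology continuous_map_product_projection) auto
 have Vo: "openin (Euclidean_space (2 * i + r)) {x \<in> topspace (Euclidean_space (2 * i + r)). x l \<in> {-(pi/2)<..<pi/2}}" for l
  by (rule openin_continuous_map_preimage[OF pc]) simp
 have iv: "y \<in> {-(pi/2)<..<pi/2} \<longleftrightarrow> \<bar>y\<bar> < pi / 2" for y :: real by auto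
 have "V = topspace (Euclidean_space (2 * i + r)) \<inter>
  (\<Inter>l\<in>{i..<2 * i + r}. {x \<in> topspace (Euclidean_space (2 * i + r)). x l \<in> {-(pi/2)<..<pi/2}})"
  unfolding V_def iv by auto
 moreover have "openin (Euclidean_space (2 * i + r)) \<dots>"
  by (intro openin_Int_Inter) (use Vo in auto)
 ultimately show V: "openin (Euclidean_space (2 * i + r)) V" by simp
 let ?E = "Euclidean_space (2 * i + r)"
 define f where "f = (%p l. if l < 2 * i + r then
   (if l < i then Re (Ln (fst p l / w0 l)) else if l < 2 * i then Im (Ln (fst p (l - i) / w0 (l - i)))
   else Im (Ln (snd p (l - 2 * i) / u0 (l - 2 * i)))) else (0::real))"
 define g where "g = (%x. ((%j. if j < i then w0 j * exp (Complex (x j) (x (i + j))) else 1),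
   (%j. if j < r then u0 j * exp (Complex 0 (x (2 * i + j))) else 1)))"
 have tU: "topspace (subtopology M U) = U" using openin_subset[OF U] by auto
 have tV: "topspace (subtopology ?E V) = V" using openin_subset[OF V] by auto
 have cLn: "continuous_map (subtopology M U) euclidean (%p. Ln (h p / c))"
  if "continuous_map M euclidean h" "c \<noteq> 0" "\<And>p. p \<in> U ==> 0 < Re (h p / c)" for h c
 proof -
  have 1: "continuous_map (subtopology M U) (top_of_set {z. 0 < Re z}) (%p. h p / c)"
   using dv[OF that(1,2)] that by (auto simp: continuous_map_in_subtopology continuous_map_from_subtopology)
  have 2: "continuous_map (top_of_set {z. 0 < Re z}) euclidean Ln"
   by (simp, intro continuous_on_Ln) (auto simp: complex_nonpos_Reals_iff)
  show ?thesis using continuous_map_compose[OF 1 2] by (simp add: o_def)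
 qed
 have cRe: "continuous_map Z euclideanreal (%p. Re (h p))" "continuous_map Z euclideanreal (%p. Im (h p))"
  if "continuous_map Z euclidean h" for Z :: "'z topology" and h
  using continuous_map_compose[OF that, of euclidean Re] continuous_map_compose[OF that, of euclidean Im]
  by (simp_all add: o_def continuous_on_Re continuous_on_Im)
 have cf: "continuous_map (subtopology M U) ?E f"
  unfolding f_def continuous_map_componentwise_Euclidean_space
 proof (intro allI impI)
  fix l assume "l < 2 * i + r"
  consider "l < i" | "i \<le> l" "l < 2 * i" | "2 * i \<le> l" by linarith
  thus "continuous_map (subtopology M U) euclideanreal
   (%p. if l < i then Re (Ln (fst p l / w0 l)) else if l < 2 * i then Im (Ln (fst p (l - i) / w0 (l - i)))
   else Im (Ln (snd p (l - 2 * i) / u0 (l - 2 * i))))"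
  proof cases
   case 1
   hence "0 < Re (fst p l / w0 l)" if "p \<in> U" for p using that by (auto simp: U_def)
   from cRe(1)[OF cLn[OF c1 w0n[OF 1] this]] show ?thesis using 1 by simp
  next
   case 2
   hence "0 < Re (fst p (l - i) / w0 (l - i))" if "p \<in> U" for p using that by (auto simp: U_def)
   from cRe(2)[OF cLn[OF c1 w0n this]] show ?thesis using 2 by simp
  next
   case 3
   hence "0 < Re (snd p (l - 2 * i) / u0 (l - 2 * i))" if "p \<in> U" for p
    using that \<open>l < 2 * i + r\<close> by (auto simp: U_def)
   from cRe(2)[OF cLn[OF c2 u0n this]] show ?thesis using 3 by simp
  qed
 qed
 have cexp: "continuous_map (subtopology ?E V) euclidean (%x. c * exp (Complex (a x) (b x)))"
  if "continuous_map ?E euclideanreal a" "continuous_map ?E euclideanreal b" for a b c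
 proof -
  have "continuous_map ?E euclidean (%x. (a x, b x))"
   using continuous_map_pairedI[OF that] by simp
  moreover have "continuous_on UNIV (%(a, b). c * exp (Complex a b))"
   unfolding case_prod_unfold by (intro continuous_intros)
  ultimately have "continuous_map ?E euclidean ((%(a, b). c * exp (Complex a b)) \<circ> (%x. (a x, b x)))"
   by (intro continuous_map_compose) auto
  thus ?thesis by (simp add: o_def continuous_map_from_subtopology)
 qed
 have gin: "g x \<in> Cstar_power i \<times> Torus r" for x
  using w0n u0 by (auto simp: g_def in_Cstar_power_iff in_torus_iff norm_mult)
 have cg: "continuous_map (subtopology ?E V) M g"
  unfolding M_def
  using gin unfolding g_def
  by (intro continuous_map_pairedI) (auto simp: continuous_map_into_Cstar_iff continuous_map_into_torus_iff intro!: cexp pc)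
 \<comment> \<open>On the torus the logarithm of a quotient is purely imaginary, so the angle alone
   recovers \<open>u\<close>.\<close>
 have norm1: "Re (Ln (u j / u0 j)) = 0" if "u \<in> Torus r" for u j
  using torus_norm[OF that, of j] torus_norm[OF u0, of j] torus_nonzero[OF that] u0n by (simp add: norm_divide)
 have gf: "g (f p) = p" if "p \<in> U" for p
 proof -
  obtain w u where p: "p = (w, u)" by force
  have wu: "w \<in> Cstar_power i" "u \<in> Torus r" using that p by (auto simp: U_def)
  have "fst (g (f p)) j = w j" for j
  proof (cases "j < i")
   case True
   have "exp (Complex (Re (Ln (w j / w0 j))) (Im (Ln (w j / w0 j)))) = w j / w0 j"
    using True wu w0n by (simp add: in_Cstar_power_iff del: Re_Ln)
   thus ?thesis using True w0n by (simp add: g_def f_def p)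
  qed (use wu in \<open>auto simp: g_def in_Cstar_power_iff\<close>)
  moreover have "snd (g (f p)) j = u j" for j
  proof (cases "j < r")
   case True
   have "exp (Complex 0 (Im (Ln (u j / u0 j)))) = u j / u0 j"
    using norm1[OF wu(2), of j] torus_nonzero[OF wu(2)] u0n by (metis complex.collapse divide_eq_0_iff exp_Ln)
   thus ?thesis using True u0n by (simp add: g_def f_def p)
  next
   case False thus ?thesis using wu by (auto simp: g_def in_torus_iff)
  qed
  ultimately show ?thesis by (simp add: p prod_eq_iff fun_eq_iff)
 qed
 have fV: "f p \<in> V" if "p \<in> U" for p
 using cases that Re_Ln_pos_lt_imp by (auto simp: U_def topspace_Euclidean_space V_def f_def)
 have pos: "0 < Re (exp (Complex a b))" if "\<bar>b\<bar> < pi / 2" for a b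
  using that by (simp add: Re_exp cos_gt_zero_pi)
 have gU: "g x \<in> U" if "x \<in> V" for x
 using pos that w0n u0n gin by (auto simp: V_def g_def case_prod_unfold U_def)
 have fg: "f (g x) = x" if "x \<in> V" for x
 proof
  fix l
  have V: "\<And>l. l < 2 * i + r ==> i \<le> l ==> \<bar>x l\<bar> < pi / 2" and out: "\<And>l. 2 * i + r \<le> l ==> x l = 0"
   using that by (auto simp: V_def topspace_Euclidean_space)
  have L: "Ln (exp (Complex a b)) = Complex a b" if "\<bar>b\<bar> < pi / 2" for a b
   using that by simp
  consider "l < i" | "i \<le> l" "l < 2 * i" | "2 * i \<le> l" "l < 2 * i + r" | "2 * i + r \<le> l" by linarith
  thus "f (g x) l = x l"
  proof cases
   case 1 thus ?thesis using w0n by (simp add: f_def g_def)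
  next
   case 2
   then obtain j where "l = i + j" "j < i" by (metis add_less_cancel_left le_Suc_ex mult_2)
   thus ?thesis using V w0n L[of "x l" "x j"] by (simp add: f_def g_def)
  next
   case 3
   then obtain j where "l = 2 * i + j" "j < r" by (metis add_less_cancel_left le_Suc_ex)
   thus ?thesis using V u0n L[of "x l" 0] by (simp add: f_def g_def)
  qed (simp add: f_def out)
 qed
 have "homeomorphic_maps (subtopology M U) (subtopology ?E V) f g"
  unfolding homeomorphic_maps_def
  using cf cg fV gU gf fg by (auto simp: continuous_map_in_subtopology)
 thus "subtopology M U homeomorphic_space subtopology ?E V"
  unfolding homeomorphic_space_def by blast
qed

lemma topological_manifold_Cstar_torus:
 "topological_manifold (2 * i + r) (prod_topology (top_of_set (Cstar_power i)) (torus_top r))"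
 unfolding topological_manifold_def
proof (intro conjI ballI)
 show "Hausdorff_space (prod_topology (top_of_set (Cstar_power i)) (torus_top r))"
  by (simp only: Hausdorff_space_prod_topology Hausdorff_top_of_set simp_thms)
 show "second_countable (prod_topology (top_of_set (Cstar_power i)) (torus_top r))"
  by (intro second_countable_prod_topology second_countable_top_of_set)
next
 fix x assume "x \<in> topspace (prod_topology (top_of_set (Cstar_power i)) (torus_top r))"
 then obtain w u where "x = (w, u)" "w \<in> Cstar_power i" "u \<in> Torus r" by auto
 thus "\<exists>U V. openin (prod_topology (top_of_set (Cstar_power i)) (torus_top r)) U \<and> x \<in> U \<and>
  openin (Euclidean_space (2 * i + r)) V \<and>
  subtopology (prod_topology (top_of_set (Cstar_power i)) (torus_top r)) U homeomorphic_space
  subtopology (Euclidean_space (2 * i + r)) V"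
  using Cstar_torus_chart by meson
qed

lemma topological_manifold_homeomorphic:
 assumes "topological_manifold d X" "X homeomorphic_space Y"
 shows "topological_manifold d Y"
 unfolding topological_manifold_def
proof (intro conjI ballI)
 obtain f g where fg: "homeomorphic_maps X Y f g" using assms unfolding homeomorphic_space_def by blast
 show "Hausdorff_space Y"
  using assms homeomorphic_Hausdorff_space unfolding topological_manifold_def by blast
 show "second_countable Y"
  using assms unfolding topological_manifold_def
  by (metis homeomorphic_space_def homeomorphic_maps_map homeomorphic_imp_open_map
    homeomorphic_imp_continuous_map homeomorphic_imp_surjective_map second_countable_open_map_image)
 fix y assume y: "y \<in> topspace Y"
 hence "g y \<in> topspace X" using fg by (auto simp: homeomorphic_maps_def continuous_map_def)
 then obtain U V where UV: "openin X U" "g y \<in> U" "openin (Euclidean_space d) V"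
  "subtopology X U homeomorphic_space subtopology (Euclidean_space d) V"
  using assms unfolding topological_manifold_def by meson
 have fm: "homeomorphic_map X Y f" using fg by (auto simp: homeomorphic_map_maps)
 have "openin Y (f ` U)" using fm UV openin_subset[OF UV(1)] homeomorphic_map_openness by blast
 moreover have "y \<in> f ` U" using fg y UV by (intro image_eqI) (auto simp: homeomorphic_maps_def)
 moreover have "homeomorphic_map (subtopology X U) (subtopology Y (f ` U)) f"
  using openin_subset[OF UV(1)] homeomorphic_imp_surjective_map[OF fm]
  by (intro homeomorphic_map_subtopologies[OF fm]) (auto)
 hence "subtopology Y (f ` U) homeomorphic_space subtopology (Euclidean_space d) V" using homeomorphic_map_imp_homeomorphic_space homeomorphic_space_sym UV(4) homeomorphic_space_trans by blast
 ultimately show "\<exists>U V. openin Y U \<and> y \<in> U \<and> openin (Euclidean_space d) V \<and>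
  subtopology Y U homeomorphic_space subtopology (Euclidean_space d) V"
  using UV by blast
qed

text \<open>If \<open>a < b\<close>, moving a point of \<open>W\<close> slightly along coordinate
  \<open>a\<close> stays in the open set \<open>W\<close> but leaves the subspace of vectors
  vanishing from index \<open>a\<close> on.\<close>

lemma Euclidean_open_not_lower_dim:
 assumes "openin (Euclidean_space b) W" "W \<noteq> {}" "W \<subseteq> topspace (Euclidean_space a)"
 shows "b \<le> a"
proof (rule ccontr)
 assume "\<not> b \<le> a"
 obtain p where p: "p \<in> W" using assms by blast
 define c where "c = (%(s::real) l. if l < b then p l + (if l = a then s else 0) else 0)"
 have "continuous_on UNIV (%x::real. if l = a then x else 0)" for l
  by (cases "l = a") auto
 hence c: "continuous_map euclideanreal (Euclidean_space b) c"
  unfolding c_def continuous_map_componentwise_Euclidean_space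
  by (auto intro!: continuous_intros)
 have "p \<in> topspace (Euclidean_space b)" using p openin_subset[OF assms(1)] by blast
 hence "c 0 = p" by (auto simp: c_def topspace_Euclidean_space)
 have "open {s. c s \<in> W}" using openin_continuous_map_preimage[OF c assms(1)] by simp
 then obtain e where "e > 0" "ball 0 e \<subseteq> {s. c s \<in> W}"
  using p \<open>c 0 = p\<close> by (auto simp: open_contains_ball)
 hence "c (e / 2) a = 0" "p a = 0" using assms(3) p by (auto simp: dist_norm subset_iff topspace_Euclidean_space)
 thus False using \<open>e > 0\<close> \<open>\<not> b \<le> a\<close> by (simp add: c_def)
qed

text \<open>Two charts at one point are compared. The transition map goes from an open subset of the
  larger space into the smaller one, viewed as a coordinate subspace of the larger. Invariance of
  domain makes its image open in the larger space, which the preceding lemma excludes unless the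
  dimensions agree.\<close>

lemma topological_manifold_dim_le:
 assumes a: "topological_manifold a X" and b: "topological_manifold b X" and ne: "topspace X \<noteq> {}" and "a \<le> b"
 shows "b \<le> a"
proof -
 obtain x where x: "x \<in> topspace X" using ne by blast
 obtain U V f f' where UV: "openin X U" "x \<in> U" "openin (Euclidean_space a) V"
  and f: "homeomorphic_maps (subtopology X U) (subtopology (Euclidean_space a) V) f f'"
  using a x unfolding topological_manifold_def homeomorphic_space_def by meson
 obtain U' V' g g' where UV': "openin X U'" "x \<in> U'" "openin (Euclidean_space b) V'"
  and g: "homeomorphic_maps (subtopology X U') (subtopology (Euclidean_space b) V') g g'"
  using b x unfolding topological_manifold_def homeomorphic_space_def by meson
 define W where "W = g ` (U \<inter> U')"
 have tU: "topspace (subtopology X U) = U" "topspace (subtopology X U') = U'"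
  "topspace (subtopology (Euclidean_space b) V') = V'" "topspace (subtopology (Euclidean_space a) V) = V"
  using openin_subset UV UV' by auto
 have "openin (subtopology (Euclidean_space b) V') W" using UV(1) g homeomorphic_map_openness[of "subtopology X U'" "subtopology (Euclidean_space b) V'" g "U \<inter> U'"] unfolding W_def homeomorphic_map_maps tU by (auto simp: openin_subtopology)
 hence W: "openin (Euclidean_space b) W" "W \<subseteq> V'"
  using openin_trans_full[OF _ UV'(3)] openin_imp_subset by blast+
 have gW: "g' w \<in> U \<inter> U'" if "w \<in> W" for w
  using that g unfolding W_def homeomorphic_maps_def tU by auto
 have inj: "inj_on (f \<circ> g') W"
  by rule (metis (no_types, lifting) IntE comp_apply f g gW W homeomorphic_maps_def subsetD tU)
 have "continuous_map (subtopology (Euclidean_space b) W) (subtopology X U) g'"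
 proof -
  have "continuous_map (subtopology (subtopology (Euclidean_space b) V') W) (subtopology X U') g'"
   using g by (auto simp: homeomorphic_maps_def continuous_map_from_subtopology)
  thus ?thesis using W gW
   by (auto simp: subtopology_subtopology Int_absorb1 continuous_map_in_subtopology)
 qed
 moreover have "continuous_map (subtopology X U) (Euclidean_space a) f"
  using f by (auto simp: homeomorphic_maps_def continuous_map_in_subtopology)
 ultimately have "continuous_map (subtopology (Euclidean_space b) W) (Euclidean_space a) (f \<circ> g')"
  by (rule continuous_map_compose)
 hence 1: "continuous_map (subtopology (Euclidean_space b) W) (Euclidean_space b) (f \<circ> g')"
  and im: "(f \<circ> g') ` W \<subseteq> topspace (Euclidean_space a)"
 proof -
  assume c: "continuous_map (subtopology (Euclidean_space b) W) (Euclidean_space a) (f \<circ> g')"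
  have "topspace (subtopology (Euclidean_space b) W) = W" using openin_subset[OF W(1)] by auto
  with c show "(f \<circ> g') ` W \<subseteq> topspace (Euclidean_space a)"
   using continuous_map_image_subset_topspace by fastforce
  have "Euclidean_space a = subtopology (Euclidean_space b) (topspace (Euclidean_space a))"
   using \<open>a \<le> b\<close> by (metis Euclidean_space_def inf.absorb_iff2 subset_Euclidean_space
     subtopology_subtopology topspace_Euclidean_space)
  with c show "continuous_map (subtopology (Euclidean_space b) W) (Euclidean_space b) (f \<circ> g')"
   by (metis continuous_map_in_subtopology)
 qed
 have "openin (Euclidean_space b) ((f \<circ> g') ` W)"
  by (rule invariance_of_domain_Euclidean_space[OF W(1) 1 inj])
 moreover have "(f \<circ> g') ` W \<noteq> {}" using UV UV' by (auto simp: W_def)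
 ultimately show ?thesis using Euclidean_open_not_lower_dim im by blast
qed

text \<open>This gives meaning to the definite description in \<open>orbit_dim\<close>. Nonemptiness
  is essential, the empty space being a manifold of every dimension.\<close>

lemma topological_manifold_dim_unique:
 assumes "topological_manifold a X" "topological_manifold b X" "topspace X \<noteq> {}"
 shows "a = b"
 using topological_manifold_dim_le[OF assms] topological_manifold_dim_le[OF assms(2,1,3)] by linarith

lemma topological_manifold_torus: "topological_manifold m (torus_top m)"
proof -
 have "Cstar_power 0 = {%_. 1}" by (auto simp: in_Cstar_power_iff)
 hence "prod_topology (top_of_set (Cstar_power 0)) (torus_top m) homeomorphic_space torus_top m"
  using homeomorphic_space_prod_topology_sing2 homeomorphic_space_sym
  by (metis UNIV_I topspace_euclidean)
 from topological_manifold_homeomorphic[OF _ this, of m] show ?thesis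
  using topological_manifold_Cstar_torus[of 0 m] by simp
qed

lemma orbit_dim_eqI:
 assumes "torus_top p homeomorphic_space subtopology X (T_orbit m act x)"
 shows "orbit_dim m X act x = p"
proof -
 have p: "topological_manifold p (subtopology X (T_orbit m act x))"
  using topological_manifold_homeomorphic[OF topological_manifold_torus assms] .
 have "topspace (subtopology X (T_orbit m act x)) \<noteq> {}"
  using homeomorphic_empty_space[OF assms] torus_one_closed
  by (metis empty_iff null_topspace_iff_trivial topspace_euclidean_subtopology)
 thus ?thesis unfolding orbit_dim_def
  using p topological_manifold_dim_unique by blast
qed

lemma torus_product_homeomorphic:
 "prod_topology (torus_top p) (torus_top q) homeomorphic_space torus_top (p + q)"
proof -
 define f where "f = (%(a, b) j. if j < p then a j else if j < p + q then b (j - p) else (1::complex))"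
 define g where "g = (%c. ((%j. if j < p then c j else 1), (%j. if j < q then c (p + j) else (1::complex))))"
 have "homeomorphic_maps (prod_topology (torus_top p) (torus_top q)) (torus_top (p + q)) f g"
  unfolding homeomorphic_maps_def
 proof (intro conjI)
  show "continuous_map (prod_topology (torus_top p) (torus_top q)) (torus_top (p + q)) f"
   unfolding continuous_map_into_torus_iff
  proof (intro conjI allI impI ballI)
   fix i assume "i < p + q"
   thus "continuous_map (prod_topology (torus_top p) (torus_top q)) euclidean (%x. f x i)"
    by cases (auto simp: f_def case_prod_unfold simp del: prod_topology_subtopology_eu
      intro!: continuous_map_torus_proj continuous_map_fst continuous_map_snd)
  qed (auto simp: f_def in_torus_iff)
  show "continuous_map (torus_top (p + q)) (prod_topology (torus_top p) (torus_top q)) g"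
   unfolding g_def
   by (intro continuous_map_pairedI; subst continuous_map_into_torus_iff)
    (auto simp: in_torus_iff intro!: continuous_on_product_coordinates[THEN continuous_on_subset])
 qed (auto simp: f_def g_def in_torus_iff fun_eq_iff)
 thus ?thesis unfolding homeomorphic_space_def by blast
qed

section \<open>Integer lattices\<close>

definition dot :: "nat => ivec => ivec => int"
 where "dot k u g = (\<Sum>i<k. u i * g i)"

definition lat :: "nat => ivec set"
 where "lat k = {u. \<forall>i\<ge>k. u i = 0}"

lemma dot_add: "dot k (u + v) g = dot k u g + dot k v g"
 and dot_diff: "dot k (u - v) g = dot k u g - dot k v g"
 and dot_uminus: "dot k (- u) g = - dot k u g"
 and dot_zero [simp]: "dot k 0 g = 0"
 and dot_scale: "dot k (%i. c * u i) g = c * dot k u g"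
 and dot_scale_right: "dot k u (%i. c * g i) = c * dot k u g"
 and dot_zero_right [simp]: "dot k u 0 = 0"
 by (simp_all add: dot_def sum.distrib sum_subtractf sum_negf ring_distribs sum_distrib_left mult_ac)

lemma dot_diff_right: "dot k u (g - h) = dot k u g - dot k u h"
 by (simp add: dot_def sum_subtractf ring_distribs)

lemma dot_comb: "dot k (%i. \<Sum>j\<in>J. c j * f j i) g = (\<Sum>j\<in>J. c j * dot k (f j) g)"
 unfolding dot_def sum_distrib_left sum_distrib_right by (subst sum.swap) (simp add: mult_ac)

lemma lat_closed [simp]:
 "0 \<in> lat k" "u \<in> lat k ==> v \<in> lat k ==> u + v \<in> lat k" "u \<in> lat k ==> v \<in> lat k ==> u - v \<in> lat k"
 "u \<in> lat k ==> - u \<in> lat k" "u \<in> lat k ==> (%i. c * u i) \<in> lat k"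
 by (simp_all add: lat_def)

lemma lat_sum: "(\<And>j. j \<in> J ==> f j \<in> lat k) ==> (%i. \<Sum>j\<in>J. c j * f j i) \<in> lat k"
 by (auto simp: lat_def)

definition unit_vec :: "nat => nat => int"
 where "unit_vec i = (%j. if j = i then 1 else 0)"

lemma unit_vec_in_lat: "i < k ==> unit_vec i \<in> lat k"
 by (simp add: lat_def unit_vec_def)

lemma dot_unit_vec: "i < k ==> dot k (unit_vec i) g = g i"
 by (simp add: dot_def unit_vec_def if_distrib[of "%x. x * _"] cong: if_cong)

lemma dot_unit_vec_right: "i < k ==> dot k u (unit_vec i) = u i"
 by (simp add: dot_def unit_vec_def if_distrib cong: if_cong)

text \<open>\<open>b\<close> consists of the rows of a unimodular integer matrix and
  \<open>b'\<close> of the dual basis: pairing with \<open>b'\<close> reads off coordinates with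
  respect to \<open>b\<close>. Both products with the inverse matrix are recorded, which spares an
  argument about one-sided inverses. Entries of \<open>b'\<close> beyond \<open>m\<close> are left
  free.\<close>

definition unimod :: "nat => (nat => nat => int) => (nat => nat => int) => bool"
 where "unimod m b b' \<longleftrightarrow> (\<forall>i<m. b i \<in> lat m) \<and>
  (\<forall>i<m. \<forall>j<m. dot m (b i) (b' j) = (if i = j then 1 else 0)) \<and>
  (\<forall>a<m. \<forall>c<m. (\<Sum>j<m. b j a * b' j c) = (if a = c then 1 else 0))"

lemma unimodD:
 assumes "unimod m b b'"
 shows "i < m ==> b i \<in> lat m"
  "i < m ==> j < m ==> dot m (b i) (b' j) = (if i = j then 1 else 0)"
  "a < m ==> c < m ==> (\<Sum>j<m. b j a * b' j c) = (if a = c then 1 else 0)"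
 using assms by (auto simp: unimod_def)

lemma unimod_unit: "unimod m unit_vec unit_vec"
 unfolding unimod_def
 by (auto simp: unit_vec_in_lat dot_unit_vec_right)
  (auto simp: unit_vec_def if_distrib[of "%x. x * _"] cong: if_cong)

lemma unimod_expand:
 assumes "unimod m b b'" "u \<in> lat m"
 shows "u = (%a. \<Sum>j<m. dot m u (b' j) * b j a)"
proof
 fix a
 show "u a = (\<Sum>j<m. dot m u (b' j) * b j a)"
 proof (cases "a < m")
  case True
  have "(\<Sum>j<m. dot m u (b' j) * b j a) = (\<Sum>c<m. u c * (\<Sum>j<m. b j a * b' j c))"
   unfolding dot_def sum_distrib_left sum_distrib_right by (subst sum.swap) (simp add: mult_ac)
  also have "\<dots> = (\<Sum>c<m. u c * (if a = c then 1 else 0))"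
   using unimodD[OF assms(1) True] by simp
  also have "\<dots> = u a" using True by (simp add: if_distrib cong: if_cong)
  finally show ?thesis by simp
 next
  case False
  thus ?thesis using assms unimodD[OF assms(1)] by (auto simp: lat_def)
 qed
qed

lemma unimod_dot:
 assumes "unimod m b b'" "u \<in> lat m"
 shows "dot m u g = (\<Sum>j<m. dot m u (b' j) * dot m (b j) g)"
 by (subst unimod_expand[OF assms]) (rule dot_comb)

lemma sum_update: "finite A ==> p \<in> A ==> (\<Sum>j\<in>A. f ((h(p := v)) j) j) = (\<Sum>j\<in>A. f (h j) j) - f (h p) p + f v (p::'a)"
 for f :: "'b => 'a => int"
 by (simp add: sum.remove)

text \<open>An elementary row operation on the basis, together with the contragredient operation on
  the dual basis.\<close>

lemma unimod_add_multiple: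
 assumes u: "unimod m b b'" and pq: "p < m" "q < m" "p \<noteq> q"
 shows "unimod m (b(p := (%i. b p i + e * b q i))) (b'(q := (%i. b' q i - e * b' p i)))"
  (is "unimod m ?c ?c'")
 unfolding unimod_def
proof (intro conjI allI impI)
 fix i assume "i < m" thus "?c i \<in> lat m" using unimodD[OF u] pq by (auto simp: lat_def)
next
 fix i j assume ij: "i < m" "j < m"
 have cc: "dot m (%i. b p i + e * b q i) g = dot m (b p) g + e * dot m (b q) g" for g
  by (simp add: dot_def sum.distrib ring_distribs sum_distrib_left mult_ac)
 have cd: "dot m v (%i. b' q i - e * b' p i) = dot m v (b' q) - e * dot m v (b' p)" for v
  by (simp add: dot_def sum_subtractf ring_distribs sum_distrib_left mult_ac)
 show "dot m (?c i) (?c' j) = (if i = j then 1 else 0)"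
  using ij pq unimodD(2)[OF u]
  by (cases "i = p"; cases "j = q") (auto simp: cc cd)
next
 fix a c assume ac: "a < m" "c < m"
 have "(\<Sum>j<m. ?c j a * ?c' j c) = (\<Sum>j<m. b j a * b' j c + (if j = p then e * b q a * b' p c else 0)
   - (if j = q then e * b q a * b' p c else 0))"
  using pq by (intro sum.cong) (auto simp: algebra_simps)
 also have "\<dots> = (\<Sum>j<m. b j a * b' j c)"
  using pq by (simp add: sum.distrib sum_subtractf)
 finally show "(\<Sum>j<m. ?c j a * ?c' j c) = (if a = c then 1 else 0)"
  using unimodD(3)[OF u ac] by simp
qed

lemma unimod_permute:
 assumes u: "unimod m b b'" and s: "bij_betw s {..<m} {..<m}"
 shows "unimod m (b \<circ> s) (b' \<circ> s)"
 unfolding unimod_def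
proof (intro conjI allI impI)
 fix a c assume "a < m" "c < m"
 thus "(\<Sum>j<m. (b \<circ> s) j a * (b' \<circ> s) j c) = (if a = c then 1 else 0)"
  using sum.reindex_bij_betw[OF s, of "%j. b j a * b' j c"] unimodD[OF u] by simp
qed (use unimodD[OF u] bij_betwE[OF s] s in \<open>auto simp: bij_betw_def inj_on_eq_iff\<close>)

lemma unimod_swap:
 assumes "unimod m b b'" "p < m" "q < m"
 shows "unimod m (b \<circ> Transposition.transpose p q) (b' \<circ> Transposition.transpose p q)"
 using assms by (intro unimod_permute) auto

text \<open>Euclid's algorithm on the integers \<open>dot m (b j) g\<close> with
  \<open>j < a\<close>: as long as two of them are non-zero, the smaller one is added to or
  subtracted from the larger one, which lowers the sum of absolute values. The survivor is moved to
  position \<open>a - 1\<close>. Vectors from index \<open>a\<close> on are untouched, so that the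
  lemma can be iterated.\<close>

lemma euclid_basis:
 assumes "unimod m b b'" "a \<le> m"
 shows "\<exists>c c'. unimod m c c' \<and> (\<forall>j\<ge>a. c j = b j \<and> c' j = b' j) \<and> (\<forall>j. Suc j < a --> dot m (c j) g = 0)"
 using assms
proof (induction "nat (\<Sum>j<a. \<bar>dot m (b j) g\<bar>)" arbitrary: b b' rule: less_induct)
 case less
 let ?h = "%j. dot m (b j) g"
 show ?case
 proof (cases "\<exists>p q. p < a \<and> q < a \<and> p \<noteq> q \<and> ?h p \<noteq> 0 \<and> ?h q \<noteq> 0")
  case True
  then obtain p q where pq: "p < a" "q < a" "p \<noteq> q" "?h p \<noteq> 0" "?h q \<noteq> 0" "\<bar>?h q\<bar> \<le> \<bar>?h p\<bar>"
   by (metis linear)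
  \<comment> \<open>With this sign the new value has absolute value
    \<open>\<bar>?h p\<bar> - \<bar>?h q\<bar>\<close>.\<close>
  define e where "e = - sgn (?h p) * sgn (?h q)"
  let ?c = "b(p := (%i. b p i + e * b q i))" and ?c' = "b'(q := (%i. b' q i - e * b' p i))"
  have un: "unimod m ?c ?c'" using unimod_add_multiple less.prems pq by simp
  have "dot m (%i. b p i + e * b q i) g = ?h p + e * ?h q"
   by (simp add: dot_def sum.distrib ring_distribs sum_distrib_left mult_ac)
  also have "\<bar>\<dots>\<bar> < \<bar>?h p\<bar>"
   using pq by (auto simp: e_def sgn_if)
  finally have lt: "\<bar>dot m (%i. b p i + e * b q i) g\<bar> < \<bar>?h p\<bar>" .
  have "(\<Sum>j<a. \<bar>dot m (?c j) g\<bar>) < (\<Sum>j<a. \<bar>?h j\<bar>)"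
   using sum_update[of "{..<a}" p "%v j. \<bar>dot m v g\<bar>" b] pq lt by simp
  moreover have "0 \<le> (\<Sum>j<a. \<bar>dot m (?c j) g\<bar>)" by simp
  ultimately have "nat (\<Sum>j<a. \<bar>dot m (?c j) g\<bar>) < nat (\<Sum>j<a. \<bar>?h j\<bar>)" by linarith
  from less.hyps[OF this un less.prems(2)] obtain c c' where
   "unimod m c c'" "\<forall>j\<ge>a. c j = ?c j \<and> c' j = ?c' j" "\<forall>j. Suc j < a --> dot m (c j) g = 0" by blast
  moreover have "?c j = b j" "?c' j = b' j" if "a \<le> j" for j using that pq by auto
  ultimately show ?thesis by metis
 next
  case False
  show ?thesis
  proof (cases "\<exists>p<a. ?h p \<noteq> 0")
   case True
   then obtain p where p: "p < a" "?h p \<noteq> 0" by blast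
   let ?s = "Transposition.transpose p (a - 1)"
   have "unimod m (b \<circ> ?s) (b' \<circ> ?s)" using unimod_swap[OF less.prems(1), of p "a - 1"] p less.prems by simp
   moreover have "(b \<circ> ?s) j = b j \<and> (b' \<circ> ?s) j = b' j" if "a \<le> j" for j
    using that p by auto
   moreover have "dot m ((b \<circ> ?s) j) g = 0" if "Suc j < a" for j
   proof -
    have "?s j \<noteq> p" "?s j < a" using that by (auto simp: Transposition.transpose_def)
    thus ?thesis using False p by auto
   qed
   ultimately show ?thesis by blast
  next
   case False
   thus ?thesis using less.prems by (intro exI) auto
  qed
 qed
qed

text \<open>The rational fact that a functional vanishing on the common kernel of \<open>G\<close>
  is a linear combination of \<open>G\<close>, with the denominators cleared into
  \<open>c\<close>.\<close>

lemma kernel_combination: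
 assumes "finite G" "\<And>u. u \<in> lat m ==> (\<And>g. g \<in> G ==> dot m u g = 0) ==> dot m u h = 0"
 shows "\<exists>c cs. c \<noteq> 0 \<and> (\<forall>u\<in>lat m. c * dot m u h = (\<Sum>g\<in>G. cs g * dot m u g))"
 using assms
proof (induction G arbitrary: h)
 case empty
 thus ?case by (intro exI[of _ 1]) auto
next
 case (insert a G)
 show ?case
 proof (cases "\<forall>u\<in>lat m. (\<forall>g\<in>G. dot m u g = 0) --> dot m u h = 0")
  case True
  then obtain c cs where c: "c \<noteq> 0" "\<forall>u\<in>lat m. c * dot m u h = (\<Sum>g\<in>G. cs g * dot m u g)"
   using insert.IH[of h] by blast
  have "c * dot m u h = (\<Sum>g\<in>insert a G. (cs(a := 0)) g * dot m u g)" if "u \<in> lat m" for u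
   using c that insert.hyps by (simp, intro sum.cong) auto
  thus ?thesis using c by blast
 next
  case False
  then obtain u where u: "u \<in> lat m" "\<And>g. g \<in> G ==> dot m u g = 0" "dot m u h \<noteq> 0" by blast
  hence ua: "dot m u a \<noteq> 0" using insert.prems by auto
  \<comment> \<open>Correcting \<open>h\<close> by a multiple of \<open>a\<close> makes it vanish on
    \<open>u\<close>; the induction hypothesis for \<open>G\<close> alone then applies to
    it.\<close>
  let ?h = "%i. dot m u a * h i - dot m u h * a i"
  have h: "dot m w ?h = dot m u a * dot m w h - dot m u h * dot m w a" for w
  proof -
   have "?h = (%i. dot m u a * h i) - (%i. dot m u h * a i)" by auto
   thus ?thesis by (simp only: dot_diff_right dot_scale_right)
  qed
  have "dot m w ?h = 0" if w: "w \<in> lat m" "\<And>g. g \<in> G ==> dot m w g = 0" for w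
  proof -
   \<comment> \<open>\<open>w\<close> is corrected by \<open>u\<close> so as to kill
     \<open>a\<close> as well; pairing the result with \<open>h\<close> is the same as pairing
     \<open>w\<close> with \<open>?h\<close>.\<close>
   define v where "v = (%i. dot m u a * w i) - (%i. dot m w a * u i)"
   have dv: "dot m v g = dot m u a * dot m w g - dot m w a * dot m u g" for g
    unfolding v_def by (simp only: dot_diff dot_scale)
   have "v \<in> lat m" unfolding v_def using u w by simp
   hence "dot m v h = 0"
    by (rule insert.prems) (auto simp: dv u w)
   thus ?thesis by (simp only: h dv) simp
  qed
  then obtain c cs where c: "c \<noteq> 0" "\<forall>w\<in>lat m. c * dot m w ?h = (\<Sum>g\<in>G. cs g * dot m w g)"
   using insert.IH by blast
  have "(c * dot m u a) * dot m w h = (\<Sum>g\<in>insert a G. (cs(a := c * dot m u h)) g * dot m w g)"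
   if "w \<in> lat m" for w
  proof -
   have "(\<Sum>g\<in>G. (cs(a := c * dot m u h)) g * dot m w g) = (\<Sum>g\<in>G. cs g * dot m w g)"
    using insert.hyps by (intro sum.cong) auto
   moreover have "c * (dot m u a * dot m w h - dot m u h * dot m w a) = (\<Sum>g\<in>G. cs g * dot m w g)"
    using c that by (simp only: h)
   ultimately show ?thesis using insert.hyps by (simp add: algebra_simps)
  qed
  thus ?thesis using c ua by (intro exI[of _ "c * dot m u a"]) auto
 qed
qed

section \<open>Independent vectors and bases adapted to an annihilator\<close>

definition lin_indep :: "nat => ivec set => bool"
 where "lin_indep m G \<longleftrightarrow> (\<forall>c. (\<forall>i<m. (\<Sum>g\<in>G. c g * g i) = 0) --> (\<forall>g\<in>G. c g = 0))"

lemma lin_indep_subset: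
 assumes "lin_indep m G" "H \<subseteq> G" "finite G"
 shows "lin_indep m H"
 unfolding lin_indep_def
proof (intro allI impI ballI)
 fix c :: "ivec => int" and h
 assume c: "\<forall>i<m. (\<Sum>g\<in>H. c g * g i) = 0" and h: "h \<in> H"
 have "(\<Sum>g\<in>G. (if g \<in> H then c g else 0) * g i) = (\<Sum>g\<in>H. c g * g i)" for i
  using assms by (intro sum.mono_neutral_cong_right) auto
 thus "c h = 0" using spec[OF assms(1)[unfolded lin_indep_def], of "%g. if g \<in> H then c g else 0"] c h \<open>H \<subseteq> G\<close> by force
qed

text \<open>Otherwise \<open>h\<close> would be rationally dependent on \<open>G\<close>: the
  identity of \<open>kernel_combination\<close>, evaluated at unit vectors, becomes a relation
  between coordinates.\<close>

lemma lin_indep_not_in_kernel: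
 assumes "lin_indep m (insert h G)" "h \<notin> G" "finite G"
 shows "\<exists>u\<in>lat m. (\<forall>g\<in>G. dot m u g = 0) \<and> dot m u h \<noteq> 0"
proof (rule ccontr)
 assume "\<not> ?thesis"
 then obtain c cs where c: "c \<noteq> 0" "\<And>u. u \<in> lat m ==> c * dot m u h = (\<Sum>g\<in>G. cs g * dot m u g)"
  using kernel_combination[OF assms(3), of m h] by blast
 have "(\<Sum>g\<in>insert h G. (cs(h := - c)) g * g i) = 0" if "i < m" for i
 proof -
  have "(\<Sum>g\<in>G. (cs(h := - c)) g * g i) = (\<Sum>g\<in>G. cs g * g i)"
   using assms by (intro sum.cong) auto
  thus ?thesis using c(2)[OF unit_vec_in_lat[OF that]] assms by (simp add: dot_unit_vec that)
 qed
 hence "(cs(h := - c)) h = 0" using assms unfolding lin_indep_def by blast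
 thus False using c by simp
qed

text \<open>The annihilator of \<open>G\<close> is spanned by the first \<open>a\<close> basis
  vectors, hence is a direct summand. When a vector is added to \<open>G\<close>, Euclid's algorithm
  leaves at most one of these with non-zero pairing, the last one; either it is dropped or nothing
  changes. For independent \<open>G\<close> every step drops one, whence
  \<open>a + card G = m\<close>.\<close>

lemma adapted_basis:
 assumes "finite G"
 shows "\<exists>b b' a. unimod m b b' \<and> a \<le> m \<and>
  (\<forall>u\<in>lat m. (\<forall>g\<in>G. dot m u g = 0) \<longleftrightarrow> (\<forall>j<m. a \<le> j --> dot m u (b' j) = 0)) \<and>
  (lin_indep m G --> a + card G = m)"
 using assms
proof (induction G)
 case empty
 thus ?case using unimod_unit by force
next
 case (insert g G)
 then obtain b0 b0' a where 0: "unimod m b0 b0'" "a \<le> m"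
  "\<forall>u\<in>lat m. (\<forall>g\<in>G. dot m u g = 0) \<longleftrightarrow> (\<forall>j<m. a \<le> j --> dot m u (b0' j) = 0)"
  "lin_indep m G --> a + card G = m" by blast
 obtain b b' where b: "unimod m b b'" "\<forall>j\<ge>a. b j = b0 j \<and> b' j = b0' j"
  "\<And>j. Suc j < a ==> dot m (b j) g = 0"
  using euclid_basis[OF 0(1,2), of g] by blast
 have K: "(\<forall>g\<in>G. dot m u g = 0) \<longleftrightarrow> (\<forall>j<m. a \<le> j --> dot m u (b' j) = 0)" if "u \<in> lat m" for u
  using 0(3) that b by auto
 have li: "lin_indep m G" if "lin_indep m (insert g G)"
  using lin_indep_subset[OF that] insert.hyps by auto
 show ?case
 proof (cases "a = 0 \<or> dot m (b (a - 1)) g = 0")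
  case True
  have g0: "dot m (b j) g = 0" if "j < a" for j
   using True b(3) that by (cases "Suc j = a") auto
  have van: "dot m u g = 0" if "u \<in> lat m" "\<forall>g\<in>G. dot m u g = 0" for u
   using K[OF that(1)] that g0 unfolding unimod_dot[OF b(1) that(1), of g]
   by (intro sum.neutral) (metis linorder_not_le lessThan_iff mult_eq_0_iff)
  hence "\<not> lin_indep m (insert g G)"
   using lin_indep_not_in_kernel insert.hyps by blast
  thus ?thesis using b(1) 0(2) K van by force
 next
  case False
  hence a: "0 < a" "dot m (b (a - 1)) g \<noteq> 0" by auto
  have dg: "dot m u g = dot m u (b' (a - 1)) * dot m (b (a - 1)) g"
   if u: "u \<in> lat m" "\<forall>j<m. a \<le> j --> dot m u (b' j) = 0" for u
  proof -
   have "dot m u g = (\<Sum>j<m. if j = a - 1 then dot m u (b' j) * dot m (b j) g else 0)"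
    unfolding unimod_dot[OF b(1) u(1), of g]
   proof (intro sum.cong refl)
    fix j assume "j \<in> {..<m}"
    thus "dot m u (b' j) * dot m (b j) g = (if j = a - 1 then dot m u (b' j) * dot m (b j) g else 0)"
     using u b(3) by auto
   qed
   thus ?thesis using a 0(2) by simp
  qed
  have "(\<forall>h\<in>insert g G. dot m u h = 0) \<longleftrightarrow> (\<forall>j<m. a - 1 \<le> j --> dot m u (b' j) = 0)" if "u \<in> lat m" for u
  proof -
   have "(\<forall>h\<in>insert g G. dot m u h = 0) \<longleftrightarrow>
    dot m u (b' (a - 1)) = 0 \<and> (\<forall>j<m. a \<le> j --> dot m u (b' j) = 0)"
    using K[OF that] dg[OF that] a by auto
   also have "\<dots> \<longleftrightarrow> (\<forall>j<m. a - 1 \<le> j --> dot m u (b' j) = 0)"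
   proof -
    have "a - 1 \<le> j \<longleftrightarrow> j = a - 1 \<or> a \<le> j" for j by auto
    moreover have "a - 1 < m" using a 0(2) by simp
    ultimately show ?thesis by metis
   qed
   finally show ?thesis .
  qed
  moreover have "a - 1 + card (insert g G) = m" if "lin_indep m (insert g G)"
   using li[OF that] 0(4) insert.hyps a by simp
  ultimately show ?thesis using b(1) 0(2)
   by (intro exI[of _ b] exI[of _ b'] exI[of _ "a - 1"]) auto
 qed
qed

lemma unimod_basis_in_kernel:
 assumes "unimod m b b'" "\<forall>u\<in>lat m. (\<forall>g\<in>G. dot m u g = 0) \<longleftrightarrow> (\<forall>j<m. a \<le> j --> dot m u (b' j) = 0)"
  and "j < a" "a \<le> m" "g \<in> G"
 shows "dot m (b j) g = 0"
using assms unimodD by auto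

subsection \<open>Characters\<close>

definition chr :: "nat => ivec => cvec => complex"
 where "chr m u t = (\<Prod>i<m. t i powi u i)"

lemma powi_sum: "x \<noteq> 0 ==> x powi (\<Sum>a\<in>A. f a) = (\<Prod>a\<in>A. x powi f a)"
 for x :: "'a::field"
 by (induction rule: infinite_finite_induct) (simp_all add: power_int_add)

lemma powi_prod: "(\<Prod>a\<in>A. f a) powi n = (\<Prod>a\<in>A. f a powi n)"
 for f :: "'b => 'a::field"
 by (induction rule: infinite_finite_induct) (simp_all add: power_int_mult_distrib)

lemma chr_zero [simp]: "chr m 0 t = 1"
 by (simp add: chr_def)

lemma chr_one [simp]: "chr m u (%_. 1) = 1"
 by (simp add: chr_def)

lemma chr_add: "(\<And>i. t i \<noteq> 0) ==> chr m (u + v) t = chr m u t * chr m v t"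
 by (simp add: chr_def power_int_add prod.distrib)

lemma chr_coord_mult: "chr m u (coord_mult s t) = chr m u s * chr m u t"
 by (simp add: chr_def coord_mult_def power_int_mult_distrib prod.distrib)

lemma chr_nonzero: "(\<And>i. t i \<noteq> 0) ==> chr m u t \<noteq> 0"
 by (simp add: chr_def)

lemma norm_chr: "t \<in> Torus m ==> cmod (chr m u t) = 1"
 by (simp add: chr_def norm_power_int torus_norm flip: prod_norm)

lemma chr_unit_vec: "i < m ==> chr m (unit_vec i) t = t i"
 by (simp add: chr_def unit_vec_def if_distrib cong: if_cong)

lemma chr_expand:
 assumes "unimod m b b'" "u \<in> lat m" "\<And>i. t i \<noteq> 0"
 shows "chr m u t = (\<Prod>j<m. chr m (b j) t powi dot m u (b' j))"
proof -
 have "chr m u t = (\<Prod>i<m. t i powi (\<Sum>j<m. dot m u (b' j) * b j i))"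
  unfolding chr_def using unimod_expand[OF assms(1,2)] by (metis (no_types, lifting))
 also have "\<dots> = (\<Prod>i<m. \<Prod>j<m. (t i powi b j i) powi dot m u (b' j))"
  using assms by (simp add: powi_sum power_int_mult mult.commute)
 also have "\<dots> = (\<Prod>j<m. chr m (b j) t powi dot m u (b' j))"
  unfolding chr_def powi_prod by (rule prod.swap)
 finally show ?thesis .
qed

lemma continuous_on_chr: "(\<And>t i. t \<in> S ==> t i \<noteq> 0) ==> continuous_on S (chr m u)"
 unfolding chr_def
 by (intro continuous_on_prod continuous_on_power_int continuous_on_subset[OF continuous_on_product_coordinates]) auto

lemma continuous_map_powi [continuous_intros]:
 assumes "continuous_map X euclidean f" "\<And>x. x \<in> topspace X ==> f x \<noteq> 0"
 shows "continuous_map X euclidean (%x. f x powi n :: complex)"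
proof -
 have "continuous_map X (top_of_set (- {0})) f" using assms by (auto simp: continuous_map_in_subtopology)
 moreover have "continuous_map (top_of_set (- {0})) euclidean (%z::complex. z powi n)"
  by (simp, intro continuous_intros) auto
 ultimately have "continuous_map X euclidean ((%z. z powi n) \<circ> f)" by (rule continuous_map_compose)
 thus ?thesis by (simp add: o_def)
qed

text \<open>Coordinates of the torus in a basis of its character lattice, cut after the first
  \<open>a\<close>. The splittings into a free part and a stabilizer part that occur in charts are
  built from it.\<close>

definition split_torus :: "nat => nat => (nat => nat => int) => cvec => cvec \<times> cvec"
 where "split_torus m a b t =
  ((%j. if j < a then chr m (b j) t else 1), (%l. if l < m - a then chr m (b (a + l)) t else 1))"

lemma split_torus_iso:
 assumes "unimod m b b'" "a \<le> m"
 shows "split_torus m a b \<in> top_group_iso (torus m) (torus a \<times>\<times> torus (m - a))"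
proof -
 define merge :: "_ => nat => complex" where "merge = (%(x, y) j. if j < a then x j else if j < m then y (j - a) else 1)"
 \<comment> \<open>The inverse map recovers coordinate \<open>i\<close> from the character given by
   column \<open>i\<close> of the dual basis.\<close>
 define \<Phi> where "\<Phi> = (%h i. if i < m then chr m (%j. b' j i) (merge h) else 1)"
 let ?P = "Torus a \<times> Torus (m - a)"
 have mT: "merge h \<in> Torus m" if "h \<in> ?P" for h
  using that assms by (auto simp: merge_def in_torus_iff)
 have mc: "continuous_on ?P (%h. merge h i)" for i
  unfolding merge_def case_prod_unfold
 proof -
  have "continuous_on ?P (%h. fst h i)" "continuous_on ?P (%h. snd h (i - a))"
   by (rule continuous_on_product_then_coordinatewise[OF continuous_on_fst[OF continuous_on_id]],
     rule continuous_on_product_then_coordinatewise[OF continuous_on_snd[OF continuous_on_id]])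
  thus "continuous_on ?P (%h. if i < a then fst h i else if i < m then snd h (i - a) else 1)"
   by (cases "i < a"; cases "i < m") simp_all
 qed
 have \<Phi>T: "\<Phi> h \<in> Torus m" if "h \<in> ?P" for h
  using norm_chr[OF mT[OF that]] by (auto simp: \<Phi>_def in_torus_iff)
 have 1: "\<Phi> (split_torus m a b t) = t" if t: "t \<in> Torus m" for t
 proof
  fix i
  have mg: "merge (split_torus m a b t) j = chr m (b j) t" if "j < m" for j
   using that by (auto simp: merge_def split_torus_def)
  show "\<Phi> (split_torus m a b t) i = t i"
  proof (cases "i < m")
   case True
   have "\<Phi> (split_torus m a b t) i = (\<Prod>j<m. chr m (b j) t powi b' j i)"
    using True mg unfolding \<Phi>_def chr_def by simp
   also have "\<dots> = chr m (unit_vec i) t"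
    using chr_expand[OF assms(1) unit_vec_in_lat[OF True], of t] torus_nonzero[OF t] by (simp add: dot_unit_vec True)
   finally show ?thesis by (simp add: chr_unit_vec True)
  qed (use t in \<open>simp add: \<Phi>_def in_torus_iff\<close>)
 qed
 have 2: "split_torus m a b (\<Phi> h) = h" if h: "h \<in> ?P" for h
 proof -
  have "chr m (b j) (\<Phi> h) = merge h j" if j: "j < m" for j
  proof -
   have "chr m (b j) (\<Phi> h) = (\<Prod>i<m. (\<Prod>l<m. (merge h l powi b' l i) powi b j i))"
    by (simp add: \<Phi>_def chr_def powi_prod)
   also have "\<dots> = (\<Prod>l<m. merge h l powi dot m (b j) (b' l))"
    using torus_nonzero[OF mT[OF h]]
    by (subst prod.swap) (simp add: dot_def powi_sum mult.commute flip: power_int_mult)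
   also have "\<dots> = (\<Prod>l<m. if l = j then merge h l else 1)"
    using unimodD[OF assms(1) j] by (intro prod.cong) auto
   finally show ?thesis using j by simp
  qed
  thus ?thesis using h assms(2) by (auto simp: split_torus_def merge_def in_torus_iff fun_eq_iff case_prod_unfold)
 qed
 have "continuous_on (Torus m) (%t. if P then chr m u t else 1)" for P u
  by (cases P) (auto intro!: continuous_on_chr torus_nonzero)
 hence c1: "continuous_on (Torus m) (split_torus m a b)"
  unfolding split_torus_def
  by (intro continuous_on_Pair continuous_on_coordinatewise_then_product)
 have "continuous_on ?P (%h. chr m u (merge h))" for u
 proof -
  have "continuous_on ?P merge" by (intro continuous_on_coordinatewise_then_product mc)
  moreover have "continuous_on (merge ` ?P) (chr m u)"
   by (intro continuous_on_chr) (use mT torus_nonzero in blast)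
  ultimately show ?thesis using continuous_on_compose[of ?P merge "chr m u"] by simp
 qed
 hence "continuous_on ?P (%h. if i < m then chr m (%j. b' j i) (merge h) else 1)" for i
  by (cases "i < m") simp_all
 hence c2: "continuous_on ?P \<Phi>"
  unfolding \<Phi>_def by (intro continuous_on_coordinatewise_then_product)
 show ?thesis
 proof (rule torus_top_group_isoI[where \<Phi> = \<Phi>])
  show "split_torus m a b t \<in> carrier (torus a \<times>\<times> torus (m - a))" if "t \<in> Torus m" for t
   using norm_chr[OF that] by (auto simp: split_torus_def in_torus_iff)
  show "split_torus m a b (coord_mult s t) =
   split_torus m a b s \<otimes>\<^bsub>torus a \<times>\<times> torus (m - a)\<^esub> split_torus m a b t" for s t
  proof -
   have "(if P then chr m u (coord_mult s t) else 1) = (if P then chr m u s else 1) * (if P then chr m u t else 1)" for P u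
    by (simp add: chr_coord_mult)
   thus ?thesis by (simp add: split_torus_def) (simp add: coord_mult_def)
  qed
 qed (use c1 c2 \<Phi>T 1 2 in \<open>auto simp: DirProd_def\<close>)
qed

section \<open>Affine toric varieties as cones over links\<close>

lemma continuous_map_compose_on:
 assumes "continuous_map X euclidean f" "continuous_on S h" "\<And>x. x \<in> topspace X ==> f x \<in> S"
 shows "continuous_map X euclidean (%x. h (f x))"
proof -
 have "continuous_map X (top_of_set S) f" using assms by (auto simp: continuous_map_in_subtopology)
 moreover have "continuous_map (top_of_set S) euclidean h" using assms by simp
 ultimately have "continuous_map X euclidean (h \<circ> f)" by (rule continuous_map_compose)
 thus ?thesis by (simp add: o_def)
qed

lemma continuous_map_mult:
 fixes f g :: "'a => 'b::real_normed_algebra"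
 shows "continuous_map X euclidean f ==> continuous_map X euclidean g ==> continuous_map X euclidean (%x. f x * g x)"
 by (simp add: continuous_map_atin tendsto_mult)

lemma continuous_map_prod:
 fixes f :: "'i => 'a => 'b::real_normed_field"
 shows "(\<And>i. i \<in> I ==> continuous_map X euclidean (f i)) ==> continuous_map X euclidean (%x. \<Prod>i\<in>I. f i x)"
 by (simp add: continuous_map_atin tendsto_prod)

text \<open>A form of properness for a source that is not compact. A point \<open>z\<close> in the
  closure of an image already lies in the closure of the image of the compact part where
  \<open>N\<close> is at most \<open>N z + 1\<close>, and that image is closed.\<close>

lemma exhaustion_closed_map:
 assumes f: "continuous_map Y Z f" and H: "Hausdorff_space Z" and N: "continuous_map Z euclideanreal N"
  and K: "\<And>R. compactin Y {y \<in> topspace Y. N (f y) \<le> R}"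
 shows "closed_map Y Z f"
 unfolding closed_map_def
proof (intro allI impI)
 fix C assume C: "closedin Y C"
 show "closedin Z (f ` C)"
 proof -
  have sub: "f ` C \<subseteq> topspace Z" using closedin_subset[OF C] f continuous_map_image_subset_topspace by fast
  have "z \<in> f ` C" if z: "z \<in> Z closure_of (f ` C)" for z
  proof -
   have zZ: "z \<in> topspace Z" using z by (meson in_closure_of)
   let ?K = "{y \<in> topspace Y. N (f y) \<le> N z + 1}"
   have "compactin Y (C \<inter> ?K)" using closed_Int_compactin[OF C K] .
   hence cl: "closedin Z (f ` (C \<inter> ?K))" using image_compactin f compactin_imp_closedin H by blast
   have "\<exists>y\<in>f ` (C \<inter> ?K). y \<in> T" if T: "z \<in> T" "openin Z T" for T
   proof -
    have "openin Z {x \<in> topspace Z. N x \<in> {..<N z + 1}}"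
     by (rule openin_continuous_map_preimage[OF N]) simp
    hence "openin Z (T \<inter> {x \<in> topspace Z. N x \<in> {..<N z + 1}})" using T by blast
    moreover have "z \<in> T \<inter> {x \<in> topspace Z. N x \<in> {..<N z + 1}}" using T zZ by simp
    ultimately have "\<exists>w\<in>f ` C. w \<in> T \<inter> {x \<in> topspace Z. N x \<in> {..<N z + 1}}"
     using z unfolding in_closure_of by meson
    then obtain w where "w \<in> f ` C" "w \<in> T" "N w < N z + 1" by auto
    thus ?thesis using closedin_subset[OF C] by force
   qed
   hence "z \<in> Z closure_of (f ` (C \<inter> ?K))" using zZ by (simp add: in_closure_of)
   hence "z \<in> f ` (C \<inter> ?K)" by (simp only: closure_of_closedin[OF cl])
   thus ?thesis by auto
  qed
  thus ?thesis using closure_of_subset_eq sub by blast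
 qed
qed

lemma homeomorphic_second_countable:
 assumes "X homeomorphic_space Y" "second_countable X"
 shows "second_countable Y"
 using assms by (metis homeomorphic_space_def homeomorphic_maps_map homeomorphic_imp_open_map
   homeomorphic_imp_continuous_map homeomorphic_imp_surjective_map second_countable_open_map_image)

lemma torus_action_subtopology:
 assumes "torus_action m X act" "T_invariant m act U"
 shows "torus_action m (subtopology X U) act"
proof -
 have "continuous_map (prod_topology (torus_top m) (subtopology X U)) X (%(t, x). act t x)"
  using torus_action_continuous[OF assms(1)]
  by (metis continuous_map_from_subtopology prod_topology_subtopology)
 thus ?thesis
  using assms unfolding torus_action_iff T_invariant_def by (auto simp: continuous_map_in_subtopology)
qed

text \<open>\<open>G\<close> stands for ray generators of a cone in the cocharacter lattice. The set
  is the semigroup of characters that are non-negative on the cone, so that its complex-valued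
  homomorphisms are the points of an affine toric variety.\<close>

definition csg :: "nat => ivec set => ivec set"
 where "csg k G = {u \<in> lat k. \<forall>g\<in>G. 0 \<le> dot k u g}"

lemma csg_closed: "0 \<in> csg k G" "u \<in> csg k G ==> v \<in> csg k G ==> u + v \<in> csg k G"
 by (auto simp: csg_def dot_add)

lemma countable_lat: "countable (lat k)"
proof -
 have "inj_on (%u. map u [0..<k]) (lat k)"
 proof (rule inj_onI, rule ext)
  fix u v i assume "u \<in> lat k" "v \<in> lat k" "map u [0..<k] = map v [0..<k]"
  thus "u i = v i" by (cases "i < k") (auto simp: lat_def)
 qed
 thus ?thesis using countable_image_inj_on countableI_type by blast
qed

lemma countable_csg: "countable (csg k G)"
 by (rule countable_subset[OF _ countable_lat[of k]]) (auto simp: csg_def)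

definition hom_pts :: "ivec set => mono set"
 where "hom_pts S = {g \<in> extensional S. g 0 = 1 \<and> (\<forall>u\<in>S. \<forall>v\<in>S. g (u + v) = g u * g v)}"

definition hom_top :: "ivec set => mono topology"
 where "hom_top S = subtopology (product_topology (%_. euclidean) S) (hom_pts S)"

definition hom_act :: "nat => ivec set => mono taction"
 where "hom_act k S t \<gamma> = (\<lambda>u\<in>S. chr k u t * \<gamma> u)"

text \<open>The torus-fixed point. It is multiplicative only if 0 is the sole unit of the semigroup,
  which is where pointedness enters.\<close>

definition apex :: "ivec set => mono"
 where "apex S = (\<lambda>u\<in>S. if u = 0 then 1 else 0)"

lemma hom_ptsD:
 assumes "g \<in> hom_pts S"
 shows "g 0 = 1" "u \<in> S ==> v \<in> S ==> g (u + v) = g u * g v" "g \<in> extensional S"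
 using assms by (auto simp: hom_pts_def)

lemma hom_ptsI:
 assumes "g \<in> extensional S" "g 0 = 1" "\<And>u v. u \<in> S ==> v \<in> S ==> g (u + v) = g u * g v"
 shows "g \<in> hom_pts S"
 using assms by (auto simp: hom_pts_def)

lemma hom_pts_eqI: "g \<in> hom_pts S ==> d \<in> hom_pts S ==> (\<And>u. u \<in> S ==> g u = d u) ==> g = d"
 using extensionalityI hom_ptsD(3) by blast

lemma topspace_hom_top [simp]: "topspace (hom_top S) = hom_pts S"
 by (auto simp: hom_top_def hom_pts_def PiE_def)

lemma continuous_map_into_hom_iff:
 "continuous_map X (hom_top S) f \<longleftrightarrow>
  (\<forall>x\<in>topspace X. f x \<in> hom_pts S) \<and> (\<forall>u\<in>S. continuous_map X euclidean (%x. f x u))"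
proof -
 have "f ` topspace X \<subseteq> extensional S" if "\<forall>x\<in>topspace X. f x \<in> hom_pts S"
  using that by (auto simp: hom_pts_def)
 thus ?thesis
  unfolding hom_top_def continuous_map_in_subtopology continuous_map_componentwise by auto
qed

lemma continuous_map_hom_eval: "u \<in> S ==> continuous_map (hom_top S) euclidean (%g. g u)"
 unfolding hom_top_def by (intro continuous_map_from_subtopology continuous_map_product_projection)

lemma continuous_map_hom_evalI:
 "continuous_map X (hom_top S) f ==> u \<in> S ==> continuous_map X euclidean (%x. f x u)"
 by (simp add: continuous_map_into_hom_iff)

lemma Hausdorff_hom_top: "Hausdorff_space (hom_top S)"
 unfolding hom_top_def by (intro Hausdorff_space_subtopology) (simp add: Hausdorff_space_product_topology)

text \<open>Only countably many evaluations are involved, so an enumeration of \<open>S\<close>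
  embeds the space in the space of complex sequences.\<close>

lemma second_countable_hom_top:
 assumes "countable S"
 shows "second_countable (hom_top S)"
proof -
 define e where "e = (%(g :: mono) n. if n \<in> to_nat_on S ` S then g (from_nat_into S n) else 0)"
 define d where "d = (%(z :: cvec). \<lambda>u\<in>S. z (to_nat_on S u))"
 have de: "d (e g) = g" if "g \<in> hom_pts S" for g
  using hom_ptsD[OF that] assms by (auto simp: d_def e_def extensional_def)
 have ins: "from_nat_into S n \<in> S" if "n \<in> to_nat_on S ` S" for n
  using that assms by auto
 have "homeomorphic_maps (hom_top S) (top_of_set (e ` hom_pts S)) e d"
  unfolding homeomorphic_maps_def
 proof (intro conjI)
  have "continuous_map (hom_top S) euclidean (%g. e g n)" for n
   unfolding e_def by (auto intro: continuous_map_hom_eval ins)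
  thus "continuous_map (hom_top S) (top_of_set (e ` hom_pts S)) e"
   by (auto simp: continuous_map_in_subtopology continuous_map_into_fun_iff)
  show "continuous_map (top_of_set (e ` hom_pts S)) (hom_top S) d"
   unfolding continuous_map_into_hom_iff
  proof (intro conjI ballI)
   fix u assume "u \<in> S"
   thus "continuous_map (top_of_set (e ` hom_pts S)) euclidean (%z. d z u)"
    by (simp add: d_def continuous_on_subset[OF continuous_on_product_coordinates])
  qed (use de in auto)
 qed (use de in auto)
 thus ?thesis using homeomorphic_maps_sym homeomorphic_second_countable second_countable_top_of_set unfolding homeomorphic_space_def by blast
qed

lemma closedin_hom_pts:
 assumes "0 \<in> S" "\<And>u v. u \<in> S ==> v \<in> S ==> u + v \<in> S"
 shows "closedin (product_topology (%_. euclidean) S) (hom_pts S)"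
proof -
 let ?P = "product_topology (%_. euclidean :: complex topology) S"
 have ev: "continuous_map ?P euclidean (%g. g u)" if "u \<in> S" for u
  using that by (rule continuous_map_product_projection)
 have 1: "closedin ?P {g \<in> topspace ?P. g 0 = 1}"
  by (rule closedin_continuous_maps_eq[OF Hausdorff_space_euclidean ev[OF assms(1)]]) simp
 have 2: "closedin ?P {g \<in> topspace ?P. g (u + v) = g u * g v}" if "u \<in> S" "v \<in> S" for u v
  by (rule closedin_continuous_maps_eq[OF Hausdorff_space_euclidean]) (intro ev continuous_map_mult assms that)+
 have "hom_pts S = \<Inter>(insert {g \<in> topspace ?P. g 0 = 1}
   ((%(u, v). {g \<in> topspace ?P. g (u + v) = g u * g v}) ` (S \<times> S)))"
  by (auto simp: hom_pts_def PiE_def)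
 also have "closedin ?P \<dots>"
  using 1 2 by (intro closedin_Inter) auto
 finally show ?thesis .
qed

text \<open>Multiplicativity is a closed condition inside a product of closed discs, which is
  compact by Tychonoff's theorem.\<close>

lemma compactin_hom_bounded:
 assumes "0 \<in> S" "\<And>u v. u \<in> S ==> v \<in> S ==> u + v \<in> S"
 shows "compactin (hom_top S) {g \<in> hom_pts S. \<forall>u\<in>S. cmod (g u) \<le> r u}"
proof -
 let ?P = "product_topology (%_. euclidean :: complex topology) S"
 have "compactin ?P (PiE S (%u. cball 0 (r u)))" by (subst compactin_PiE) auto
 from closed_Int_compactin[OF closedin_hom_pts[OF assms] this]
 have "compactin ?P (hom_pts S \<inter> PiE S (%u. cball 0 (r u)))" by blast
 moreover have "hom_pts S \<inter> PiE S (%u. cball 0 (r u)) = {g \<in> hom_pts S. \<forall>u\<in>S. cmod (g u) \<le> r u}"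
  by (auto simp: hom_pts_def PiE_def)
 ultimately show ?thesis unfolding hom_top_def by (auto simp: compactin_subtopology)
qed

lemma hom_act_in_hom_pts:
 assumes "t \<in> Torus k" "g \<in> hom_pts (csg k G)"
 shows "hom_act k (csg k G) t g \<in> hom_pts (csg k G)"
 using assms hom_ptsD
 by (intro hom_ptsI) (simp_all add: hom_act_def csg_closed chr_add torus_nonzero)

lemma torus_action_hom: "torus_action k (hom_top (csg k G)) (hom_act k (csg k G))"
 unfolding torus_action_iff
proof (intro conjI ballI)
 show "hom_act k (csg k G) (%_. 1) g = g" if "g \<in> topspace (hom_top (csg k G))" for g
  using that by (auto simp: hom_act_def hom_pts_def extensional_def)
 show "continuous_map (prod_topology (torus_top k) (hom_top (csg k G))) (hom_top (csg k G))
   (%(t, x). hom_act k (csg k G) t x)"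
  unfolding continuous_map_into_hom_iff
 proof (intro conjI ballI)
  fix u assume u: "u \<in> csg k G"
  have 1: "continuous_map (prod_topology (torus_top k) (hom_top (csg k G))) euclidean (%p. snd p u)"
   by (rule continuous_map_hom_evalI[OF continuous_map_snd u])
  have 2: "continuous_map (prod_topology (torus_top k) (hom_top (csg k G))) euclidean (%p. chr k u (fst p))" using continuous_on_chr torus_nonzero continuous_map_compose[OF continuous_map_fst, of "torus_top k" euclidean "chr k u"] by (simp add: o_def)
  show "continuous_map (prod_topology (torus_top k) (hom_top (csg k G))) euclidean
    (%x. (case x of (t, x) => hom_act k (csg k G) t x) u)"
   using continuous_map_mult[OF 2 1] by (simp add: hom_act_def case_prod_unfold)
 qed (auto simp: hom_act_in_hom_pts)
 show "hom_act k (csg k G) (coord_mult s t) g = hom_act k (csg k G) s (hom_act k (csg k G) t g)" for s t g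
  by (auto simp: hom_act_def chr_coord_mult)
qed (auto simp: hom_act_in_hom_pts)

section \<open>Dickson's lemma\<close>

lemma nat_sequence_monotone_subsequence:
 fixes s :: "nat => nat"
 shows "\<exists>r. strict_mono r \<and> incseq (s \<circ> r)"
proof -
 obtain f where f: "strict_mono f" "monoseq (%n. s (f n))" using seq_monosub by blast
 show ?thesis
 proof (cases "incseq (%n. s (f n))")
  case True
  thus ?thesis using f by (auto simp: o_def)
 next
  case False
  hence d: "decseq (%n. s (f n))" using f by (simp add: monoseq_iff)
  obtain n0 where n0: "\<And>n. s (f n0) \<le> s (f n)"
   using ex_has_least_nat[of "%_. True" 0 "%n. s (f n)"] by blast
  have "s (f (n0 + n)) = s (f n0)" for n
   using n0[of "n0 + n"] decseqD[OF d, of n0 "n0 + n"] by simp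
  hence "incseq (s \<circ> (%n. f (n0 + n)))" by (simp add: incseq_def)
  moreover have "strict_mono (%n. f (n0 + n))" using f by (simp add: strict_mono_def)
  ultimately show ?thesis by blast
 qed
qed

lemma simultaneous_monotone_subsequence:
 fixes f :: "nat => 'a" and m :: "'g => 'a => nat"
 assumes "finite G"
 shows "\<exists>r. strict_mono r \<and> (\<forall>g\<in>G. incseq (%n. m g (f (r n))))"
 using assms
proof (induction G)
 case empty
 thus ?case by (intro exI) (auto simp: strict_mono_def)
next
 case (insert g G)
 then obtain r where r: "strict_mono r" "\<forall>g\<in>G. incseq (%n. m g (f (r n)))" by blast
 obtain q where q: "strict_mono q" "incseq ((%n. m g (f (r n))) \<circ> q)"
  using nat_sequence_monotone_subsequence by blast
 have "strict_mono (r \<circ> q)" using r q by (simp add: strict_mono_def)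
 moreover have "\<forall>h\<in>insert g G. incseq (%n. m h (f ((r \<circ> q) n)))"
  using r q by (auto simp: incseq_def strict_mono_leD)
 ultimately show ?case by blast
qed

text \<open>An infinite \<open>A\<close> would contain an injective sequence; along a subsequence on
  which every \<open>\<mu> g\<close> is weakly increasing, the first two members are comparable and
  hence equal.\<close>

lemma finite_antichain:
 fixes \<mu> :: "'g => 'a => nat"
 assumes "finite G" "\<And>x y. x \<in> A ==> y \<in> A ==> (\<And>g. g \<in> G ==> \<mu> g x \<le> \<mu> g y) ==> x = y"
 shows "finite A"
proof (rule ccontr)
 assume "infinite A"
 then obtain f :: "nat => 'a" where f: "inj f" "range f \<subseteq> A" using infinite_countable_subset by blast
 obtain r where r: "strict_mono r" "\<forall>g\<in>G. incseq (%n. \<mu> g (f (r n)))"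
  using simultaneous_monotone_subsequence[OF assms(1)] by blast
 have "f (r 0) = f (r 1)"
  by (rule assms) (use f r in \<open>auto simp: incseq_def\<close>)
 thus False using f r by (auto simp: inj_eq strict_mono_eq)
qed

text \<open>The names refer to the dual cone, which carries the semigroup. \<open>pointed\<close>
  says that \<open>G\<close> spans rationally, so that 0 is the only unit of \<open>csg k G\<close>;
  \<open>full\<close> says that some character is positive on all of \<open>G\<close>, so that the
  cone generated by \<open>G\<close> is strongly convex.\<close>

locale toric_cone =
 fixes k :: nat and G :: "ivec set"
 assumes finite_G: "finite G"
  and pointed: "\<And>u. u \<in> lat k ==> (\<And>g. g \<in> G ==> dot k u g = 0) ==> u = 0"
  and full: "\<exists>u\<in>lat k. \<forall>g\<in>G. 0 < dot k u g"

context toric_cone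
begin

abbreviation S :: "ivec set" where "S \<equiv> csg k G"

definition deg :: "ivec => int"
 where "deg u = (\<Sum>g\<in>G. dot k u g)"

lemma deg_add: "deg (u + v) = deg u + deg v"
 and deg_zero [simp]: "deg 0 = 0"
 by (simp_all add: deg_def dot_add sum.distrib)

lemma deg_nonneg: "u \<in> S ==> 0 \<le> deg u"
 by (auto simp: deg_def csg_def intro!: sum_nonneg)

text \<open>A sum of non-negative pairings vanishes only if each of them does, which pointedness
  forbids.\<close>

lemma deg_pos:
 assumes "u \<in> S" "u \<noteq> 0"
 shows "0 < deg u"
proof (rule ccontr)
 assume "\<not> 0 < deg u"
 hence "(\<Sum>g\<in>G. dot k u g) = 0" using deg_nonneg[OF assms(1)] by (simp add: deg_def)
 thus False using finite_G pointed assms by (subst (asm) sum_nonneg_eq_0_iff) (auto simp: csg_def)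
qed

lemma nat_deg_add: "u \<in> S ==> v \<in> S ==> nat (deg (u + v)) = nat (deg u) + nat (deg v)"
 by (simp add: deg_add deg_nonneg nat_add_distrib)

text \<open>Gordan's lemma. \<open>H\<close> consists of the indecomposable elements; as vectors of
  pairings with \<open>G\<close> they form an antichain, hence are finite in number. The conclusion
  asks only for one generator that can be subtracted, the form suited to induction on
  \<open>deg\<close>.\<close>

lemma finite_generation:
 "\<exists>H. finite H \<and> H \<subseteq> S - {0} \<and> (\<forall>u\<in>S. u \<noteq> 0 --> (\<exists>h\<in>H. u - h \<in> S))"
proof -
 define H where "H = {h \<in> S - {0}. \<forall>v\<in>S - {0}. h - v \<in> S --> v = h}"
 have mem: "y - x \<in> S" if "x \<in> S" "y \<in> S" "\<And>g. g \<in> G ==> nat (dot k x g) \<le> nat (dot k y g)" for x y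
 using that by (force simp: dot_diff csg_def)
 have "finite H"
  by (rule finite_antichain[OF finite_G, where \<mu> = "%g u. nat (dot k u g)"])
   (use mem in \<open>auto simp: H_def\<close>)
 moreover have "\<exists>h\<in>H. u - h \<in> S" if "u \<in> S" "u \<noteq> 0" for u
  using that
 proof (induction "nat (deg u)" arbitrary: u rule: less_induct)
  case less
  show ?case
  proof (cases "u \<in> H")
   case True
   thus ?thesis by (intro bexI) (auto simp: csg_closed)
  next
   case False
   then obtain v where v: "v \<in> S" "v \<noteq> 0" "u - v \<in> S" "v \<noteq> u" using less.prems by (auto simp: H_def)
   have "0 < deg (u - v)" using deg_pos v by simp
   moreover have "deg u = deg v + deg (u - v)" using deg_add[of v "u - v"] by simp
   ultimately have "nat (deg v) < nat (deg u)" using deg_nonneg[OF v(1)] by simp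
   then obtain h where "h \<in> H" "v - h \<in> S" using less.hyps v by blast
   moreover have "u - h = (v - h) + (u - v)" by simp
   ultimately show ?thesis using csg_closed v by metis
  qed
 qed
 ultimately show ?thesis by (intro exI) (auto simp: H_def)
qed

definition gens :: "ivec set"
 where "gens = (SOME H. finite H \<and> H \<subseteq> S - {0} \<and> (\<forall>u\<in>S. u \<noteq> 0 --> (\<exists>h\<in>H. u - h \<in> S)))"

lemma gens: "finite gens" "gens \<subseteq> S - {0}" "u \<in> S ==> u \<noteq> 0 ==> \<exists>h\<in>gens. u - h \<in> S"
 using someI_ex[OF finite_generation] unfolding gens_def by blast+

text \<open>The flow of the one-parameter subgroup in the interior of the cone given by \<open>deg\<close>.\<close>

definition flow :: "real => mono => mono"
 where "flow c \<gamma> = (\<lambda>u\<in>S. of_real c ^ nat (deg u) * \<gamma> u)"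

text \<open>The root of order \<open>deg h\<close> makes each summand homogeneous of degree one
  under the flow. The height thus scales linearly, and the flow line of a point other than the apex
  meets every positive level exactly once.\<close>

definition height :: "mono => real"
 where "height \<gamma> = (\<Sum>h\<in>gens. root (nat (deg h)) (cmod (\<gamma> h)))"

lemma flow_in_hom_pts: "g \<in> hom_pts S ==> flow c g \<in> hom_pts S"
 by (intro hom_ptsI) (auto simp: flow_def csg_closed hom_ptsD nat_deg_add power_add)

text \<open>Because \<open>0 ^ 0 = 1\<close> and non-zero elements have positive degree, the formula
  for the flow stays valid at time 0 and collapses everything there.\<close>

lemma flow_zero: "g \<in> hom_pts S ==> flow 0 g = apex S"
using deg_pos hom_ptsD flow_def apex_def by auto

lemma flow_one: "g \<in> hom_pts S ==> flow 1 g = g"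
 by (auto simp: flow_def hom_pts_def extensional_restrict)

lemma flow_flow: "flow c (flow m g) = flow (c * m) g"
 by (auto simp: flow_def power_mult_distrib)

text \<open>Two elements with sum 0 have non-negative degrees with sum 0, hence vanish: no units
  contradict multiplicativity.\<close>

lemma apex_in_hom_pts: "apex S \<in> hom_pts S"
proof -
 have "u = 0 \<and> v = 0" if "u \<in> S" "v \<in> S" "u + v = 0" for u v
 proof -
  show ?thesis using deg_add[of u v] that deg_nonneg[OF that(1)] deg_nonneg[OF that(2)] deg_pos[of u] deg_pos[of v] that by auto
 qed
 hence "(if u + v = 0 then 1 else 0) = (if u = 0 then 1 else 0) * (if v = 0 then 1 else (0::complex))"
  if "u \<in> S" "v \<in> S" for u v
 proof (cases "u + v = 0")
  case True
  hence "u = 0" "v = 0" using that \<open>\<And>v u. u \<in> S ==> v \<in> S ==> u + v = 0 ==> u = 0 \<and> v = 0\<close> by blast+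
  thus ?thesis by simp
 next
  case False
  thus ?thesis by auto
 qed
 thus ?thesis by (intro hom_ptsI) (simp_all add: apex_def csg_closed)
qed

lemma gens_deg: "h \<in> gens ==> 0 < nat (deg h)"
 using deg_pos gens by auto

lemma height_flow:
 assumes "g \<in> hom_pts S" "0 \<le> c"
 shows "height (flow c g) = c * height g"
 unfolding height_def sum_distrib_left
proof (rule sum.cong)
 fix h assume h: "h \<in> gens"
 thus "root (nat (deg h)) (cmod (flow c g h)) = c * root (nat (deg h)) (cmod (g h))" using gens(2) assms(2) gens_deg[OF h] assms by (auto simp: flow_def norm_mult norm_power real_root_power_cancel real_root_mult)
qed simp

lemma height_nonneg: "0 \<le> height g"
 unfolding height_def by (intro sum_nonneg) (simp add: real_root_ge_zero)

lemma height_apex: "height (apex S) = 0"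
 using height_flow[of "apex S" 0] flow_zero apex_in_hom_pts by simp

text \<open>The finitely many generators seen by the height control all coordinates: one generator
  is peeled off \<open>u\<close>, and induction runs on the degree. Together with
  \<open>compactin_hom_bounded\<close> this makes sublevel sets of the height compact.\<close>

lemma norm_le_height:
 assumes "g \<in> hom_pts S" "height g \<le> R" "u \<in> S"
 shows "cmod (g u) \<le> R ^ nat (deg u)"
 using assms(3)
proof (induction "nat (deg u)" arbitrary: u rule: less_induct)
 case less
 have R: "0 \<le> R" using height_nonneg[of g] assms by linarith
 show ?case
 proof (cases "u = 0")
  case True
  thus ?thesis using hom_ptsD[OF assms(1)] by simp
 next
  case False
  then obtain h where h: "h \<in> gens" "u - h \<in> S" using gens less.prems by blast
  have hS: "h \<in> S" using h gens by auto
  have u: "u = h + (u - h)" by simp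
  have d: "nat (deg u) = nat (deg h) + nat (deg (u - h))" using nat_deg_add[OF hS h(2)] by simp
  have "root (nat (deg h)) (cmod (g h)) \<le> height g"
   unfolding height_def by (rule member_le_sum[OF h(1)]) (use gens in \<open>auto simp: real_root_ge_zero\<close>)
  hence "root (nat (deg h)) (cmod (g h)) \<le> R" using assms by linarith
  hence "cmod (g h) \<le> R ^ nat (deg h)"
   using gens_deg[OF h(1)] by (metis norm_ge_zero power_mono real_root_ge_zero real_root_pow_pos2)
  moreover have "cmod (g (u - h)) \<le> R ^ nat (deg (u - h))"
   using less.hyps[OF _ h(2)] d gens_deg[OF h(1)] by linarith
  moreover have "g u = g h * g (u - h)" using hom_ptsD(2)[OF assms(1) hS h(2)] u by metis
  ultimately show ?thesis unfolding d using R by (simp add: norm_mult power_add mult_mono)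
 qed
qed

lemma height_eq_0:
 assumes "g \<in> hom_pts S" "height g = 0"
 shows "g = apex S"
proof (rule hom_pts_eqI[OF assms(1) apex_in_hom_pts])
 fix u assume u: "u \<in> S"
 show "g u = apex S u"
 proof (cases "u = 0")
  case False
  thus ?thesis using norm_le_height[OF assms(1), of 0 u] assms deg_pos u by (auto simp: zero_power apex_def)
 qed (use u hom_ptsD(1)[OF assms(1)] in \<open>simp add: apex_def\<close>)
qed

lemma continuous_map_height: "continuous_map (hom_top S) euclideanreal height"
 unfolding height_def
proof (rule continuous_map_sum)
 fix h assume "h \<in> gens"
 hence h: "h \<in> S" "0 < nat (deg h)" using gens gens_deg by auto
 show "continuous_map (hom_top S) euclideanreal (%g. root (nat (deg h)) (cmod (g h)))"
  by (rule continuous_map_compose_on[OF continuous_map_norm[OF continuous_map_hom_eval[OF h(1)]], of UNIV])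
   (auto intro!: continuous_intros)
qed (rule gens(1))

lemma compactin_height_le: "compactin (hom_top S) {g \<in> hom_pts S. height g \<le> R}"
proof (rule closed_compactin[OF compactin_hom_bounded[of S "%u. R ^ nat (deg u)"]])
 show "{g \<in> hom_pts S. height g \<le> R} \<subseteq> {g \<in> hom_pts S. \<forall>u\<in>S. cmod (g u) \<le> R ^ nat (deg u)}"
  using norm_le_height by blast
 show "closedin (hom_top S) {g \<in> hom_pts S. height g \<le> R}"
  using closedin_continuous_map_preimage[OF continuous_map_height, of "{..R}"] by simp
qed (auto simp: csg_closed)

section \<open>The link and the open cone over it\<close>

definition link :: "mono topology"
 where "link = subtopology (hom_top S) {\<gamma>. height \<gamma> = 1}"

lemma link_alt: "link = subtopology (hom_top S) {g \<in> hom_pts S. height g = 1}"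
proof -
 have "{g \<in> hom_pts S. height g = 1} = topspace (hom_top S) \<inter> {g. height g = 1}" by auto
 thus ?thesis unfolding link_def by (simp only: subtopology_restrict)
qed

lemma topspace_link: "topspace link = {g \<in> hom_pts S. height g = 1}"
 by (auto simp: link_def)

lemma compact_link: "compact_space link"
proof -
 have "closedin (hom_top S) {g \<in> hom_pts S. height g = 1}"
  using closedin_continuous_map_preimage[OF continuous_map_height, of "{1}"] by simp
 hence "compactin (hom_top S) {g \<in> hom_pts S. height g = 1}"
  by (rule closed_compactin[OF compactin_height_le[of 1], rotated]) auto
 thus ?thesis unfolding link_alt by (rule compact_space_subtopology)
qed

lemma Hausdorff_link: "Hausdorff_space link"
 unfolding link_def by (intro Hausdorff_space_subtopology Hausdorff_hom_top)

lemma second_countable_link: "second_countable link"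
 unfolding link_def by (intro second_countable_subtopology second_countable_hom_top countable_csg)

lemma height_hom_act:
 assumes "t \<in> Torus k" "g \<in> hom_pts S"
 shows "height (hom_act k S t g) = height g"
 unfolding height_def
proof (rule sum.cong)
 fix h assume "h \<in> gens"
 thus "root (nat (deg h)) (cmod (hom_act k S t g h)) = root (nat (deg h)) (cmod (g h))" using gens norm_chr[OF assms(1)] by (auto simp: norm_mult hom_act_def)
qed simp

lemma torus_action_link: "torus_action k link (hom_act k S)"
 unfolding link_alt
 by (rule torus_action_subtopology[OF torus_action_hom])
  (auto simp: T_invariant_def height_hom_act hom_act_in_hom_pts)

lemma flow_continuous:
 assumes "continuous_map X (hom_top S) f" "continuous_map X euclideanreal l"
 shows "continuous_map X (hom_top S) (%x. flow (l x) (f x))"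
 unfolding continuous_map_into_hom_iff
proof (intro conjI ballI)
 fix x assume "x \<in> topspace X"
 thus "flow (l x) (f x) \<in> hom_pts S" using assms flow_in_hom_pts by (simp add: continuous_map_into_hom_iff)
next
 fix u assume u: "u \<in> S"
 have "continuous_map X euclidean (%x. complex_of_real (l x) ^ nat (deg u))"
  by (rule continuous_map_compose_on[OF assms(2), of UNIV]) (auto intro!: continuous_intros)
 from continuous_map_mult[OF this continuous_map_hom_evalI[OF assms(1) u]]
 show "continuous_map X euclidean (%x. flow (l x) (f x) u)" by (simp add: flow_def)
qed

text \<open>The cone parameter in the interval from 0 to 1 corresponds to the height in the half
  line by \<open>s / (1 - s)\<close>; the inverse \<open>h / (1 + h)\<close> appears in
  \<open>to_cone\<close>.\<close>

definition of_cone :: "(mono \<times> real) option => mono"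
 where "of_cone c = (case c of None => apex S | Some (g, s) => flow (s / (1 - s)) g)"

definition to_cone :: "mono => (mono \<times> real) option"
 where "to_cone \<gamma> = (if height \<gamma> = 0 then None else Some (flow (1 / height \<gamma>) \<gamma>, height \<gamma> / (1 + height \<gamma>)))"

lemma of_cone_to_cone:
 assumes "g \<in> hom_pts S"
 shows "of_cone (to_cone g) = g" "to_cone g \<in> cone_set (topspace link)"
proof -
 show "of_cone (to_cone g) = g"
  using height_eq_0[OF assms] height_nonneg[of g] flow_one[OF assms]
  by (auto simp: of_cone_def to_cone_def flow_flow field_simps)
 show "to_cone g \<in> cone_set (topspace link)"
  using height_nonneg[of g] height_flow
  by (auto simp: to_cone_def cone_set_def topspace_link flow_in_hom_pts assms)
qed

lemma to_cone_of_cone: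
 assumes "c \<in> cone_set (topspace link)"
 shows "to_cone (of_cone c) = c" "of_cone c \<in> hom_pts S"
using assms apex_in_hom_pts flow_in_hom_pts height_flow flow_one by (auto simp: topspace_link cone_set_def of_cone_def height_apex to_cone_def field_simps flow_flow)

text \<open>The delicate point is continuity of \<open>to_cone\<close> at the apex. It is obtained
  by showing that the map from the product of the link with the interval is closed, by exhaustion
  through the height.\<close>

lemma cone_homeomorphic:
 "homeomorphic_maps (open_cone link) (hom_top S) of_cone to_cone"
proof -
 let ?I = "top_of_set {0..<1::real}"
 let ?Y = "prod_topology link ?I"
 define f where "f = (%(\<gamma>, s). flow (s / (1 - s)) \<gamma>)"
 have tY: "topspace ?Y = topspace link \<times> {0..<1}" by simp
 have fc: "of_cone (cone_proj p) = f p" if "p \<in> topspace ?Y" for p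
  using that flow_zero by (auto simp: f_def cone_proj_def of_cone_def topspace_link)
 have c1: "continuous_map ?Y (hom_top S) f"
 proof -
  have "continuous_map ?Y (hom_top S) fst"
   using continuous_map_fst[of link ?I] by (simp add: link_def continuous_map_in_subtopology)
  moreover have "continuous_map ?Y euclideanreal (%p. snd p / (1 - snd p))"
  proof (rule continuous_map_compose_on[where S = "{0..<1}" and f = snd and h = "%s. s / (1 - s)"])
   show "continuous_map ?Y euclideanreal snd"
    using continuous_map_snd[of link ?I] by (simp add: continuous_map_in_subtopology)
   show "continuous_on {0..<1} (%s. s / (1 - s) :: real)" by (intro continuous_intros) auto
  qed auto
  ultimately show ?thesis unfolding f_def case_prod_unfold by (rule flow_continuous)
 qed
 have cont: "continuous_map (open_cone link) (hom_top S) of_cone"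
  unfolding continuous_map_def
 proof (intro conjI allI impI)
  show "of_cone \<in> topspace (open_cone link) \<rightarrow> topspace (hom_top S)"
   using to_cone_of_cone by (auto simp: topspace_open_cone)
  fix V assume V: "openin (hom_top S) V"
  have "{p \<in> topspace link \<times> {0..<1}. cone_proj p \<in> {c \<in> cone_set (topspace link). of_cone c \<in> V}} =
   {p \<in> topspace ?Y. f p \<in> V}"
  proof -
   have "cone_proj p \<in> cone_set (topspace link)" if "p \<in> topspace ?Y" for p
    using that by (auto simp: cone_proj_def cone_set_def)
   thus ?thesis using fc by auto
  qed
  thus "openin (open_cone link) {x \<in> topspace (open_cone link). of_cone x \<in> V}"
   using openin_continuous_map_preimage[OF c1 V] by (simp add: topspace_open_cone openin_open_cone)
 qed
 have closed: "closed_map ?Y (hom_top S) f"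
 proof (rule exhaustion_closed_map[OF c1 Hausdorff_hom_top continuous_map_height])
  fix R :: real
  have hf: "height (f (\<gamma>, s)) = s / (1 - s)" if "\<gamma> \<in> topspace link" "s \<in> {0..<1}" for \<gamma> s
   using that height_flow by (auto simp: f_def topspace_link)
  show "compactin ?Y {y \<in> topspace ?Y. height (f y) \<le> R}"
  proof (cases "R < 0")
   case True
   hence "\<not> height (f y) \<le> R" for y using height_nonneg[of "f y"] by linarith
   thus ?thesis by auto
  next
   case False
   have R: "R / (1 + R) < 1" using False by simp
   have "s / (1 - s) \<le> R \<longleftrightarrow> s \<le> R / (1 + R)" if "s < 1" for s
    using that False by (simp add: pos_divide_le_eq pos_le_divide_eq algebra_simps)
   hence "{y \<in> topspace ?Y. height (f y) \<le> R} = topspace link \<times> {0..R / (1 + R)}"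
    using R hf by auto
   moreover have "{0..R / (1 + R)} \<subseteq> {0..<1}" using R by auto
   ultimately show ?thesis
    using compact_link by (simp add: compactin_Times compact_space_def compactin_subtopology)
  qed
 qed
 have "continuous_map (hom_top S) (open_cone link) to_cone"
  unfolding continuous_map_closedin
 proof (intro conjI allI impI)
  show "to_cone \<in> topspace (hom_top S) \<rightarrow> topspace (open_cone link)"
   using of_cone_to_cone by (simp add: topspace_open_cone)
  fix C assume C: "closedin (open_cone link) C"
  let ?C = "{p \<in> topspace ?Y. cone_proj p \<in> C}"
  have Csub: "C \<subseteq> cone_set (topspace link)" using closedin_subset[OF C] by (simp add: topspace_open_cone)
  have "openin ?Y {p \<in> topspace link \<times> {0..<1}. cone_proj p \<in> cone_set (topspace link) - C}" using C by (auto simp: topspace_open_cone closedin_def openin_open_cone)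
  moreover have "{p \<in> topspace link \<times> {0..<1}. cone_proj p \<in> cone_set (topspace link) - C} = topspace ?Y - ?C"
   by (auto simp: cone_proj_def cone_set_def)
  ultimately have "closedin ?Y ?C" by (simp only: closedin_def) blast
  hence fC: "closedin (hom_top S) (f ` ?C)" using closed by (simp add: closed_map_def)
  have ap: "closedin (hom_top S) {apex S}"
   using Hausdorff_hom_top apex_in_hom_pts by (simp add: closedin_Hausdorff_singleton)
  \<comment> \<open>The apex is added separately because \<open>f\<close> misses it when the link is
    empty.\<close>
  have "{\<gamma> \<in> topspace (hom_top S). to_cone \<gamma> \<in> C} = f ` ?C \<union> (if None \<in> C then {apex S} else {})"
  proof (intro equalityI subsetI)
   fix \<gamma> assume "\<gamma> \<in> {\<gamma> \<in> topspace (hom_top S). to_cone \<gamma> \<in> C}"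
   hence g: "\<gamma> \<in> hom_pts S" "to_cone \<gamma> \<in> C" by auto
   show "\<gamma> \<in> f ` ?C \<union> (if None \<in> C then {apex S} else {})"
   proof (cases "to_cone \<gamma>")
    case None
    thus ?thesis using g height_eq_0 by (auto simp: to_cone_def split: if_splits)
   next
    case (Some p)
    hence p: "p \<in> topspace link \<times> {0<..<1}" using Csub g by (auto simp: cone_set_def)
    hence "cone_proj p = to_cone \<gamma>" by (auto simp: cone_proj_def Some)
    moreover have "p \<in> topspace ?Y" using p by auto
    ultimately show ?thesis using fc[of p] of_cone_to_cone[OF g(1)] g by auto
   qed
  next
   fix \<gamma> assume "\<gamma> \<in> f ` ?C \<union> (if None \<in> C then {apex S} else {})"
   then consider p where "p \<in> ?C" "\<gamma> = f p" | "None \<in> C" "\<gamma> = apex S" by (auto split: if_splits)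
   thus "\<gamma> \<in> {\<gamma> \<in> topspace (hom_top S). to_cone \<gamma> \<in> C}"
   proof cases
    case 1
    hence "\<gamma> = of_cone (cone_proj p)" "cone_proj p \<in> C" using fc by auto
    thus ?thesis using to_cone_of_cone Csub by auto
   next
    case 2
    thus ?thesis using apex_in_hom_pts by (simp add: to_cone_def height_apex)
   qed
  qed
  thus "closedin (hom_top S) {\<gamma> \<in> topspace (hom_top S). to_cone \<gamma> \<in> C}"
   using fC ap by (cases "None \<in> C") (simp_all only: if_True if_False Un_empty_right closedin_Un)
 qed
 thus ?thesis unfolding homeomorphic_maps_def
  using cont of_cone_to_cone to_cone_of_cone by (simp add: topspace_open_cone)
qed

lemma flow_hom_act: "g \<in> hom_pts S ==> flow c (hom_act k S t g) = hom_act k S t (flow c g)"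
 by (auto simp: flow_def hom_act_def)

lemma hom_act_apex: "hom_act k S t (apex S) = apex S"
 by (auto simp: hom_act_def apex_def)

lemma to_cone_hom_act:
 assumes "t \<in> Torus k" "g \<in> hom_pts S"
 shows "to_cone (hom_act k S t g) = map_option (%(y, s). (hom_act k S t y, s)) (to_cone g)"
 using height_hom_act[OF assms] flow_hom_act[OF assms(2)] by (simp add: to_cone_def)

lemma to_cone_apex: "to_cone (apex S) = None"
 by (simp add: to_cone_def height_apex)

end

subsection \<open>Localization at a face\<close>

lemma continuous_map_inverse_complex:
 assumes "continuous_map X euclidean f" "\<And>x. x \<in> topspace X ==> f x \<noteq> 0"
 shows "continuous_map X euclidean (%x. inverse (f x :: complex))"
 by (rule continuous_map_compose_on[OF assms(1), of "- {0}"]) (auto intro!: continuous_intros assms)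

lemma finite_sum_in_closed:
 fixes v :: "'i => nat => int"
 assumes "finite I" "0 \<in> F" "\<And>u w. u \<in> F ==> w \<in> F ==> u + w \<in> F" "\<And>i. i \<in> I ==> v i \<in> F"
 shows "(\<Sum>i\<in>I. v i) \<in> F"
 using assms by induction (auto)

lemma dot_sum: "dot k (\<Sum>i\<in>I. v i) g = (\<Sum>i\<in>I. dot k (v i) g)"
 by (induction rule: infinite_finite_induct) (simp_all add: dot_add del: plus_fun_apply zero_fun_apply)

text \<open>\<open>H\<close> collects the generators of a face of the cone, and \<open>w\<close> is
  a character in the relative interior of the dual face: zero on \<open>H\<close>, positive on the
  remaining generators. Inverting \<open>w\<close> enlarges \<open>csg k G\<close> to
  \<open>csg k H\<close>, whose units are spanned by the first \<open>a\<close> vectors of the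
  adapted basis \<open>b\<close>.\<close>

locale localization =
 fixes k :: nat and G H :: "ivec set" and w :: ivec
  and b b' :: "nat => nat => int" and a :: nat
 assumes finite_G: "finite G" and H_sub: "H \<subseteq> G" and w: "w \<in> csg k G"
  and w_H: "\<And>h. h \<in> H ==> dot k w h = 0" and w_pos: "\<And>g. g \<in> G - H ==> 0 < dot k w g"
  and unimod: "unimod k b b'" and a_le: "a \<le> k"
  and kernel: "\<forall>u\<in>lat k. (\<forall>h\<in>H. dot k u h = 0) \<longleftrightarrow> (\<forall>j<k. a \<le> j --> dot k u (b' j) = 0)"

context localization
begin

abbreviation S :: "ivec set" where "S \<equiv> csg k G"

text \<open>For \<open>h\<close> in \<open>H\<close> the pairings with the first \<open>a\<close>
  basis vectors vanish, so these \<open>k - a\<close> numbers are all its coordinates in the dual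
  basis.\<close>

definition quot :: "ivec => nat => int"
 where "quot h = (%l. if l < k - a then dot k (b (a + l)) h else 0)"

abbreviation S' :: "ivec set" where "S' \<equiv> csg (k - a) (quot ` H)"

definition lift :: "ivec => nat => int"
 where "lift c = (%i. \<Sum>l<k - a. c l * b (a + l) i)"

definition proj :: "ivec => nat => int"
 where "proj u = (%l. if l < k - a then dot k u (b' (a + l)) else 0)"

text \<open>The extension of \<open>y\<close> to the localization \<open>csg k H\<close>, as a
  fraction whose denominator is a power of \<open>y w\<close>. The exponent is crude but explicit:
  \<open>w\<close> is at least 1 on each generator outside \<open>H\<close>, so that many copies
  bring \<open>u\<close> into \<open>csg k G\<close>.\<close>

definition ext :: "mono => mono"
 where "ext y u = (let N = nat (\<Sum>g\<in>G. \<bar>dot k u g\<bar>) in y (u + (%i. int N * w i)) / y w ^ N)"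

definition opn :: "mono set"
 where "opn = {g \<in> hom_pts S. g w \<noteq> 0}"

definition loc :: "mono => cvec \<times> mono"
 where "loc \<gamma> = ((%j. if j < a then ext \<gamma> (b j) else 1), (\<lambda>c\<in>S'. ext \<gamma> (lift c)))"

definition unext :: "cvec => mono => mono"
 where "unext z d u = (\<Prod>j<a. z j powi dot k u (b' j)) * d (proj u)"

definition unloc :: "cvec \<times> mono => mono"
 where "unloc p = (\<lambda>u\<in>S. unext (fst p) (snd p) u)"

lemma w_lat: "w \<in> lat k" "(%i. c * w i) \<in> lat k"
 using w by (auto simp: csg_def)

lemma S_sub: "u \<in> S ==> u \<in> csg k H"
 using H_sub by (auto simp: csg_def)

lemma basis_lat: "j < k ==> b j \<in> lat k"
 using unimodD(1)[OF unimod] .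

lemma basis_kernel: "j < a ==> h \<in> H ==> dot k (b j) h = 0"
 using unimod_basis_in_kernel[OF unimod kernel _ a_le] .

lemma basis_csg: "j < a ==> b j \<in> csg k H" "j < a ==> - b j \<in> csg k H"
 using basis_lat a_le basis_kernel by (auto simp: csg_def dot_uminus)

lemma lift_lat: "lift c \<in> lat k"
 unfolding lift_def using basis_lat by (intro lat_sum) auto

lemma dot_lift: "dot k (lift c) g = dot (k - a) c (quot g)"
 unfolding lift_def dot_comb by (auto simp: dot_def quot_def)

lemma lift_csg: "c \<in> S' ==> lift c \<in> csg k H"
 using lift_lat dot_lift by (auto simp: csg_def)

lemma lift_add: "lift (c + d) = lift c + lift d" and lift_zero [simp]: "lift 0 = 0"
 by (auto simp: lift_def ring_distribs sum.distrib)

lemma dot_lift_basis: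
 assumes "j < k"
 shows "dot k (lift c) (b' j) = (if a \<le> j then c (j - a) else 0)"
proof -
 have "dot k (lift c) (b' j) = (\<Sum>l<k - a. c l * (if a + l = j then 1 else 0))"
  unfolding lift_def dot_comb using unimodD(2)[OF unimod _ assms] by simp
 also have "\<dots> = (\<Sum>l<k - a. if l = j - a then (if a \<le> j then c l else 0) else 0)"
  by (intro sum.cong) auto
 also have "\<dots> = (if a \<le> j then c (j - a) else 0)" using assms by auto
 finally show ?thesis .
qed

lemma proj_lat: "proj u \<in> lat (k - a)"
 by (simp add: proj_def lat_def)

lemma proj_lift: "c \<in> lat (k - a) ==> proj (lift c) = c"
 by (auto simp: proj_def dot_lift_basis lat_def)

lemma proj_add: "proj (u + v) = proj u + proj v" and proj_zero [simp]: "proj 0 = 0"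
 by (auto simp: proj_def dot_add)

lemma decompose:
 assumes "u \<in> lat k"
 shows "u = (%i. \<Sum>j<a. dot k u (b' j) * b j i) + lift (proj u)"
proof
 fix i
 have "u i = (\<Sum>j<k. dot k u (b' j) * b j i)" using unimod_expand[OF unimod assms] by metis
 also have "\<dots> = (\<Sum>j<a. dot k u (b' j) * b j i) + (\<Sum>j\<in>{a..<k}. dot k u (b' j) * b j i)"
  using a_le sum.atLeastLessThan_concat[of 0 a k "%j. dot k u (b' j) * b j i"] by (simp add: lessThan_atLeast0)
 also have "(\<Sum>j\<in>{a..<k}. dot k u (b' j) * b j i) = (\<Sum>l<k - a. dot k u (b' (a + l)) * b (a + l) i)"
  using a_le sum.shift_bounds_nat_ivl[of "%j. dot k u (b' j) * b j i" 0 a "k - a"]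
  by (simp add: lessThan_atLeast0 add.commute)
 also have "\<dots> = lift (proj u) i" by (simp add: lift_def proj_def)
 finally show "u i = ((%i. \<Sum>j<a. dot k u (b' j) * b j i) + lift (proj u)) i" by simp
qed

lemma dot_proj:
 assumes "u \<in> lat k" "h \<in> H"
 shows "dot (k - a) (proj u) (quot h) = dot k u h"
proof -
 have "dot k u h = (\<Sum>j<a. dot k u (b' j) * dot k (b j) h) + dot k (lift (proj u)) h"
  by (subst (1) decompose[OF assms(1)]) (simp only: dot_add dot_comb)
 thus ?thesis using basis_kernel assms by (simp add: dot_lift)
qed

lemma proj_csg: "u \<in> csg k H ==> proj u \<in> S'"
 using dot_proj proj_lat by (auto simp: csg_def)

lemma proj_basis: "j < a ==> proj (b j) = 0"
 using unimodD[OF unimod, of j] by (auto simp: proj_def)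

lemma proj_w: "proj w = 0"
using w_lat w_H kernel by (force simp: proj_def)

lemma scaled_in_S:
 assumes "u \<in> csg k H" "nat (\<Sum>g\<in>G. \<bar>dot k u g\<bar>) \<le> N"
 shows "u + (%i. int N * w i) \<in> S"
proof -
 have "0 \<le> dot k (u + (%i. int N * w i)) g" if g: "g \<in> G" for g
 proof (cases "g \<in> H")
  case True
  thus ?thesis using assms w_H by (simp add: dot_add dot_scale csg_def)
 next
  case False
  hence "1 \<le> dot k w g" using w_pos g by fastforce
  hence "int N \<le> int N * dot k w g" by (simp add: mult_le_cancel_left1)
  moreover have "\<bar>dot k u g\<bar> \<le> (\<Sum>g\<in>G. \<bar>dot k u g\<bar>)" using finite_G g by (intro member_le_sum) auto
  ultimately show ?thesis using assms by (simp add: dot_add dot_scale)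
 qed
 thus ?thesis using assms w_lat by (auto simp: csg_def)
qed

lemma scale_Suc: "(%i. int (Suc N) * w i) = (%i. int N * w i) + w"
 by (auto simp: ring_distribs)

lemma hom_scaled:
 fixes f :: "_ => complex"
 assumes "\<And>u v. u \<in> A ==> v \<in> S ==> f (u + v) = f u * f v" "\<And>u v. u \<in> A ==> v \<in> S ==> u + v \<in> A" "v \<in> A"
 shows "f (v + (%i. int N * w i)) = f v * f w ^ N \<and> v + (%i. int N * w i) \<in> A"
proof (induction N)
 case 0
 show ?case using assms by simp
next
 case (Suc N)
 have e: "v + (%i. int (Suc N) * w i) = (v + (%i. int N * w i)) + w"
  by (simp only: scale_Suc add.assoc)
 show ?case unfolding e using Suc assms w by (simp add: del: plus_fun_apply)
qed

text \<open>Uniqueness of the extension: a function that is multiplicative against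
  \<open>csg k G\<close> and restricts to \<open>y\<close> has no choice but the fraction. Explicit
  extensions are recognised through this lemma.\<close>

lemma ext_eqI:
 assumes f: "\<And>u v. u \<in> csg k H ==> v \<in> S ==> f (u + v) = f u * f v"
  and y: "\<And>u. u \<in> S ==> y u = f u" "y w \<noteq> 0" and u: "u \<in> csg k H"
 shows "ext y u = f u"
proof -
 define N where "N = nat (\<Sum>g\<in>G. \<bar>dot k u g\<bar>)"
 have "f (u + (%i. int N * w i)) = f u * f w ^ N"
  by (rule hom_scaled[THEN conjunct1, of "csg k H"]) (use f u S_sub csg_closed in blast)+
 moreover have "u + (%i. int N * w i) \<in> S" unfolding N_def by (rule scaled_in_S[OF u order_refl])
 ultimately show ?thesis using y w by (simp add: ext_def N_def)
qed

text \<open>Any exponent that brings \<open>u\<close> into the semigroup gives the same fraction, by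
  cross multiplication of the two candidates.\<close>

lemma ext_scaled:
 assumes "y \<in> opn" "u \<in> csg k H" "u + (%i. int N * w i) \<in> S"
 shows "ext y u = y (u + (%i. int N * w i)) / y w ^ N"
proof -
 define M where "M = nat (\<Sum>g\<in>G. \<bar>dot k u g\<bar>)"
 have g: "y \<in> hom_pts S" "y w \<noteq> 0" using assms by (auto simp: opn_def)
 have h: "y (v + (%i. int N * w i)) = y v * y w ^ N" if "v \<in> S" for v N
  by (rule hom_scaled[THEN conjunct1, of S]) (use that hom_ptsD[OF g(1)] csg_closed in blast)+
 have M: "u + (%i. int M * w i) \<in> S" unfolding M_def by (rule scaled_in_S[OF assms(2) order_refl])
 show ?thesis using h[OF M, of N] h[OF assms(3), of M] g by (simp add: ext_def M_def[symmetric] field_simps)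
qed

lemma ext_self: "g \<in> opn ==> u \<in> S ==> ext g u = g u"
 using ext_scaled[of g u 0] S_sub by (simp add: plus_fun_def)

lemma ext_zero: "g \<in> opn ==> ext g 0 = 1"
 using ext_self hom_ptsD[of g S] by (simp add: csg_closed opn_def)

lemma ext_add:
 assumes g: "y \<in> opn" and u: "u \<in> csg k H" and v: "v \<in> csg k H"
 shows "ext y (u + v) = ext y u * ext y v"
proof -
 define N where "N = nat (\<Sum>g\<in>G. \<bar>dot k u g\<bar>)"
 define M where "M = nat (\<Sum>g\<in>G. \<bar>dot k v g\<bar>)"
 have N: "u + (%i. int N * w i) \<in> S" unfolding N_def by (rule scaled_in_S[OF u order_refl])
 have M: "v + (%i. int M * w i) \<in> S" unfolding M_def by (rule scaled_in_S[OF v order_refl])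
 have e: "(u + v) + (%i. int (N + M) * w i) = (u + (%i. int N * w i)) + (v + (%i. int M * w i))"
  by (auto simp: ring_distribs)
 have NM: "(u + v) + (%i. int (N + M) * w i) \<in> S" unfolding e by (rule csg_closed(2)[OF N M])
 have "y ((u + v) + (%i. int (N + M) * w i)) = y (u + (%i. int N * w i)) * y (v + (%i. int M * w i))"
  unfolding e using g N M by (intro hom_ptsD) (simp_all add: opn_def del: plus_fun_apply)
 thus ?thesis
  using ext_scaled[OF g csg_closed(2)[OF u v] NM] ext_scaled[OF g u N] ext_scaled[OF g v M] by (simp add: power_add)
qed

lemma ext_unit:
 assumes g: "y \<in> opn" and u: "u \<in> csg k H" "- u \<in> csg k H"
 shows "ext y u \<noteq> 0"
 using ext_add[OF g u] ext_zero[OF g] by auto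

lemma ext_multiple:
 assumes g: "y \<in> opn" and u: "u \<in> csg k H" "- u \<in> csg k H"
 shows "ext y (%i. c * u i) = ext y u powi c"
proof -
 have cl: "(%i. c * u i) \<in> csg k H" for c
 using u by (force simp: dot_uminus csg_def dot_scale)
 have n: "ext y (%i. int n * u i) = ext y u ^ n" for n
 proof (induction n)
  case 0
  have "(%i. int 0 * u i) = 0" by auto
  thus ?case using ext_zero[OF g] by simp
 next
  case (Suc n)
  have "(%i. int (Suc n) * u i) = (%i. int n * u i) + u" by (auto simp: ring_distribs)
  thus ?case using ext_add[OF g cl u(1)] Suc by simp
 qed
 show ?thesis
 proof (cases "0 \<le> c")
  case True
  thus ?thesis using n[of "nat c"] by (simp add: power_int_def)
 next
  case False
  have "(%i. c * u i) + (%i. int (nat (- c)) * u i) = 0" using False by auto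
  hence "ext y (%i. c * u i) = inverse (ext y u ^ nat (- c))" using ext_add[OF g cl cl, of c "int (nat (- c))"] ext_zero[OF g] n by (metis inverse_unique mult.commute)
  thus ?thesis using False by (simp add: power_int_def power_inverse)
 qed
qed

lemma ext_kernel_comb:
 assumes g: "y \<in> opn" and J: "finite J" "\<And>j. j \<in> J ==> j < a"
 shows "ext y (%i. \<Sum>j\<in>J. c j * b j i) = (\<Prod>j\<in>J. ext y (b j) powi c j) \<and> (%i. \<Sum>j\<in>J. c j * b j i) \<in> csg k H"
 using J
proof (induction J)
 case empty
 have "(%i::nat. 0::int) = 0" by auto
 thus ?case using ext_zero[OF g] csg_closed by simp
next
 case (insert p J)
 have p: "p < a" using insert.prems by auto
 have e: "(%i. \<Sum>j\<in>insert p J. c j * b j i) = (%i. c p * b p i) + (%i. \<Sum>j\<in>J. c j * b j i)"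
  using insert.hyps by auto
 have "(%i. c p * b p i) \<in> csg k H"
  using basis_lat a_le p basis_kernel by (auto simp: csg_def dot_scale)
 thus ?case unfolding e using insert ext_add[OF g] ext_multiple[OF g basis_csg[OF p]] csg_closed by simp
qed

lemma ext_decompose:
 assumes g: "y \<in> opn" and u: "u \<in> csg k H"
 shows "ext y u = (\<Prod>j<a. ext y (b j) powi dot k u (b' j)) * ext y (lift (proj u))"
proof -
 have "u \<in> lat k" using u by (simp add: csg_def)
 have "ext y u = ext y ((%i. \<Sum>j<a. dot k u (b' j) * b j i) + lift (proj u))"
  using decompose[OF \<open>u \<in> lat k\<close>] by simp
 also have "\<dots> = ext y (%i. \<Sum>j<a. dot k u (b' j) * b j i) * ext y (lift (proj u))"
  using ext_kernel_comb[OF g, of "{..<a}"] lift_csg[OF proj_csg[OF u]] by (intro ext_add[OF g]) auto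
 finally show ?thesis using ext_kernel_comb[OF g, of "{..<a}" "%j. dot k u (b' j)"] by simp
qed

lemma continuous_map_ext:
 assumes "continuous_map X (hom_top S) f" "\<And>x. x \<in> topspace X ==> f x w \<noteq> 0" "u \<in> csg k H"
 shows "continuous_map X euclidean (%x. ext (f x) u)"
proof -
 define N where "N = nat (\<Sum>g\<in>G. \<bar>dot k u g\<bar>)"
 have N: "u + (%i. int N * w i) \<in> S" unfolding N_def by (rule scaled_in_S[OF assms(3) order_refl])
 have 1: "continuous_map X euclidean (%x. f x w powi (- int N))"
  by (rule continuous_map_powi[OF continuous_map_hom_evalI[OF assms(1) w] assms(2)])
 have 2: "continuous_map X euclidean (%x. f x (u + (%i. int N * w i)))"
  by (rule continuous_map_hom_evalI[OF assms(1) N])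
 have "ext (f x) u = f x (u + (%i. int N * w i)) * f x w powi (- int N)" for x
  by (simp add: ext_def N_def[symmetric] power_int_minus field_simps)
 thus ?thesis using continuous_map_mult[OF 2 1] by simp
qed

lemma openin_opn: "openin (hom_top S) opn"
using openin_continuous_map_preimage continuous_map_hom_eval w by (force simp: opn_def)

lemma loc_in:
 assumes g: "y \<in> opn"
 shows "fst (loc y) \<in> Cstar_power a" "snd (loc y) \<in> hom_pts S'"
using ext_unit basis_csg hom_ptsI by (auto simp: in_Cstar_power_iff loc_def lift_csg g ext_add lift_add ext_zero csg_closed)

lemma unext_add:
 assumes "z \<in> Cstar_power a" "d \<in> hom_pts S'" "u \<in> csg k H" "v \<in> csg k H"
 shows "unext z d (u + v) = unext z d u * unext z d v"
using assms hom_ptsD proj_csg by (auto simp: in_Cstar_power_iff prod.distrib power_int_add dot_add proj_add unext_def)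

lemma unloc_in:
 assumes "z \<in> Cstar_power a" "d \<in> hom_pts S'"
 shows "unloc (z, d) \<in> opn"
proof -
 have "unext z d 0 = 1" using hom_ptsD[OF assms(2)] by (simp add: unext_def)
 hence "unloc (z, d) \<in> hom_pts S"
  by (intro hom_ptsI) (auto simp: unloc_def csg_closed unext_add[OF assms S_sub S_sub])
 moreover have "unext z d w \<noteq> 0"
  using hom_ptsD[OF assms(2)] assms by (simp add: unext_def proj_w in_Cstar_power_iff)
 ultimately show ?thesis using w by (simp add: opn_def unloc_def)
qed

lemma ext_unloc:
 assumes z: "z \<in> Cstar_power a" and d: "d \<in> hom_pts S'" and u: "u \<in> csg k H"
 shows "ext (unloc (z, d)) u = unext z d u"
 by (rule ext_eqI[OF _ _ _ u])
  (use unext_add[OF z d _ S_sub] unloc_in[OF z d] in \<open>auto simp: unloc_def opn_def simp del: plus_fun_apply\<close>)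

lemma loc_unloc:
 assumes z: "z \<in> Cstar_power a" and d: "d \<in> hom_pts S'"
 shows "loc (unloc (z, d)) = (z, d)"
proof -
 have "unext z d (b j) = z j" if j: "j < a" for j
 proof -
  have "d 0 = 1" using hom_ptsD(1)[OF d] .
  have "unext z d (b j) = (\<Prod>l<a. if l = j then z l else 1)"
   using unimodD[OF unimod, of j] a_le j
   unfolding unext_def proj_basis[OF j] \<open>d 0 = 1\<close> mult_1_right by (intro prod.cong) auto
  thus ?thesis using j by simp
 qed
 hence 1: "fst (loc (unloc (z, d))) = z"
  using z ext_unloc[OF z d basis_csg(1)] by (auto simp: loc_def in_Cstar_power_iff)
 have "unext z d (lift c) = d c" if "c \<in> S'" for c
 using that a_le by (auto simp: csg_def proj_lift dot_lift_basis unext_def)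
 hence "snd (loc (unloc (z, d))) = d"
  using ext_unloc[OF z d lift_csg] hom_ptsD[OF d] by (auto simp: loc_def extensional_def)
 with 1 show ?thesis by (simp add: prod_eq_iff)
qed

lemma unloc_loc:
 assumes g: "y \<in> opn"
 shows "unloc (loc y) = y"
proof (rule hom_pts_eqI)
 show "y \<in> hom_pts S" using g by (simp add: opn_def)
 show "unloc (loc y) \<in> hom_pts S"
  using unloc_in[of "fst (loc y)" "snd (loc y)"] loc_in[OF g] by (simp add: opn_def)
 fix u assume u: "u \<in> S"
 show "unloc (loc y) u = y u" using ext_decompose[OF g S_sub[OF u]] proj_csg[OF S_sub[OF u]] u ext_self[OF g u] by (simp add: unloc_def unext_def loc_def)
qed

text \<open>A principal open subset of an affine toric variety is a torus of units times the affine
  toric variety of the quotient semigroup. Continuity holds both ways because extensions are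
  fractions of evaluations and the inverse is a monomial times an evaluation.\<close>

lemma loc_homeomorphic:
 "homeomorphic_maps (subtopology (hom_top S) opn)
   (prod_topology (top_of_set (Cstar_power a)) (hom_top S')) loc unloc"
 (is "homeomorphic_maps ?X ?Y _ _")
proof -
 have tX: "topspace ?X = opn" by (auto simp: opn_def)
 have id: "continuous_map ?X (hom_top S) (%g. g)" by simp
 have e: "continuous_map ?X euclidean (%g. ext g u)" if "u \<in> csg k H" for u
  by (rule continuous_map_ext[OF id _ that]) (auto simp: opn_def)
 have c1: "continuous_map ?X ?Y loc"
 proof -
  have "continuous_map ?X (top_of_set (Cstar_power a)) (%g. fst (loc g))"
   unfolding continuous_map_into_Cstar_iff using loc_in e basis_csg by (auto simp: loc_def)
  moreover have "continuous_map ?X (hom_top S') (%g. snd (loc g))"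
   unfolding continuous_map_into_hom_iff using loc_in e lift_csg by (auto simp: loc_def)
  ultimately have "continuous_map ?X ?Y (%g. (fst (loc g), snd (loc g)))" by (rule continuous_map_pairedI)
  thus ?thesis by simp
 qed
 have "continuous_map ?Y (hom_top S) unloc"
  unfolding continuous_map_into_hom_iff
 proof (intro conjI ballI)
  fix u assume u: "u \<in> S"
  have "continuous_map ?Y euclidean (%p. (\<Prod>j<a. fst p j powi dot k u (b' j)))"
   by (intro continuous_map_prod continuous_map_powi continuous_map_Cstar_proj[OF continuous_map_fst])
    (auto simp: in_Cstar_power_iff)
  moreover have "continuous_map ?Y euclidean (%p. snd p (proj u))"
   by (rule continuous_map_hom_evalI[OF continuous_map_snd proj_csg[OF S_sub[OF u]]])
  ultimately show "continuous_map ?Y euclidean (%p. unloc p u)"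
   using continuous_map_mult u by (simp add: unloc_def unext_def)
 qed (use unloc_in in \<open>auto simp: opn_def\<close>)
 thus ?thesis using unloc_in c1 unloc_loc loc_unloc unfolding homeomorphic_maps_def by (auto simp: continuous_map_in_subtopology)
qed

text \<open>Twisting by a multiplicative function on the lattice commutes with extension. It is
  applied to characters of the compact torus and to the real powers produced by the flow.\<close>

lemma ext_character:
 assumes g: "y \<in> opn" and c: "\<And>u v. u \<in> lat k ==> v \<in> lat k ==> c (u + v) = c u * c v" "c w \<noteq> 0"
  and u: "u \<in> csg k H"
 shows "ext (\<lambda>u\<in>S. c u * y u) u = c u * ext y u"
proof (rule ext_eqI[OF _ _ _ u])
 fix u v assume uv: "u \<in> csg k H" "v \<in> S"
 thus "c (u + v) * ext y (u + v) = c u * ext y u * (c v * ext y v)"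
  using c ext_add[OF g uv(1) S_sub[OF uv(2)]] by (simp add: csg_def)
qed (use g c(2) w ext_self[OF g] in \<open>auto simp: opn_def\<close>)

lemma chr_lift: "t \<in> Torus k ==> chr k (lift c) t = chr (k - a) c (snd (split_torus k a b t))"
proof -
 assume t: "t \<in> Torus k"
 have "chr k (lift c) t = (\<Prod>j<k. chr k (b j) t powi (if a \<le> j then c (j - a) else 0))"
  unfolding chr_expand[OF unimod lift_lat torus_nonzero[OF t]] by (intro prod.cong) (auto simp: dot_lift_basis)
 also have "\<dots> = (\<Prod>j<a. chr k (b j) t powi (if a \<le> j then c (j - a) else 0)) *
   (\<Prod>j\<in>{a..<k}. chr k (b j) t powi (if a \<le> j then c (j - a) else 0))"
  using a_le prod.atLeastLessThan_concat[of 0 a k "%j. chr k (b j) t powi (if a \<le> j then c (j - a) else 0)"]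
  by (simp only: lessThan_atLeast0)
 also have "\<dots> = 1 * (\<Prod>j\<in>{a..<k}. chr k (b j) t powi c (j - a))" by simp
 also have "\<dots> = (\<Prod>l<k - a. chr k (b (a + l)) t powi c l)"
  using a_le prod.shift_bounds_nat_ivl[of "%j. chr k (b j) t powi c (j - a)" 0 a "k - a"]
  by (simp add: lessThan_atLeast0 add.commute)
 finally show ?thesis by (simp add: chr_def split_torus_def)
qed

lemma loc_hom_act:
 assumes t: "t \<in> Torus k" and g: "y \<in> opn"
 shows "loc (hom_act k S t y) =
  ((%j. if j < a then fst (split_torus k a b t) j * fst (loc y) j else 1),
   hom_act (k - a) S' (snd (split_torus k a b t)) (snd (loc y)))"
using ext_character g chr_add chr_nonzero torus_nonzero t basis_csg lift_csg chr_lift by (auto simp: split_torus_def hom_act_def loc_def)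

lemma toric_cone_quotient:
 assumes "\<exists>u\<in>lat k. \<forall>g\<in>G. 0 < dot k u g"
 shows "toric_cone (k - a) (quot ` H)"
proof
 show "finite (quot ` H)" using finite_subset[OF H_sub finite_G] by simp
next
 fix c assume c: "c \<in> lat (k - a)" "\<And>g. g \<in> quot ` H ==> dot (k - a) c g = 0"
 hence "\<forall>h\<in>H. dot k (lift c) h = 0" by (simp add: dot_lift)
 hence "proj (lift c) = 0" using kernel lift_lat by (auto simp: proj_def)
 thus "c = 0" using proj_lift[OF c(1)] by simp
next
 obtain u where u: "u \<in> lat k" "\<forall>g\<in>G. 0 < dot k u g" using assms by blast
 thus "\<exists>u\<in>lat (k - a). \<forall>g\<in>quot ` H. 0 < dot (k - a) u g"
  using H_sub by (intro bexI[of _ "proj u"]) (auto simp: dot_proj proj_lat)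
qed

end

text \<open>The elements with non-zero value form a subsemigroup \<open>F\<close>, and
  \<open>H\<close> consists of the generators annihilating it. Each other generator is positive on
  some element of \<open>F\<close>; the sum \<open>w\<close> of such elements stays in
  \<open>F\<close> and is positive on all of these generators at once.\<close>

lemma face_of_point:
 assumes G: "finite G" and y: "y \<in> hom_pts (csg k G)"
 obtains H w where "H \<subseteq> G" "w \<in> csg k G" "y w \<noteq> 0" "\<And>h. h \<in> H ==> dot k w h = 0"
  "\<And>g. g \<in> G - H ==> 0 < dot k w g" "\<And>u h. u \<in> csg k G ==> y u \<noteq> 0 ==> h \<in> H ==> dot k u h = 0"
proof -
 define F where "F = {u \<in> csg k G. y u \<noteq> 0}"
 define H where "H = {g \<in> G. \<forall>u\<in>F. dot k u g = 0}"
 have "\<exists>u\<in>F. 0 < dot k u g" if "g \<in> G - H" for g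
  using that by (force simp: H_def F_def csg_def)
 then obtain v where v: "\<And>g. g \<in> G - H ==> v g \<in> F \<and> 0 < dot k (v g) g" by metis
 define w where "w = (\<Sum>g\<in>G - H. v g)"
 have F: "0 \<in> F" "\<And>u u'. u \<in> F ==> u' \<in> F ==> u + u' \<in> F"
  using hom_ptsD[OF y] by (auto simp: F_def csg_closed)
 have w: "w \<in> F" unfolding w_def using G v F by (intro finite_sum_in_closed) auto
 have "0 < dot k w g" if g: "g \<in> G - H" for g
  unfolding w_def dot_sum
 proof (rule sum_pos2[of _ g])
  show "0 \<le> dot k (v i) g" if "i \<in> G - H" for i using v[OF that] g by (auto simp: F_def csg_def)
 qed (use G g v in auto)
 moreover have "dot k u h = 0" if "u \<in> csg k G" "y u \<noteq> 0" "h \<in> H" for u h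
  using that by (auto simp: H_def F_def)
 moreover have "dot k w h = 0" if "h \<in> H" for h using w that by (auto simp: H_def)
 moreover have "H \<subseteq> G" "w \<in> csg k G" "y w \<noteq> 0" using w by (auto simp: F_def H_def)
 ultimately show ?thesis using that by blast
qed

text \<open>If \<open>H\<close> annihilates the support of \<open>y\<close>, every element of the
  localization with non-zero value is a unit, so the quotient coordinate is the fixed point. This is
  what centres charts.\<close>

lemma (in localization) loc_apex:
 assumes y: "y \<in> opn" and F: "\<And>u h. u \<in> S ==> y u \<noteq> 0 ==> h \<in> H ==> dot k u h = 0"
 shows "snd (loc y) = apex S'"
proof
 fix c
 show "snd (loc y) c = apex S' c"
 proof (cases "c \<in> S' \<and> c \<noteq> 0")
  case True
  define N where "N = nat (\<Sum>g\<in>G. \<bar>dot k (lift c) g\<bar>)"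
  let ?u = "lift c + (%i. int N * w i)"
  have u: "?u \<in> S" unfolding N_def using True by (intro scaled_in_S[OF lift_csg order_refl]) simp
  have "y ?u = 0"
  proof (rule ccontr)
   assume "y ?u \<noteq> 0"
   hence "dot k (lift c) h = 0" if "h \<in> H" for h
    using F[OF u _ that] w_H[OF that] by (simp add: dot_add dot_scale)
   hence "\<forall>j<k. a \<le> j --> dot k (lift c) (b' j) = 0" using kernel lift_lat by blast
   hence "proj (lift c) = 0" by (auto simp: proj_def)
   thus False using proj_lift True by (simp add: csg_def)
  qed
  thus ?thesis using True ext_scaled[OF y lift_csg u] by (simp add: loc_def apex_def)
 qed (auto simp: loc_def apex_def ext_zero[OF y])
qed

text \<open>Allows a chosen unit direction to be moved to the last of the \<open>a\<close>
  positions, as the slice in the link requires.\<close>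

lemma (in localization) localization_swap:
 assumes "p < a" "q < a"
 shows "localization k G H w (b \<circ> Transposition.transpose p q) (b' \<circ> Transposition.transpose p q) a"
proof
 show "unimod k (b \<circ> Transposition.transpose p q) (b' \<circ> Transposition.transpose p q)"
  using unimod_swap[OF unimod, of p q] assms a_le by simp
 show "\<forall>u\<in>lat k. (\<forall>h\<in>H. dot k u h = 0) \<longleftrightarrow>
   (\<forall>j<k. a \<le> j --> dot k u ((b' \<circ> Transposition.transpose p q) j) = 0)"
  using kernel assms by simp
qed (use finite_G H_sub w w_H w_pos a_le in auto)

lemma localization_at_point:
 assumes "finite G" "y \<in> hom_pts (csg k G)"
 obtains H w b b' a where "localization k G H w b b' a" "y w \<noteq> 0"
  "\<And>u h. u \<in> csg k G ==> y u \<noteq> 0 ==> h \<in> H ==> dot k u h = 0"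
proof -
 obtain H w where Hw: "H \<subseteq> G" "w \<in> csg k G" "y w \<noteq> 0" "\<And>h. h \<in> H ==> dot k w h = 0"
  "\<And>g. g \<in> G - H ==> 0 < dot k w g" "\<And>u h. u \<in> csg k G ==> y u \<noteq> 0 ==> h \<in> H ==> dot k u h = 0"
  using face_of_point[OF assms] by blast
 obtain b b' a where b: "unimod k b b'" "a \<le> k"
  "\<forall>u\<in>lat k. (\<forall>h\<in>H. dot k u h = 0) \<longleftrightarrow> (\<forall>j<k. a \<le> j --> dot k u (b' j) = 0)"
  using adapted_basis[OF finite_subset[OF Hw(1) assms(1)]] by blast
 have "localization k G H w b b' a"
  by unfold_locales (use assms Hw b in auto)
 thus ?thesis using that Hw by blast
qed

section \<open>Spaces locally modelled on toric cones\<close>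

definition model_act :: "nat => nat => nat => ivec set => cvec \<times> cvec =>
  (cvec \<times> cvec) \<times> mono =>
  (cvec \<times> cvec) \<times> mono"
 where "model_act i r k S = (%(a, b) ((w, u), d).
  (((%j. if j < i then a j * w j else w j), (%j. if j < r then a (i + j) * u j else u j)), hom_act k S b d))"

definition model_top :: "nat => nat => ivec set =>
  ((cvec \<times> cvec) \<times> mono) topology"
 where "model_top i r S = prod_topology (prod_topology (top_of_set (Cstar_power i)) (torus_top r)) (hom_top S)"

text \<open>The chart is onto the whole model, so that flows and orbits can be followed inside it.
  The condition at \<open>apex\<close> centres it at \<open>x\<close> and thereby fixes
  \<open>i\<close>: the orbit of \<open>x\<close> has dimension \<open>i + (m - n)\<close>.\<close>

definition toric_chart :: "nat => nat => 'x topology => 'x taction => 'x => nat => ivec set => 'x set =>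
  (cvec => cvec \<times> cvec) =>
  ('x => (cvec \<times> cvec) \<times> mono) => bool"
 where "toric_chart n m X act x i G U F f \<longleftrightarrow>
  i \<le> n \<and> toric_cone (n - i) G \<and> openin X U \<and> x \<in> U \<and> T_invariant m act U \<and>
  F \<in> top_group_iso (torus m) (torus (i + (m - n)) \<times>\<times> torus (n - i)) \<and>
  homeomorphic_map (subtopology X U) (model_top i (m - n) (csg (n - i) G)) f \<and>
  snd (f x) = apex (csg (n - i) G) \<and>
  (\<forall>t\<in>Torus m. \<forall>y\<in>U. f (act t y) = model_act i (m - n) (n - i) (csg (n - i) G) (F t) (f y))"

abbreviation charted :: "nat => nat => 'x topology => 'x taction => 'x => bool"
 where "charted n m X act x \<equiv> \<exists>i G U \<Psi> \<phi>. toric_chart n m X act x i G U \<Psi> \<phi>"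

text \<open>The class on which the induction runs. A chart centred at each point is the only
  structure demanded beyond global topology; everything about strata is derived from it.\<close>

definition toric_like :: "nat => nat => 'x topology => 'x taction => bool"
 where "toric_like n m X act \<longleftrightarrow>
  n \<le> m \<and> compact_space X \<and> Hausdorff_space X \<and> second_countable X \<and> torus_action m X act \<and> topspace X \<noteq> {} \<and>
  (\<forall>x\<in>topspace X. charted n m X act x)"

lemma topspace_model_top: "topspace (model_top i r S) = (Cstar_power i \<times> Torus r) \<times> hom_pts S"
 by (simp add: model_top_def)

lemma continuous_map_into_model_iff:
 "continuous_map X (model_top i r S) f \<longleftrightarrow>
  continuous_map X (top_of_set (Cstar_power i)) (%x. fst (fst (f x))) \<and>
  continuous_map X (torus_top r) (%x. snd (fst (f x))) \<and> continuous_map X (hom_top S) (%x. snd (f x))"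
 by (simp only: model_top_def continuous_map_pairwise o_def conj_assoc)

lemma continuous_map_model_proj:
 "continuous_map (model_top i r S) (top_of_set (Cstar_power i)) (%p. fst (fst p))"
 "continuous_map (model_top i r S) (torus_top r) (%p. snd (fst p))"
 "continuous_map (model_top i r S) (hom_top S) snd"
 using continuous_map_into_model_iff[of "model_top i r S" i r S "%p. p"] by auto

section \<open>Charts of the link\<close>

context toric_cone
begin

text \<open>The homomorphism constantly 1 differs from the apex as soon as the lattice is
  non-trivial; rescaling it to height 1 gives a point.\<close>

lemma link_nonempty:
 assumes "0 < k"
 shows "topspace link \<noteq> {}"
proof -
 obtain u where u: "u \<in> lat k" "\<forall>g\<in>G. 0 < dot k u g" using full by blast
 have "unit_vec 0 \<noteq> 0" by (auto simp: unit_vec_def fun_eq_iff)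
 then obtain g where "g \<in> G" using pointed[OF unit_vec_in_lat[OF assms]] by blast
 hence u0: "u \<noteq> 0" "u \<in> S" using u by (auto simp: csg_def)
 define \<gamma> where "\<gamma> = (\<lambda>u\<in>S. 1 :: complex)"
 have g: "\<gamma> \<in> hom_pts S" by (rule hom_ptsI) (auto simp: \<gamma>_def csg_closed)
 have "\<gamma> u \<noteq> apex S u" using u0 by (simp add: \<gamma>_def apex_def)
 hence h: "height \<gamma> \<noteq> 0" using height_eq_0[OF g] by auto
 show ?thesis using height_flow[OF g, of "1 / height \<gamma>"] height_nonneg h flow_in_hom_pts[OF g] by (auto simp: topspace_link)
qed

lemma deg_sum: "deg (%i. \<Sum>j\<in>J. c j * f j i) = (\<Sum>j\<in>J. c j * deg (f j))"
 unfolding deg_def dot_comb sum_distrib_left by (rule sum.swap)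

text \<open>The orbits of the flow through a point of the face are met exactly once by the slice on which a
 coordinate of non-zero degree has modulus one.\<close>

lemma link_chart:
 assumes y: "y \<in> topspace link"
 shows "\<exists>i G' U F f. toric_chart (k - 1) k link (hom_act k S) y i G' U F f"
proof -
 have yS: "y \<in> hom_pts S" "height y = 1" using y by (auto simp: topspace_link)
 obtain H w b0 b0' a where L0: "localization k G H w b0 b0' a" and yw: "y w \<noteq> 0"
  and yF: "\<And>u h. u \<in> S ==> y u \<noteq> 0 ==> h \<in> H ==> dot k u h = 0"
  using localization_at_point[OF finite_G yS(1)] by blast
 interpret L0: localization k G H w b0 b0' a by (rule L0)
 \<comment> \<open>\<open>w = 0\<close> would force \<open>H = G\<close>, so that \<open>y\<close>
   vanishes away from 0 and is the apex, whose height is 0.\<close>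
 have w0: "w \<noteq> 0"
 proof
  assume "w = 0"
  hence "y u = apex S u" if "u \<in> S" for u using L0.w_pos yF[OF that] pointed[of u] that hom_ptsD[OF yS(1)] by cases (auto simp: apex_def csg_def)
  thus False using hom_pts_eqI[OF yS(1) apex_in_hom_pts] yS height_apex by simp
 qed
 have "w = (%i. \<Sum>j<a. dot k w (b0' j) * b0 j i)"
  using L0.decompose[OF L0.w_lat(1)] by (simp add: L0.proj_w)
 from arg_cong[OF this, of deg] have dw: "deg w = (\<Sum>j<a. dot k w (b0' j) * deg (b0 j))"
  unfolding deg_sum .
 \<comment> \<open>\<open>deg w\<close> is positive and is a combination of the degrees of the unit
   directions, so these cannot all be zero.\<close>
 have "\<exists>p<a. deg (b0 p) \<noteq> 0"
 using ccontr deg_pos L0.w w0 dw by force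
 then obtain p where p: "p < a" "deg (b0 p) \<noteq> 0" by blast
 define b where "b = b0 \<circ> Transposition.transpose p (a - 1)"
 define b' where "b' = b0' \<circ> Transposition.transpose p (a - 1)"
 interpret L: localization k G H w b b' a
  unfolding b_def b'_def using L0.localization_swap p by simp
 define i where "i = a - 1"
 have ia: "i < a" "a = Suc i" "i \<le> k - 1" "k - 1 - i = k - a" "k - (k - 1) = 1" "i + 1 = a"
  using p L.a_le by (auto simp: i_def)
 define d where "d = real_of_int (deg (b i))"
 have d: "d \<noteq> 0" using p by (simp add: d_def b_def i_def)
 let ?q = "b i"
 have q: "?q \<in> csg k H" "- ?q \<in> csg k H" using L.basis_csg[OF ia(1)] by auto
 \<comment> \<open>Elements of the localization may have negative degree, so the flow acts on
   extensions by real powers.\<close>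
 have ext_flow: "L.ext (flow c \<gamma>) u = of_real (c powr deg u) * L.ext \<gamma> u"
  if g: "\<gamma> \<in> L.opn" and c: "0 < c" and u: "u \<in> csg k H" for c \<gamma> u
 proof -
  have "flow c \<gamma> = (\<lambda>u\<in>S. of_real (c powr deg u) * \<gamma> u)"
   unfolding flow_def
  proof (rule restrict_ext)
   fix u assume "u \<in> S"
   hence "c powr deg u = c ^ nat (deg u)" using deg_nonneg c by (simp flip: powr_realpow)
   thus "of_real c ^ nat (deg u) * \<gamma> u = of_real (c powr deg u) * \<gamma> u" by simp
  qed
  moreover have "L.ext (\<lambda>u\<in>S. of_real (c powr deg u) * \<gamma> u) u = of_real (c powr deg u) * L.ext \<gamma> u"
   by (rule L.ext_character[OF g _ _ u]) (use c in \<open>auto simp: deg_add powr_add simp del: plus_fun_apply\<close>)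
  ultimately show ?thesis by simp
 qed
 have flow_opn: "flow c \<gamma> \<in> L.opn" if "\<gamma> \<in> L.opn" "0 < c" for c \<gamma>
  using that L.w flow_in_hom_pts by (auto simp: L.opn_def flow_def)
 \<comment> \<open>The flow time at which the coordinate \<open>?q\<close> acquires modulus one; it
   exists because the degree \<open>d\<close> of \<open>?q\<close> is non-zero.\<close>
 define lam where "lam \<gamma> = cmod (L.ext \<gamma> ?q) powr (- 1 / d)" for \<gamma>
 \<comment> \<open>On the slice this coordinate is a pure phase and becomes the single circle
   factor; the other \<open>i = a - 1\<close> unit coordinates stay in
   \<open>Cstar_power i\<close>.\<close>
 define f where "f \<gamma> = (let z = fst (L.loc (flow (lam \<gamma>) \<gamma>)) in
   (((%j. if j < i then z j else 1), (%j::nat. if j < 1 then z i else 1)), snd (L.loc (flow (lam \<gamma>) \<gamma>))))" for \<gamma>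
 define mrg where "mrg z u = (%j. if j < i then z j else if j = i then u 0 else 1)" for z u :: cvec
 \<comment> \<open>The inverse reassembles the \<open>a\<close> unit coordinates and flows the
   resulting point to height one.\<close>
 define f' where "f' p = (let \<gamma> = L.unloc (mrg (fst (fst p)) (snd (fst p)), snd p) in flow (1 / height \<gamma>) \<gamma>)" for p
 define U where "U = topspace link \<inter> L.opn"
 have U: "\<gamma> \<in> L.opn" "height \<gamma> = 1" "\<gamma> \<in> hom_pts S" if "\<gamma> \<in> U" for \<gamma>
  using that by (auto simp: U_def topspace_link)
 have lam: "0 < lam \<gamma>" if "\<gamma> \<in> L.opn" for \<gamma> using L.ext_unit[OF that q] by (simp add: lam_def)
 have unit: "cmod (L.ext (flow (lam \<gamma>) \<gamma>) ?q) = 1" if g: "\<gamma> \<in> L.opn" for \<gamma>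
 proof -
  have "lam \<gamma> powr d * cmod (L.ext \<gamma> ?q) = 1" using d L.ext_unit[OF g q] unfolding lam_def powr_powr by simp
  thus ?thesis using ext_flow[OF g lam[OF g] q(1)] by (simp add: norm_mult d_def)
 qed
 let ?X = "subtopology link U" and ?Y = "model_top i 1 L.S'"
 have tX: "topspace ?X = U" by (auto simp: U_def)
 have tY: "topspace ?Y = (Cstar_power i \<times> Torus 1) \<times> hom_pts L.S'" by (simp add: topspace_model_top)
 have mrg: "mrg z u \<in> Cstar_power a" if "z \<in> Cstar_power i" "u \<in> Torus 1" for z u
  using that torus_nonzero by (auto simp: mrg_def in_Cstar_power_iff ia)
 have mrg_f: "(mrg (fst (fst (f \<gamma>))) (snd (fst (f \<gamma>))), snd (f \<gamma>)) = L.loc (flow (lam \<gamma>) \<gamma>)"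
  if "\<gamma> \<in> U" for \<gamma>
  using L.loc_in[OF flow_opn[OF U(1)[OF that] lam[OF U(1)[OF that]]]] ia(2)
  by (auto simp: f_def mrg_def Let_def prod_eq_iff in_Cstar_power_iff)
 have f_in: "f \<gamma> \<in> topspace ?Y" if "\<gamma> \<in> U" for \<gamma>
 using flow_opn U that lam unit tY L.loc_in by (auto simp: L.loc_def in_torus_iff in_Cstar_power_iff f_def)
 have hpos: "0 < height \<gamma>" if "\<gamma> \<in> L.opn" for \<gamma>
 using that w0 L.w height_eq_0 height_nonneg by (force simp: apex_def L.opn_def order_less_le)
 have norm_U: "flow (1 / height \<gamma>) \<gamma> \<in> U" if "\<gamma> \<in> L.opn" for \<gamma>
  using flow_opn hpos[OF that] height_flow that
  by (auto simp: U_def topspace_link L.opn_def)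
 have un: "L.unloc (mrg z u, \<delta>) \<in> L.opn" if "((z, u), \<delta>) \<in> topspace ?Y" for z u \<delta>
  using that mrg unfolding tY by (intro L.unloc_in) auto
 have f'_in: "f' p \<in> U" if "p \<in> topspace ?Y" for p
  using norm_U[OF un[of "fst (fst p)" "snd (fst p)" "snd p"]] that by (simp add: f'_def Let_def)
 have 1: "f' (f \<gamma>) = \<gamma>" if g: "\<gamma> \<in> U" for \<gamma>
 proof -
  have o: "flow (lam \<gamma>) \<gamma> \<in> L.opn" using flow_opn U[OF g] lam by blast
  show ?thesis using height_flow[OF U(3)[OF g], of "lam \<gamma>"] U[OF g] lam[OF U(1)[OF g]] flow_one unfolding f'_def mrg_f[OF g] L.unloc_loc[OF o] by (simp add: flow_flow)
 qed
 have 2: "f (f' p) = p" if pY: "p \<in> topspace ?Y" for p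
 proof -
  obtain z u \<delta> where p: "p = ((z, u), \<delta>)" by (metis surj_pair)
  have zu: "z \<in> Cstar_power i" "u \<in> Torus 1" "\<delta> \<in> hom_pts L.S'" using pY unfolding p tY by auto
  define \<gamma> where "\<gamma> = L.unloc (mrg z u, \<delta>)"
  have o: "\<gamma> \<in> L.opn" using un pY by (simp add: p \<gamma>_def)
  have loc: "L.loc \<gamma> = (mrg z u, \<delta>)" unfolding \<gamma>_def by (rule L.loc_unloc[OF mrg[OF zu(1,2)] zu(3)])
  hence "L.ext \<gamma> ?q = mrg z u i" using ia(1) by (simp add: L.loc_def fun_eq_iff) metis
  hence e1: "cmod (L.ext \<gamma> ?q) = 1" using torus_norm[OF zu(2)] by (simp add: mrg_def)
  have h: "0 < 1 / height \<gamma>" using hpos[OF o] by simp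
  have "cmod (L.ext (flow (1 / height \<gamma>) \<gamma>) ?q) = (1 / height \<gamma>) powr d"
   using ext_flow[OF o h q(1)] e1 by (simp add: norm_mult d_def)
  hence "flow (lam (flow (1 / height \<gamma>) \<gamma>)) (flow (1 / height \<gamma>) \<gamma>) = \<gamma>" using d h flow_one o by (auto simp: powr_powr lam_def L.opn_def flow_flow)
  hence "f (f' p) = (((%j. if j < i then mrg z u j else 1), (%j. if j < 1 then mrg z u i else 1)), \<delta>)"
   by (simp add: f_def f'_def p \<gamma>_def[symmetric] loc Let_def)
  also have "\<dots> = p" using zu by (auto simp: p mrg_def in_Cstar_power_iff in_torus_iff)
  finally show ?thesis .
 qed
 have id: "continuous_map ?X (hom_top S) (%\<gamma>. \<gamma>)"
  unfolding link_def by (simp add: continuous_map_from_subtopology)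
 have c_ext: "continuous_map ?X euclidean (%\<gamma>. L.ext \<gamma> ?q)"
  by (rule L.continuous_map_ext[OF id _ q(1)]) (auto simp: U_def L.opn_def)
 have "continuous_map ?X euclideanreal lam"
  unfolding lam_def
 proof (rule continuous_map_compose_on[OF c_ext, of "- {0}"])
  show "continuous_on (- {0}) (%z. cmod z powr (- 1 / d))" by (intro continuous_intros) auto
 qed (use L.ext_unit[OF _ q] U(1) in auto)
 hence "continuous_map ?X (hom_top S) (%\<gamma>. flow (lam \<gamma>) \<gamma>)" by (rule flow_continuous[OF id])
 hence "continuous_map ?X (subtopology (hom_top S) L.opn) (%\<gamma>. flow (lam \<gamma>) \<gamma>)"
  unfolding continuous_map_in_subtopology using flow_opn U lam tX by blast
 hence cl: "continuous_map ?X (prod_topology (top_of_set (Cstar_power a)) (hom_top L.S')) (L.loc \<circ> (%\<gamma>. flow (lam \<gamma>) \<gamma>))"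
  using L.loc_homeomorphic continuous_map_compose unfolding homeomorphic_maps_def by blast
 have cl1: "continuous_map ?X euclidean (%\<gamma>. fst (L.loc (flow (lam \<gamma>) \<gamma>)) j)" for j
  using continuous_map_Cstar_proj[OF continuous_map_fst_of[OF cl]] by simp
 have cl2: "continuous_map ?X (hom_top L.S') (%\<gamma>. snd (L.loc (flow (lam \<gamma>) \<gamma>)))"
  using continuous_map_snd_of[OF cl] by (simp add: o_def)
 have cf: "continuous_map ?X ?Y f"
  unfolding continuous_map_into_model_iff continuous_map_into_Cstar_iff continuous_map_into_torus_iff
 proof (intro conjI ballI allI impI)
  fix x assume "x \<in> topspace ?X"
  thus "fst (fst (f x)) \<in> Cstar_power i" "snd (fst (f x)) \<in> Torus 1"
   using f_in unfolding tY by (auto simp: mem_Times_iff)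
 qed (use cl1 cl2 in \<open>simp_all add: f_def Let_def\<close>)
 have "continuous_map ?Y (prod_topology (top_of_set (Cstar_power a)) (hom_top L.S'))
   (%p. (mrg (fst (fst p)) (snd (fst p)), snd p))"
 proof (rule continuous_map_pairedI)
  show "continuous_map ?Y (top_of_set (Cstar_power a)) (%p. mrg (fst (fst p)) (snd (fst p)))"
   unfolding continuous_map_into_Cstar_iff
  proof (intro conjI ballI allI impI)
   fix j assume "j < a"
   then consider "j < i" | "j = i" using ia by linarith
   thus "continuous_map ?Y euclidean (%p. mrg (fst (fst p)) (snd (fst p)) j)"
    by (auto simp: mrg_def intro: continuous_map_Cstar_proj[OF continuous_map_model_proj(1)]
      continuous_map_torus_proj[OF continuous_map_model_proj(2)])
  next
   fix p assume "p \<in> topspace ?Y"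
   thus "mrg (fst (fst p)) (snd (fst p)) \<in> Cstar_power a" unfolding tY using mrg by auto
  qed
  show "continuous_map ?Y (hom_top L.S') snd" by (rule continuous_map_model_proj)
 qed
 hence cu: "continuous_map ?Y (hom_top S) (%p. L.unloc (mrg (fst (fst p)) (snd (fst p)), snd p))" using L.loc_homeomorphic continuous_map_compose unfolding homeomorphic_maps_def by (auto simp: continuous_map_in_subtopology o_def)
 have "continuous_map ?Y euclideanreal (%p. 1 / height (L.unloc (mrg (fst (fst p)) (snd (fst p)), snd p)))"
 proof (rule continuous_map_compose_on[where S = "- {0}" and h = "%s. 1 / s"])
  show "continuous_map ?Y euclideanreal (%p. height (L.unloc (mrg (fst (fst p)) (snd (fst p)), snd p)))"
   using continuous_map_compose[OF cu continuous_map_height] by (simp add: o_def)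
  show "continuous_on (- {0}) (%s::real. 1 / s)" by (intro continuous_intros) auto
  show "height (L.unloc (mrg (fst (fst p)) (snd (fst p)), snd p)) \<in> - {0}" if "p \<in> topspace ?Y" for p
   using hpos[OF un[of "fst (fst p)" "snd (fst p)" "snd p"]] that by simp
 qed
 from flow_continuous[OF cu this] have "continuous_map ?Y (hom_top S) f'" unfolding f'_def[abs_def] Let_def .
 moreover have "?X = subtopology (hom_top S) U"
  unfolding link_def subtopology_subtopology by (rule arg_cong) (auto simp: U_def topspace_link)
 ultimately have homeo: "homeomorphic_map ?X ?Y f" using f'_in cf 1 2 unfolding homeomorphic_map_maps homeomorphic_maps_def tX by (auto simp: continuous_map_in_subtopology)
 have inv: "hom_act k S t \<gamma> \<in> U" if "t \<in> Torus k" "\<gamma> \<in> U" for t \<gamma>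
  using that L.w hom_act_in_hom_pts height_hom_act chr_nonzero torus_nonzero
  by (auto simp: U_def topspace_link L.opn_def hom_act_def)
 have equi: "f (hom_act k S t \<gamma>) = model_act i 1 (k - a) L.S' (split_torus k a b t) (f \<gamma>)"
  if t: "t \<in> Torus k" and g: "\<gamma> \<in> U" for t \<gamma>
 proof -
  have "L.ext (hom_act k S t \<gamma>) ?q = chr k ?q t * L.ext \<gamma> ?q"
   unfolding hom_act_def
   by (rule L.ext_character[OF U(1)[OF g] _ _ q(1)]) (use chr_add chr_nonzero torus_nonzero[OF t] in blast)+
  hence e: "flow (lam (hom_act k S t \<gamma>)) (hom_act k S t \<gamma>) = hom_act k S t (flow (lam \<gamma>) \<gamma>)" using norm_chr[OF t] flow_hom_act[OF U(3)[OF g]] by (simp add: lam_def norm_mult)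
  have o: "flow (lam \<gamma>) \<gamma> \<in> L.opn" using flow_opn U[OF g] lam by blast
  show ?thesis
   unfolding f_def e L.loc_hom_act[OF t o] using ia
   by (auto simp: model_act_def Let_def split_torus_def)
 qed
 have r: "split_torus k a b \<in> top_group_iso (torus k) (torus (i + 1) \<times>\<times> torus (k - a))"
  using split_torus_iso[OF L.unimod L.a_le] ia by simp
 have yU: "y \<in> U" using y yS yw by (simp add: U_def L.opn_def)
 have "snd (f y) = apex L.S'"
 using yF L.loc_apex flow_opn U yU lam by (force simp: flow_def Let_def f_def)
 moreover have "openin link U"
 using link_def L.openin_opn by (auto simp: U_def L.opn_def openin_subtopology)
 moreover have "toric_cone (k - a) (L.quot ` H)"
  by (rule L.toric_cone_quotient[OF full])
 ultimately have "toric_chart (k - 1) k link (hom_act k S) y i (L.quot ` H) U (split_torus k a b) f"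
  unfolding toric_chart_def T_invariant_def ia(4,5) using ia yU inv r homeo equi by blast
 thus ?thesis by blast
qed

text \<open>The flow removes one real dimension from \<open>2 * k\<close>; as the torus keeps rank
  \<open>k\<close>, the second parameter \<open>k - 1\<close> accounts for the dimension
  \<open>2 * k - 1\<close>.\<close>

lemma link_toric_like:
 assumes "0 < k"
 shows "toric_like (k - 1) k link (hom_act k S)"
 unfolding toric_like_def
 using compact_link Hausdorff_link second_countable_link torus_action_link link_nonempty[OF assms] link_chart by auto

end

section \<open>Transport along equivariant homeomorphisms\<close>

lemma toric_chart_transport:
 assumes c: "toric_chart n m X act x i G U F p" and fg: "homeomorphic_maps X Y f g"
  and eq: "\<And>t x. t \<in> Torus m ==> x \<in> topspace X ==> f (act t x) = act' t (f x)"
 shows "toric_chart n m Y act' (f x) i G (f ` U) F (p \<circ> g)"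
proof -
 have U: "U \<subseteq> topspace X" "openin X U" using c openin_subset by (auto simp: toric_chart_def)
 have gf: "g (f x) = x" if "x \<in> topspace X" for x using fg that by (simp add: homeomorphic_maps_def)
 have fm: "homeomorphic_map X Y f" using fg by (auto simp: homeomorphic_map_maps)
 have gm: "homeomorphic_maps Y X g f" using fg homeomorphic_maps_sym by blast
 have tY: "topspace Y = f ` topspace X" using homeomorphic_imp_surjective_map[OF fm] by simp
 have "topspace Y \<inter> f ` U = f ` U" using U by (auto simp: tY)
 moreover have "g ` f ` U = topspace X \<inter> U" using gf U by force
 ultimately have "g ` (topspace Y \<inter> f ` U) = topspace X \<inter> U" by simp
 hence "homeomorphic_map (subtopology Y (f ` U)) (subtopology X U) g"
  using homeomorphic_maps_subtopologies[OF gm] unfolding homeomorphic_map_maps by blast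
 hence "homeomorphic_map (subtopology Y (f ` U)) (model_top i (m - n) (csg (n - i) G)) (p \<circ> g)"
  using c homeomorphic_map_compose by (auto simp: toric_chart_def)
 moreover have "openin Y (f ` U)" using fm U homeomorphic_map_openness by blast
 moreover have "T_invariant m act' (f ` U)"
  unfolding T_invariant_def
 proof (intro ballI; elim imageE; hypsubst)
  fix t x assume t: "t \<in> Torus m" "x \<in> U"
  hence "act t x \<in> U" using c by (auto simp: toric_chart_def T_invariant_def)
  thus "act' t (f x) \<in> f ` U" using eq[OF t(1), of x] t U by force
 qed
 moreover have "p (g (act' t (f y))) = model_act i (m - n) (n - i) (csg (n - i) G) (F t) (p (g (f y)))"
  if "t \<in> Torus m" "y \<in> U" for t y
 proof -
  have "act t y \<in> U" using c that by (auto simp: toric_chart_def T_invariant_def)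
  hence "g (act' t (f y)) = act t y" using eq gf[of "act t y"] that U by force
  thus ?thesis using c that gf U by (auto simp: toric_chart_def)
 qed
 ultimately show ?thesis using c gf U unfolding toric_chart_def by auto
qed

lemma toric_like_transport:
 assumes T: "toric_like n m X act" and fg: "homeomorphic_maps X Y f g"
  and eq: "\<And>t x. t \<in> Torus m ==> x \<in> topspace X ==> f (act t x) = act' t (f x)"
 shows "toric_like n m Y act'"
proof -
 have XY: "X homeomorphic_space Y" using fg by (auto simp: homeomorphic_space_def)
 have fm: "homeomorphic_map X Y f" using fg by (auto simp: homeomorphic_map_maps)
 have tY: "topspace Y = f ` topspace X" using homeomorphic_imp_surjective_map[OF fm] by simp
 have gf: "g (f x) = x" if "x \<in> topspace X" for x using fg that by (simp add: homeomorphic_maps_def)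
 have act: "torus_action m X act" using T by (simp add: toric_like_def)
 have fX: "f x \<in> topspace Y" if "x \<in> topspace X" for x using that tY by blast
 have "torus_action m Y act'"
  unfolding torus_action_iff tY
 proof (intro conjI ballI; (elim imageE; hypsubst)?)
  fix t x assume t: "t \<in> Torus m" and x: "x \<in> topspace X"
  show "act' t (f x) \<in> f ` topspace X" using eq[OF t x] torus_action_closed[OF act t x] by force
  fix s assume s: "s \<in> Torus m"
  show "act' (coord_mult s t) (f x) = act' s (act' t (f x))"
   using eq[OF t x] eq[OF s torus_action_closed[OF act t x]] eq[OF torus_coord_mult[OF s t] x]
    torus_action_mult[OF act s t x] by simp
 next
  fix x assume x: "x \<in> topspace X"
  show "act' (%_. 1) (f x) = f x" using eq[OF torus_one_closed x] torus_action_one[OF act x] by simp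
 next
  have "continuous_map (prod_topology (torus_top m) Y) X (%p. act (fst p) (g (snd p)))"
  proof (rule torus_action_continuous_compose[OF act continuous_map_fst])
   show "continuous_map (prod_topology (torus_top m) Y) X (%p. g (snd p))"
    using continuous_map_compose[OF continuous_map_snd, of Y X g] fg by (simp add: o_def homeomorphic_maps_def)
  qed
  hence "continuous_map (prod_topology (torus_top m) Y) Y (f \<circ> (%p. act (fst p) (g (snd p))))"
   using fg by (intro continuous_map_compose) (auto simp: homeomorphic_maps_def)
  thus "continuous_map (prod_topology (torus_top m) Y) Y (%(t, x). act' t x)"
   by (rule continuous_map_eq) (use eq gf in \<open>auto simp: tY\<close>)
 qed
 moreover have "charted n m Y act' y" if y: "y \<in> topspace Y" for y
 proof -
  obtain x where x: "x \<in> topspace X" "y = f x" using y tY by blast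
  then obtain i G U F h where "toric_chart n m X act x i G U F h" using T unfolding toric_like_def by blast
  hence "toric_chart n m Y act' (f x) i G (f ` U) F (h \<circ> g)"
   by (rule toric_chart_transport[OF _ fg]) (rule eq)
  thus ?thesis unfolding x by blast
 qed
 ultimately show ?thesis
  using T homeomorphic_compact_space[OF XY] homeomorphic_Hausdorff_space[OF XY] homeomorphic_second_countable[OF XY]
  unfolding toric_like_def tY by blast
qed

section \<open>Orbits in a chart\<close>

context toric_cone
begin

text \<open>Orbit dimension inside the affine model. It can be read off in the link because the flow
  commutes with the torus; the apex is fixed and gets 0.\<close>

definition odim :: "mono => nat"
 where "odim \<delta> = (if \<delta> = apex S then 0
  else orbit_dim k link (hom_act k S) (flow (1 / height \<delta>) \<delta>))"

lemma hom_pts_zero: "k = 0 ==> hom_pts S = {apex S}"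
proof -
 assume "k = 0"
 hence "u = 0" if "u \<in> S" for u using that by (auto simp: csg_def lat_def)
 hence "g = apex S" if "g \<in> hom_pts S" for g
  using that by (intro hom_pts_eqI[OF that apex_in_hom_pts]) (metis hom_ptsD apex_in_hom_pts)
 thus ?thesis using apex_in_hom_pts by blast
qed

lemma height_pos: "d \<in> hom_pts S ==> d \<noteq> apex S ==> 0 < height d"
 using height_eq_0 height_nonneg by (metis order_less_le)

lemma normalized_in_link:
 "d \<in> hom_pts S ==> d \<noteq> apex S ==> flow (1 / height d) d \<in> topspace link"
 using height_pos[of d] height_flow by (simp add: topspace_link flow_in_hom_pts)

lemma flow_apex: "flow c (apex S) = apex S"
  by (auto simp: flow_def apex_def)

lemma odim_flow:
 assumes "d \<in> hom_pts S" "0 < c"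
 shows "odim (flow c d) = odim d"
proof (cases "d = apex S")
 case True
 thus ?thesis by (simp add: flow_apex)
next
 case False
 have h: "height (flow c d) = c * height d" using height_flow assms by simp
 have "flow c d \<noteq> apex S" using h height_pos[OF assms(1) False] assms height_apex by auto
 thus ?thesis using False assms by (simp add: odim_def h flow_flow)
qed

end

lemma toric_chartD:
 assumes "toric_chart n m X act x i G U F f"
 shows "i \<le> n" "toric_cone (n - i) G" "openin X U" "x \<in> U" "T_invariant m act U"
  "F \<in> top_group_iso (torus m) (torus (i + (m - n)) \<times>\<times> torus (n - i))"
  "homeomorphic_map (subtopology X U) (model_top i (m - n) (csg (n - i) G)) f"
  "snd (f x) = apex (csg (n - i) G)"
  "\<And>t y. t \<in> Torus m ==> y \<in> U ==>
   f (act t y) = model_act i (m - n) (n - i) (csg (n - i) G) (F t) (f y)"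
  "U \<subseteq> topspace X" "\<And>t y. t \<in> Torus m ==> y \<in> U ==> act t y \<in> U"
  "\<And>y. y \<in> U ==> fst (fst (f y)) \<in> Cstar_power i" "\<And>y. y \<in> U ==> snd (fst (f y)) \<in> Torus (m - n)"
  "\<And>y. y \<in> U ==> snd (f y) \<in> hom_pts (csg (n - i) G)" "inj_on f U"
proof -
 show U: "openin X U" "U \<subseteq> topspace X" using assms openin_subset by (auto simp: toric_chart_def)
 show h: "homeomorphic_map (subtopology X U) (model_top i (m - n) (csg (n - i) G)) f"
  using assms by (simp add: toric_chart_def)
 have tU: "topspace (subtopology X U) = U" using U by auto
 show "inj_on f U" using homeomorphic_imp_injective_map[OF h] tU by simp
 have "f y \<in> (Cstar_power i \<times> Torus (m - n)) \<times> hom_pts (csg (n - i) G)" if "y \<in> U" for y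
  using homeomorphic_imp_surjective_map[OF h] that unfolding tU topspace_model_top by blast
 thus "\<And>y. y \<in> U ==> fst (fst (f y)) \<in> Cstar_power i" "\<And>y. y \<in> U ==> snd (fst (f y)) \<in> Torus (m - n)"
  "\<And>y. y \<in> U ==> snd (f y) \<in> hom_pts (csg (n - i) G)" by (auto simp: mem_Times_iff)
qed (use assms in \<open>auto simp: toric_chart_def T_invariant_def\<close>)

lemma iso_in_carrier:
 assumes "F \<in> top_group_iso (torus m) (torus p \<times>\<times> torus q)" "t \<in> Torus m"
 shows "fst (F t) \<in> Torus p" "snd (F t) \<in> Torus q"
proof -
 have "F t \<in> Torus p \<times> Torus q"
  using top_group_isoD[OF assms(1)] assms by (auto simp: bij_betw_def)
 thus "fst (F t) \<in> Torus p" "snd (F t) \<in> Torus q" by auto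
qed

lemma iso_surj:
 assumes "F \<in> top_group_iso (torus m) (torus p \<times>\<times> torus q)" "a \<in> Torus p" "b \<in> Torus q"
 obtains t where "t \<in> Torus m" "F t = (a, b)"
proof -
 have "(a, b) \<in> F ` Torus m"
  using top_group_isoD[OF assms(1)] assms by (auto simp: bij_betw_def)
 thus ?thesis using that by force
qed

text \<open>The action of \<open>U(1)\<^bsup>i+r\<^esup>\<close> on \<open>(\<complex>\<^sup>\<times>)\<^sup>i \<times> U(1)\<^sup>r\<close>; on the ambient functions it is the identity
 outside the coordinates in use.\<close>

definition base_act :: "nat => nat => cvec => cvec \<times> cvec =>
  cvec \<times> cvec"
 where "base_act i r a p = ((%j. if j < i then a j * fst p j else fst p j), (%j. if j < r then a (i + j) * snd p j else snd p j))"

lemma model_act_eq: "model_act i r k S ab p = (base_act i r (fst ab) (fst p), hom_act k S (snd ab) (snd p))"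
 by (simp add: model_act_def base_act_def case_prod_unfold)

lemma base_act_in:
 assumes "a \<in> Torus (i + r)" "p \<in> Cstar_power i \<times> Torus r"
 shows "base_act i r a p \<in> Cstar_power i \<times> Torus r"
 using assms torus_nonzero
 by (auto simp: base_act_def in_Cstar_power_iff in_torus_iff norm_mult)

lemma base_act_inj:
 assumes "a \<in> Torus (i + r)" "a' \<in> Torus (i + r)" "p \<in> Cstar_power i \<times> Torus r"
  and eq: "base_act i r a p = base_act i r a' p"
 shows "a = a'"
proof
 fix j
 have f: "a j * fst p j = a' j * fst p j" if "j < i" for j
  using fun_cong[OF arg_cong[OF eq, of fst], of j] that by (simp add: base_act_def)
 have s: "a (i + j) * snd p j = a' (i + j) * snd p j" if "j < r" for j
  using fun_cong[OF arg_cong[OF eq, of snd], of j] that by (simp add: base_act_def)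
 consider "j < i" | l where "j = i + l" "l < r" | "i + r \<le> j" by (metis add_less_cancel_left le_Suc_ex not_le)
 thus "a j = a' j"
 proof cases
  case 1
  thus ?thesis using f assms by (auto simp: in_Cstar_power_iff)
 next
  case 2
  thus ?thesis using s assms torus_nonzero by auto
 next
  case 3
  thus ?thesis using assms by (simp add: in_torus_iff)
 qed
qed

lemma base_act_transitive:
 assumes "u \<in> Torus r" "u' \<in> Torus r"
 obtains a where "a \<in> Torus (0 + r)" "base_act 0 r a (w, u) = (w, u')"
proof
 let ?a = "%j. u' j / u j"
 show "?a \<in> Torus (0 + r)" using assms by (auto simp: in_torus_iff norm_divide)
 show "base_act 0 r ?a (w, u) = (w, u')"
  using assms torus_nonzero by (auto simp: base_act_def in_torus_iff)
qed

lemma continuous_base_act: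
 assumes "p \<in> Cstar_power i \<times> Torus r" "continuous_map X (torus_top (i + r)) f"
 shows "continuous_map X (prod_topology (top_of_set (Cstar_power i)) (torus_top r)) (%x. base_act i r (f x) p)"
proof -
 have f: "f x \<in> Torus (i + r)" if "x \<in> topspace X" for x
  using assms that by (simp add: continuous_map_into_torus_iff)
 have c: "continuous_map X euclidean (%x. f x l * c)" for l c
  by (rule continuous_map_mult[OF continuous_map_torus_proj[OF assms(2)]]) simp
 have "continuous_map X (top_of_set (Cstar_power i)) (%x. fst (base_act i r (f x) p))"
  unfolding continuous_map_into_Cstar_iff using base_act_in[OF f assms(1)] c by (auto simp: base_act_def)
 moreover have "continuous_map X (torus_top r) (%x. snd (base_act i r (f x) p))"
  unfolding continuous_map_into_torus_iff using base_act_in[OF f assms(1)] c by (auto simp: base_act_def)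
 ultimately have "continuous_map X (prod_topology (top_of_set (Cstar_power i)) (torus_top r))
   (%x. (fst (base_act i r (f x) p), snd (base_act i r (f x) p)))" by (rule continuous_map_pairedI)
 thus ?thesis by simp
qed

text \<open>Over the apex the second torus factor acts trivially, while the first acts freely
  because all base coordinates are non-zero.\<close>

lemma toric_chart_act_eq_iff:
 assumes c: "toric_chart n m X act x i G U F f" and y: "y \<in> U" "snd (f y) = apex (csg (n - i) G)"
  and s: "s \<in> Torus m" and t: "t \<in> Torus m"
 shows "act s y = act t y \<longleftrightarrow> fst (F s) = fst (F t)"
proof -
 interpret C: toric_cone "n - i" G using toric_chartD(2)[OF c] .
 note D = toric_chartD[OF c]
 have "act s y = act t y \<longleftrightarrow> f (act s y) = f (act t y)"
  using D D(11)[OF s y(1)] D(11)[OF t y(1)] by (auto dest: inj_onD)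
 also have "\<dots> \<longleftrightarrow> base_act i (m - n) (fst (F s)) (fst (f y)) = base_act i (m - n) (fst (F t)) (fst (f y))"
  unfolding D(9)[OF s y(1)] D(9)[OF t y(1)] model_act_eq y by (simp add: C.hom_act_apex)
 also have "\<dots> \<longleftrightarrow> fst (F s) = fst (F t)"
  using base_act_inj iso_in_carrier[OF D(6) s] iso_in_carrier[OF D(6) t] D(12,13)[OF y(1)] by auto
 finally show ?thesis .
qed

lemma toric_chart_orbit:
 assumes c: "toric_chart n m X act x i G U F f" and act: "torus_action m X act" and H: "Hausdorff_space X"
  and y: "y \<in> U" "snd (f y) = apex (csg (n - i) G)"
 shows "torus_top (i + (m - n)) homeomorphic_space subtopology X (T_orbit m act y)"
 by (rule orbit_homeomorphic_torus[OF act H _ toric_chartD(6)[OF c] toric_chart_act_eq_iff[OF c y]])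
  (use y toric_chartD(10)[OF c] in auto)

text \<open>Every point is the centre of some chart, and there its orbit is visibly a torus.\<close>

lemma toric_like_orbit:
 assumes T: "toric_like n m X act" and x: "x \<in> topspace X"
 obtains p where "m - n \<le> p" "p \<le> m" "torus_top p homeomorphic_space subtopology X (T_orbit m act x)"
proof -
 obtain i G U F f where c: "toric_chart n m X act x i G U F f" using T x unfolding toric_like_def by meson
 show ?thesis using toric_chart_orbit[OF c _ _ toric_chartD(4,8)[OF c]] that[of "i + (m - n)"] toric_chartD[OF c] T by (simp add: toric_like_def)
qed

lemma orbit_subset: "torus_action m X act ==> x \<in> topspace X ==> T_orbit m act x \<subseteq> topspace X"
 unfolding orbit_conv_image using torus_action_closed by auto

text \<open>The orbit is the product of a free orbit of the base torus, of dimension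
  \<open>i + (m - n)\<close>, with the orbit of the second coordinate, which the flow moves into the
  link.\<close>

lemma toric_chart_orbit_dim:
 assumes c: "toric_chart n m X act x i G U P f" and act: "torus_action m X act" and H: "Hausdorff_space X"
  and y: "y \<in> U"
 shows "orbit_dim m X act y = i + (m - n) + toric_cone.odim (n - i) G (snd (f y))"
proof -
 interpret C: toric_cone "n - i" G using toric_chartD(2)[OF c] .
 note D = toric_chartD[OF c]
 let ?k = "n - i" and ?r = "m - n" and ?S = "csg (n - i) G"
 define \<delta> where "\<delta> = snd (f y)"
 show ?thesis
 proof (cases "\<delta> = apex ?S")
  case True
  thus ?thesis
   using orbit_dim_eqI[OF toric_chart_orbit[OF c act H y]] by (simp add: \<delta>_def C.odim_def)
 next
  case False
  have \<delta>: "\<delta> \<in> hom_pts ?S" using D(14)[OF y] by (simp add: \<delta>_def)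
  have k: "0 < ?k" using C.hom_pts_zero \<delta> False by auto
  let ?h = "C.height \<delta>"
  have h: "0 < ?h" using C.height_pos[OF \<delta> False] .
  define \<gamma> where "\<gamma> = C.flow (1 / ?h) \<delta>"
  have \<gamma>: "\<gamma> \<in> topspace C.link" using C.normalized_in_link[OF \<delta> False] by (simp add: \<gamma>_def)
  have \<gamma>\<delta>: "C.flow ?h \<gamma> = \<delta>" using h C.flow_one[OF \<delta>] by (simp add: \<gamma>_def C.flow_flow)
  let ?O = "T_orbit ?k (hom_act ?k ?S) \<gamma>"
  obtain p where p: "torus_top p homeomorphic_space subtopology C.link ?O"
   using toric_like_orbit[OF C.link_toric_like[OF k] \<gamma>] by blast
  have O: "?O \<subseteq> topspace C.link" by (rule orbit_subset[OF C.torus_action_link \<gamma>])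
  obtain g where g: "homeomorphic_maps (subtopology X U) (model_top i ?r ?S) f g"
   using D by (auto simp: homeomorphic_map_maps)
  have gf: "g (f z) = z" if "z \<in> U" for z using g that D(10) by (auto simp: homeomorphic_maps_def)
  have fstf: "fst (f y) \<in> Cstar_power i \<times> carrier (torus ?r)" using D(12,13)[OF y] by (simp add: mem_Times_iff)
  \<comment> \<open>A point of the link is pushed back by the flow to the height of
    \<open>\<delta>\<close> before the chart is inverted.\<close>
  define F where "F = (%(a, \<gamma>'). g (base_act i ?r a (fst (f y)), C.flow ?h \<gamma>'))"
  let ?Y = "prod_topology (torus_top (i + ?r)) (subtopology C.link ?O)"
  have tY: "topspace ?Y = Torus (i + ?r) \<times> ?O" using O by auto
  have in_model: "(base_act i ?r a (fst (f y)), C.flow ?h \<gamma>') \<in> topspace (model_top i ?r ?S)"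
   if "a \<in> Torus (i + ?r)" "\<gamma>' \<in> ?O" for a \<gamma>'
   using base_act_in[OF that(1) fstf] that O C.flow_in_hom_pts by (auto simp: topspace_model_top C.topspace_link)
  have F_eq: "F (fst (P t), hom_act ?k ?S (snd (P t)) \<gamma>) = act t y" if t: "t \<in> Torus m" for t
  proof -
   have "F (fst (P t), hom_act ?k ?S (snd (P t)) \<gamma>) = g (f (act t y))" using C.flow_hom_act \<gamma> \<gamma>\<delta> D(9)[OF t y] by (auto simp: C.topspace_link \<delta>_def model_act_eq F_def)
   thus ?thesis using gf D(11)[OF t y] by simp
  qed
  have im: "F ` topspace ?Y = T_orbit m act y"
  proof
   show "F ` topspace ?Y \<subseteq> T_orbit m act y"
    unfolding tY
   proof clarsimp
    fix a \<gamma>' assume a: "a \<in> Torus (i + ?r)" and "\<gamma>' \<in> ?O"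
    then obtain b where b: "b \<in> carrier (torus ?k)" "\<gamma>' = hom_act ?k ?S b \<gamma>" by (auto simp: orbit_conv_image)
    obtain t where "t \<in> Torus m" "P t = (a, b)" using iso_surj[OF D(6) a b(1)] .
    thus "F (a, \<gamma>') \<in> T_orbit m act y" using F_eq[of t] b by (auto simp: orbit_conv_image)
   qed
   show "T_orbit m act y \<subseteq> F ` topspace ?Y"
    unfolding tY
   proof (clarsimp simp: orbit_conv_image)
    fix t assume t: "t \<in> Torus m"
    show "act t y \<in> F ` (Torus (i + ?r) \<times> (%t. hom_act ?k ?S t \<gamma>) ` carrier (torus ?k))"
     unfolding F_eq[OF t, symmetric] using iso_in_carrier[OF D(6) t] by simp
   qed
  qed
  have inj: "inj_on F (topspace ?Y)"
   unfolding tY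
  proof (rule inj_onI, clarify)
   fix a \<gamma>1 a' \<gamma>2 assume a: "a \<in> Torus (i + ?r)" "a' \<in> Torus (i + ?r)"
    and g12: "\<gamma>1 \<in> ?O" "\<gamma>2 \<in> ?O" and "F (a, \<gamma>1) = F (a', \<gamma>2)"
   hence eq: "base_act i ?r a (fst (f y)) = base_act i ?r a' (fst (f y))" "C.flow ?h \<gamma>1 = C.flow ?h \<gamma>2"
    using g in_model unfolding F_def homeomorphic_maps_def
    by (metis case_prod_conv snd_conv)+
   have "\<gamma>1 = C.flow (1 / ?h) (C.flow ?h \<gamma>1)" "\<gamma>2 = C.flow (1 / ?h) (C.flow ?h \<gamma>2)"
    using g12 O h C.flow_one by (auto simp: C.flow_flow C.topspace_link)
   thus "a = a' \<and> \<gamma>1 = \<gamma>2" using base_act_inj[OF a fstf eq(1)] eq by metis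
  qed
  have "continuous_map ?Y (model_top i ?r ?S) (%q. (base_act i ?r (fst q) (fst (f y)), C.flow ?h (snd q)))"
   unfolding model_top_def
  proof (rule continuous_map_pairedI[OF continuous_base_act[OF fstf continuous_map_fst]])
   have "continuous_map ?Y (hom_top ?S) snd"
    using continuous_map_snd[of "torus_top (i + ?r)" "subtopology C.link ?O"]
    by (auto simp: C.link_def continuous_map_in_subtopology)
   thus "continuous_map ?Y (hom_top ?S) (%q. C.flow ?h (snd q))" by (rule C.flow_continuous) simp
  qed
  hence "continuous_map ?Y (subtopology X U) (g \<circ> (%q. (base_act i ?r (fst q) (fst (f y)), C.flow ?h (snd q))))"
   using g by (intro continuous_map_compose) (auto simp: homeomorphic_maps_def)
  hence cF: "continuous_map ?Y (subtopology X (T_orbit m act y)) F" using im by (auto simp: continuous_map_in_subtopology case_prod_unfold o_def F_def)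
  have comp: "compact_space ?Y"
   using homeomorphic_compact_space[OF p] compact_torus
   by (simp add: compact_space_prod_topology compact_space_subtopology)
  have "homeomorphic_map ?Y (subtopology X (T_orbit m act y)) F" using orbit_subset[OF act] y D im by (intro compact_map_homeomorphic_map[OF comp _ cF _ inj]) (auto simp: Hausdorff_space_subtopology[OF H] )
  hence h1: "?Y homeomorphic_space subtopology X (T_orbit m act y)" by (rule homeomorphic_map_imp_homeomorphic_space)
  have h2: "prod_topology (torus_top (i + ?r)) (torus_top p) homeomorphic_space ?Y"
   by (rule homeomorphic_space_prod_topology[OF homeomorphic_space_refl p])
  have h3: "torus_top (i + ?r + p) homeomorphic_space prod_topology (torus_top (i + ?r)) (torus_top p)"
   by (rule homeomorphic_space_sym[THEN iffD1, OF torus_product_homeomorphic])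
  have "torus_top (i + ?r + p) homeomorphic_space subtopology X (T_orbit m act y)"
   by (rule homeomorphic_space_trans[OF h3 homeomorphic_space_trans[OF h2 h1]])
  hence "orbit_dim m X act y = i + ?r + p" by (rule orbit_dim_eqI)
  moreover have "C.odim \<delta> = p" using False orbit_dim_eqI[OF p] by (simp add: C.odim_def \<gamma>_def)
  ultimately show ?thesis by (simp add: \<delta>_def)
 qed
qed

lemma toric_like_orbit_dim:
 assumes "toric_like n m X act" "x \<in> topspace X"
 shows "m - n \<le> orbit_dim m X act x" "orbit_dim m X act x \<le> m"
 using toric_like_orbit[OF assms] orbit_dim_eqI by metis+

context toric_cone
begin

text \<open>Orbits in the link have dimension at least \<open>k - (k - 1) = 1\<close>, so the circle
  factor prevents any fixed point away from the apex.\<close>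

lemma odim_pos:
 assumes "d \<in> hom_pts S" "d \<noteq> apex S"
 shows "0 < odim d"
proof -
 have "0 < k" using hom_pts_zero assms by auto
 thus ?thesis
  using toric_like_orbit_dim[OF link_toric_like normalized_in_link[OF assms]] assms by (simp add: odim_def)
qed

lemma odim_eq_0_iff: "d \<in> hom_pts S ==> odim d = 0 \<longleftrightarrow> d = apex S"
 using odim_pos by (auto simp: odim_def)

lemma odim_link: "g \<in> topspace link ==> odim g = orbit_dim k link (hom_act k S) g"
 using height_apex flow_one by (auto simp: odim_def topspace_link)

end

section \<open>Existence of free orbits\<close>

lemma toric_chart_point:
 assumes c: "toric_chart n m X act x i G U F f" and "p \<in> Cstar_power i \<times> Torus (m - n)"
  "d \<in> hom_pts (csg (n - i) G)"
 obtains y where "y \<in> U" "f y = (p, d)"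
proof -
 have "(p, d) \<in> f ` U"
  using homeomorphic_imp_surjective_map[OF toric_chartD(7)[OF c]] toric_chartD[OF c] assms
  by (simp add: topspace_model_top Int_absorb1)
 thus ?thesis using that by force
qed

text \<open>Kept apart from the induction so that one argument serves the links inside the induction
  and the given space afterwards.\<close>

lemma free_orbit_step:
 assumes T: "toric_like n m X act"
  and IH: "\<And>k G. 0 < k ==> k \<le> n ==> toric_cone k G ==>
   \<exists>\<gamma>\<in>hom_pts (csg k G). toric_cone.odim k G \<gamma> = k"
  and x: "x \<in> topspace X" and c: "toric_chart n m X act x i G U F f"
 shows "\<exists>\<gamma>\<in>hom_pts (csg (n - i) G). \<forall>y\<in>U. snd (f y) = \<gamma> --> orbit_dim m X act y = m"
proof -
 note D = toric_chartD[OF c]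
 have nm: "n \<le> m" and act: "torus_action m X act" "Hausdorff_space X" using T by (auto simp: toric_like_def)
 interpret C: toric_cone "n - i" G using D(2) .
 obtain \<gamma> where \<gamma>: "\<gamma> \<in> hom_pts (csg (n - i) G)" "C.odim \<gamma> = n - i"
 proof (cases "n = i")
  case True
  thus ?thesis using that C.apex_in_hom_pts unfolding C.odim_def by simp
 next
  case False
  thus ?thesis using IH[of "n - i" G] D(1,2) that by auto
 qed
 thus ?thesis using toric_chart_orbit_dim[OF c act] nm D(1) by force
qed

text \<open>Strong induction on \<open>k\<close>: charts of the link are modelled on cones of
  dimension \<open>k - 1 - i\<close>, which is smaller than \<open>k\<close>.\<close>

lemma free_orbit_link:
 assumes "0 < k" "toric_cone k G"
 shows "\<exists>g\<in>hom_pts (csg k G). toric_cone.odim k G g = k"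
 using assms
proof (induction k arbitrary: G rule: less_induct)
 case (less k)
 interpret C: toric_cone k G by (rule less.prems)
 have T: "toric_like (k - 1) k C.link (hom_act k (csg k G))" using C.link_toric_like less.prems by blast
 obtain x where x: "x \<in> topspace C.link" using C.link_nonempty less.prems by blast
 obtain i G' U F f where c: "toric_chart (k - 1) k C.link (hom_act k (csg k G)) x i G' U F f"
  using T x unfolding toric_like_def by blast
 have "\<exists>g\<in>hom_pts (csg (k - 1 - i) G'). \<forall>y\<in>U. snd (f y) = g --> orbit_dim k C.link (hom_act k (csg k G)) y = k"
  by (rule free_orbit_step[OF T _ x c]) (use less in auto)
 then obtain g where g: "g \<in> hom_pts (csg (k - 1 - i) G')"
  "\<forall>y\<in>U. snd (f y) = g --> orbit_dim k C.link (hom_act k (csg k G)) y = k" by blast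
 have "fst (f x) \<in> Cstar_power i \<times> carrier (torus (k - (k - 1)))"
  using toric_chartD(12,13)[OF c toric_chartD(4)[OF c]] by (simp add: mem_Times_iff)
 from toric_chart_point[OF c this g(1)] obtain y where y: "y \<in> U" "snd (f y) = g" by (metis snd_conv)
 thus ?case using g toric_chartD(10)[OF c] C.odim_link by (intro bexI) (auto simp: C.topspace_link)
qed

lemma free_orbit_chart:
 assumes T: "toric_like n m X act" and x: "x \<in> topspace X" and c: "toric_chart n m X act x i G U F f"
 obtains g where "g \<in> hom_pts (csg (n - i) G)" "\<And>y. y \<in> U ==> snd (f y) = g ==> orbit_dim m X act y = m"
 using free_orbit_step[OF T _ x c] free_orbit_link by metis

section \<open>The stratification\<close>

lemma connected_Cstar: "connected (Cstar_power i)"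
proof -
 have "Cstar_power i = PiE UNIV (%j. if j < i then - {0} else {1})"
  by (auto simp: in_Cstar_power_iff PiE_def Pi_def)
 moreover have "connected (- {0 :: complex})"
  by (rule connected_punctured_universe) simp
 ultimately have "connectedin (product_topology (%_. euclidean :: complex topology) (UNIV :: nat set)) (Cstar_power i)"
  by (simp add: connectedin_PiE)
 thus ?thesis by (simp add: euclidean_product_topology)
qed

lemma orbit_filtration_0:
 "orbit_filtration 0 n m X act (2 * j + (int m - int n)) =
  {x \<in> topspace X. int (orbit_dim m X act x) \<le> j + (int m - int n)}"
 by (simp add: orbit_filtration_def)

lemma stratum_union_0:
 assumes "n \<le> m"
 shows "stratum_union 0 n m X act i = {x \<in> topspace X. orbit_dim m X act x = i + (m - n)}"
 using assms orbit_filtration_0[of n m X act "int i"] orbit_filtration_0[of n m X act "int i - 1"]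
 by (auto simp: stratum_union_def)

text \<open>Over a fixed base point the flow converges to the apex as its time tends to 0. Both the
  density of free orbits and the frontier condition come from this.\<close>

lemma toric_chart_flow_closure:
 assumes c: "toric_chart n m X act x i G U F f" and z: "z \<in> U" "snd (f z) = apex (csg (n - i) G)"
  and d: "d \<in> hom_pts (csg (n - i) G)"
  and A: "\<And>y s. 0 < s ==> y \<in> U ==> f y = (fst (f z), toric_cone.flow (n - i) G s d) ==> y \<in> A"
 shows "z \<in> X closure_of A"
proof -
 interpret C: toric_cone "n - i" G using toric_chartD(2)[OF c] .
 note D = toric_chartD[OF c]
 obtain g where g: "homeomorphic_maps (subtopology X U) (model_top i (m - n) (csg (n - i) G)) f g"
  using D by (auto simp: homeomorphic_map_maps)
 have gf: "g (f z) = z" if "z \<in> U" for z using g that D by (auto simp: homeomorphic_maps_def)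
 have fz: "fst (f z) \<in> Cstar_power i \<times> Torus (m - n)" using D(12,13)[OF z(1)] by (simp add: mem_Times_iff)
 define h where "h s = g (fst (f z), C.flow s d)" for s
 have "continuous_map euclideanreal (model_top i (m - n) (csg (n - i) G)) (%s. (fst (f z), C.flow s d))"
  unfolding model_top_def
  by (intro continuous_map_pairedI C.flow_continuous) (use fz d in \<open>auto simp: continuous_map_const\<close>)
 hence "continuous_map euclideanreal (subtopology X U) (g \<circ> (%s. (fst (f z), C.flow s d)))"
  using g by (intro continuous_map_compose) (auto simp: homeomorphic_maps_def)
 hence ch: "continuous_map euclideanreal X h" "range h \<subseteq> U"
  by (auto simp: h_def[abs_def] o_def continuous_map_in_subtopology)
 have h0: "h 0 = z" using C.flow_zero[OF d] z gf by (simp add: h_def) (metis prod.collapse)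
 have hA: "h s \<in> A" if "0 < s" for s
 proof (rule A[OF that])
  show "h s \<in> U" using ch by blast
  show "f (h s) = (fst (f z), C.flow s d)"
  proof -
   show ?thesis using fz d C.flow_in_hom_pts g unfolding h_def homeomorphic_maps_def by (auto simp: topspace_model_top)
  qed
 qed
 show ?thesis
  unfolding in_closure_of
 proof (intro conjI allI impI)
  show "z \<in> topspace X" using z D by blast
  fix T assume T: "z \<in> T \<and> openin X T"
  hence "open {s. h s \<in> T}" using openin_continuous_map_preimage[OF ch(1), of T] by simp
  then obtain e where "e > 0" "ball 0 e \<subseteq> {s. h s \<in> T}" using T h0 by (auto simp: open_contains_ball)
  thus "\<exists>y. y \<in> A \<and> y \<in> T" using hA[of "e / 2"] by force
 qed
qed

text \<open>The set is the image of the base times the positive half line under the inverse chart.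
  Since orbit dimension is constant on it, it will lie in a single stratum.\<close>

lemma toric_chart_flow_connected:
 assumes c: "toric_chart n m X act x i G U F f" and d: "d \<in> hom_pts (csg (n - i) G)"
 shows "connectedin X {y \<in> U. \<exists>s>0. snd (f y) = toric_cone.flow (n - i) G s d}" (is "connectedin X ?P")
proof -
 interpret C: toric_cone "n - i" G using toric_chartD(2)[OF c] .
 note D = toric_chartD[OF c]
 let ?M = "model_top i (m - n) (csg (n - i) G)"
 obtain g where g: "homeomorphic_maps (subtopology X U) ?M f g"
  using D by (auto simp: homeomorphic_map_maps)
 have gf: "g (f z) = z" if "z \<in> U" for z using g that D by (auto simp: homeomorphic_maps_def)
 let ?B = "prod_topology (top_of_set (Cstar_power i)) (torus_top (m - n))"
 let ?Z = "prod_topology ?B (top_of_set {0::real<..})"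
 have "connected ((Cstar_power i \<times> Torus (m - n)) \<times> {0::real<..})"
  by (intro connected_Times connected_Cstar connected_torus connected_Ioi)
 hence "connectedin euclidean ((Cstar_power i \<times> Torus (m - n)) \<times> {0::real<..})" by simp
 hence "connected_space ?Z"
  unfolding connectedin_def prod_topology_subtopology_eu by rule
 hence conZ: "connectedin ?Z (topspace ?Z)" by (simp only: connectedin_topspace)
 have cm: "continuous_map ?Z ?M (%q. (fst q, C.flow (snd q) d))"
  unfolding model_top_def
 proof (intro continuous_map_pairedI continuous_map_fst C.flow_continuous)
  show "continuous_map ?Z (hom_top (csg (n - i) G)) (%q. d)" using d by simp
  show "continuous_map ?Z euclideanreal snd" using continuous_map_snd[of ?B "top_of_set {0<..}"] by auto
 qed
 hence "continuous_map ?Z (subtopology X U) (g \<circ> (%q. (fst q, C.flow (snd q) d)))"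
  using g by (intro continuous_map_compose) (auto simp: homeomorphic_maps_def)
 hence cg: "continuous_map ?Z X (%q. g (fst q, C.flow (snd q) d))" "(%q. g (fst q, C.flow (snd q) d)) ` topspace ?Z \<subseteq> U"
  by (auto simp: o_def continuous_map_in_subtopology)
 have "(%q. g (fst q, C.flow (snd q) d)) ` topspace ?Z = ?P"
 proof (intro equalityI subsetI)
  fix y assume "y \<in> (%q. g (fst q, C.flow (snd q) d)) ` topspace ?Z"
  then obtain q where q: "q \<in> topspace ?Z" "y = g (fst q, C.flow (snd q) d)" by blast
  have "(fst q, C.flow (snd q) d) \<in> topspace ?M" using cm q continuous_map_image_subset_topspace by blast
  hence "f y = (fst q, C.flow (snd q) d)" using g q by (simp add: homeomorphic_maps_def)
  moreover have "0 < snd q" using q by auto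
  moreover have "y \<in> U" using cg q by blast
  ultimately show "y \<in> ?P" by auto
 next
  fix y assume y: "y \<in> ?P"
  then obtain s where s: "0 < s" "snd (f y) = C.flow s d" by blast
  have "y = g (fst (fst (f y), s), C.flow (snd (fst (f y), s)) d)" using gf y s by (metis (no_types, lifting) fst_conv mem_Collect_eq prod.collapse snd_conv)
  moreover have "(fst (f y), s) \<in> topspace ?Z" using D y s by (auto simp: mem_Times_iff)
  ultimately show "y \<in> (%q. g (fst q, C.flow (snd q) d)) ` topspace ?Z" by rule
 qed
 thus ?thesis using connectedin_continuous_map_image[OF cg(1) conZ] by simp
qed

lemma toric_chart_orbit_dim_ge:
 assumes c: "toric_chart n m X act x i G U F f" and act: "torus_action m X act" "Hausdorff_space X"
  and y: "y \<in> U"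
 shows "i + (m - n) \<le> orbit_dim m X act y"
  "orbit_dim m X act y = i + (m - n) \<longleftrightarrow> snd (f y) = apex (csg (n - i) G)"
 using toric_chart_orbit_dim[OF c act y] toric_cone.odim_eq_0_iff[OF toric_chartD(2,14)[OF c]] y by auto

lemma toric_chart_stratum_manifold:
 assumes c: "toric_chart n m X act x i G U F f" and act: "torus_action m X act" "Hausdorff_space X"
 shows "topological_manifold (2 * i + (m - n)) (subtopology X {y \<in> U. snd (f y) = apex (csg (n - i) G)})"
proof -
 interpret C: toric_cone "n - i" G using toric_chartD(2)[OF c] .
 note D = toric_chartD[OF c]
 let ?M = "model_top i (m - n) (csg (n - i) G)" and ?A = "apex (csg (n - i) G)"
 let ?B = "prod_topology (top_of_set (Cstar_power i)) (torus_top (m - n))"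
 let ?W = "{y \<in> U. snd (f y) = ?A}"
 obtain g where g: "homeomorphic_maps (subtopology X U) ?M f g"
  using D by (auto simp: homeomorphic_map_maps)
 have gf: "g (f z) = z" if "z \<in> U" for z using g that D by (auto simp: homeomorphic_maps_def)
 have fg: "f (g (p, ?A)) = (p, ?A)" "g (p, ?A) \<in> U" if "p \<in> topspace ?B" for p
 proof -
  have "(p, ?A) \<in> topspace ?M" using that C.apex_in_hom_pts by (auto simp: topspace_model_top)
  thus "f (g (p, ?A)) = (p, ?A)" "g (p, ?A) \<in> U"
   using g continuous_map_image_subset_topspace by (fastforce simp: homeomorphic_maps_def)+
 qed
 have "homeomorphic_maps ?B (subtopology X ?W) (%p. g (p, ?A)) (%y. fst (f y))"
  unfolding homeomorphic_maps_def
 proof (intro conjI ballI)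
  have "continuous_map ?B ?M (%p. (p, ?A))"
   unfolding model_top_def using C.apex_in_hom_pts by (intro continuous_map_pairedI) (auto)
  hence "continuous_map ?B (subtopology X U) (g \<circ> (%p. (p, ?A)))"
   using g by (intro continuous_map_compose) (auto simp: homeomorphic_maps_def)
  thus "continuous_map ?B (subtopology X ?W) (%p. g (p, ?A))" using fg by (simp add: o_def continuous_map_in_subtopology)
  have "continuous_map (subtopology X U) ?B (%y. fst (f y))"
   using homeomorphic_imp_continuous_map[OF D(7)] continuous_map_fst_of unfolding model_top_def by (fastforce simp: o_def)
  thus "continuous_map (subtopology X ?W) ?B (%y. fst (f y))"
   by (rule continuous_map_from_subtopology_mono) auto
  show "fst (f (g (p, ?A))) = p" if "p \<in> topspace ?B" for p using fg[OF that] by simp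
  show "g (fst (f y), ?A) = y" if "y \<in> topspace (subtopology X ?W)" for y
   using that gf by (auto, metis prod.collapse)
 qed
 thus ?thesis
  using topological_manifold_homeomorphic[OF topological_manifold_Cstar_torus] unfolding homeomorphic_space_def by blast
qed

text \<open>Orbit dimension is smallest at the centre of a chart, which makes the filtration closed
  and identifies the stratum of \<open>x\<close> near \<open>x\<close> with the apex locus. For the
  frontier condition, the part of a stratum in the closure of another is shown to be open and closed
  in that connected stratum.\<close>

lemma toric_like_manifold_stratified:
 assumes T: "toric_like n m X act"
 shows "manifold_stratified 0 n m X act"
proof -
 have nm: "n \<le> m" and act: "torus_action m X act" "Hausdorff_space X" and sc: "second_countable X"
  using T by (auto simp: toric_like_def)
 have chart: "charted n m X act x" if "x \<in> topspace X" for x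
  using T that by (simp add: toric_like_def)
 let ?D = "orbit_dim m X act"
 have dim: "?D x = i + (m - n)" if "toric_chart n m X act x i G U F f" for x i G U F f
  using toric_chart_orbit_dim_ge[OF that act toric_chartD(4)[OF that]] toric_chartD[OF that] by simp
 have opn: "openin X {x \<in> topspace X. d < ?D x}" for d
 proof (subst openin_subopen, intro ballI)
  fix x assume x: "x \<in> {x \<in> topspace X. d < ?D x}"
  then obtain i G U F f where c: "toric_chart n m X act x i G U F f" using chart by blast
  have "U \<subseteq> {x \<in> topspace X. d < ?D x}"
   using toric_chart_orbit_dim_ge[OF c act] dim[OF c] x toric_chartD(10)[OF c] by force
  thus "\<exists>T. openin X T \<and> x \<in> T \<and> T \<subseteq> {x \<in> topspace X. d < ?D x}"
   using toric_chartD[OF c] by blast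
 qed
 have closed: "closedin X {x \<in> topspace X. int (?D x) \<le> c}" for c
 proof (cases "c < 0")
  case True
  thus ?thesis by auto
 next
  case False
  hence "{x \<in> topspace X. int (?D x) \<le> c} = topspace X - {x \<in> topspace X. nat c < ?D x}" by auto
  thus ?thesis using opn by auto
 qed
 show ?thesis
  unfolding manifold_stratified_def
 proof (intro conjI allI ballI impI)
  show "closedin X (orbit_filtration 0 n m X act j)" for j
   unfolding orbit_filtration_def using closed .
 next
  fix A B assume A: "A \<in> strata 0 n m X act" and B: "B \<in> strata 0 n m X act" and ne: "A \<inter> X closure_of B \<noteq> {}"
  obtain i where iA: "A \<in> connected_components_of (subtopology X (stratum_union 0 n m X act i))"
   using A by (auto simp: strata_def)
  obtain i' where iB: "B \<in> connected_components_of (subtopology X (stratum_union 0 n m X act i'))"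
   using B by (auto simp: strata_def)
  have conA: "connectedin X A" and subA: "A \<subseteq> {x \<in> topspace X. ?D x = i + (m - n)}"
   using connectedin_connected_components_of[OF iA] by (auto simp: connectedin_subtopology stratum_union_0[OF nm])
  have subB: "B \<subseteq> {x \<in> topspace X. ?D x = i' + (m - n)}"
   using connectedin_connected_components_of[OF iB] by (auto simp: connectedin_subtopology stratum_union_0[OF nm])
  \<comment> \<open>A chart at \<open>z\<close> meets \<open>B\<close> in some \<open>y\<close>. The
    flow family of \<open>y\<close> over the whole base is connected with constant orbit dimension,
    hence contained in \<open>B\<close>, and it accumulates at every apex point of the
    chart.\<close>
  have nbh: "\<exists>U. openin X U \<and> z \<in> U \<and> A \<inter> U \<subseteq> X closure_of B" if z: "z \<in> A \<inter> X closure_of B" for z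
  proof -
   have zX: "z \<in> topspace X" "?D z = i + (m - n)" using z subA by auto
   obtain i0 G U F f where c: "toric_chart n m X act z i0 G U F f" using chart zX by blast
   have c: "toric_chart n m X act z i G U F f" using dim zX c by simp
   interpret C: toric_cone "n - i" G using toric_chartD(2)[OF c] .
   have "\<exists>y. y \<in> B \<and> y \<in> U" using z toric_chartD[OF c] unfolding Int_iff in_closure_of by blast
   then obtain y where y: "y \<in> B" "y \<in> U" by blast
   define \<delta> where "\<delta> = snd (f y)"
   have \<delta>: "\<delta> \<in> hom_pts (csg (n - i) G)" using toric_chartD(14)[OF c y(2)] by (simp add: \<delta>_def)
   let ?P = "{y \<in> U. \<exists>s>0. snd (f y) = C.flow s \<delta>}"
   have yP: "y \<in> ?P" using y C.flow_one[OF \<delta>] by (auto simp: \<delta>_def intro!: exI[of _ 1])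
   have "?P \<subseteq> stratum_union 0 n m X act i'"
   proof (clarsimp simp: stratum_union_0[OF nm])
    fix y' s assume y': "y' \<in> U" "0 < s" "snd (f y') = C.flow s \<delta>"
    show "y' \<in> topspace X \<and> ?D y' = i' + (m - n)" using toric_chart_orbit_dim[OF c act y'(1)] toric_chart_orbit_dim[OF c act y(2)] C.odim_flow[OF \<delta> y'(2)] y' y subB toric_chartD(10)[OF c] by (auto simp: \<delta>_def)
   qed
   hence PB: "?P \<subseteq> B" using toric_chart_flow_connected[OF c \<delta>] connected_components_of_maximal[OF iB] yP y by (auto simp: connectedin_subtopology disjnt_iff)
   have "A \<inter> U \<subseteq> X closure_of B"
   proof
    fix x assume x: "x \<in> A \<inter> U"
    hence "snd (f x) = apex (csg (n - i) G)"
     using toric_chart_orbit_dim_ge[OF c act] subA by auto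
    thus "x \<in> X closure_of B"
    proof (intro toric_chart_flow_closure[OF c _ _ \<delta>])
     fix y' s assume y': "0 < s" "y' \<in> U" "f y' = (fst (f x), C.flow s \<delta>)"
     thus "y' \<in> B" using PB by force
    qed (use x in auto)
   qed
   thus ?thesis using toric_chartD[OF c] by blast
  qed
  let ?T = "A \<inter> X closure_of B"
  have "closedin (subtopology X A) ?T" by (simp add: closedin_subtopology_Int_closed)
  moreover have "openin (subtopology X A) ?T"
  proof (subst openin_subopen, intro ballI)
   fix z assume "z \<in> ?T"
   then obtain U where "openin X U" "z \<in> U" "A \<inter> U \<subseteq> X closure_of B" using nbh by blast
   thus "\<exists>T. openin (subtopology X A) T \<and> z \<in> T \<and> T \<subseteq> ?T"
    using \<open>z \<in> ?T\<close> by (intro exI[of _ "A \<inter> U"]) (auto simp: openin_subtopology_Int2)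
  qed
  moreover have "connected_space (subtopology X A)" "topspace (subtopology X A) = A"
   using conA by (auto simp: connectedin_def)
  ultimately show "A \<subseteq> X closure_of B" using ne connected_space_clopen_in by blast
 next
  fix i assume "i \<le> n"
  let ?X = "subtopology X (stratum_union 0 n m X act i)"
  show "topological_manifold (0 + 2 * i + (m - n)) ?X"
   unfolding topological_manifold_def
  proof (intro conjI ballI)
   show "Hausdorff_space ?X" by (rule Hausdorff_space_subtopology[OF act(2)])
   show "second_countable ?X" by (rule second_countable_subtopology[OF sc])
   fix x assume "x \<in> topspace ?X"
   hence x: "x \<in> topspace X" "?D x = i + (m - n)" by (auto simp: stratum_union_0[OF nm])
   obtain i0 G U F f where c: "toric_chart n m X act x i0 G U F f" using chart x by blast
   have c: "toric_chart n m X act x i G U F f" using dim x c by simp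
   let ?W = "{y \<in> U. snd (f y) = apex (csg (n - i) G)}"
   have W: "?W = stratum_union 0 n m X act i \<inter> U"
    using toric_chart_orbit_dim_ge[OF c act] toric_chartD[OF c] by (auto simp: stratum_union_0[OF nm])
   have oW: "openin ?X ?W" unfolding W using toric_chartD(3)[OF c] by (rule openin_subtopology_Int2)
   have sW: "subtopology X ?W = subtopology ?X ?W"
    by (simp add: subtopology_subtopology W)
   have "x \<in> topspace (subtopology ?X ?W)" using toric_chartD[OF c] W by auto
   then obtain V E where V: "openin (subtopology ?X ?W) V" "x \<in> V" "openin (Euclidean_space (2 * i + (m - n))) E"
    "subtopology (subtopology ?X ?W) V homeomorphic_space subtopology (Euclidean_space (2 * i + (m - n))) E"
    using toric_chart_stratum_manifold[OF c act] unfolding topological_manifold_def sW by meson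
   moreover have "openin ?X V" using V oW openin_trans_full by blast
   moreover have "subtopology (subtopology ?X ?W) V = subtopology ?X V"
    using openin_imp_subset[OF V(1)] by (simp add: subtopology_subtopology Int_assoc inf.absorb2)
   ultimately show "\<exists>V E. openin ?X V \<and> x \<in> V \<and> openin (Euclidean_space (0 + 2 * i + (m - n))) E \<and>
    subtopology ?X V homeomorphic_space subtopology (Euclidean_space (0 + 2 * i + (m - n))) E" by auto
  qed
 qed
qed

lemma toric_chart_stabilizer:
 assumes c: "toric_chart n m X act x i G U F f" and act: "torus_action m X act" and H: "Hausdorff_space X"
 shows "F ` stabilizer (torus m) act x = {\<one>\<^bsub>torus (i + (m - n))\<^esub>} \<times> Torus (n - i)"
  "subtorus m (stabilizer (torus m) act x)"
proof -
 note D = toric_chartD[OF c]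
 have x: "x \<in> topspace X" using D by blast
 have S: "stabilizer (torus m) act x = {t \<in> Torus m. fst (F t) = (%_. 1)}"
  using toric_chart_act_eq_iff[OF c D(4,8) _ torus_one_closed] torus_action_one[OF act x]
   top_group_iso_one[OF D(6)] by (auto simp: stabilizer_def)
 show im: "F ` stabilizer (torus m) act x = {\<one>\<^bsub>torus (i + (m - n))\<^esub>} \<times> Torus (n - i)"
 proof (intro equalityI subsetI)
  fix p assume "p \<in> F ` stabilizer (torus m) act x"
  thus "p \<in> {\<one>\<^bsub>torus (i + (m - n))\<^esub>} \<times> Torus (n - i)"
   using iso_in_carrier[OF D(6)] by (auto simp: S mem_Times_iff)
 next
  fix p assume "p \<in> {\<one>\<^bsub>torus (i + (m - n))\<^esub>} \<times> Torus (n - i)"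
  then obtain b where b: "p = ((%_. 1), b)" "b \<in> Torus (n - i)" by auto
  obtain t where "t \<in> Torus m" "F t = p" using iso_surj[OF D(6) torus_one_closed b(2)] b by metis
  thus "p \<in> F ` stabilizer (torus m) act x" using b by (auto simp: S intro!: image_eqI)
 qed
 obtain P where P: "homeomorphic_maps (torus_top m) (top_of_set (carrier (torus (i + (m - n))) \<times> Torus (n - i))) F P"
  using top_group_isoD[OF D(6)] unfolding homeomorphic_map_maps by auto
 have "stabilizer (torus m) act x = P ` ({%_. 1} \<times> Torus (n - i))"
 proof -
  have "P ` F ` stabilizer (torus m) act x = stabilizer (torus m) act x"
   using P by (force simp: S homeomorphic_maps_def image_image)
  thus ?thesis using im by simp
 qed
 moreover have "continuous_on ({%_. 1} \<times> Torus (n - i)) P"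
  using P by (auto simp: homeomorphic_maps_def torus_one_closed intro: continuous_on_subset)
 ultimately have con: "connected (stabilizer (torus m) act x)"
  using connected_continuous_image[OF _ connected_Times[OF connected_sing connected_torus]] by metis
 have "closedin (torus_top m) {t \<in> topspace (torus_top m). act t x = x}"
  by (rule closedin_continuous_maps_eq[OF H torus_action_continuous_compose[OF act]]) (use x in auto)
 hence cl: "closedin (torus_top m) (stabilizer (torus m) act x)" by (simp add: stabilizer_def)
 have "subgroup (stabilizer (torus m) act x) (torus m)"
 proof (rule group.subgroupI[OF torus_group])
  show "stabilizer (torus m) act x \<subseteq> Torus m" by (auto simp: stabilizer_def)
  show "stabilizer (torus m) act x \<noteq> {}"
   using torus_action_one[OF act x] torus_one_closed by (auto simp: stabilizer_def)
 next
  fix t assume "t \<in> stabilizer (torus m) act x"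
  hence t: "t \<in> Torus m" "act t x = x" by (auto simp: stabilizer_def)
  thus "inv\<^bsub>torus m\<^esub> t \<in> stabilizer (torus m) act x"
   using torus_action_inverse[OF act t(1) x] torus_inverse by (simp add: torus_m_inv stabilizer_def)
  fix s assume "s \<in> stabilizer (torus m) act x"
  thus "t \<otimes>\<^bsub>torus m\<^esub> s \<in> stabilizer (torus m) act x"
   using torus_action_mult[OF act t(1) _ x] t torus_coord_mult by (auto simp: stabilizer_def)
 qed
 thus "subtorus m (stabilizer (torus m) act x)" using cl con by (simp add: subtorus_def)
qed

lemma toric_like_orbit_filtered:
 assumes T: "toric_like n m X act"
 shows "orbit_filtered_T_space 0 n m X act"
  "x \<in> topspace X ==> x \<in> X closure_of {y \<in> topspace X. orbit_dim m X act y = m}"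
proof -
 have nm: "n \<le> m" and act: "torus_action m X act" "Hausdorff_space X" and ne: "topspace X \<noteq> {}"
  using T by (auto simp: toric_like_def)
 have cl: "x \<in> X closure_of {y \<in> topspace X. orbit_dim m X act y = m}" if x: "x \<in> topspace X" for x
 proof -
  obtain i G U F f where c: "toric_chart n m X act x i G U F f" using T x unfolding toric_like_def by meson
  interpret C: toric_cone "n - i" G using toric_chartD(2)[OF c] .
  obtain g where g: "g \<in> hom_pts (csg (n - i) G)" "\<And>y. y \<in> U ==> snd (f y) = g ==> orbit_dim m X act y = m"
   using free_orbit_chart[OF T x c] by blast
  have "fst (f x) \<in> Cstar_power i \<times> Torus (m - n)"
   using toric_chartD(12,13)[OF c toric_chartD(4)[OF c]] by (simp add: mem_Times_iff)
  from toric_chart_point[OF c this g(1)] obtain y0 where y0: "y0 \<in> U" "snd (f y0) = g" by (metis snd_conv)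
  show ?thesis
  proof (rule toric_chart_flow_closure[OF c toric_chartD(4,8)[OF c] g(1)])
   fix y s assume y: "0 < s" "y \<in> U" "f y = (fst (f x), C.flow s g)"
   show "y \<in> {y \<in> topspace X. orbit_dim m X act y = m}" using toric_chart_orbit_dim[OF c act y(2)] toric_chart_orbit_dim[OF c act y0(1)] y C.odim_flow[OF g(1) y(1)] y0 g toric_chartD[OF c] by auto
  qed
 qed
 thus "x \<in> topspace X ==> x \<in> X closure_of {y \<in> topspace X. orbit_dim m X act y = m}" .
 obtain x0 where x0: "x0 \<in> topspace X" using ne by blast
 then obtain y where y: "y \<in> topspace X" "orbit_dim m X act y = m"
  using cl unfolding in_closure_of by auto
 have f1: "orbit_filtration 0 n m X act (int (0 + m + n)) = topspace X"
  using toric_like_orbit_dim[OF T] orbit_filtration_0[of n m X act "int n"] by (auto simp: algebra_simps)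
 have f2: "orbit_filtration 0 n m X act (int (0 + m + n) - 2) = {x \<in> topspace X. int (orbit_dim m X act x) \<le> int m - 1}"
  using orbit_filtration_0[of n m X act "int n - 1"] by (auto simp: algebra_simps)
 have "orbit_filtration 0 n m X act (int (0 + m + n) - 2) \<subset> orbit_filtration 0 n m X act (int (0 + m + n))"
 using y f1 f2 by force
 moreover have "{x \<in> topspace X. int (orbit_dim m X act x) \<le> int m - int n - 1} = {}"
  using toric_like_orbit_dim[OF T] by force
 moreover have "subtorus m (stabilizer (torus m) act x)" if "x \<in> topspace X" for x
  using T that toric_chart_stabilizer unfolding toric_like_def by meson
 ultimately show "orbit_filtered_T_space 0 n m X act"
  using T toric_like_manifold_stratified unfolding orbit_filtered_T_space_def toric_like_def by simp
qed

text \<open>For \<open>n = 0\<close> the model is a single torus, so each chart domain is one free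
  orbit. Orbits are therefore open, and compactness leaves finitely many of them.\<close>

lemma toric_like_disjoint_tori:
 assumes T: "toric_like 0 m X act"
 shows "disjoint_tori m X act"
proof -
 have act: "torus_action m X act" "Hausdorff_space X" and comp: "compact_space X"
  using T by (auto simp: toric_like_def)
 have chart: "\<exists>G U P f. toric_chart 0 m X act x 0 G U P f" if x: "x \<in> topspace X" for x
 proof -
  obtain i G U P f where c: "toric_chart 0 m X act x i G U P f" using T x unfolding toric_like_def by meson
  moreover have "i = 0" using toric_chartD[OF c] by simp
  ultimately show ?thesis by blast
 qed
 let ?O = "T_orbit m act"
 have orb: "openin X (?O x)" "\<And>s t. s \<in> Torus m ==> t \<in> Torus m ==> act s x = act t x ==> s = t"
  if x: "x \<in> topspace X" for x
 proof -
  obtain G U P f where c: "toric_chart 0 m X act x 0 G U P f" using chart[OF x] by blast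
  note D = toric_chartD[OF c]
  interpret C: toric_cone 0 G using D by simp
  have ap: "snd (f y) = apex (csg 0 G)" if "y \<in> U" for y
   using D(14)[OF that] C.hom_pts_zero by simp
  have "U = ?O x"
  proof (intro equalityI subsetI)
   fix y assume y: "y \<in> U"
   have u: "snd (fst (f x)) \<in> Torus m" "snd (fst (f y)) \<in> Torus m"
    using D(13)[OF y] D(13)[OF D(4)] by auto
   have w: "fst (fst (f y)) = fst (fst (f x))"
    using D(12)[OF y] D(12)[OF D(4)] by (auto simp: in_Cstar_power_iff)
   obtain a where a: "a \<in> Torus (0 + m)" "base_act 0 m a (fst (f x)) = fst (f y)"
    using base_act_transitive[OF u, of "fst (fst (f x))"] w by (metis prod.collapse)
   obtain t where t: "t \<in> Torus m" "P t = (a, %_. 1)"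
    using iso_surj[OF D(6), of a "%_. 1"] a torus_one_closed by auto
   have "f (act t x) = f y"
    using D(9)[OF t(1) D(4)] a t ap[OF y] ap[OF D(4)] C.hom_act_apex by (simp add: model_act_eq prod_eq_iff)
   hence "act t x = y" using D D(11)[OF t(1) D(4)] y by (meson inj_onD)
   thus "y \<in> ?O x" using t by (auto simp: orbit_conv_image)
  next
   fix y assume "y \<in> ?O x"
   thus "y \<in> U" using D by (auto simp: orbit_conv_image)
  qed
  thus "openin X (?O x)" using D by simp
  fix s t assume st: "s \<in> Torus m" "t \<in> Torus m" "act s x = act t x"
  have "P s = P t" using toric_chart_act_eq_iff[OF c D(4,8) st(1,2)] st iso_in_carrier[OF D(6) st(1)] iso_in_carrier[OF D(6) st(2)] by (auto simp: in_torus_iff prod_eq_iff)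
  thus "s = t" using top_group_isoD[OF D(6)] st by (meson bij_betw_def inj_onD)
 qed
 have self: "x \<in> ?O x" if "x \<in> topspace X" for x
  unfolding orbit_conv_image using torus_action_one[OF act(1) that] torus_one_closed by force
 have orb_eq: "?O y = ?O x" if x: "x \<in> topspace X" and y: "y \<in> ?O x" for x y
 proof -
  obtain t where t: "t \<in> Torus m" "y = act t x" using y by (auto simp: orbit_conv_image)
  have "act s y = act (coord_mult s t) x" if "s \<in> Torus m" for s
   using torus_action_mult[OF act(1) that t(1) x] t by simp
  moreover have "act s x = act (coord_mult s (%i. inverse (t i))) y" if s: "s \<in> Torus m" for s
  proof -
   show ?thesis using torus_action_mult[OF act(1) s torus_inverse[OF t(1)]] torus_action_closed[OF act(1) t(1) x] torus_action_inverse[OF act(1) t(1) x] t by simp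
  qed
  ultimately show ?thesis
   unfolding orbit_conv_image using torus_coord_mult t torus_inverse[OF t(1)] by blast
 qed
 have "\<exists>R. finite R \<and> R \<subseteq> topspace X \<and> topspace X = (\<Union>x\<in>R. ?O x)"
 proof -
  have "\<exists>\<F>. finite \<F> \<and> \<F> \<subseteq> ?O ` topspace X \<and> topspace X \<subseteq> \<Union>\<F>"
  proof -
   have "\<forall>U\<in>?O ` topspace X. openin X U" "topspace X \<subseteq> \<Union>(?O ` topspace X)" using orb self by auto
   thus ?thesis using comp unfolding compact_space_alt by meson
  qed
  then obtain \<F> where F: "finite \<F>" "\<F> \<subseteq> ?O ` topspace X" "topspace X \<subseteq> \<Union>\<F>" by blast
  then obtain R where R: "finite R" "R \<subseteq> topspace X" "\<F> = ?O ` R" by (meson finite_subset_image)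
  have "(\<Union>x\<in>R. ?O x) \<subseteq> topspace X" using orbit_subset[OF act(1)] R by blast
  thus ?thesis using F R by blast
 qed
 then obtain R0 where R0: "finite R0" "R0 \<subseteq> topspace X" "topspace X = (\<Union>x\<in>R0. ?O x)" by blast
 \<comment> \<open>One representative for each orbit of the finite cover.\<close>
 define R where "R = (%Z. SOME x. x \<in> R0 \<and> ?O x = Z) ` ?O ` R0"
 have sel: "(SOME x. x \<in> R0 \<and> ?O x = ?O y) \<in> R0 \<and> ?O (SOME x. x \<in> R0 \<and> ?O x = ?O y) = ?O y" if "y \<in> R0" for y
  using that by (intro someI_ex[of "%x. x \<in> R0 \<and> ?O x = ?O y"]) blast
 have R: "finite R" "R \<subseteq> topspace X" "inj_on ?O R" "topspace X = (\<Union>x\<in>R. ?O x)"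
 proof -
  show "finite R" using R0 by (simp add: R_def)
  show "R \<subseteq> topspace X" using sel R0 by (auto simp: R_def)
  show "inj_on ?O R" unfolding R_def inj_on_def using sel by auto
  show "topspace X = (\<Union>x\<in>R. ?O x)" unfolding R0 R_def using sel by auto
 qed
 obtain e where e: "bij_betw e {..<card R} R" using R bij_betw_from_nat_into_finite by blast
 have eR: "e a \<in> topspace X" if "a < card R" for a using e R(2) that by (auto simp: bij_betw_def)
 define h where "h = (%(a, s). act s (e a))"
 let ?Y = "prod_topology (discrete_topology {..<card R}) (torus_top m)"
 have "continuous_map ?Y X h"
  unfolding h_def case_prod_unfold
 proof (rule torus_action_continuous_compose[OF act(1) continuous_map_snd])
  have "continuous_map (discrete_topology {..<card R}) X e" using eR by simp
  from continuous_map_compose[OF continuous_map_fst this] show "continuous_map ?Y X (%p. e (fst p))" by (simp add: o_def)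
 qed
 moreover have "h ` topspace ?Y = topspace X"
 proof -
  have "h ` topspace ?Y = (\<Union>a<card R. ?O (e a))" by (force simp: h_def orbit_conv_image)
  also have "\<dots> = (\<Union>x\<in>e ` {..<card R}. ?O x)" by blast
  also have "e ` {..<card R} = R" using e by (simp add: bij_betw_def)
  finally show ?thesis using R by simp
 qed
 moreover have "inj_on h (topspace ?Y)"
 proof (rule inj_onI, clarsimp simp: h_def)
  fix a b s t assume ab: "a < card R" "b < card R" and st: "s \<in> Torus m" "t \<in> Torus m"
   and eq: "act s (e a) = act t (e b)"
  have "act s (e a) \<in> ?O (e a)" "act t (e b) \<in> ?O (e b)" using st by (auto simp: orbit_conv_image)
  hence "?O (e a) = ?O (e b)" using orb_eq eR ab eq by metis
  moreover have "e a \<in> R" "e b \<in> R" using e ab by (auto simp: bij_betw_def)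
  ultimately have "a = b" using R e ab by (auto simp: bij_betw_def inj_on_def)
  thus "a = b \<and> s = t" using orb(2)[OF eR[OF ab(1)] st] eq by simp
 qed
 moreover have "compact_space ?Y"
  using compact_torus
  by (simp add: compact_space_prod_topology compact_space_discrete_topology compact_space_subtopology)
 ultimately have "homeomorphic_map ?Y X h" using act by (intro compact_map_homeomorphic_map)
 moreover have "h (a, coord_mult t s) = act t (h (a, s))"
  if "a < card R" "s \<in> Torus m" "t \<in> Torus m" for a s t
  using torus_action_mult[OF act(1) that(3,2) eR[OF that(1)]] by (simp add: h_def)
 ultimately show ?thesis unfolding disjoint_tori_def by blast
qed

section \<open>Locally standard T-pseudomanifolds\<close>

text \<open>Moves a space to another type with the transported topology; any injection will do.
  Links reach their carrier type in this way.\<close>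

lemma homeomorphic_image_topology:
 assumes "inj_on f (topspace X)"
 obtains Y g where "homeomorphic_maps X Y f g"
proof -
 define g where "g = inv_into (topspace X) f"
 have gf: "g (f x) = x" if "x \<in> topspace X" for x using assms that by (simp add: g_def)
 let ?Y = "pullback_topology (f ` topspace X) g X"
 have tY: "topspace ?Y = f ` topspace X" using gf by (auto simp: topspace_pullback_topology)
 have "homeomorphic_maps X ?Y f g"
  unfolding homeomorphic_maps_def
 proof (intro conjI ballI)
  show "continuous_map X ?Y f"
   unfolding continuous_map_def
  proof (intro conjI allI impI)
   fix V assume "openin ?Y V"
   then obtain U where U: "openin X U" "V = g -` U \<inter> f ` topspace X" by (auto simp: openin_pullback_topology)
   have "f x \<in> V \<longleftrightarrow> x \<in> U" if "x \<in> topspace X" for x using that by (simp add: U gf)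
   hence "{x \<in> topspace X. f x \<in> V} = U" using openin_subset[OF U(1)] by auto
   thus "openin X {x \<in> topspace X. f x \<in> V}" using U by simp
  qed (use tY in auto)
  have "continuous_map ?Y X (id \<circ> g)" by rule (rule continuous_map_id)
  thus "continuous_map ?Y X g" by simp
 qed (use gf tY in auto)
 thus ?thesis using that by blast
qed

lemma open_cone_functorial:
 assumes f: "continuous_map X Y f"
 shows "continuous_map (open_cone X) (open_cone Y) (map_option (%(y, s). (f y, s)))" (is "continuous_map _ _ ?F")
 unfolding continuous_map_def
proof (intro conjI allI impI)
 let ?I = "top_of_set {0..<1::real}"
 have fY: "f x \<in> topspace Y" if "x \<in> topspace X" for x using f that continuous_map_image_subset_topspace by fast
 thus "?F \<in> topspace (open_cone X) \<rightarrow> topspace (open_cone Y)"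
  by (auto simp: topspace_open_cone cone_set_def)
 fix W assume W: "openin (open_cone Y) W"
 have "continuous_map (prod_topology X ?I) (prod_topology Y ?I) (%p. (f (fst p), snd p))"
  using continuous_map_compose[OF continuous_map_fst f]
  by (intro continuous_map_pairedI continuous_map_snd) (simp add: o_def)
 moreover have "openin (prod_topology Y ?I) {p \<in> topspace Y \<times> {0..<1}. cone_proj p \<in> W}"
  using W by (simp add: openin_open_cone)
 ultimately have "openin (prod_topology X ?I) {p \<in> topspace (prod_topology X ?I). (f (fst p), snd p) \<in> {p \<in> topspace Y \<times> {0..<1}. cone_proj p \<in> W}}"
  by (rule openin_continuous_map_preimage)
 moreover have "{p \<in> topspace (prod_topology X ?I). (f (fst p), snd p) \<in> {p \<in> topspace Y \<times> {0..<1}. cone_proj p \<in> W}} =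
   {p \<in> topspace X \<times> {0..<1}. cone_proj p \<in> {c \<in> topspace (open_cone X). ?F c \<in> W}}"
  using fY by (auto simp: cone_proj_def topspace_open_cone cone_set_def)
 ultimately show "openin (open_cone X) {c \<in> topspace (open_cone X). ?F c \<in> W}"
  by (auto simp: openin_open_cone topspace_open_cone)
qed

lemma open_cone_homeomorphic:
 assumes "homeomorphic_maps X Y f g"
 shows "homeomorphic_maps (open_cone X) (open_cone Y)
  (map_option (%(y, s). (f y, s))) (map_option (%(y, s). (g y, s)))"
 using assms open_cone_functorial open_cone_functorial
 by (auto simp: homeomorphic_maps_def topspace_open_cone cone_set_def)

lemma (in toric_cone) link_empty: "k = 0 ==> topspace link = {}"
using hom_pts_zero height_apex topspace_link by auto

lemma local_model_action_eq:
 "local_model_action i r actL ab (p, q, c) =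
  (p, base_act i r (fst ab) q, map_option (%(y, s). (actL (snd ab) y, s)) c)"
 by (simp add: local_model_action_def base_act_def case_prod_unfold cong: if_cong)

text \<open>The values on an enumeration of the countable semigroup determine a point; their real
  and imaginary parts are stored at even and odd indices.\<close>

lemma (in toric_cone) link_in_reals:
 obtains f :: "mono => nat => real" and L g where "homeomorphic_maps link L f g"
proof -
 define f where "f = (%(\<gamma> :: mono) n.
  (if even n then Re (\<gamma> (from_nat_into S (n div 2))) else Im (\<gamma> (from_nat_into S (n div 2)))))"
 have "inj_on f (topspace link)"
 proof (rule inj_onI)
  fix \<gamma> d assume g: "\<gamma> \<in> topspace link" "d \<in> topspace link" and eq: "f \<gamma> = f d"
  have "\<gamma> u = d u" if u: "u \<in> S" for u
  proof -
   define j where "j = to_nat_on S u"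
   have j: "from_nat_into S j = u" using u countable_csg by (simp add: j_def)
   show ?thesis using fun_cong[OF eq, of "2 * j"] fun_cong[OF eq, of "2 * j + 1"] by (simp add: f_def j complex_eq_iff)
  qed
  thus "\<gamma> = d" using g by (intro hom_pts_eqI) (auto simp: topspace_link)
 qed
 thus ?thesis using homeomorphic_image_topology that by blast
qed

lemma orbit_dim_transport:
 assumes T: "toric_like n m X act" and fg: "homeomorphic_maps X Y f g"
  and eq: "\<And>t x. t \<in> Torus m ==> x \<in> topspace X ==> f (act t x) = act' t (f x)" and x: "x \<in> topspace X"
 shows "orbit_dim m Y act' (f x) = orbit_dim m X act x"
proof -
 obtain p where p: "torus_top p homeomorphic_space subtopology X (T_orbit m act x)"
  using toric_like_orbit[OF T x] by blast
 have "torus_action m X act" using T by (simp add: toric_like_def)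
 hence sub: "T_orbit m act x \<subseteq> topspace X" using x by (rule orbit_subset)
 have im: "T_orbit m act' (f x) = f ` T_orbit m act x" using eq x by (force simp: orbit_conv_image)
 have fm: "homeomorphic_map X Y f" using fg by (auto simp: homeomorphic_map_maps)
 have "f ` T_orbit m act x \<subseteq> topspace Y" using sub homeomorphic_imp_surjective_map[OF fm] by blast
 hence "homeomorphic_map (subtopology X (T_orbit m act x)) (subtopology Y (T_orbit m act' (f x))) f"
  unfolding im using sub by (intro homeomorphic_map_subtopologies[OF fm]) (simp add: Int_absorb1)
 hence "torus_top p homeomorphic_space subtopology Y (T_orbit m act' (f x))"
  using p homeomorphic_space_trans homeomorphic_map_imp_homeomorphic_space by blast
 thus ?thesis using orbit_dim_eqI p by metis
qed

lemma identity_top_group_iso: "(%t. t) \<in> top_group_iso (torus m) (torus m)"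
 by (rule torus_top_group_isoI) auto

text \<open>The links of all charts come from the same family, so that the induction over \<open>n\<close> only has to treat
 spaces of the form \<open>toric_like\<close>.\<close>

lemma toric_chart_pseudomanifold_chart:
 fixes X :: "'x topology"
 assumes T: "toric_like n m X act"
  and IH: "\<And>n' m' (L :: (nat => real) topology) actL. n' < n ==> toric_like n' m' L actL ==> link_pseudomanifold 0 n' m' L actL"
  and c: "toric_chart n m X act x i G U P l"
 shows "\<exists>U L actL FL l. pseudomanifold_link link_pseudomanifold n i L actL FL \<and>
  pseudomanifold_chart 0 n m X act i x U L actL FL l"
proof -
 note D = toric_chartD[OF c]
 have nm: "n \<le> m" and act: "torus_action m X act" "Hausdorff_space X" using T by (auto simp: toric_like_def)
 interpret C: toric_cone "n - i" G using D(2) .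
 let ?k = "n - i" and ?r = "m - n" and ?S = "csg (n - i) G"
 obtain f :: "mono => nat => real" and L g where fg: "homeomorphic_maps C.link L f g"
  using C.link_in_reals by blast
 define actL where "actL t y = f (hom_act ?k ?S t (g y))" for t y
 have gf: "g (f d) = d" if "d \<in> topspace C.link" for d using fg that by (simp add: homeomorphic_maps_def)
 have tL: "topspace L = f ` topspace C.link"
  using fg homeomorphic_imp_surjective_map[of C.link L f] by (simp add: homeomorphic_maps_map)
 have eqf: "f (hom_act ?k ?S t d) = actL t (f d)" if "d \<in> topspace C.link" for t d
  using gf[OF that] by (simp add: actL_def)
 \<comment> \<open>Torus rank \<open>?k\<close> and second parameter \<open>?k - 1\<close> account
   for the dimension \<open>2 * ?k - 1\<close> of the link. At \<open>i = n\<close> the link is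
   empty and carries the empty filtration.\<close>
 define FL where "FL = (if i = n then (%_. {}) else orbit_filtration 0 (?k - 1) ?k L actL)"
 have T_link: "toric_like (?k - 1) ?k C.link (hom_act ?k ?S)" if "i < n" using C.link_toric_like that by simp
 have link: "pseudomanifold_link link_pseudomanifold n i L actL FL"
 proof (cases "i = n")
  case True
  have "topspace C.link = {}" using True by (intro C.link_empty) simp
  thus ?thesis using tL True by (simp add: pseudomanifold_link_def FL_def)
 next
  case False
  hence i: "i < n" using D(1) by simp
  have "link_pseudomanifold 0 (?k - 1) ?k L actL" using toric_like_transport[OF T_link[OF i] fg] eqf i by (intro IH) auto
  moreover have "0 + (n - i) + (?k - 1) = 2 * n - 2 * i - 1" by auto
  ultimately show ?thesis using i unfolding pseudomanifold_link_def FL_def by force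
 qed
 let ?cone = "map_option (%(y, s). (f y, s))"
 \<comment> \<open>Since \<open>l = 0\<close>, the Euclidean factor of the local model is a single
   point.\<close>
 define F where "F y = ((%_::nat. 0::real), fst (l y), ?cone (C.to_cone (snd (l y))))" for y
 let ?E = "Euclidean_space 0"
 have E: "topspace ?E = {%_. 0}" by (auto simp: topspace_Euclidean_space)
 let ?B = "prod_topology (top_of_set (Cstar_power i)) (torus_top ?r)"
 have chom: "homeomorphic_map (hom_top ?S) (open_cone L) (?cone \<circ> C.to_cone)"
  using homeomorphic_map_compose
   C.cone_homeomorphic open_cone_homeomorphic[OF fg] unfolding homeomorphic_maps_map by blast
 have "homeomorphic_map (model_top i ?r ?S) (prod_topology (subtopology ?E (topspace ?E)) (prod_topology ?B (open_cone L)))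
   (%p. ((%_. 0), fst p, ?cone (C.to_cone (snd p))))"
 proof -
  obtain q where q: "homeomorphic_maps (hom_top ?S) (open_cone L) (?cone \<circ> C.to_cone) q"
   using chom by (auto simp: homeomorphic_map_maps)
  have "homeomorphic_maps (model_top i ?r ?S) (prod_topology (subtopology ?E (topspace ?E)) (prod_topology ?B (open_cone L)))
    (%p. ((%_. 0), fst p, ?cone (C.to_cone (snd p)))) (%z. (fst (snd z), q (snd (snd z))))"
   unfolding homeomorphic_maps_def
  proof (intro conjI ballI)
   have s: "continuous_map (model_top i ?r ?S) ?B fst" "continuous_map (model_top i ?r ?S) (hom_top ?S) snd"
    unfolding model_top_def by (rule continuous_map_fst, rule continuous_map_snd)
   have "continuous_map (model_top i ?r ?S) (open_cone L) (%p. ?cone (C.to_cone (snd p)))"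
    using continuous_map_compose[OF s(2), of "open_cone L" "?cone \<circ> C.to_cone"] q
    by (simp add: homeomorphic_maps_def o_def)
   thus "continuous_map (model_top i ?r ?S) (prod_topology (subtopology ?E (topspace ?E)) (prod_topology ?B (open_cone L)))
     (%p. ((%_. 0), fst p, ?cone (C.to_cone (snd p))))"
    using s by (intro continuous_map_pairedI) (auto simp: E)
   let ?Z = "prod_topology (subtopology ?E (topspace ?E)) (prod_topology ?B (open_cone L))"
   have t: "continuous_map ?Z ?B (%z. fst (snd z))" "continuous_map ?Z (open_cone L) (%z. snd (snd z))"
    using continuous_map_fst_of[OF continuous_map_snd] continuous_map_snd_of[OF continuous_map_snd]
    by (auto simp: o_def)
   have "continuous_map ?Z (hom_top ?S) (%z. q (snd (snd z)))"
    using continuous_map_compose[OF t(2), of "hom_top ?S" q] q by (simp add: homeomorphic_maps_def o_def)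
   thus "continuous_map ?Z (model_top i ?r ?S) (%z. (fst (snd z), q (snd (snd z))))"
    unfolding model_top_def using t by (intro continuous_map_pairedI)
  next
   fix p assume "p \<in> topspace (model_top i ?r ?S)"
   thus "(fst (snd ((%_. 0::real), fst p, ?cone (C.to_cone (snd p)))), q (snd (snd ((%_::nat. 0::real), fst p, ?cone (C.to_cone (snd p)))))) = p"
    using q by (auto simp: homeomorphic_maps_def topspace_model_top)
  next
   fix z assume "z \<in> topspace (prod_topology (subtopology ?E (topspace ?E)) (prod_topology ?B (open_cone L)))"
   thus "((%_. 0), fst (fst (snd z), q (snd (snd z))), ?cone (C.to_cone (snd (fst (snd z), q (snd (snd z)))))) = z"
    using q by (auto simp: homeomorphic_maps_def E)
  qed
  thus ?thesis by (auto simp: homeomorphic_map_maps)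
 qed
 from homeomorphic_map_compose[OF D(7) this]
 have hom: "homeomorphic_map (subtopology X U)
   (prod_topology (subtopology ?E (topspace ?E)) (prod_topology ?B (open_cone L))) F"
  by (simp add: F_def[abs_def] o_def)
 have equi: "F (act t y) = local_model_action i ?r actL (P t) (F y)" if t: "t \<in> Torus m" and y: "y \<in> U" for t y
 proof -
  show ?thesis using C.to_cone_hom_act[OF iso_in_carrier(2)[OF D(6) t] D(14)[OF y]] C.of_cone_to_cone[OF D(14)[OF y]] eqf D(9)[OF t y] by (auto simp: cone_set_def local_model_action_eq model_act_eq F_def)
 qed
 have dimL: "orbit_dim ?k L actL (f d) = C.odim d" if "d \<in> topspace C.link" "i < n" for d
  using orbit_dim_transport[OF T_link[OF that(2)] fg eqf that(1)] C.odim_link[OF that(1)] by simp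
 \<comment> \<open>Both filtrations bound \<open>C.odim\<close> by \<open>(j + 1) div 2\<close>: on
   the side of \<open>X\<close> because of the degree shift of the cone, on the side of the link
   because its torus has one rank more than its second parameter. At \<open>j = -1\<close> only the
   apex is left.\<close>
 have filt: "F ` (U \<inter> orbit_filtration 0 n m X act (int 0 + 2 * int i + (int m - int n) + (j + 1))) =
   topspace ?E \<times> (Cstar_power i \<times> carrier (torus ?r)) \<times> cone_set (FL j)" if j: "-1 \<le> j" for j
 proof -
  have filtX: "y \<in> orbit_filtration 0 n m X act (int 0 + 2 * int i + (int m - int n) + (j + 1)) \<longleftrightarrow>
    int (C.odim (snd (l y))) \<le> (j + 1) div 2" if y: "y \<in> U" for y
  proof -
   show ?thesis using y D nm toric_chart_orbit_dim[OF c act y] by (auto simp: orbit_filtration_def)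
  qed
  have j0: "0 \<le> (j + 1) div 2" using j by simp
  have filtL: "f d \<in> FL j \<longleftrightarrow> int (C.odim d) \<le> (j + 1) div 2" if d: "d \<in> topspace C.link" for d
  proof -
   have "?k \<noteq> 0" using d C.link_empty by blast
   hence i: "i < n" by simp
   show ?thesis using i d dimL tL by (auto simp: FL_def orbit_filtration_def)
  qed
  have FLsub: "FL j \<subseteq> topspace L" by (auto simp: FL_def orbit_filtration_def)
  have cone: "?cone (C.to_cone e) \<in> cone_set (FL j) \<longleftrightarrow> int (C.odim e) \<le> (j + 1) div 2"
   if e: "e \<in> hom_pts ?S" for e
  proof (cases "e = apex ?S")
   case True
   thus ?thesis using j0 by (simp add: C.to_cone_apex C.odim_def cone_set_def)
  next
   case False
   have h: "0 < C.height e" using C.height_pos[OF e False] .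
   have "C.odim (C.flow (1 / C.height e) e) = C.odim e" using C.odim_flow[OF e] h by simp
   moreover have "0 < C.height e / (1 + C.height e)" "C.height e / (1 + C.height e) < 1" using h by auto
   ultimately show ?thesis
    using filtL[OF C.normalized_in_link[OF e False]] by (auto simp: C.to_cone_def cone_set_def)
  qed
  have im: "F ` U = topspace ?E \<times> (Cstar_power i \<times> carrier (torus ?r)) \<times> cone_set (topspace L)"
   using homeomorphic_imp_surjective_map[OF hom] D by (simp add: Int_absorb1 topspace_open_cone)
  have mono: "cone_set (FL j) \<subseteq> cone_set (topspace L)" using FLsub by (auto simp: cone_set_def)
  show ?thesis
  proof (intro equalityI subsetI)
   fix z assume "z \<in> F ` (U \<inter> orbit_filtration 0 n m X act (int 0 + 2 * int i + (int m - int n) + (j + 1)))"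
   then obtain y where y: "y \<in> U" "z = F y" "int (C.odim (snd (l y))) \<le> (j + 1) div 2" using filtX by auto
   thus "z \<in> topspace ?E \<times> (Cstar_power i \<times> carrier (torus ?r)) \<times> cone_set (FL j)"
    using cone[OF D(14)[OF y(1)]] D(12,13) by (simp add: F_def E mem_Times_iff)
  next
   fix z assume z: "z \<in> topspace ?E \<times> (Cstar_power i \<times> carrier (torus ?r)) \<times> cone_set (FL j)"
   hence "z \<in> F ` U" unfolding im using mono by auto
   then obtain y where y: "y \<in> U" "z = F y" by blast
   thus "z \<in> F ` (U \<inter> orbit_filtration 0 n m X act (int 0 + 2 * int i + (int m - int n) + (j + 1)))" using z cone[OF D(14)[OF y(1)]] filtX by (simp add: F_def)
  qed
 qed
 have "pseudomanifold_chart 0 n m X act i x U L actL FL F"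
  unfolding pseudomanifold_chart_def
 proof (intro conjI exI ballI)
  show "openin ?E (topspace ?E)" by simp
  show "contractible_space (subtopology ?E (topspace ?E))" by simp
  show "openin (top_of_set (Cstar_power i)) (Cstar_power i)" by simp
  show "T_invariant i coord_mult (Cstar_power i)"
   by (auto simp: T_invariant_def coord_mult_def in_Cstar_power_iff in_torus_iff) (metis norm_zero zero_neq_one)
  show "P \<in> top_group_iso (torus m) (torus (i + (m - n)) \<times>\<times> torus (n - i))" by (rule D)
  show "P ` stabilizer (torus m) act x = {\<one>\<^bsub>torus (i + (m - n))\<^esub>} \<times> Torus (n - i)"
   by (rule toric_chart_stabilizer[OF c act])
  show "weakly_equivariant m act (%t. local_model_action i (m - n) actL (P t)) U F"
   unfolding weakly_equivariant_def by (rule bexI[OF _ identity_top_group_iso]) (simp add: equi)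
 qed (use D(3,4,5) hom filt in auto)
 with link show ?thesis by blast
qed

text \<open>The hypothesis concerns spaces carried by \<open>nat => real\<close>, while
  \<open>X\<close> is arbitrary; so the step serves the induction on that carrier as well as the
  final statement.\<close>

lemma toric_like_step:
 fixes X :: "'x topology"
 assumes T: "toric_like n m X act"
  and IH: "\<And>n' m' (L :: (nat => real) topology) actL. n' < n ==> toric_like n' m' L actL ==> link_pseudomanifold 0 n' m' L actL"
 shows "pseudomanifold_step link_pseudomanifold 0 n m X act"
proof (cases "n = 0")
 case True
 thus ?thesis using toric_like_disjoint_tori toric_like_orbit_filtered[OF T] T
  by (simp add: pseudomanifold_step_def)
next
 case False
 have nm: "n \<le> m" and act: "torus_action m X act" "Hausdorff_space X" using T by (auto simp: toric_like_def)
 have "orbit_filtration 0 n m X act (int (0 + m + n)) - orbit_filtration 0 n m X act (int (0 + m + n) - 2) =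
   {y \<in> topspace X. orbit_dim m X act y = m}"
  using orbit_filtration_0[of n m X act "int n"] orbit_filtration_0[of n m X act "int n - 1"]
  by (auto simp: algebra_simps)
 hence dense: "X closure_of (orbit_filtration 0 n m X act (int (0 + m + n)) - orbit_filtration 0 n m X act (int (0 + m + n) - 2)) = topspace X"
  using toric_like_orbit_filtered[OF T] closure_of_subset_topspace by fastforce
 have "\<exists>U L actL FL f. pseudomanifold_link link_pseudomanifold n i L actL FL \<and> pseudomanifold_chart 0 n m X act i x U L actL FL f"
  if x: "x \<in> stratum_union 0 n m X act i" for i x
 proof -
  have xX: "x \<in> topspace X" "orbit_dim m X act x = i + (m - n)" using x by (auto simp: stratum_union_0[OF nm])
  then obtain i0 G U F f where c: "toric_chart n m X act x i0 G U F f" using T unfolding toric_like_def by meson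
  show ?thesis using toric_chart_orbit_dim_ge[OF c act toric_chartD(4)[OF c]] toric_chartD[OF c] xX toric_chart_pseudomanifold_chart[OF T IH c] by simp
 qed
 thus ?thesis using False dense toric_like_orbit_filtered[OF T] by (simp add: pseudomanifold_step_def)
qed

lemma toric_like_link_pseudomanifold:
 "toric_like n m (L :: (nat => real) topology) actL ==> link_pseudomanifold 0 n m L actL"
proof (induction n arbitrary: m L actL rule: less_induct)
 case (less n)
 show ?case by (rule , rule toric_like_step[OF less.prems less.IH])
qed

theorem toric_like_pseudomanifold:
 "toric_like n m X act ==> locally_standard_T_pseudomanifold 0 n m X act"
 unfolding locally_standard_T_pseudomanifold_def
 by (rule toric_like_step) (auto intro: toric_like_link_pseudomanifold)

section \<open>Polar coordinates near a simplicial cone\<close>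

lemma csg_multiple: "u \<in> csg k G ==> (%i. int n * u i) \<in> csg k G"
 by (auto simp: csg_def dot_scale)

lemma hom_multiple:
 assumes "g \<in> hom_pts (csg k G)" "u \<in> csg k G"
 shows "g (%i. int n * u i) = g u ^ n"
proof (induction n)
 case 0
 thus ?case using hom_ptsD[OF assms(1)] by (simp add: zero_fun_def)
next
 case (Suc n)
 have "(%i. int (Suc n) * u i) = u + (%i. int n * u i)" by (auto simp: algebra_simps)
 thus ?case using Suc hom_ptsD(2)[OF assms csg_multiple[OF assms(2)], of n] by simp
qed

lemma hom_comb:
 assumes g: "y \<in> hom_pts (csg k G)" and J: "finite J" and f: "\<And>j. j \<in> J ==> f j \<in> csg k G"
 shows "y (%i. \<Sum>j\<in>J. int (c j) * f j i) = (\<Prod>j\<in>J. y (f j) ^ c j) \<and> (%i. \<Sum>j\<in>J. int (c j) * f j i) \<in> csg k G"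
 using J f
proof (induction J)
 case empty
 thus ?case using hom_ptsD[OF g] csg_closed by (simp add: zero_fun_def)
next
 case (insert x J)
 let ?s = "%i. \<Sum>j\<in>J. int (c j) * f j i"
 have "(%i. \<Sum>j\<in>insert x J. int (c j) * f j i) = (%i. int (c x) * f x i) + ?s" using insert by auto
 thus ?case
  using insert hom_ptsD(2)[OF g csg_multiple, of "f x" ?s "c x"] hom_multiple[OF g, of "f x" "c x"]
   csg_closed(2)[OF csg_multiple, of "f x" k G ?s "c x"] by simp
qed

text \<open>The non-zero values of \<open>y\<close> are Laurent monomials in finitely many non-zero
  numbers \<open>z j\<close>. A torus element is chosen whose first \<open>a\<close> characters are
  the phases of these numbers and whose remaining characters are 1.\<close>

lemma hom_phase:
 assumes G: "finite G" and y: "y \<in> hom_pts (csg k G)"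
 obtains \<tau> where "\<tau> \<in> Torus k" "\<And>c. c \<in> csg k G ==> y c = of_real (cmod (y c)) * chr k c \<tau>"
proof -
 obtain H w b b' a where L: "localization k G H w b b' a" and yw: "y w \<noteq> 0"
  and F: "\<And>u h. u \<in> csg k G ==> y u \<noteq> 0 ==> h \<in> H ==> dot k u h = 0"
  using localization_at_point[OF G y] by metis
 interpret L: localization k G H w b b' a by fact
 have yo: "y \<in> L.opn" using y yw by (simp add: L.opn_def)
 define z where "z = fst (L.loc y)"
 have z: "z \<in> Cstar_power a" using L.loc_in[OF yo] by (simp add: z_def)
 have loc: "L.loc y = (z, apex L.S')" using L.loc_apex[OF yo F] by (simp add: z_def prod_eq_iff)
 let ?s = "%j. if j < a then z j / of_real (cmod (z j)) else 1"
 have "(?s, %_. 1) \<in> split_torus k a b ` Torus k" using z top_group_isoD[OF split_torus_iso[OF L.unimod L.a_le]] by (auto simp: in_Cstar_power_iff norm_divide in_torus_iff bij_betw_def)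
 then obtain \<tau> where \<tau>: "\<tau> \<in> Torus k" "(?s, %_. 1) = split_torus k a b \<tau>" by auto
 have fs: "chr k (b j) \<tau> = z j / of_real (cmod (z j))" if "j < a" for j
  using fun_cong[OF arg_cong[OF \<tau>(2), of fst], of j] that by (simp add: split_torus_def)
 have sn: "chr k (b j) \<tau> = 1" if "a \<le> j" "j < k" for j
  using fun_cong[OF arg_cong[OF \<tau>(2), of snd], of "j - a"] that by (simp add: split_torus_def diff_less_mono)
 have "y c = of_real (cmod (y c)) * chr k c \<tau>" if c: "c \<in> csg k G" for c
 proof (cases "y c = 0")
  case False
  have pj: "L.proj c = 0"
   using F[OF c False] L.kernel c by (auto simp: L.proj_def csg_def fun_eq_iff)
  have "y c = L.unext z (apex L.S') c" using L.unloc_loc[OF yo] c loc by (auto simp: L.unloc_def)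
  also have "\<dots> = (\<Prod>j<a. z j powi dot k c (b' j))" by (simp add: L.unext_def pj apex_def csg_closed)
  finally have yc: "y c = (\<Prod>j<a. z j powi dot k c (b' j))" .
  have "chr k c \<tau> = (\<Prod>j<k. chr k (b j) \<tau> powi dot k c (b' j))"
   by (rule chr_expand[OF L.unimod]) (use c torus_nonzero[OF \<tau>(1)] in \<open>auto simp: csg_def\<close>)
  also have "\<dots> = (\<Prod>j<a. chr k (b j) \<tau> powi dot k c (b' j))"
   by (rule prod.mono_neutral_right) (use L.a_le sn in auto)
  also have "\<dots> = y c / of_real (cmod (y c))"
   by (simp add: fs yc prod_norm[symmetric] norm_power_int power_int_divide_distrib prod_dividef)
  finally show ?thesis by simp
 qed simp
 thus ?thesis using that \<tau> by blast
qed

text \<open>\<open>\<nu>\<close> lists the \<open>k\<close> generators of a simplicial cone, and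
  \<open>v\<close> is their dual basis multiplied by a common denominator \<open>d\<close>.\<close>

locale simplicial =
 fixes k :: nat and \<nu> v :: "nat => nat => int" and d :: nat
 assumes d: "0 < d" and v: "\<And>l. l < k ==> v l \<in> lat k"
  and dual: "\<And>l l'. l < k ==> l' < k ==> dot k (v l) (\<nu> l') = (if l = l' then int d else 0)"
  and pointed: "\<And>u. u \<in> lat k ==> (\<And>l. l < k ==> dot k u (\<nu> l) = 0) ==> u = 0"

context simplicial
begin

abbreviation S where "S \<equiv> csg k (\<nu> ` {..<k})"

text \<open>For the standard basis these are ordinary polar coordinates. In general the radii enter
  through the pairings with the generators and \<open>\<tau>\<close> supplies the phases.\<close>

definition polar :: "(nat => real) => cvec => mono"
 where "polar r \<tau> = (\<lambda>c\<in>S. (\<Prod>l<k. complex_of_real (r l) ^ nat (dot k c (\<nu> l))) * chr k c \<tau>)"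

lemma S_iff: "c \<in> S \<longleftrightarrow> c \<in> lat k \<and> (\<forall>l<k. 0 \<le> dot k c (\<nu> l))"
 by (auto simp: csg_def)

lemma v_in_S: "l < k ==> v l \<in> S"
 using v dual by (auto simp: S_iff)

lemma toric_cone: "toric_cone k (\<nu> ` {..<k})"
proof
 let ?u = "%i. \<Sum>l<k. 1 * v l i"
 have "dot k ?u (\<nu> l) = int d" if "l < k" for l
  unfolding dot_comb using that dual by simp
 thus "\<exists>u\<in>lat k. \<forall>g\<in>\<nu> ` {..<k}. 0 < dot k u g" using lat_sum[of "{..<k}" v k "%_. 1"] v d
  by (intro bexI) auto
qed (use pointed in auto)

lemma polar_in:
 assumes "t \<in> Torus k"
 shows "polar r t \<in> hom_pts S"
 by (intro hom_ptsI)
  (auto simp: polar_def dot_add nat_add_distrib S_iff power_add prod.distrib chr_add torus_nonzero[OF assms])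

lemma expand:
 assumes "c \<in> lat k"
 shows "(%i. int d * c i) = (%i. \<Sum>l<k. dot k c (\<nu> l) * v l i)"
proof -
 let ?s = "%i. \<Sum>l<k. dot k c (\<nu> l) * v l i"
 have s: "?s \<in> lat k" using v by (intro lat_sum) auto
 have "dot k ?s (\<nu> l) = int d * dot k c (\<nu> l)" if "l < k" for l
  unfolding dot_comb using that dual by (simp add: if_distrib[of "%x. _ * x"] cong: if_cong)
 hence "(%i. int d * c i) - ?s = 0"
  using s assms by (intro pointed) (auto simp: dot_diff dot_scale)
 thus ?thesis by simp
qed

text \<open>\<open>d\<close> times \<open>c\<close> is a combination of the \<open>v l\<close> with
  non-negative coefficients, so \<open>y c ^ d\<close> is a monomial in the \<open>y (v l)\<close>;
  for moduli the root of order \<open>d\<close> is unambiguous.\<close>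

lemma hom_modulus:
 assumes g: "y \<in> hom_pts S" and c: "c \<in> S"
 shows "cmod (y c) = (\<Prod>l<k. root d (cmod (y (v l))) ^ nat (dot k c (\<nu> l)))"
proof -
 have cl: "c \<in> lat k" "\<And>l. l < k ==> int (nat (dot k c (\<nu> l))) = dot k c (\<nu> l)" using c by (auto simp: S_iff)
 have "y c ^ d = (\<Prod>l<k. y (v l) ^ nat (dot k c (\<nu> l)))" using cl hom_multiple[OF g c, of d] hom_comb[OF g finite_lessThan v_in_S, of k "%l. l" "%l. nat (dot k c (\<nu> l))"] unfolding expand[OF cl(1)] by simp
 hence "cmod (y c) ^ d = (\<Prod>l<k. cmod (y (v l)) ^ nat (dot k c (\<nu> l)))"
  by (metis (no_types, lifting) norm_power prod_norm prod.cong)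
 also have "\<dots> = (\<Prod>l<k. root d (cmod (y (v l))) ^ nat (dot k c (\<nu> l))) ^ d"
  unfolding prod_power_distrib using d
  by (intro prod.cong) (simp_all add: power_mult[symmetric] mult.commute, simp add: power_mult)
 finally show ?thesis using d by (subst (asm) power_eq_iff_eq_base) (auto intro!: prod_nonneg)
qed

lemma polar_surj:
 assumes "\<gamma> \<in> hom_pts S"
 obtains r t where "t \<in> Torus k" "\<And>l. 0 \<le> r l" "\<And>l. k \<le> l ==> r l = 0" "\<gamma> = polar r t"
proof -
 obtain t where t: "t \<in> Torus k" "\<And>c. c \<in> S ==> \<gamma> c = of_real (cmod (\<gamma> c)) * chr k c t"
  using hom_phase[OF _ assms] by blast
 let ?r = "%l. if l < k then root d (cmod (\<gamma> (v l))) else 0"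
 have "\<gamma> = polar ?r t"
 proof (rule hom_pts_eqI[OF assms polar_in[OF t(1)]])
  fix c assume c: "c \<in> S"
  thus "\<gamma> c = polar ?r t c"
   by (subst t) (simp_all add: polar_def hom_modulus[OF assms c])
 qed
 thus ?thesis using t d by (intro that) auto
qed

lemma norm_polar_v:
 assumes "l < k" "t \<in> Torus k" "0 \<le> r l"
 shows "cmod (polar r t (v l)) = r l ^ d"
proof -
 have "(\<Prod>l'<k. complex_of_real (r l') ^ nat (dot k (v l) (\<nu> l'))) = (\<Prod>l'<k. if l' = l then complex_of_real (r l') ^ d else 1)"
  using dual assms by (intro prod.cong) auto
 thus ?thesis
  using assms v_in_S by (simp add: polar_def norm_mult norm_chr norm_power)
qed

text \<open>The radii are recovered from the moduli at the \<open>v l\<close>. Phases are seen only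
  by characters that vanish on the generators of radius zero. Such a character belongs to the
  lattice, not necessarily to the semigroup, and is written as a difference of two semigroup
  elements of the same kind.\<close>

lemma polar_eq_iff:
 assumes t: "t \<in> Torus k" "t' \<in> Torus k" and r: "\<And>l. l < k ==> 0 \<le> r l" "\<And>l. l < k ==> 0 \<le> r' l"
 shows "polar r t = polar r' t' \<longleftrightarrow> (\<forall>l<k. r l = r' l) \<and>
  (\<forall>c\<in>lat k. (\<forall>l<k. r l = 0 --> dot k c (\<nu> l) = 0) --> chr k c t = chr k c t')"
  (is "_ \<longleftrightarrow> ?r \<and> ?c")
proof (intro iffI conjI)
 assume eq: "polar r t = polar r' t'"
 show rr: ?r
 by (metis eq norm_polar_v t r d power_eq_iff_eq_base)
 show ?c
 proof (intro ballI impI)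
  fix c assume c: "c \<in> lat k" "\<forall>l<k. r l = 0 --> dot k c (\<nu> l) = 0"
  have eq1: "chr k u t = chr k u t'" if "u \<in> S" "\<And>l. l < k ==> r l = 0 ==> dot k u (\<nu> l) = 0" for u
  proof -
   have "(\<Prod>l<k. complex_of_real (r l) ^ nat (dot k u (\<nu> l))) \<noteq> 0" using that by simp
   moreover have "(\<Prod>l<k. complex_of_real (r' l) ^ nat (dot k u (\<nu> l))) = (\<Prod>l<k. complex_of_real (r l) ^ nat (dot k u (\<nu> l)))"
    using rr by simp
   ultimately show ?thesis using fun_cong[OF eq, of u] that by (simp add: polar_def del: prod_zero_iff)
  qed
  \<comment> \<open>Adding \<open>N l\<close> copies of each \<open>v l\<close> makes
    \<open>c\<close> non-negative on all generators, and nothing is added where the radius is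
    zero.\<close>
  define N where "N l = (if r l = 0 then 0 else \<bar>dot k c (\<nu> l)\<bar>)" for l
  let ?u = "%i. \<Sum>l<k. N l * v l i"
  have u: "dot k ?u (\<nu> l) = N l * int d" if "l < k" for l
   unfolding dot_comb using dual that by (simp add: if_distrib[of "%x. _ * x"] cong: if_cong)
  have ul: "?u \<in> lat k" using v by (intro lat_sum) auto
  have "0 \<le> dot k c (\<nu> l) + N l * int d" if "l < k" for l
  proof -
   have "\<bar>dot k c (\<nu> l)\<bar> * 1 \<le> \<bar>dot k c (\<nu> l)\<bar> * int d" using d by (intro mult_left_mono) auto
   thus ?thesis using c that by (auto simp: N_def)
  qed
  hence "chr k (c + ?u) t = chr k (c + ?u) t'" "chr k ?u t = chr k ?u t'"
   using c ul u by (intro eq1; auto simp: S_iff dot_add N_def)+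
  thus "chr k c t = chr k c t'"
   using chr_nonzero torus_nonzero[OF t(1)] torus_nonzero[OF t(2)] by (simp add: chr_add)
 qed
next
 assume h: "?r \<and> ?c"
 show "polar r t = polar r' t'"
 proof (rule hom_pts_eqI[OF polar_in[OF t(1)] polar_in[OF t(2)]])
  fix c assume c: "c \<in> S"
  have p: "(\<Prod>l<k. complex_of_real (r' l) ^ nat (dot k c (\<nu> l))) = (\<Prod>l<k. complex_of_real (r l) ^ nat (dot k c (\<nu> l)))"
   using h by simp
  show "polar r t c = polar r' t' c"
  proof (cases "\<forall>l<k. r l = 0 --> dot k c (\<nu> l) = 0")
   case True
   thus ?thesis using h c by (simp add: polar_def S_iff)
  next
   case False
   then obtain l where "l < k" "r l = 0" "dot k c (\<nu> l) \<noteq> 0" by blast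
   hence "(\<Prod>l<k. complex_of_real (r l) ^ nat (dot k c (\<nu> l))) = 0"
    using c by (intro prod_zero bexI) (auto simp: S_iff)
   thus ?thesis using p by (simp add: polar_def)
  qed
 qed
qed

lemma polar_zero:
 assumes "\<And>l. l < k ==> r l = 0"
 shows "polar r t = apex S"
proof -
 have "(\<Prod>l<k. complex_of_real (r l) ^ nat (dot k c (\<nu> l))) = (if c = 0 then 1 else 0)" if c: "c \<in> S" for c
 proof (cases "c = 0")
  case False
  then obtain l where l: "l < k" "dot k c (\<nu> l) \<noteq> 0" using pointed c by (auto simp: S_iff)
  hence "(\<Prod>l<k. complex_of_real (r l) ^ nat (dot k c (\<nu> l))) = 0"
   using c assms by (intro prod_zero bexI) (auto simp: S_iff)
  thus ?thesis by simp
 qed simp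
 thus ?thesis by (auto simp: polar_def apex_def)
qed

lemma polar_coord_mult: "polar r (coord_mult s t) = hom_act k S s (polar r t)"
 by (auto simp: polar_def hom_act_def chr_coord_mult)

end

text \<open>The face is the whole cone here, so \<open>w = 0\<close> is admissible and the
  localization splits off the annihilator of the vectors \<open>q l\<close>. Independence gives for
  each \<open>l\<close> a functional detecting only \<open>q l\<close>; the product \<open>D\<close>
  of these pairings is a common denominator for the dual basis.\<close>

lemma simplicial_quotient:
 assumes inj: "inj_on q {..<k}" and li: "lin_indep m (q ` {..<k})"
 obtains b b' a v d where "localization m (q ` {..<k}) (q ` {..<k}) 0 b b' a" "a + k = m"
  "simplicial k (%l. localization.quot m b a (q l)) v d"
proof -
 let ?G = "q ` {..<k}"
 obtain b b' a where b: "unimod m b b'" "a \<le> m"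
  "\<forall>u\<in>lat m. (\<forall>h\<in>?G. dot m u h = 0) \<longleftrightarrow> (\<forall>j<m. a \<le> j --> dot m u (b' j) = 0)"
  "a + card ?G = m" using adapted_basis[of ?G m] li by blast
 then interpret L: localization m ?G ?G 0 b b' a
  by unfold_locales (auto simp: csg_closed)
 have ak: "a + k = m" "m - a = k" using b card_image[OF inj] by auto
 have "\<exists>u\<in>lat m. 0 < dot m u (q l) \<and> (\<forall>l'<k. l' \<noteq> l --> dot m u (q l') = 0)" if l: "l < k" for l
 proof -
  let ?H = "q ` ({..<k} - {l})"
  have "insert (q l) ?H = ?G" "q l \<notin> ?H" using l inj by (auto simp: inj_on_def)
  then obtain u where u: "u \<in> lat m" "\<forall>h\<in>?H. dot m u h = 0" "dot m u (q l) \<noteq> 0"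
   using lin_indep_not_in_kernel[of m "q l" ?H] li by auto
  thus ?thesis by (intro bexI[of _ "if 0 < dot m u (q l) then u else - u"]) (auto simp: dot_uminus)
 qed
 then obtain u where u: "\<And>l. l < k ==> u l \<in> lat m \<and> 0 < dot m (u l) (q l) \<and> (\<forall>l'<k. l' \<noteq> l --> dot m (u l) (q l') = 0)" by metis
 define D where "D = (\<Prod>l<k. dot m (u l) (q l))"
 have D: "0 < D" unfolding D_def using u by (intro prod_pos) auto
 define v where "v l = (%i. (D div dot m (u l) (q l)) * u l i)" for l
 have vl: "v l \<in> lat m" if "l < k" for l using u[OF that] by (simp add: v_def)
 have vd: "dot m (v l) (q l') = (if l = l' then int (nat D) else 0)" if l: "l < k" and l': "l' < k" for l l'
 proof -
  have "dot m (u l) (q l) dvd D" unfolding D_def using l by auto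
  thus ?thesis using u[OF l] l' D unfolding v_def dot_scale by auto
 qed
 have "simplicial k (%l. L.quot (q l)) (%l. L.proj (v l)) (nat D)"
 proof
  show "0 < nat D" using D by simp
  fix l assume l: "l < k"
  show "L.proj (v l) \<in> lat k" using L.proj_lat ak by simp
  fix l' assume l': "l' < k"
  show "dot k (L.proj (v l)) (L.quot (q l')) = (if l = l' then int (nat D) else 0)"
   using L.dot_proj[OF vl[OF l], of "q l'"] vd[OF l l'] l' ak by simp
 next
  fix c assume c: "c \<in> lat k" "\<And>l. l < k ==> dot k c (L.quot (q l)) = 0"
  hence "\<forall>h\<in>?G. dot m (L.lift c) h = 0" using L.dot_lift ak by auto
  hence "c l = 0" if "l < k" for l using L.kernel L.lift_lat L.dot_lift_basis[of "a + l" c] that ak by simp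
  thus "c = 0" using c by (auto simp: lat_def fun_eq_iff) (metis not_le)
 qed
 thus ?thesis using that L.localization_axioms ak by blast
qed

lemma quotient_maps_homeomorphic:
 assumes q: "quotient_map Z X q" and f: "quotient_map Z Y f"
  and eq: "\<And>z z'. z \<in> topspace Z ==> z' \<in> topspace Z ==> q z = q z' \<longleftrightarrow> f z = f z'"
 obtains p where "homeomorphic_map X Y p" "\<And>z. z \<in> topspace Z ==> p (q z) = f z"
proof -
 obtain p where p: "continuous_map X Y p" "\<And>z. z \<in> topspace Z ==> p (q z) = f z"
  using quotient_map_lift_exists[OF q quotient_imp_continuous_map[OF f]] eq by metis
 obtain h where h: "continuous_map Y X h" "\<And>z. z \<in> topspace Z ==> h (f z) = q z"
  using quotient_map_lift_exists[OF f quotient_imp_continuous_map[OF q]] eq by metis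
 have "homeomorphic_maps X Y p h"
  unfolding homeomorphic_maps_def
  using p h by (auto simp: quotient_imp_surjective_map[OF q, symmetric] quotient_imp_surjective_map[OF f, symmetric])
 thus ?thesis using that p homeomorphic_maps_imp_map by blast
qed

lemma prod_lessThan_add: "(\<Prod>j<a + k. f j) = (\<Prod>j<a. f j) * (\<Prod>l<k. f (a + l))"
 for f :: "nat => 'a::comm_monoid_mult"
 by (induction k) (auto simp: mult.assoc)

definition corner :: "nat => nat => (nat => real) set"
 where "corner i n = {r. (\<forall>j<i. 0 < r j) \<and> (\<forall>j. i \<le> j \<and> j < n --> 0 \<le> r j) \<and> (\<forall>j\<ge>n. r j = 0)}"

text \<open>Over a corner \<open>W\<close>, both the given space and the model are quotients of
  \<open>W\<close> times the torus. Once the fibres are seen to agree and the polar map is seen to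
  be closed, uniqueness of quotients yields the chart without an explicit inverse.\<close>

lemma polar_chart:
 assumes act: "torus_action m X act" and n: "n \<le> m" "n = i + k" and U: "openin X U"
  and q: "quotient_map (prod_topology W (torus_top m)) (subtopology X U) q"
  and \<rho>: "homeomorphic_map W (top_of_set (corner i n)) \<rho>"
  and \<mu>: "inj_on \<mu> {..<k}" "lin_indep m (\<mu> ` {..<k})"
  and fib: "\<And>p p' t s. p \<in> topspace W ==> p' \<in> topspace W ==> t \<in> Torus m ==> s \<in> Torus m ==>
   q (p, t) = q (p', s) \<longleftrightarrow> p = p' \<and>
    (\<forall>u\<in>lat m. (\<forall>l<k. \<rho> p (i + l) = 0 --> dot m u (\<mu> l) = 0) --> chr m u t = chr m u s)"
  and equi: "\<And>p t s. p \<in> topspace W ==> t \<in> Torus m ==> s \<in> Torus m ==>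
   q (p, coord_mult t s) = act t (q (p, s))"
  and p0: "p0 \<in> topspace W" "t0 \<in> Torus m" "\<And>l. l < k ==> \<rho> p0 (i + l) = 0"
 shows "\<exists>G F \<phi>. toric_chart n m X act (q (p0, t0)) i G U F \<phi>"
proof -
 let ?H = "\<mu> ` {..<k}" and ?T = "Torus m"
 obtain b b' a v d where "localization m ?H ?H 0 b b' a" and ak: "a + k = m"
  and "simplicial k (%l. localization.quot m b a (\<mu> l)) v d"
  using simplicial_quotient[OF \<mu>] .
 then interpret L: localization m ?H ?H 0 b b' a + simplicial k "%l. localization.quot m b a (\<mu> l)" v d by auto
 have a: "a = i + (m - n)" "m - a = k" "a \<le> m" using ak n by auto
 let ?S = "csg k ((%l. L.quot (\<mu> l)) ` {..<k})" and ?sp = "split_torus m a b"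
 let ?Y = "prod_topology W (torus_top m)" and ?Z = "model_top i (m - n) ?S"
 have sp: "fst (?sp t) \<in> Torus a" "snd (?sp t) \<in> Torus k" if "t \<in> ?T" for t
  using that a by (auto simp: split_torus_def in_torus_iff norm_chr)
 have \<rho>in: "\<rho> p \<in> corner i n" if "p \<in> topspace W" for p
  using homeomorphic_imp_surjective_map[OF \<rho>] that by auto
 have \<rho>pos: "j < i ==> 0 < \<rho> p j" "0 \<le> \<rho> p j" "n \<le> j ==> \<rho> p j = 0" if "p \<in> topspace W" for p j
  using \<rho>in[OF that] by (auto simp: corner_def) (metis less_eq_real_def not_le)
 \<comment> \<open>Positive radii multiply the first \<open>i\<close> characters, the next
   \<open>m - n\<close> characters stay phases, and the last \<open>k\<close> enter polar
   coordinates, whose radii may vanish.\<close>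
 define f where "f = (%(p, t). (((%j. if j < i then of_real (\<rho> p j) * chr m (b j) t else 1),
  (%j. if j < m - n then chr m (b (i + j)) t else 1)), polar (%l. \<rho> p (i + l)) (snd (?sp t))))"
 have tn: "\<And>i. t i \<noteq> 0" if "t \<in> ?T" for t using torus_nonzero[OF that] .
 have f_in: "f z \<in> topspace ?Z" if z: "z \<in> topspace ?Y" for z
 proof -
  obtain p t where [simp]: "z = (p, t)" by force
  have pt: "p \<in> topspace W" "t \<in> ?T" using z by auto
  have "\<rho> p j \<noteq> 0" if "j < i" for j using \<rho>pos(1)[OF pt(1) that] by simp
  thus ?thesis
   using sp polar_in chr_nonzero tn pt
   by (auto simp: f_def topspace_model_top in_Cstar_power_iff in_torus_iff norm_chr)
 qed
 have chr_lift: "chr m (L.lift c) t = chr k c (snd (?sp t))" if "t \<in> ?T" for c t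
  using L.chr_lift[OF that] a by simp
 have chr_split: "chr m u t = (\<Prod>j<a. chr m (b j) t powi dot m u (b' j)) * chr k (L.proj u) (snd (?sp t))"
  if "t \<in> ?T" "u \<in> lat m" for t u
 proof -
  have "chr k (L.proj u) (snd (?sp t)) = (\<Prod>l<k. chr m (b (a + l)) t powi dot m u (b' (a + l)))"
   unfolding chr_def[of k] using a(2) by (intro prod.cong) (auto simp: L.proj_def split_torus_def)
  thus ?thesis
   using chr_expand[OF L.unimod that(2) tn[OF that(1)]] by (simp only: prod_lessThan_add[of _ a k, unfolded ak])
 qed
 have f_eq: "q (p, t) = q (p', s) \<longleftrightarrow> f (p, t) = f (p', s)"
  if p: "p \<in> topspace W" "p' \<in> topspace W" and t: "t \<in> ?T" "s \<in> ?T" for p p' t s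
 proof -
  let ?ann = "%u. \<forall>l<k. \<rho> p (i + l) = 0 --> dot m u (\<mu> l) = 0"
  have pol: "polar (%l. \<rho> p (i + l)) (snd (?sp t)) = polar (%l. \<rho> p' (i + l)) (snd (?sp s)) \<longleftrightarrow>
   (\<forall>l<k. \<rho> p (i + l) = \<rho> p' (i + l)) \<and>
   (\<forall>c\<in>lat k. (\<forall>l<k. \<rho> p (i + l) = 0 --> dot k c (L.quot (\<mu> l)) = 0) --> chr k c (snd (?sp t)) = chr k c (snd (?sp s)))"
   by (rule polar_eq_iff) (use sp t \<rho>pos p in auto)
  show ?thesis
  proof
   assume "q (p, t) = q (p', s)"
   hence h: "p = p'" "\<And>u. u \<in> lat m ==> ?ann u ==> chr m u t = chr m u s" using fib[OF p t] by auto
   have "chr m (b j) t = chr m (b j) s" if "j < a" for j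
    using L.basis_kernel L.basis_lat that a by (intro h) auto
   moreover have "chr k c (snd (?sp t)) = chr k c (snd (?sp s))"
    if "c \<in> lat k" "\<forall>l<k. \<rho> p (i + l) = 0 --> dot k c (L.quot (\<mu> l)) = 0" for c
    using h(2)[of "L.lift c"] that L.lift_lat L.dot_lift chr_lift t a by auto
   ultimately show "f (p, t) = f (p', s)" using pol h a by (auto simp: f_def)
  next
   assume e: "f (p, t) = f (p', s)"
   have e1: "of_real (\<rho> p j) * chr m (b j) t = of_real (\<rho> p' j) * chr m (b j) s" if "j < i" for j
    using fun_cong[OF arg_cong[OF e, of "%x. fst (fst x)"], of j] that by (simp add: f_def)
   have e2: "chr m (b j) t = chr m (b j) s" if "i \<le> j" "j < a" for j
   proof -
    have "j - i < m - n" "i + (j - i) = j" using that a by auto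
    thus ?thesis using fun_cong[OF arg_cong[OF e, of "%x. snd (fst x)"], of "j - i"] by (simp add: f_def)
   qed
   have e3: "\<rho> p j = \<rho> p' j" if "j < i" for j
    using arg_cong[OF e1[OF that], of cmod] \<rho>pos(1)[OF p(1) that] \<rho>pos(1)[OF p(2) that] t by (simp add: norm_mult norm_chr)
   have e4: "chr m (b j) t = chr m (b j) s" if "j < a" for j
    using e1[of j] e2[OF _ that] e3 \<rho>pos[OF p(1), of j] by force
   note e5 = pol[THEN iffD1, OF arg_cong[OF e, of snd, unfolded f_def, simplified]]
   have "\<rho> p j = \<rho> p' j" for j
    using e3 e5[THEN conjunct1, rule_format, of "j - i"] \<rho>pos[OF p(1), of j] \<rho>pos[OF p(2), of j] n
    by (cases "j < i"; cases "j < n") auto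
   hence pp: "p = p'" using homeomorphic_imp_injective_map[OF \<rho>] p by (auto simp: inj_on_def fun_eq_iff)
   moreover have "chr m u t = chr m u s" if u: "u \<in> lat m" "?ann u" for u
    using chr_split t e4 L.dot_proj u e5[THEN conjunct2, rule_format, OF L.proj_lat[of u, unfolded a(2)]] a(2) by simp
   ultimately show "q (p, t) = q (p', s)" using fib[OF p t] by blast
  qed
 qed
 have cf: "continuous_map ?Y ?Z f"
 proof -
  have c1: "continuous_map ?Y euclidean (%z. chr m u (snd z))" for u
   by (rule continuous_map_compose_on[of _ snd ?T])
    (use tn continuous_on_chr continuous_map_snd[of W "torus_top m"] in \<open>auto simp: continuous_map_in_subtopology\<close>)
  have c2: "continuous_map ?Y euclideanreal (%z. \<rho> (fst z) j)" for j
  proof -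
   have "continuous_map W euclidean \<rho>"
    using homeomorphic_imp_continuous_map[OF \<rho>] continuous_map_in_subtopology by blast
   thus ?thesis
    using continuous_map_compose[OF continuous_map_fst, of W euclideanreal "%p. \<rho> p j"] by (simp add: continuous_map_into_fun_iff o_def)
  qed
  have c3: "continuous_map ?Y euclidean (%z. complex_of_real (\<rho> (fst z) j))" for j
   using continuous_map_compose[OF c2, of euclidean complex_of_real] by (simp add: o_def)
  show ?thesis
   unfolding continuous_map_into_model_iff continuous_map_into_Cstar_iff continuous_map_into_torus_iff continuous_map_into_hom_iff
  proof (intro conjI ballI allI impI)
   fix z assume "z \<in> topspace ?Y"
   thus "fst (fst (f z)) \<in> Cstar_power i" "snd (fst (f z)) \<in> Torus (m - n)" "snd (f z) \<in> hom_pts ?S"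
    using f_in[of z] by (auto simp: topspace_model_top)
  next
   fix c assume c: "c \<in> ?S"
   have "continuous_map ?Y euclidean (%z. (\<Prod>l<k. complex_of_real (\<rho> (fst z) (i + l)) ^ nat (dot k c (L.quot (\<mu> l)))) * chr m (L.lift c) (snd z))"
    by (intro continuous_map_mult continuous_map_prod c1 continuous_map_compose_on[OF c3, of UNIV]) (auto intro!: continuous_intros)
   thus "continuous_map ?Y euclidean (%z. snd (f z) c)"
    by (rule continuous_map_eq) (use c chr_lift in \<open>auto simp: f_def polar_def\<close>)
  qed (use c1 c3 in \<open>auto simp: f_def case_prod_unfold intro!: continuous_map_mult\<close>)
 qed
 have Hd: "Hausdorff_space ?Z"
  unfolding model_top_def by (simp add: Hausdorff_space_prod_topology Hausdorff_top_of_set Hausdorff_hom_top)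
 \<comment> \<open>The inverses are included so that a bound on \<open>N\<close> also keeps the
   first \<open>i\<close> radii away from 0; the other radii are bounded through the values at the
   \<open>v l\<close>.\<close>
 define N where "N = (%(y :: (cvec \<times> cvec) \<times> mono).
  (\<Sum>j<i. cmod (fst (fst y) j) + cmod (inverse (fst (fst y) j))) + (\<Sum>l<k. cmod (snd y (v l))))"
 have cN: "continuous_map ?Z euclideanreal N"
 proof -
  have "continuous_map ?Z euclideanreal (%y. cmod (fst (fst y) j) + cmod (inverse (fst (fst y) j)))" if "j < i" for j
   by (intro continuous_map_add continuous_map_norm continuous_map_inverse_complex
     continuous_map_Cstar_proj[OF continuous_map_model_proj(1)])
    (use that in \<open>auto simp: topspace_model_top in_Cstar_power_iff\<close>)
  moreover have "continuous_map ?Z euclideanreal (%y. cmod (snd y (v l)))" if "l < k" for l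
   by (intro continuous_map_norm continuous_map_hom_evalI[OF continuous_map_model_proj(3)] v_in_S that)
  ultimately show ?thesis unfolding N_def by (intro continuous_map_add[OF continuous_map_sum continuous_map_sum]) auto
 qed
 have bounds: "j < i ==> inverse (R + 1) \<le> \<rho> p j" "\<rho> p j \<le> R + 1"
  if p: "p \<in> topspace W" "t \<in> ?T" and R: "N (f (p, t)) \<le> R" for p t R j
 proof -
  have s: "cmod (snd (f (p, t)) (v l)) = \<rho> p (i + l) ^ d" if "l < k" for l
   using norm_polar_v[OF that sp(2)[OF p(2)], of "%l. \<rho> p (i + l)"] \<rho>pos[OF p(1)] by (simp add: f_def)
  have w: "cmod (fst (fst (f (p, t))) j) = \<rho> p j" "cmod (inverse (fst (fst (f (p, t))) j)) = inverse (\<rho> p j)" if "j < i" for j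
   using \<rho>pos that p by (simp_all add: f_def norm_mult norm_chr norm_inverse)
  have Nf: "N (f (p, t)) = (\<Sum>j<i. \<rho> p j + inverse (\<rho> p j)) + (\<Sum>l<k. \<rho> p (i + l) ^ d)"
   unfolding N_def using s w by simp
  have s1: "\<rho> p j + inverse (\<rho> p j) \<le> (\<Sum>j<i. \<rho> p j + inverse (\<rho> p j))" if "j < i" for j
   by (rule member_le_sum) (use that \<rho>pos[OF p(1)] in auto)
  have s2: "\<rho> p (i + l) ^ d \<le> (\<Sum>l<k. \<rho> p (i + l) ^ d)" if "l < k" for l
   by (rule member_le_sum) (use that \<rho>pos[OF p(1)] in auto)
  have nn: "0 \<le> (\<Sum>j<i. \<rho> p j + inverse (\<rho> p j))" "0 \<le> (\<Sum>l<k. \<rho> p (i + l) ^ d)"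
   using \<rho>pos[OF p(1)] by (auto intro!: sum_nonneg)
  have R0: "0 \<le> R" using nn R Nf by simp
  have b1: "\<rho> p j + inverse (\<rho> p j) \<le> R" if "j < i" for j using s1[OF that] nn R Nf by simp
  show "inverse (R + 1) \<le> \<rho> p j" if "j < i"
  proof -
   have "inverse (\<rho> p j) \<le> R + 1" "0 < inverse (\<rho> p j)" using b1[OF that] \<rho>pos(1)[OF p(1) that] by auto
   hence "inverse (R + 1) \<le> inverse (inverse (\<rho> p j))" by (rule le_imp_inverse_le)
   thus ?thesis by simp
  qed
  show "\<rho> p j \<le> R + 1"
  proof (cases "j < i")
   case True
   hence "0 < inverse (\<rho> p j)" using \<rho>pos(1)[OF p(1) True] by simp
   thus ?thesis using b1[OF True] by linarith
  next
   case False
   show ?thesis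
   proof (cases "j < n \<and> 1 < \<rho> p j")
    case True
    hence "\<rho> p j \<le> \<rho> p j ^ d" using d by (simp add: self_le_power)
    moreover have "j - i < k" using True False n by auto
    ultimately show ?thesis using s2[of "j - i"] nn R Nf False by simp
   qed (use R0 \<rho>pos(3)[OF p(1), of j] in auto)
  qed
 qed
 have K: "compactin ?Y {y \<in> topspace ?Y. N (f y) \<le> R}" for R
 proof -
  let ?B = "PiE UNIV (%j. if j < i then {inverse (max 0 R + 1)..max 0 R + 1} else if j < n then {0..max 0 R + 1} else {0::real})"
  have "compactin (product_topology (%_. euclideanreal) (UNIV :: nat set)) ?B" by (subst compactin_PiE) auto
  hence "compact ?B" by (simp add: euclidean_product_topology)
  moreover have Bsub: "?B \<subseteq> corner i n"
  proof
   fix r assume "r \<in> ?B"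
   hence r: "r j \<in> (if j < i then {inverse (max 0 R + 1)..max 0 R + 1} else if j < n then {0..max 0 R + 1} else {0::real})" for j by blast
   have R: "0 < inverse (max 0 R + 1)" by simp
   have "0 < r j" if "j < i" for j using order.strict_trans2[OF R] r[of j] that by simp
   moreover have "0 \<le> r j" if "i \<le> j \<and> j < n" for j using r[of j] that by simp
   moreover have "r j = 0" if "n \<le> j" for j using r[of j] that n by simp
   ultimately show "r \<in> corner i n" by (simp add: corner_def)
  qed
  ultimately have "compactin (top_of_set (corner i n)) ?B" by (simp add: compactin_subtopology)
  moreover obtain g where g: "homeomorphic_maps W (top_of_set (corner i n)) \<rho> g" using \<rho> homeomorphic_map_maps by blast
  ultimately have gB: "compactin W (g ` ?B)" by (auto simp: homeomorphic_maps_def intro: image_compactin)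
  have "compactin ?Y (g ` ?B \<times> ?T)" using gB compact_torus by (simp add: compactin_Times)
  moreover have "{y \<in> topspace ?Y. N (f y) \<le> R} \<subseteq> g ` ?B \<times> ?T"
  proof clarify
   fix p t assume pt: "(p, t) \<in> topspace ?Y" "N (f (p, t)) \<le> R"
   have "\<rho> p \<in> ?B" using pt pt bounds \<rho>pos by auto
   hence "p \<in> g ` ?B" using g pt by (intro image_eqI) (auto simp: homeomorphic_maps_def)
   thus "p \<in> g ` ?B \<and> t \<in> ?T" using pt by simp
  qed
  moreover have "closedin ?Y {y \<in> topspace ?Y. N (f y) \<le> R}"
   using closedin_continuous_map_preimage[OF continuous_map_compose[OF cf cN], of "{..R}"] by simp
  ultimately show ?thesis using closed_compactin by blast
 qed
 have surj: "f ` topspace ?Y = topspace ?Z"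
 proof (intro equalityI subsetI)
  fix y assume "y \<in> topspace ?Z"
  then obtain w u \<delta> where [simp]: "y = ((w, u), \<delta>)" and w: "w \<in> Cstar_power i" and u: "u \<in> Torus (m - n)"
   and \<delta>: "\<delta> \<in> hom_pts ?S" by (auto simp: topspace_model_top)
  obtain r \<tau> where r: "\<tau> \<in> Torus k" "\<And>l. 0 \<le> r l" "\<And>l. k \<le> l ==> r l = 0" "\<delta> = polar r \<tau>"
   using polar_surj[OF \<delta>] by metis
  let ?r = "%j. if j < i then cmod (w j) else r (j - i)"
  have "?r \<in> \<rho> ` topspace W" using w r n homeomorphic_imp_surjective_map[OF \<rho>] by (auto simp: corner_def in_Cstar_power_iff)
  then obtain p where p: "?r = \<rho> p" "p \<in> topspace W" by rule
  have p2: "\<rho> p j = (if j < i then cmod (w j) else r (j - i))" for j using fun_cong[OF p(1), of j] by simp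
  let ?s = "%j. if j < i then w j / of_real (cmod (w j)) else u (j - i)"
  have "(?s, \<tau>) \<in> ?sp ` ?T" using w u r a top_group_isoD(3)[OF split_torus_iso[OF L.unimod a(3)]] by (auto simp: in_Cstar_power_iff norm_divide in_torus_iff bij_betw_def)
  then obtain t where t: "t \<in> ?T" "(?s, \<tau>) = ?sp t" by auto
  have "chr m (b j) t = ?s j" if "j < a" for j
   using fun_cong[OF arg_cong[OF t(2), of fst], of j] that by (simp add: split_torus_def)
  hence "f (p, t) = y"
   using p2 r w u a t(2)[symmetric] by (auto simp: f_def in_Cstar_power_iff in_torus_iff fun_eq_iff)
  thus "y \<in> f ` topspace ?Y" using p t by force
 qed (use f_in in auto)
 have "quotient_map ?Y ?Z f"
  using cf surj exhaustion_closed_map[OF cf Hd cN K] by (intro continuous_closed_imp_quotient_map)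
 then obtain \<phi> where \<phi>: "homeomorphic_map (subtopology X U) ?Z \<phi>" "\<And>z. z \<in> topspace ?Y ==> \<phi> (q z) = f z"
  by (rule quotient_maps_homeomorphic[OF q]) (use f_eq in auto)
 have Uq: "U = q ` (topspace W \<times> ?T)"
  using quotient_imp_surjective_map[OF q] openin_subset[OF U] by auto
 have G: "(%l. L.quot (\<mu> l)) ` {..<k} = L.quot ` ?H" by auto
 have ni: "n - i = k" and lt: "\<And>j. j < i ==> j < a" "\<And>j. j < m - n ==> i + j < a" using n a by auto
 have "toric_chart n m X act (q (p0, t0)) i ((%l. L.quot (\<mu> l)) ` {..<k}) U ?sp \<phi>"
  unfolding toric_chart_def
 proof (intro conjI ballI)
  show "toric_cone (n - i) ((%l. L.quot (\<mu> l)) ` {..<k})" using toric_cone n by simp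
  show "T_invariant m act U"
   unfolding T_invariant_def Uq by (auto simp: equi[symmetric] torus_coord_mult)
  show "?sp \<in> top_group_iso (torus m) (torus (i + (m - n)) \<times>\<times> torus (n - i))"
   using split_torus_iso[OF L.unimod a(3)] a n by simp
  show "snd (\<phi> (q (p0, t0))) = apex (csg (n - i) ((%l. L.quot (\<mu> l)) ` {..<k}))"
   using \<phi> p0 n polar_zero by (simp add: f_def)
  show "q (p0, t0) \<in> U" using p0 Uq by auto
  fix t y assume t: "t \<in> ?T" "y \<in> U"
  then obtain p s where y: "y = q (p, s)" "p \<in> topspace W" "s \<in> ?T" using Uq by auto
  have sps: "snd (?sp (coord_mult t s)) = coord_mult (snd (?sp t)) (snd (?sp s))"
   by (auto simp: split_torus_def coord_mult_def chr_coord_mult[unfolded coord_mult_def])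
  have "\<phi> (act t y) = f (p, coord_mult t s)" using equi y t \<phi>(2)[of "(p, coord_mult t s)"] torus_coord_mult by simp
  also have "\<dots> = model_act i (m - n) (n - i) (csg (n - i) ((%l. L.quot (\<mu> l)) ` {..<k})) (?sp t) (f (p, s))"
   using lt ni sps by (auto simp: f_def model_act_def chr_coord_mult polar_coord_mult split_torus_def)
  finally show "\<phi> (act t y) = model_act i (m - n) (n - i) (csg (n - i) ((%l. L.quot (\<mu> l)) ` {..<k})) (?sp t) (\<phi> y)"
   using \<phi> y by simp
 qed (use n U \<phi> in auto)
 thus ?thesis by blast
qed

section \<open>Simple polytopes\<close>

text \<open>A minimal system of half spaces, with normals parallel to the affine hull, is reindexed
  by the facets. Minimality is what makes the passage from half spaces to facets injective.\<close>

lemma facet_inequalities: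
 fixes P :: "'p::euclidean_space set"
 assumes P: "polyhedron P" "P \<noteq> {}"
 obtains a b where "P = {x \<in> affine hull P. \<forall>F. F facet_of P --> a F \<bullet> x \<le> b F}"
  "\<And>F. F facet_of P ==> F = {x \<in> P. a F \<bullet> x = b F}"
  "\<And>F x. F facet_of P ==> x \<in> affine hull P ==> x + a F \<in> affine hull P"
proof -
 obtain \<H> where fin: "finite \<H>" and PH: "P = affine hull P \<inter> \<Inter>\<H>"
  and h: "\<forall>h\<in>\<H>. \<exists>a b. a \<noteq> 0 \<and> h = {x. a \<bullet> x \<le> b} \<and> (\<forall>x\<in>affine hull P. x + a \<in> affine hull P)"
  and min: "\<And>F'. F' \<subset> \<H> ==> P \<subset> affine hull P \<inter> \<Inter>F'"
  using P unfolding polyhedron_Int_affine_parallel_minimal by blast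
 obtain a where "\<forall>h\<in>\<H>. \<exists>b. a h \<noteq> 0 \<and> h = {x. a h \<bullet> x \<le> b} \<and> (\<forall>x\<in>affine hull P. x + a h \<in> affine hull P)"
  using bchoice[OF h] by blast
 from bchoice[OF this] obtain b where
  *: "\<forall>h\<in>\<H>. a h \<noteq> 0 \<and> h = {x. a h \<bullet> x \<le> b h} \<and> (\<forall>x\<in>affine hull P. x + a h \<in> affine hull P)" ..
 hence ab: "\<And>h. h \<in> \<H> ==> a h \<noteq> 0 \<and> h = {x. a h \<bullet> x \<le> b h}"
  and par: "\<And>h x. h \<in> \<H> ==> x \<in> affine hull P ==> x + a h \<in> affine hull P" by auto
 define Q where "Q h = P \<inter> {x. a h \<bullet> x = b h}" for h
 have facets: "F facet_of P \<longleftrightarrow> F \<in> Q ` \<H>" for F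
  using facet_of_polyhedron_explicit[OF fin PH ab min, of F] by (auto simp: Q_def)
 have "convex P" "rel_interior P \<noteq> {}" using P by (auto simp: polyhedron_imp_convex rel_interior_eq_empty)
 then obtain z where z: "z \<in> P" "\<And>h. h \<in> \<H> ==> a h \<bullet> z < b h"
  using rel_interior_polyhedron_explicit[OF fin PH ab min] by auto
 have le: "a h \<bullet> x \<le> b h" if "h \<in> \<H>" "x \<in> h" for h x using ab that by blast
 have "Q h \<noteq> Q g" if hg: "h \<in> \<H>" "g \<in> \<H>" "h \<noteq> g" for h g
 proof -
  obtain y where y: "y \<in> affine hull P" "y \<in> \<Inter>(\<H> - {h})" "y \<notin> P" using min[of "\<H> - {h}"] hg by blast
  hence "y \<notin> h" using PH by blast
  hence hy: "b h < a h \<bullet> y" using ab[OF hg(1)] by force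
  define s where "s = (b h - a h \<bullet> z) / (a h \<bullet> y - a h \<bullet> z)"
  have s: "0 < s" "s < 1" "s * (a h \<bullet> y - a h \<bullet> z) = b h - a h \<bullet> z" using z(2)[OF hg(1)] hy by (auto simp: s_def)
  \<comment> \<open>The segment from the relative interior point \<open>z\<close> to a point
    \<open>y\<close> that violates only \<open>h\<close> crosses the boundary of \<open>h\<close>
    here, strictly inside every other half space.\<close>
  let ?w = "(1 - s) *\<^sub>R z + s *\<^sub>R y"
  have wh: "a h \<bullet> ?w = b h" using s by (simp add: algebra_simps)
  have strict: "a h' \<bullet> ?w < b h'" if "h' \<in> \<H>" "h' \<noteq> h" for h'
  proof -
   have "(1 - s) * (a h' \<bullet> z) < (1 - s) * b h'" "s * (a h' \<bullet> y) \<le> s * b h'"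
    using z le y that s by auto
   thus ?thesis by (simp add: algebra_simps)
  qed
  have "?w \<in> affine hull P"
   using hull_inc[OF z(1), of affine] y affine_affine_hull[of P] by (auto simp: affine_alt)
  moreover have "?w \<in> h'" if "h' \<in> \<H>" for h'
   using ab[OF that] wh strict[OF that] by force
  ultimately have "?w \<in> Q h" "?w \<notin> Q g" using PH wh strict[OF hg(2)] hg by (auto simp: Q_def)
  thus ?thesis by blast
 qed
 hence inj: "inj_on Q \<H>" by (auto simp: inj_on_def)
 define \<eta> where "\<eta> = inv_into \<H> Q"
 have \<eta>: "\<eta> F \<in> \<H>" "Q (\<eta> F) = F" if "F facet_of P" for F
  using that facets inv_into_into[of F Q \<H>] f_inv_into_f[of F Q \<H>] by (auto simp: \<eta>_def)
 have H\<eta>: "\<exists>F. F facet_of P \<and> h = \<eta> F" if "h \<in> \<H>" for h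
  using that facets inv_into_f_f[OF inj that] by (intro exI) (auto simp: \<eta>_def)
 show ?thesis
 proof (rule that[of "a \<circ> \<eta>" "b \<circ> \<eta>"])
  have "x \<in> P" if "x \<in> affine hull P" "\<And>h. h \<in> \<H> ==> a h \<bullet> x \<le> b h" for x
   using that ab PH by blast
  moreover have "a h \<bullet> x \<le> b h" if "x \<in> P" "h \<in> \<H>" for x h using le that PH by blast
  ultimately show "P = {x \<in> affine hull P. \<forall>F. F facet_of P --> (a \<circ> \<eta>) F \<bullet> x \<le> (b \<circ> \<eta>) F}"
   using hull_subset[of P affine] \<eta> H\<eta> by auto metis
 qed (use \<eta> par in \<open>auto simp: Q_def\<close>)
qed

text \<open>The intersection of \<open>P\<close> with all facets through \<open>p\<close> is a face,
  and an extreme point of a face is a vertex of \<open>P\<close>.\<close>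

lemma polytope_vertex_of_point:
 fixes P :: "'p::euclidean_space set"
 assumes P: "polytope P" "p \<in> P"
 obtains v where "{v} face_of P" "\<And>F. F facet_of P ==> p \<in> F ==> v \<in> F"
proof -
 let ?E = "\<Inter>(insert P {F. F facet_of P \<and> p \<in> F})"
 have E: "?E face_of P"
  using polytope_imp_convex[OF P(1)] by (intro face_of_Inter) (auto simp: face_of_refl facet_of_imp_face_of)
 have "polytope ?E" using face_of_polytope_polytope[OF P(1) E] .
 moreover have "p \<in> ?E" using P by auto
 ultimately obtain v where "v extreme_point_of ?E"
  using extreme_point_exists_convex[of ?E] by (auto simp: polytope_imp_compact polytope_imp_convex)
 hence v: "{v} face_of P" "v \<in> ?E"
  using face_of_trans[OF _ E] face_of_singleton by (auto simp: extreme_point_of_def)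
 show ?thesis using v by (intro that[of v]) auto
qed

text \<open>The vector dual to \<open>a j\<close> is its component orthogonal to the other
  \<open>a i\<close>, divided by the squared length of that component.\<close>

lemma dual_vectors:
 fixes a :: "'i => 'p::euclidean_space"
 assumes "finite I" "inj_on a I" "independent (a ` I)"
 obtains w where "\<And>i. i \<in> I ==> w i \<in> span (a ` I)"
  "\<And>i j. i \<in> I ==> j \<in> I ==> a i \<bullet> w j = (if i = j then 1 else 0)"
proof -
 have "\<exists>w\<in>span (a ` I). \<forall>i\<in>I. a i \<bullet> w = (if i = j then 1 else 0)" if j: "j \<in> I" for j
 proof -
  let ?B = "a ` (I - {j})"
  obtain y z where y: "y \<in> span ?B" and z: "\<And>w. w \<in> span ?B ==> z \<bullet> w = 0" and e: "a j = y + z"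
   using orthogonal_subspace_decomp_exists unfolding Linear_Algebra.orthogonal_def by metis
  have "a ` I - {a j} = ?B" using assms j by (auto simp: inj_on_def)
  hence z0: "z \<noteq> 0" using assms j e y unfolding dependent_def by auto
  have "y \<in> span (a ` I)" using y span_mono[of ?B "a ` I"] by auto
  moreover have "a j \<in> span (a ` I)" using j by (intro span_base) auto
  ultimately have zs: "z \<in> span (a ` I)" using e span_diff[of "a j" "a ` I" y] by simp
  have "a i \<bullet> z = (if i = j then z \<bullet> z else 0)" if "i \<in> I" for i
   using z[of "a i"] z[OF y] that span_base[of "a i" ?B] e
   by (auto simp: inner_commute inner_right_distrib)
  thus ?thesis using zs z0 by (intro bexI[of _ "z /\<^sub>R (z \<bullet> z)"]) (auto simp: span_mul)
 qed
 then obtain w where "\<And>j. j \<in> I ==> w j \<in> span (a ` I) \<and> (\<forall>i\<in>I. a i \<bullet> w j = (if i = j then 1 else 0))" by metis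
 thus ?thesis by (intro that) auto
qed

text \<open>Multiplying \<open>r\<close> by the first factor is a homeomorphism from the numbers \<open>r \<ge> 0\<close> with \<open>\<bar>r - c\<bar> < e\<close> to a
 half line, closed for \<open>c = 0\<close> and open otherwise; the second factor gives the inverse.\<close>

definition stretch_factor :: "real => real => real => real"
 where "stretch_factor e c r = (if c = 0 then 1 / (e - r) else (r - c + e) / (r * (e + c - r)))"

definition shrink_factor :: "real => real => real => real"
 where "shrink_factor e c s = (if c = 0 then e / (1 + s) else (c + e * ((s - 1) / (s + 1))) / s)"

lemma stretch_factor:
 assumes e: "0 < e" and c: "c = 0 \<or> e \<le> c"
 shows "0 \<le> r ==> \<bar>r - c\<bar> < e ==> 0 < stretch_factor e c r \<and>
   shrink_factor e c (stretch_factor e c r * r) * stretch_factor e c r = 1" (is "_ ==> _ ==> ?r")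
  and "continuous_on {r. 0 \<le> r \<and> \<bar>r - c\<bar> < e} (stretch_factor e c)" (is ?cr)
  and "0 \<le> s ==> c = 0 \<or> s \<noteq> 0 ==> 0 < shrink_factor e c s \<and> \<bar>shrink_factor e c s * s - c\<bar> < e \<and>
   stretch_factor e c (shrink_factor e c s * s) * shrink_factor e c s = 1" (is "_ ==> _ ==> ?s")
  and "continuous_on {s. 0 \<le> s \<and> (c = 0 \<or> s \<noteq> 0)} (shrink_factor e c)" (is ?cs)
proof -
 show ?r if r: "0 \<le> r" "\<bar>r - c\<bar> < e"
 proof (cases "c = 0")
  case False
  hence r: "0 < r" "0 < r - c + e" "0 < e + c - r" using r c by auto
  let ?s = "(r - c + e) / (e + c - r)"
  show ?thesis using r by (auto simp: divide_simps shrink_factor_def stretch_factor_def)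
 qed (use r e in \<open>simp add: stretch_factor_def shrink_factor_def field_simps\<close>)
 show ?s if s: "0 \<le> s" "c = 0 \<or> s \<noteq> 0"
 proof (cases "c = 0")
  case False
  define r where "r = c + e * ((s - 1) / (s + 1))"
  have r: "\<bar>r - c\<bar> < e" using s False e by (auto simp: field_simps abs_less_iff r_def)
  moreover have "0 < r" using r c False by linarith
  moreover have "r - c + e = s * (e + c - r)" using s by (simp add: r_def divide_simps) (simp add: algebra_simps)
  ultimately show ?thesis using False s unfolding stretch_factor_def shrink_factor_def r_def[symmetric] by simp
 qed (use s e in \<open>auto simp: stretch_factor_def shrink_factor_def field_simps add_nonneg_eq_0_iff\<close>)
 show ?cr unfolding stretch_factor_def using c by (cases "c = 0") (auto intro!: continuous_intros)
 show ?cs unfolding shrink_factor_def by (cases "c = 0") (auto intro!: continuous_intros)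
qed

definition slab :: "nat => real => (nat => real) => (nat => real) set"
 where "slab n e c = {r. (\<forall>j<n. 0 \<le> r j \<and> \<bar>r j - c j\<bar> < e) \<and> (\<forall>j\<ge>n. r j = 0)}"

text \<open>The stretching acts coordinatewise: coordinates with \<open>c j = 0\<close> fill a
  half-open interval and become a closed half line, the others an open interval of positive numbers
  and become an open half line. Vanishing is preserved because facets are recognised by it.\<close>

lemma slab_corner:
 assumes e: "0 < e" and i: "i \<le> n" and c: "\<And>j. j < i ==> e \<le> c j" "\<And>j. i \<le> j ==> c j = 0"
 obtains h where "homeomorphic_map (top_of_set (slab n e c)) (top_of_set (corner i n)) h"
  "\<And>r j. r \<in> slab n e c ==> i \<le> j ==> h r j = 0 \<longleftrightarrow> r j = 0"
proof -
 let ?p = "%j. stretch_factor e (c j)" and ?q = "%j. shrink_factor e (c j)"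
 let ?h = "%r j. ?p j (r j) * r j" and ?g = "%s j. ?q j (s j) * s j"
 have c': "c j = 0 \<or> e \<le> c j" "c j = 0 \<longleftrightarrow> i \<le> j" for j using c e by (cases "j < i"; force)+
 note f = stretch_factor[OF e c'(1)]
 have A: "0 \<le> r j" "\<bar>r j - c j\<bar> < e" if "r \<in> slab n e c" for r j
  using that c i e by (cases "j < n"; auto simp: slab_def)+
 have B: "c j = 0 \<or> s j \<noteq> 0" "0 \<le> s j" if s: "s \<in> corner i n" for s j
 proof -
  have "0 < s j" if "j < i" using s that by (simp add: corner_def)
  moreover have "0 \<le> s j" if "i \<le> j" using s that by (cases "j < n") (auto simp: corner_def)
  ultimately show "c j = 0 \<or> s j \<noteq> 0" "0 \<le> s j" using c' by (cases ; force)+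
 qed
 have co: "continuous_on S (%r. r j)" for j and S :: "(nat => real) set"
  by (rule continuous_on_subset[of UNIV]) auto
 have F: "0 < ?p j (r j)" "?q j (?h r j) * ?p j (r j) = 1" if "r \<in> slab n e c" for r j
  using f(1)[OF A[OF that]] by auto
 have F': "0 < ?q j (s j)" "\<bar>?g s j - c j\<bar> < e" "?p j (?g s j) * ?q j (s j) = 1" if "s \<in> corner i n" for s j
  using f(3)[OF B(2,1)[OF that]] by auto
 have "homeomorphic_maps (top_of_set (slab n e c)) (top_of_set (corner i n)) ?h ?g"
  unfolding homeomorphic_maps_def continuous_map_in_subtopology
 proof (intro conjI ballI)
  have "continuous_on (slab n e c) (%r. ?h r j)" for j
   by (intro continuous_on_mult co continuous_on_compose2[OF f(2) co]) (use A in auto)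
  thus "continuous_map (top_of_set (slab n e c)) euclidean ?h"
   by (simp add: continuous_on_coordinatewise_then_product)
  have "continuous_on (corner i n) (%s. ?g s j)" for j
   by (intro continuous_on_mult co continuous_on_compose2[OF f(4) co]) (use B in auto)
  thus "continuous_map (top_of_set (corner i n)) euclidean ?g"
   by (simp add: continuous_on_coordinatewise_then_product)
  show "?h \<in> topspace (top_of_set (slab n e c)) \<rightarrow> corner i n"
  proof
   fix r assume r: "r \<in> topspace (top_of_set (slab n e c))"
   have "r j \<noteq> 0" if "j < i" for j using A[of r j] r c(1)[OF that] by auto
   hence "0 < r j" if "j < i" for j using A r that by (simp add: less_le)
   thus "?h r \<in> corner i n"
    using r F by (auto simp: corner_def slab_def less_imp_le)
  qed
  show "?g \<in> topspace (top_of_set (corner i n)) \<rightarrow> slab n e c"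
  proof
   fix s assume s: "s \<in> topspace (top_of_set (corner i n))"
   hence "0 \<le> ?g s j" for j using F'[of s j] B by simp
   thus "?g s \<in> slab n e c" using s F' by (auto simp: slab_def corner_def)
  qed
 qed (use F F' in \<open>auto simp: mult.assoc[symmetric]\<close>)
 thus ?thesis using that F homeomorphic_maps_imp_map by (metis (no_types, lifting) less_irrefl mult_eq_0_iff)
qed

text \<open>Coordinates near \<open>p\<close> are the slacks of the \<open>n\<close> facets through
  a vertex \<open>v\<close> that lies on every facet containing \<open>p\<close>. Simplicity makes
  their normals a basis of the directions of the affine hull, so the slacks determine the point.
  Facets missing \<open>p\<close> get the indices below \<open>i\<close>, those through
  \<open>p\<close> the remaining \<open>k\<close>.\<close>

lemma simple_polytope_chart:
 fixes P :: "'p::euclidean_space set"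
 assumes P: "simple_polytope n P" and p: "p \<in> P"
 obtains i k g W q where "n = i + k" "openin (top_of_set P) W" "p \<in> W"
  "homeomorphic_map (top_of_set W) (top_of_set (corner i n)) q"
  "inj_on g {..<k}" "g ` {..<k} = {F. F facet_of P \<and> p \<in> F}"
  "\<And>x l. x \<in> W ==> l < k ==> q x (i + l) = 0 \<longleftrightarrow> x \<in> g l"
  "\<And>x F. x \<in> W ==> F facet_of P ==> x \<in> F ==> p \<in> F"
proof -
 have poly: "polytope P" "polyhedron P" and dimP: "aff_dim P = int n" and conv: "convex P"
  using P polytope_imp_polyhedron polytope_imp_convex by (auto simp: simple_polytope_def)
 let ?F = "{F. F facet_of P}" and ?A = "affine hull P"
 have finF: "finite ?F" by (rule finite_polytope_facets[OF poly(1)])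
 obtain a b where Pab: "P = {x \<in> ?A. \<forall>F. F facet_of P --> a F \<bullet> x \<le> b F}"
  and Fab: "\<And>F. F facet_of P ==> F = {x \<in> P. a F \<bullet> x = b F}"
  and par: "\<And>F x. F facet_of P ==> x \<in> ?A ==> x + a F \<in> ?A"
  using facet_inequalities[OF poly(2)] p by blast
 have inF: "x \<in> F \<longleftrightarrow> a F \<bullet> x = b F" if "F facet_of P" "x \<in> P" for F x using Fab that by auto
 have PA: "x \<in> ?A" "F facet_of P ==> a F \<bullet> x \<le> b F" if "x \<in> P" for x F using that Pab by blast+
 obtain v where v: "{v} face_of P" "\<And>F. F facet_of P ==> p \<in> F ==> v \<in> F" using polytope_vertex_of_point[OF poly(1) p] by blast
 have vP: "v \<in> P" using face_of_imp_subset[OF v(1)] by simp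
 let ?Fv = "{F. F facet_of P \<and> v \<in> F}" and ?Fp = "{F. F facet_of P \<and> p \<in> F}"
 have card: "card ?Fv = n" and fin: "finite ?Fv" "finite ?Fp"
  using P v finF by (auto simp: simple_polytope_def)
 have shift: "v + u \<in> ?A" if "u \<in> span (a ` ?Fv)" for u
 proof -
  define V where "V = (%x. x - v) ` ?A"
  have "subspace V" using affine_diffs_subspace_subtract[of ?A v] PA[OF vP] by (auto simp: V_def)
  moreover have "a ` ?Fv \<subseteq> V" using par[OF _ PA(1)[OF vP]] by (force simp: V_def)
  ultimately have "u \<in> V" using that span_minimal by blast
  thus ?thesis by (auto simp: V_def)
 qed
 \<comment> \<open>A non-zero direction on which all facet normals at \<open>v\<close> vanish would
   allow \<open>v\<close> to be moved both ways inside \<open>P\<close>, contradicting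
   extremality.\<close>
 have zero: "u = 0" if u: "v + u \<in> ?A" "\<And>F. F \<in> ?Fv ==> a F \<bullet> u = 0" for u
 proof -
  have "\<exists>e>0. \<forall>F\<in>?F - ?Fv. e * \<bar>a F \<bullet> u\<bar> \<le> b F - a F \<bullet> v"
  proof -
   define e where "e = Min (insert 1 ((%F. (b F - a F \<bullet> v) / (1 + \<bar>a F \<bullet> u\<bar>)) ` (?F - ?Fv)))"
   have pos: "0 < (b F - a F \<bullet> v) / (1 + \<bar>a F \<bullet> u\<bar>)" if "F \<in> ?F - ?Fv" for F
    using that PA[OF vP] inF[OF _ vP] by force
   have "0 < e" unfolding e_def using finF pos by simp
   moreover have "e * \<bar>a F \<bullet> u\<bar> \<le> b F - a F \<bullet> v" if "F \<in> ?F - ?Fv" for F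
   proof -
    have "e \<le> (b F - a F \<bullet> v) / (1 + \<bar>a F \<bullet> u\<bar>)" unfolding e_def using finF that by simp
    thus ?thesis using \<open>0 < e\<close> by (auto simp: pos_le_divide_eq distrib_left)
   qed
   ultimately show ?thesis by blast
  qed
  then obtain e where e: "0 < e" "\<And>F. F \<in> ?F - ?Fv ==> e * \<bar>a F \<bullet> u\<bar> \<le> b F - a F \<bullet> v" by blast
  have "v + s *\<^sub>R u \<in> P" if s: "\<bar>s\<bar> = e" for s
  proof -
   have "(1 - s) *\<^sub>R v + s *\<^sub>R (v + u) \<in> ?A" using affine_affine_hull[of P] PA[OF vP] u by (simp add: affine_alt)
   hence "v + s *\<^sub>R u \<in> ?A" by (simp add: algebra_simps)
   moreover have "a F \<bullet> (v + s *\<^sub>R u) \<le> b F" if F: "F facet_of P" for F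
   proof (cases "v \<in> F")
    case True
    thus ?thesis using u F PA(2)[OF vP F] by (simp add: inner_right_distrib)
   next
    case False
    have "s * (a F \<bullet> u) \<le> \<bar>s\<bar> * \<bar>a F \<bullet> u\<bar>" by (metis abs_ge_self abs_mult)
    thus ?thesis using e(2)[of F] F False s by (simp add: inner_right_distrib)
   qed
   ultimately show ?thesis using Pab by blast
  qed
  from this[of e] this[of "- e"] have eP: "v + e *\<^sub>R u \<in> P" "v - e *\<^sub>R u \<in> P" using e by auto
  have mid: "midpoint (v + e *\<^sub>R u) (v - e *\<^sub>R u) = v" by (simp add: midpoint_def)
  have "v + e *\<^sub>R u = v - e *\<^sub>R u"
  by (metis mid midpoint_in_open_segment v eP face_of_singleton extreme_point_of_def)
  hence "2 *\<^sub>R (e *\<^sub>R u) = 0" by (simp only: scaleR_2) (simp add: algebra_simps)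
  thus ?thesis using e by simp
 qed
 have sub: "u \<in> span (a ` ?Fv)" if u: "v + u \<in> ?A" for u
 proof -
  obtain y z where y: "y \<in> span (a ` ?Fv)" and z: "\<And>w. w \<in> span (a ` ?Fv) ==> z \<bullet> w = 0" and e: "u = y + z"
   by (rule orthogonal_subspace_decomp_exists) (rule , auto simp: Linear_Algebra.orthogonal_def)
  have vz: "v + z \<in> ?A" using mem_affine_3[OF affine_affine_hull u shift[OF y] PA(1)[OF vP], of 1 "-1" 1] e by (simp add: algebra_simps)
  have "z = 0" using z[OF span_base] by (intro zero[OF vz]) (auto simp: inner_commute[of z])
  thus ?thesis using e y by simp
 qed
 have "int n = dim ((%x. x - v) ` ?A)"
  using aff_dim_dim_affine_diffs[OF affine_affine_hull PA(1)[OF vP]] dimP by simp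
 also have "(%x. x - v) ` ?A = span (a ` ?Fv)"
  using sub shift by force
 finally have dimn: "n = dim (a ` ?Fv)" by simp
 \<comment> \<open>There are as many facets as the dimension spanned by their normals, so the
   normals are distinct and independent.\<close>
 hence cardn: "card (a ` ?Fv) = n" using dim_le_card'[of "a ` ?Fv"] card_image_le[OF fin(1), of a] fin card by simp
 have inj: "inj_on a ?Fv" using eq_card_imp_inj_on[OF fin(1)] cardn card by simp
 have ind: "independent (a ` ?Fv)"
  using card_le_dim_spanning[of "a ` ?Fv" "span (a ` ?Fv)"] fin cardn dimn span_superset[of "a ` ?Fv"] by simp
 obtain w where w: "\<And>F. F \<in> ?Fv ==> w F \<in> span (a ` ?Fv)"
  "\<And>F G. F \<in> ?Fv ==> G \<in> ?Fv ==> a F \<bullet> w G = (if F = G then 1 else 0)"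
  using dual_vectors[OF fin(1) inj ind] by blast
 define k where "k = card ?Fp"
 have FpFv: "?Fp \<subseteq> ?Fv" using v by auto
 have kn: "k \<le> n" using card_mono[OF fin(1) FpFv] card by (simp add: k_def)
 define i where "i = n - k"
 have n: "n = i + k" using kn by (simp add: i_def)
 have "card (?Fv - ?Fp) = i" using card card_Diff_subset[OF fin(2) FpFv] by (simp add: i_def k_def)
 then obtain g1 where g1: "bij_betw g1 {..<i} (?Fv - ?Fp)" using ex_bij_betw_nat_finite[of "?Fv - ?Fp"] fin by (auto simp: atLeast0LessThan)
 obtain g where g: "bij_betw g {..<k} ?Fp" using ex_bij_betw_nat_finite[OF fin(2)] by (auto simp: atLeast0LessThan k_def)
 define G where "G j = (if j < i then g1 j else g (j - i))" for j
 have GF: "G j \<in> ?Fv" "p \<in> G j \<longleftrightarrow> i \<le> j" if "j < n" for j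
  using that bij_betwE[OF g1] bij_betwE[OF g] FpFv n by (auto simp: G_def)
 have Gsurj: "\<exists>j<n. F = G j" if F: "F \<in> ?Fv" for F
 proof (cases "p \<in> F")
  case True
  hence "F \<in> g ` {..<k}" using g F by (simp add: bij_betw_def)
  then obtain l where "F = g l" "l < k" by blast
  thus ?thesis using n by (intro exI[of _ "i + l"]) (simp add: G_def)
 next
  case False
  hence "F \<in> g1 ` {..<i}" using g1 F by (simp add: bij_betw_def)
  then obtain l where "F = g1 l" "l < i" by blast
  thus ?thesis using n by (intro exI[of _ l]) (simp add: G_def)
 qed
 have Ginj: "G j = G j' \<longleftrightarrow> j = j'" if "j < n" "j' < n" for j j'
 proof -
  have "G ` {..<n} = ?Fv" using GF(1) Gsurj by auto
  thus ?thesis using eq_card_imp_inj_on[of "{..<n}" G] card that by (auto simp: inj_on_def)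
 qed
 define L where "L x = (%j. if j < n then b (G j) - a (G j) \<bullet> x else 0)" for x
 \<comment> \<open>\<open>X\<close> inverts the slack map \<open>L\<close>: it moves
   \<open>p\<close> along the dual vectors until the slacks are \<open>r\<close>.\<close>
 define X where "X r = p + (\<Sum>j<n. (L p j - r j) *\<^sub>R w (G j))" for r
 have ws: "(\<Sum>j<n. c j *\<^sub>R w (G j)) \<in> span (a ` ?Fv)" for c using GF w by (intro span_sum span_mul) auto
 have aw: "a (G j) \<bullet> (\<Sum>j<n. c j *\<^sub>R w (G j)) = c j" if "j < n" for c j
 proof -
  have "a (G j) \<bullet> (\<Sum>j<n. c j *\<^sub>R w (G j)) = (\<Sum>j'<n. if j' = j then c j' else 0)"
   unfolding inner_sum_right using GF w Ginj that by (intro sum.cong) auto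
  thus ?thesis using that by simp
 qed
 have XA: "X r \<in> ?A" for r
 proof -
  show ?thesis using mem_affine_3[OF affine_affine_hull PA(1)[OF p] PA(1)[OF vP] shift[OF ws], of 1 "-1" 1] by (simp add: X_def)
 qed
 have LX: "L (X r) = r" if "\<And>j. n \<le> j ==> r j = 0" for r
  using aw that by (auto simp: L_def X_def inner_right_distrib)
 have XL: "X (L x) = x" if x: "x \<in> ?A" for x
 proof -
  have "v + (x - X (L x)) \<in> ?A"
   using mem_affine_3[OF affine_affine_hull PA(1)[OF vP] XA x, of 1 "-1" 1 "L x"] by (simp add: algebra_simps)
  moreover have "a F \<bullet> (x - X (L x)) = 0" if F: "F \<in> ?Fv" for F
  proof -
   obtain j where "j < n" "F = G j" using Gsurj[OF F] by blast
   thus ?thesis using aw by (simp add: X_def inner_right_distrib inner_diff_right L_def)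
  qed
  ultimately have "x - X (L x) = 0" by (intro zero)
  thus ?thesis by simp
 qed
 have Lp: "i \<le> j ==> L p j = 0" for j
  using GF inF[OF _ p, of "G j"] by (auto simp: L_def)
 \<comment> \<open>Small enough that no facet missing \<open>p\<close> is reached and that the
   \<open>i\<close> positive slacks stay positive; the 1 in the denominator covers a vanishing
   sum.\<close>
 define e where "e = Min (insert 1 ((%F. (b F - a F \<bullet> p) / (1 + (\<Sum>j<n. \<bar>a F \<bullet> w (G j)\<bar>))) ` (?F - ?Fp) \<union> L p ` {..<i}))"
 have Lpos: "0 < L p j" if "j < i" for j
  using GF inF[OF _ p, of "G j"] PA(2)[OF p, of "G j"] that n by (force simp: L_def)
 have e0: "0 < e"
 proof -
  have "0 < (b F - a F \<bullet> p) / (1 + (\<Sum>j<n. \<bar>a F \<bullet> w (G j)\<bar>))" if "F \<in> ?F - ?Fp" for F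
  proof -
   have "0 < 1 + (\<Sum>j<n. \<bar>a F \<bullet> w (G j)\<bar>)" by (intro add_pos_nonneg) auto
   moreover have "a F \<bullet> p < b F" using that PA(2)[OF p, of F] inF[OF _ p, of F] by auto
   ultimately show ?thesis by simp
  qed
  thus ?thesis unfolding e_def using finF Lpos by auto
 qed
 have eL: "e \<le> L p j" if "j < i" for j unfolding e_def using finF that by simp
 have slack: "a F \<bullet> X r < b F" if r: "\<And>j. j < n ==> \<bar>r j - L p j\<bar> < e" and F: "F \<in> ?F - ?Fp" for r F
 proof -
  let ?s = "\<Sum>j<n. \<bar>a F \<bullet> w (G j)\<bar>"
  have "e \<le> (b F - a F \<bullet> p) / (1 + ?s)" unfolding e_def using finF F by simp
  moreover have "0 \<le> ?s" by simp
  ultimately have "e * (1 + ?s) \<le> b F - a F \<bullet> p" by (simp add: pos_le_divide_eq)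
  moreover have "a F \<bullet> (X r - p) \<le> e * ?s"
   unfolding X_def add_diff_cancel_left' inner_sum_right sum_distrib_left
  proof (rule sum_mono)
   fix j assume "j \<in> {..<n}"
   hence "\<bar>L p j - r j\<bar> \<le> e" using r[of j] by simp
   hence "\<bar>L p j - r j\<bar> * \<bar>a F \<bullet> w (G j)\<bar> \<le> e * \<bar>a F \<bullet> w (G j)\<bar>" by (intro mult_right_mono) auto
   moreover have "(L p j - r j) * (a F \<bullet> w (G j)) \<le> \<bar>L p j - r j\<bar> * \<bar>a F \<bullet> w (G j)\<bar>" by (metis abs_ge_self abs_mult)
   ultimately show "a F \<bullet> (L p j - r j) *\<^sub>R w (G j) \<le> e * \<bar>a F \<bullet> w (G j)\<bar>" by simp
  qed
  ultimately show ?thesis using e0 by (simp add: inner_diff_right distrib_left)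
 qed
 define W where "W = {x \<in> P. \<forall>j\<in>{..<n}. \<bar>L x j - L p j\<bar> < e}"
 have cL: "continuous_on S (%x. L x j)" for S j unfolding L_def by (cases "j < n") (auto intro!: continuous_intros)
 have cX: "continuous_on S X" for S
  unfolding X_def by (intro continuous_intros continuous_on_subset[of UNIV "%r. r _" S]) auto
 have WF: "p \<in> F" if x: "x \<in> W" "F facet_of P" "x \<in> F" for x F
 proof (rule ccontr)
  assume "p \<notin> F"
  hence "a F \<bullet> X (L x) < b F" using x by (intro slack) (auto simp: W_def)
  thus False using XL PA inF x by (auto simp: W_def)
 qed
 have eW: "L x \<in> slab n e (L p)" if x: "x \<in> W" for x
  using x PA GF by (auto simp: slab_def W_def) (auto simp: L_def)
 have eX: "X r \<in> W" if r: "r \<in> slab n e (L p)" for r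
 proof -
  have r1: "\<bar>r j - L p j\<bar> < e" if "j < n" for j
   using r that by (auto simp: slab_def)
  have rn: "\<And>j. n \<le> j ==> r j = 0" using r by (auto simp: slab_def)
  have "a F \<bullet> X r \<le> b F" if F: "F facet_of P" for F
  proof (cases "p \<in> F")
   case True
   hence "F \<in> ?Fv" using F FpFv by auto
   then obtain j where j: "j < n" "F = G j" using Gsurj by blast
   hence "0 \<le> L (X r) j" using LX r by (simp add: slab_def)
   thus ?thesis using j by (simp add: L_def)
  next
   case False
   thus ?thesis using slack r1 F by force
  qed
  thus ?thesis using XA Pab r1 LX[OF rn] by (auto simp: W_def)
 qed
 have "homeomorphic_maps (top_of_set W) (top_of_set (slab n e (L p))) L X"
  unfolding homeomorphic_maps_def
 proof (intro conjI ballI)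
  fix r assume "r \<in> topspace (top_of_set (slab n e (L p)))"
  thus "L (X r) = r" using LX by (simp add: slab_def)
 qed (use eW eX XL cX PA(1) continuous_on_coordinatewise_then_product[of W L, OF cL] in
   \<open>auto simp: continuous_map_in_subtopology W_def\<close>)
 hence h1: "homeomorphic_map (top_of_set W) (top_of_set (slab n e (L p))) L" by (rule homeomorphic_maps_imp_map)
 obtain h where h: "homeomorphic_map (top_of_set (slab n e (L p))) (top_of_set (corner i n)) h"
  "\<And>r j. r \<in> slab n e (L p) ==> i \<le> j ==> h r j = 0 \<longleftrightarrow> r j = 0"
  using slab_corner[OF e0, of i n "L p"] eL Lp n by auto
 show ?thesis
 proof (rule that[OF n, of W "h \<circ> L" g])
  have "openin (top_of_set P) (\<Inter>j\<in>{..<n}. P \<inter> (%x. \<bar>L x j - L p j\<bar>) -` {..<e})" if "n \<noteq> 0"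
   using that by (intro openin_Inter) (auto intro!: continuous_intros cL)
  moreover have "W = (\<Inter>j\<in>{..<n}. P \<inter> (%x. \<bar>L x j - L p j\<bar>) -` {..<e})" if "n \<noteq> 0" using that by (auto simp: W_def)
  moreover have "W = P" if "n = 0" using that by (auto simp: W_def)
  ultimately show "openin (top_of_set P) W" by force
  show "p \<in> W" using p e0 by (simp add: W_def)
  show "homeomorphic_map (top_of_set W) (top_of_set (corner i n)) (h \<circ> L)" using homeomorphic_map_compose[OF h1 h(1)] .
  show "inj_on g {..<k}" "g ` {..<k} = ?Fp" using g by (auto simp: bij_betw_def)
  fix x assume x: "x \<in> W"
  fix l assume l: "l < k"
  have "(h \<circ> L) x (i + l) = 0 \<longleftrightarrow> L x (i + l) = 0" using h(2)[OF eW[OF x]] by simp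
  also have "\<dots> \<longleftrightarrow> x \<in> g l"
   using inF bij_betwE[OF g] l x n by (auto simp: L_def G_def W_def)
  finally show "(h \<circ> L) x (i + l) = 0 \<longleftrightarrow> x \<in> g l" .
 qed (use WF in auto)
qed

section \<open>From charts to global topological properties\<close>

lemma second_countable_local:
 assumes X: "compact_space X"
  and U: "\<And>x. x \<in> topspace X ==> \<exists>U. openin X U \<and> x \<in> U \<and> second_countable (subtopology X U)"
 shows "second_countable X"
proof -
 let ?\<U> = "{U. openin X U \<and> second_countable (subtopology X U)}"
 have "topspace X \<subseteq> \<Union>?\<U>" using U by blast
 then obtain \<F> where \<F>: "finite \<F>" "\<F> \<subseteq> ?\<U>" "topspace X \<subseteq> \<Union>\<F>"
  using X unfolding compact_space_alt by (metis (no_types, lifting) mem_Collect_eq)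
 have "\<forall>U\<in>\<F>. \<exists>\<B>. countable \<B> \<and> (\<forall>V\<in>\<B>. openin (subtopology X U) V) \<and>
   (\<forall>W x. openin (subtopology X U) W \<and> x \<in> W --> (\<exists>V\<in>\<B>. x \<in> V \<and> V \<subseteq> W))"
  using \<F> unfolding second_countable_def by blast
 from bchoice[OF this] obtain \<B> where \<B>: "\<forall>U\<in>\<F>. countable (\<B> U) \<and> (\<forall>V\<in>\<B> U. openin (subtopology X U) V) \<and>
   (\<forall>W x. openin (subtopology X U) W \<and> x \<in> W --> (\<exists>V\<in>\<B> U. x \<in> V \<and> V \<subseteq> W))" ..
 show ?thesis
  unfolding second_countable_def
 proof (intro exI[of _ "\<Union>U\<in>\<F>. \<B> U"] conjI ballI allI impI)
  show "countable (\<Union>U\<in>\<F>. \<B> U)" using \<F> \<B> by (auto intro: countable_finite)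
  show "openin X V" if V: "V \<in> (\<Union>U\<in>\<F>. \<B> U)" for V
  proof -
   obtain U where "U \<in> \<F>" "V \<in> \<B> U" using V by blast
   thus ?thesis using \<B> \<F> openin_trans_full[of X U V] by blast
  qed
  fix W x assume W: "openin X W \<and> x \<in> W"
  then obtain U where U: "U \<in> \<F>" "x \<in> U" using \<F> openin_subset by blast
  moreover have "openin (subtopology X U) (U \<inter> W)" using W by (simp add: openin_subtopology_Int2)
  ultimately obtain V where "V \<in> \<B> U" "x \<in> V" "V \<subseteq> U \<inter> W" using \<B> W by blast
  thus "\<exists>V\<in>\<Union>U\<in>\<F>. \<B> U. x \<in> V \<and> V \<subseteq> W" using U by blast
 qed
qed

text \<open>Finitely many charts give second countability. For the Hausdorff property two points
  either have disjoint neighbourhoods by assumption or lie in one chart, which is open and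
  Hausdorff.\<close>

lemma toric_likeI:
 assumes n: "n \<le> m" and X: "compact_space X" "torus_action m X act" "topspace X \<noteq> {}"
  and charts: "\<And>x. x \<in> topspace X ==> charted n m X act x"
  and sep: "\<And>x y. x \<in> topspace X ==> y \<in> topspace X ==> x \<noteq> y ==>
   (\<exists>V W. openin X V \<and> openin X W \<and> x \<in> V \<and> y \<in> W \<and> disjnt V W) \<or>
   (\<exists>z i G U F f. toric_chart n m X act z i G U F f \<and> x \<in> U \<and> y \<in> U)"
 shows "toric_like n m X act"
proof -
 have U: "openin X U" "Hausdorff_space (subtopology X U)" "second_countable (subtopology X U)"
  if "toric_chart n m X act z i G U F f" for z i G U F f
 proof -
  let ?Y = "model_top i (m - n) (csg (n - i) G)"
  have "Hausdorff_space ?Y" "second_countable ?Y"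
   unfolding model_top_def
   by (simp_all add: Hausdorff_space_prod_topology Hausdorff_top_of_set Hausdorff_hom_top second_countable_prod_topology
     second_countable_top_of_set second_countable_hom_top countable_csg)
  moreover have "?Y homeomorphic_space subtopology X U"
   using that by (meson toric_chart_def homeomorphic_map_imp_homeomorphic_space homeomorphic_space_sym)
  ultimately show "openin X U" "Hausdorff_space (subtopology X U)" "second_countable (subtopology X U)"
   using that homeomorphic_Hausdorff_space homeomorphic_second_countable unfolding toric_chart_def by blast+
 qed
 have "second_countable X"
 by (metis second_countable_local X U charts toric_chart_def)
 moreover have "Hausdorff_space X"
  unfolding Hausdorff_space_def
 proof clarify
  fix x y assume xy: "x \<in> topspace X" "y \<in> topspace X" "x \<noteq> y"
  from sep[OF this] show "\<exists>V W. openin X V \<and> openin X W \<and> x \<in> V \<and> y \<in> W \<and> disjnt V W"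
  proof
   assume "\<exists>z i G U F f. toric_chart n m X act z i G U F f \<and> x \<in> U \<and> y \<in> U"
   then obtain z i G U F f where c: "toric_chart n m X act z i G U F f" "x \<in> U" "y \<in> U" by blast
   have "\<exists>V W. openin (subtopology X U) V \<and> openin (subtopology X U) W \<and> x \<in> V \<and> y \<in> W \<and> disjnt V W"
    using U(2)[OF c(1), unfolded Hausdorff_space_def, rule_format, of x y] xy c by simp
   thus ?thesis using openin_trans_full U[OF c(1)] by blast
  qed
 qed
 ultimately show ?thesis using n X charts by (simp add: toric_like_def)
qed

section \<open>Quotients of a simple polytope times a torus\<close>

lemma torus_characters_eq_iff:
 assumes "t \<in> Torus m" "s \<in> Torus m"
 shows "chr m u (inv\<^bsub>torus m\<^esub> t \<otimes>\<^bsub>torus m\<^esub> s) = 1 \<longleftrightarrow> chr m u t = chr m u s"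
proof -
 have h: "chr m u t * chr m u (coord_mult (%i. inverse (t i)) s) = chr m u s"
  using torus_nonzero[OF assms(1)] by (simp add: chr_coord_mult[symmetric] coord_mult_def mult.assoc[symmetric])
 thus ?thesis using chr_nonzero[OF torus_nonzero[OF assms(1)], of m u] by (simp add: torus_m_inv[OF assms(1)] h[symmetric])
qed

text \<open>Serves both kinds of quotients: \<open>v\<close> attaches an integer vector to each
  facet, and \<open>H p\<close> is the common kernel of the characters vanishing on the vectors of
  the facets through \<open>p\<close>. The projection \<open>\<pi>\<close> to the polytope separates
  points over different \<open>p\<close>, while all points over one \<open>p\<close> share a
  chart.\<close>

lemma polytope_torus_quotient_toric_like:
 fixes P :: "'p::euclidean_space set"
 assumes P: "simple_polytope n P" and n: "n \<le> m" and Q: "polytope_torus_quotient m P H X act"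
  and v: "\<And>p. p \<in> P ==> inj_on v {F. F facet_of P \<and> p \<in> F} \<and> lin_indep m (v ` {F. F facet_of P \<and> p \<in> F})"
  and H: "\<And>p. p \<in> P ==> H p = {t \<in> Torus m.
   \<forall>u\<in>lat m. (\<forall>F. F facet_of P \<and> p \<in> F --> dot m u (v F) = 0) --> chr m u t = 1}"
 shows "toric_like n m X act"
proof -
 let ?T = "Torus m" and ?Z = "prod_topology (top_of_set P) (torus_top m)"
 obtain q where q: "quotient_map ?Z X q" and act: "torus_action m X act"
  and fib: "\<And>p p' t s. p \<in> P ==> p' \<in> P ==> t \<in> ?T ==> s \<in> ?T ==>
   q (p, t) = q (p', s) \<longleftrightarrow> p = p' \<and> inv\<^bsub>torus m\<^esub> t \<otimes>\<^bsub>torus m\<^esub> s \<in> H p"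
  and equi: "\<And>p t s. p \<in> P ==> t \<in> ?T ==> s \<in> ?T ==> q (p, coord_mult t s) = act t (q (p, s))"
  using Q unfolding polytope_torus_quotient_def torus_mult by blast
 have fib': "q (p, t) = q (p', s) \<longleftrightarrow> p = p' \<and> (\<forall>u\<in>lat m. (\<forall>F. F facet_of P \<and> p \<in> F --> dot m u (v F) = 0) --> chr m u t = chr m u s)"
  if "p \<in> P" "p' \<in> P" "t \<in> ?T" "s \<in> ?T" for p p' t s
 using that torus_inverse torus_coord_mult fib torus_characters_eq_iff H by (auto simp: torus_m_inv)
 have poly: "polytope P" "P \<noteq> {}" using P by (auto simp: simple_polytope_def)
 have "compact_space ?Z"
  using poly compact_torus
  by (simp add: compact_space_prod_topology compact_space_subtopology polytope_imp_compact del: prod_topology_subtopology_eu)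
 hence comp: "compact_space X"
  using image_compactin[OF _ quotient_imp_continuous_map[OF q]] quotient_imp_surjective_map[OF q] by (metis compact_space_def)
 have sur: "topspace X = q ` (P \<times> ?T)" using quotient_imp_surjective_map[OF q] by simp
 have fst_eq: "fst z = fst z'" if "z \<in> topspace ?Z" "z' \<in> topspace ?Z" "q z = q z'" for z z'
  using that fib by auto
 obtain \<pi> where \<pi>: "continuous_map X (top_of_set P) \<pi>" "\<And>z. z \<in> topspace ?Z ==> \<pi> (q z) = fst z"
  by (rule quotient_map_lift_exists[OF q continuous_map_fst]) (use fst_eq in blast)+
 have qX: "q (p, t) \<in> topspace X" if "p \<in> P" "t \<in> ?T" for p t using that sur by blast
 have \<pi>': "\<pi> (q (p, t)) = p" if "p \<in> P" "t \<in> ?T" for p t using \<pi> that by simp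
 have chart: "\<exists>i G U R f. toric_chart n m X act (q (p, t)) i G U R f \<and> {x \<in> topspace X. \<pi> x = p} \<subseteq> U"
  if p: "p \<in> P" and t: "t \<in> ?T" for p t
 proof -
  obtain i k g W h where n': "n = i + k" and W: "openin (top_of_set P) W" "p \<in> W"
   and h: "homeomorphic_map (top_of_set W) (top_of_set (corner i n)) h"
   and g: "inj_on g {..<k}" "g ` {..<k} = {F. F facet_of P \<and> p \<in> F}"
   and hg: "\<And>x l. x \<in> W ==> l < k ==> h x (i + l) = 0 \<longleftrightarrow> x \<in> g l"
   and Wp: "\<And>x F. x \<in> W ==> F facet_of P ==> x \<in> F ==> p \<in> F"
   by (rule simple_polytope_chart[OF P p]) blast
  have WP: "W \<subseteq> P" using W openin_subset by fastforce
  define U where "U = {x \<in> topspace X. \<pi> x \<in> W}"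
  have U: "openin X U" unfolding U_def using openin_continuous_map_preimage[OF \<pi>(1) W(1)] .
  have "{z \<in> topspace ?Z. q z \<in> U} = W \<times> ?T" using WP qX \<pi>' by (force simp: U_def)
  from quotient_map_restriction[OF q this]
  have qU: "quotient_map (prod_topology (top_of_set W) (torus_top m)) (subtopology X U) q"
   using U WP by (simp add: subtopology_Times subtopology_subtopology Int_absorb1 del: prod_topology_subtopology_eu)
  have "inj_on (v \<circ> g) {..<k}" "lin_indep m ((v \<circ> g) ` {..<k})"
   using comp_inj_on[OF g(1), of v] v[OF p] unfolding image_comp[symmetric] g by auto
  moreover have "q (x, t) = q (x', s) \<longleftrightarrow> x = x' \<and>
    (\<forall>u\<in>lat m. (\<forall>l<k. h x (i + l) = 0 --> dot m u ((v \<circ> g) l) = 0) --> chr m u t = chr m u s)"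
   if x: "x \<in> W" "x' \<in> W" "t \<in> ?T" "s \<in> ?T" for x x' t s
  proof -
   have "(\<forall>F. F facet_of P \<and> x \<in> F --> dot m u (v F) = 0) \<longleftrightarrow> (\<forall>l<k. h x (i + l) = 0 --> dot m u ((v \<circ> g) l) = 0)" for u
   proof -
    have "{F. F facet_of P \<and> x \<in> F} = g ` {l. l < k \<and> h x (i + l) = 0}" (is "?l = ?r")
    proof
     show "?l \<subseteq> ?r"
     proof
      fix F assume F: "F \<in> ?l"
      hence "F \<in> g ` {..<k}" using g Wp[OF x(1)] by blast
      thus "F \<in> ?r" using F hg[OF x(1)] by auto
     qed
     show "?r \<subseteq> ?l" using g hg[OF x(1)] by auto
    qed
    hence "(\<forall>F\<in>?l. dot m u (v F) = 0) \<longleftrightarrow> (\<forall>F\<in>?r. dot m u (v F) = 0)" by simp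
    thus ?thesis by auto
   qed
   thus ?thesis using fib'[of x x' t s] x WP by auto
  qed
  moreover have "h p (i + l) = 0" if "l < k" for l using hg[OF W(2) that] g that by auto
  ultimately obtain G R f where "toric_chart n m X act (q (p, t)) i G U R f"
   using polar_chart[OF act n n' U qU h, of "v \<circ> g" p t] equi WP W t by (auto simp: subset_iff)
  moreover have "{x \<in> topspace X. \<pi> x = p} \<subseteq> U" using W by (auto simp: U_def)
  ultimately show ?thesis by blast
 qed
 show ?thesis
 proof (rule toric_likeI[OF n comp act])
  show "topspace X \<noteq> {}" using sur poly torus_one_closed by blast
  show "charted n m X act x" if x: "x \<in> topspace X" for x
  proof -
   obtain p t where "p \<in> P" "t \<in> ?T" "x = q (p, t)" using x sur by auto
   thus ?thesis using chart by blast
  qed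
  fix x y assume xy: "x \<in> topspace X" "y \<in> topspace X" "x \<noteq> y"
  show "(\<exists>V W. openin X V \<and> openin X W \<and> x \<in> V \<and> y \<in> W \<and> disjnt V W) \<or>
   (\<exists>z i G U R f. toric_chart n m X act z i G U R f \<and> x \<in> U \<and> y \<in> U)"
  proof (cases "\<pi> x = \<pi> y")
   case True
   obtain p t where pt: "p \<in> P" "t \<in> ?T" "x = q (p, t)" using xy sur by auto
   then obtain i G U R f where "toric_chart n m X act (q (p, t)) i G U R f" "{x \<in> topspace X. \<pi> x = p} \<subseteq> U"
    using chart by blast
   moreover have "\<pi> x = p" using \<pi>' pt by simp
   ultimately have "toric_chart n m X act (q (p, t)) i G U R f \<and> x \<in> U \<and> y \<in> U" using xy True by auto
   thus ?thesis by force
  next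
   case False
   have cm: "continuous_map X euclidean \<pi>" using \<pi> continuous_map_into_fulltopology by blast
   obtain A B where "open A" "open B" "\<pi> x \<in> A" "\<pi> y \<in> B" "A \<inter> B = {}" using hausdorff[OF False] by blast
   thus ?thesis
    using xy openin_continuous_map_preimage[OF cm, of A] openin_continuous_map_preimage[OF cm, of B]
    by (intro disjI1 exI exI[of _ "{x \<in> topspace X. \<pi> x \<in> B}"]) (auto simp: disjnt_def)
  qed
 qed
qed

lemma cis_sum: "finite A ==> cis (\<Sum>x\<in>A. f x) = (\<Prod>x\<in>A. cis (f x))"
 by (induction rule: finite_induct) (auto simp: cis_mult[symmetric])

lemma chr_cis:
 assumes "\<And>i. i < m ==> t i = cis (2 * pi * q i)"
 shows "chr m u t = cis (2 * pi * (\<Sum>i<m. q i * of_int (u i)))"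
using chr_def assms by (auto simp: mult_ac cis_power_int sum_distrib_left cis_sum)

text \<open>The generated subgroup lies in the annihilator by a check on generators. Conversely the
  arguments of the characters of \<open>t\<close> have to be distributed over the circles. This
  linear system is solved by the dual basis; its denominator \<open>d\<close> is harmless because
  the circles are parametrized by real numbers.\<close>

lemma generate_circles:
 assumes inj: "inj_on q I" and I: "finite I" and li: "lin_indep m (q ` I)"
 shows "generate (torus m) (\<Union>G\<in>I. circle_subgroup m (q G)) = {t \<in> Torus m.
   \<forall>u\<in>lat m. (\<forall>G\<in>I. dot m u (q G) = 0) --> chr m u t = 1}" (is "generate _ ?C = ?A")
proof
 have C: "?C \<subseteq> ?A"
 proof clarify
  fix G t assume G: "G \<in> I" "t \<in> circle_subgroup m (q G)"
  then obtain x where t: "t = (%i. if i < m then cis (2 * pi * of_int (q G i) * x) else 1)" by (auto simp: circle_subgroup_def)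
  have "chr m u t = 1" if "dot m u (q G) = 0" for u
  proof -
   have "(\<Sum>i<m. of_int (q G i) * x * of_int (u i)) = of_int (dot m u (q G)) * x"
    by (simp add: dot_def sum_distrib_left mult_ac)
   thus ?thesis using chr_cis that by (simp add: t mult.assoc)
  qed
  thus "t \<in> Torus m \<and> (\<forall>u\<in>lat m. (\<forall>G\<in>I. dot m u (q G) = 0) --> chr m u t = 1)"
   using G by (auto simp: t in_torus_iff)
 qed
 show "generate (torus m) ?C \<subseteq> ?A"
 proof
  fix t assume "t \<in> generate (torus m) ?C"
  thus "t \<in> ?A"
  proof induction
   case (inv h)
   hence h: "h \<in> ?A" using C by blast
   hence "inv\<^bsub>torus m\<^esub> h \<in> Torus m" by (simp add: torus_m_inv torus_inverse)
   moreover have "chr m u (inv\<^bsub>torus m\<^esub> h) = 1" if "chr m u h = 1" for u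
    using torus_characters_eq_iff[of h m "%_. 1" u] h that torus_one_closed by (auto simp: coord_mult_def)
   ultimately show ?case using h by auto
  qed (use C torus_one_closed in \<open>auto simp: torus_coord_mult chr_coord_mult\<close>)
 qed
 show "?A \<subseteq> generate (torus m) ?C"
 proof
  fix t assume t: "t \<in> ?A"
  define k where "k = card I"
  obtain g where g: "bij_betw g {..<k} I" using ex_bij_betw_nat_finite[OF I] by (auto simp: k_def atLeast0LessThan)
  let ?q = "%l. q (g l)"
  have gI: "?q ` {..<k} = q ` I" using g by (auto simp: bij_betw_def)
  have "inj_on ?q {..<k}" using g inj comp_inj_on[of g "{..<k}" q] by (simp add: bij_betw_def o_def)
  then obtain b b' a v d where "localization m (?q ` {..<k}) (?q ` {..<k}) 0 b b' a" and ak: "a + k = m"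
   and "simplicial k (%l. localization.quot m b a (?q l)) v d"
   using simplicial_quotient li gI by metis
  then interpret L: localization m "?q ` {..<k}" "?q ` {..<k}" 0 b b' a
   + simplicial k "%l. localization.quot m b a (?q l)" v d by auto
  have tn: "\<And>i. t i \<noteq> 0" using t torus_nonzero by auto
  have "\<exists>f. chr m (b j) t = cis (2 * pi * f)" for j
  proof -
   have "cmod (chr m (b j) t) = 1" using norm_chr t by blast
   hence "chr m (b j) t = cis (Arg (chr m (b j) t))" using cis_Arg by (cases "chr m (b j) t = 0") (auto simp: sgn_eq)
   thus ?thesis by (intro exI[of _ "Arg (chr m (b j) t) / (2 * pi)"]) simp
  qed
  then obtain f where f: "\<And>j. chr m (b j) t = cis (2 * pi * f j)" by metis
  \<comment> \<open>The angle on the \<open>l\<close>-th circle: the arguments of the last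
    \<open>k\<close> characters paired with the dual vector \<open>v l\<close>, divided by the
    common denominator.\<close>
  define x where "x l = (\<Sum>j<k. f (a + j) * of_int (v l j)) / of_nat d" for l
  have ba: "chr m (b j) t = 1" if "j < a" for j
  using L.basis_kernel that gI t L.basis_lat ak by auto
  have coord: "t i = cis (2 * pi * (\<Sum>l<k. of_int (q (g l) i) * x l))" if i: "i < m" for i
  proof -
   let ?u = "unit_vec i" and ?p = "L.proj (unit_vec i)"
   have u: "?u \<in> lat m" using unit_vec_in_lat[OF i] .
   have "t i = chr m ?u t" using chr_unit_vec[OF i] by simp
   also have "\<dots> = (\<Prod>j<k. chr m (b (a + j)) t powi dot m ?u (b' (a + j)))"
    using chr_expand[OF L.unimod u tn] ba by (simp add: prod_lessThan_add[of _ a k, unfolded ak])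
   also have "\<dots> = (\<Prod>j<k. cis (2 * pi * (f (a + j) * of_int (?p j))))"
    using ak by (intro prod.cong) (auto simp: f L.proj_def cis_power_int mult_ac)
   also have "\<dots> = cis (2 * pi * (\<Sum>j<k. f (a + j) * of_int (?p j)))"
    by (simp add: cis_sum sum_distrib_left)
   also have "(\<Sum>j<k. f (a + j) * of_int (?p j)) = (\<Sum>j<k. \<Sum>l<k. of_int (q (g l) i) * (f (a + j) * of_int (v l j)) / of_nat d)"
   proof (rule sum.cong[OF refl])
    fix j
    have "of_int (int d * ?p j) = (\<Sum>l<k. of_int (q (g l) i) * of_int (v l j) :: real)" using fun_cong[OF expand[of ?p], of j] L.proj_lat L.dot_proj[OF u] ak dot_unit_vec[OF i] by force
    hence "of_int (?p j) = (\<Sum>l<k. of_int (q (g l) i) * of_int (v l j) / of_nat d :: real)"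
     using d by (simp add: sum_divide_distrib[symmetric] field_simps)
    thus "f (a + j) * of_int (?p j) = (\<Sum>l<k. of_int (q (g l) i) * (f (a + j) * of_int (v l j)) / of_nat d)"
     by (simp add: sum_distrib_left mult_ac)
   qed
   also have "\<dots> = (\<Sum>l<k. of_int (q (g l) i) * x l)"
    by (subst sum.swap) (simp add: x_def sum_distrib_left sum_divide_distrib)
   finally show ?thesis .
  qed
  have "(%i. if i < m then cis (2 * pi * (\<Sum>l\<in>J. of_int (q (g l) i) * x l)) else 1) \<in> generate (torus m) ?C"
   if "finite J" "J \<subseteq> {..<k}" for J
   using that
  proof (induction J)
   case empty
   thus ?case using generate.one[of "torus m" ?C] by (simp cong: if_cong)
  next
   case (insert l J)
   let ?s = "%i. if i < m then cis (2 * pi * of_int (q (g l) i) * x l) else 1"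
   have "?s \<in> ?C" using insert.prems bij_betwE[OF g] by (intro UN_I) (auto simp: circle_subgroup_def)
   from generate.eng[OF generate.incl[OF this] insert.IH] insert.prems
   have "coord_mult ?s (%i. if i < m then cis (2 * pi * (\<Sum>l\<in>J. of_int (q (g l) i) * x l)) else 1) \<in> generate (torus m) ?C" by simp
   moreover have "coord_mult ?s (%i. if i < m then cis (2 * pi * (\<Sum>l\<in>J. of_int (q (g l) i) * x l)) else 1) =
    (%i. if i < m then cis (2 * pi * (\<Sum>l\<in>insert l J. of_int (q (g l) i) * x l)) else 1)"
    using insert.hyps by (auto simp: coord_mult_def cis_mult distrib_left mult.assoc)
   ultimately show ?case by simp
  qed
  from this[of "{..<k}"] have "(%i. if i < m then cis (2 * pi * (\<Sum>l<k. of_int (q (g l) i) * x l)) else 1) \<in> generate (torus m) ?C" by simp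
  moreover have "t = (%i. if i < m then cis (2 * pi * (\<Sum>l<k. of_int (q (g l) i) * x l)) else 1)"
   using coord t by (auto simp: in_torus_iff)
  ultimately show "t \<in> generate (torus m) ?C" by simp
 qed
qed

text \<open>Independence of the family indexed by \<open>I\<close> also excludes repeated vectors,
  since a repetition gives the non-trivial relation with coefficients 1 and -1.\<close>

lemma independent_family:
 assumes I: "finite I" and c: "\<And>c. (\<forall>i<n. (\<Sum>F\<in>I. c F * m F i) = 0) ==> \<forall>F\<in>I. c F = (0::int)"
 shows "inj_on m I \<and> lin_indep n (m ` I)"
proof
 show inj: "inj_on m I"
 proof (rule inj_onI, rule ccontr)
  fix F G assume FG: "F \<in> I" "G \<in> I" "m F = m G" "F \<noteq> G"
  let ?c = "%H. (if H = F then 1 else 0) - (if H = G then 1 else 0) :: int"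
  have "(\<Sum>H\<in>I. ?c H * m H i) = 0" for i
   using I FG by (simp add: left_diff_distrib sum_subtractf if_distrib[of "%x. x * _"] cong: if_cong)
  thus False using c[of ?c] FG by auto
 qed
 show "lin_indep n (m ` I)"
  unfolding lin_indep_def using c[of "_ \<circ> m"] by (auto simp: sum.reindex[OF inj])
qed

section \<open>Quasitoric orbifolds and moment-angle manifolds\<close>

lemma exists_face_rel_interior:
 fixes P :: "'p::euclidean_space set"
 assumes P: "polytope P" "p \<in> P"
 shows "\<exists>F. F face_of P \<and> p \<in> rel_interior F"
proof -
 let ?A = "{F. F face_of P \<and> p \<in> F}"
 have "finite ?A" "P \<in> ?A"
  using finite_polytope_faces[OF P(1)] P face_of_refl[OF polytope_imp_convex[OF P(1)]] by auto
 then obtain M where M: "M \<in> ?A" "\<And>F. F \<in> ?A ==> F \<subseteq> M ==> M = F" using finite_has_minimal[of ?A] by blast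
 have poly: "polytope M" using face_of_polytope_polytope[OF P(1)] M by simp
 have "p \<in> rel_interior M"
 proof (rule ccontr)
  assume "p \<notin> rel_interior M"
  hence "p \<in> rel_frontier M" using M closure_subset by (auto simp: rel_frontier_def)
  then obtain C where C: "C facet_of M" "p \<in> C" using rel_frontier_of_polyhedron[OF polytope_imp_polyhedron[OF poly]] by auto
  hence "C \<in> ?A" "C \<subseteq> M" using M by (auto simp: facet_of_def face_of_imp_subset intro: face_of_trans)
  thus False using M(2)[of C] C by auto
 qed
 thus ?thesis using M by blast
qed

lemma quasitoric_orbifold_toric_like:
 assumes "quasitoric_orbifold n P m X act"
 shows "toric_like n n X act"
proof -
 have P: "simple_polytope n P" "polytope P" and m: "characteristic_function n P m"
  and Q: "polytope_torus_quotient n P (%p. face_torus n P m (THE F. F face_of P \<and> p \<in> rel_interior F)) X act"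
  using assms by (auto simp: quasitoric_orbifold_def simple_polytope_def)
 have fin: "finite {F. F facet_of P \<and> p \<in> F}" for p
  using finite_polytope_facets[OF P(2)] by auto
 have ind: "inj_on m {F. F facet_of P \<and> p \<in> F} \<and> lin_indep n (m ` {F. F facet_of P \<and> p \<in> F})" for p
 proof (rule independent_family[OF fin])
  fix c assume c: "\<forall>i<n. (\<Sum>F\<in>{F. F facet_of P \<and> p \<in> F}. c F * m F i) = 0"
  have "{F. F facet_of P \<and> p \<in> F} \<subseteq> {F. F facet_of P} \<and> \<Inter>{F. F facet_of P \<and> p \<in> F} \<noteq> {}" by auto
  thus "\<forall>F\<in>{F. F facet_of P \<and> p \<in> F}. c F = 0"
   by (rule m[unfolded characteristic_function_def, THEN conjunct2, rule_format, THEN ballI[of "{F. F facet_of P \<and> p \<in> F}"]])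
    (use c in auto)
 qed
 show ?thesis
 proof (rule polytope_torus_quotient_toric_like[OF P(1) order_refl Q ind])
  fix p assume p: "p \<in> P"
  obtain F where F: "F face_of P" "p \<in> rel_interior F" using exists_face_rel_interior[OF P(2) p] by blast
  have the: "(THE F. F face_of P \<and> p \<in> rel_interior F) = F"
   using F face_of_eq by (intro the_equality) blast+
  \<comment> \<open>A facet contains the face \<open>F\<close> exactly when it contains the relative
    interior point \<open>p\<close>, so the torus of the face is determined by the facets through
    \<open>p\<close>.\<close>
  have "{G. G facet_of P \<and> F \<subseteq> G} = {G. G facet_of P \<and> p \<in> G}"
   using F rel_interior_subset subset_of_face_of[of _ P F] face_of_imp_subset facet_of_imp_face_of by blast
  thus "face_torus n P m (THE F. F face_of P \<and> p \<in> rel_interior F) = {t \<in> Torus n.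
    \<forall>u\<in>lat n. (\<forall>F. F facet_of P \<and> p \<in> F --> dot n u (m F) = 0) --> chr n u t = 1}"
   unfolding the face_torus_def using generate_circles[of m "{G. G facet_of P \<and> p \<in> G}" n] ind fin by simp
 qed
qed

text \<open>The instance in which the \<open>j\<close>-th facet carries the \<open>j\<close>-th unit
  vector. That \<open>n \<le> m\<close> holds follows from the \<open>n\<close> facets at a
  vertex.\<close>

lemma moment_angle_manifold_toric_like:
 assumes "moment_angle_manifold n m P F X act"
 shows "toric_like n m X act"
proof -
 have P: "simple_polytope n P" "polytope P" "P \<noteq> {}" and F: "bij_betw F {..<m} {G. G facet_of P}"
  and Q: "polytope_torus_quotient m P (%p. {t \<in> Torus m. \<forall>j<m. p \<notin> F j --> t j = 1}) X act"
  using assms by (auto simp: moment_angle_manifold_def simple_polytope_def)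
 define l where "l G = unit_vec (inv_into {..<m} F G)" for G
 have lF: "l (F j) = unit_vec j" if "j < m" for j using F that by (simp add: l_def bij_betw_inv_into_left)
 have facet: "\<exists>j<m. G = F j" if "G facet_of P" for G
 using F that by (auto simp: bij_betw_def)
 have finF: "finite {G. G facet_of P}" "card {G. G facet_of P} = m" using F bij_betw_finite bij_betw_same_card by fastforce+
 hence fin: "finite {G. G facet_of P \<and> p \<in> G}" for p by auto
 obtain v where v: "{v} face_of P" using polytope_vertex_of_point P by blast
 hence n: "n \<le> m" using P card_mono[OF finF(1), of "{G. G facet_of P \<and> v \<in> G}"] finF by (auto simp: simple_polytope_def)
 show ?thesis
 proof (rule polytope_torus_quotient_toric_like[OF P(1) n Q])
  fix p
  show "inj_on l {G. G facet_of P \<and> p \<in> G} \<and> lin_indep m (l ` {G. G facet_of P \<and> p \<in> G})"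
  proof (rule independent_family[OF fin], rule ballI)
   fix c G assume c: "\<forall>i<m. (\<Sum>H\<in>{G. G facet_of P \<and> p \<in> G}. c H * l H i) = 0" and G: "G \<in> {G. G facet_of P \<and> p \<in> G}"
   obtain j where j: "j < m" "G = F j" using facet G by blast
   have "l H j = (if H = G then 1 else 0)" if H: "H facet_of P" for H
   by (metis facet H lF j unit_vec_def)
   hence "(\<Sum>H\<in>{G. G facet_of P \<and> p \<in> G}. c H * l H j) = (\<Sum>H\<in>{G. G facet_of P \<and> p \<in> G}. if H = G then c H else 0)"
    by (intro sum.cong) auto
   thus "c G = 0" using c j G fin by simp
  qed
  assume p: "p \<in> P"
  have "(\<forall>j<m. p \<notin> F j --> t j = 1) \<longleftrightarrow>
    (\<forall>u\<in>lat m. (\<forall>G. G facet_of P \<and> p \<in> G --> dot m u (l G) = 0) --> chr m u t = 1)" for t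
  proof safe
   fix u assume t: "\<forall>j<m. p \<notin> F j --> t j = 1" and u: "\<forall>G. G facet_of P \<and> p \<in> G --> dot m u (l G) = 0"
   have "t j powi u j = 1" if "j < m" for j
    using t u bij_betwE[OF F] that lF by (cases "p \<in> F j") (auto simp: dot_unit_vec_right)
   thus "chr m u t = 1" by (simp add: chr_def)
  next
   fix j assume h: "\<forall>u\<in>lat m. (\<forall>G. G facet_of P \<and> p \<in> G --> dot m u (l G) = 0) --> chr m u t = 1"
    and j: "j < m" "p \<notin> F j"
   have "dot m (unit_vec j) (l G) = 0" if G: "G facet_of P" "p \<in> G" for G
    using facet[OF G(1)] G j lF by (auto simp: dot_unit_vec) (auto simp: unit_vec_def)
   thus "t j = 1" using h chr_unit_vec[OF j(1), of t] unit_vec_in_lat[OF j(1)] by metis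
  qed
  thus "{t \<in> Torus m. \<forall>j<m. p \<notin> F j --> t j = 1} = {t \<in> Torus m.
    \<forall>u\<in>lat m. (\<forall>F. F facet_of P \<and> p \<in> F --> dot m u (l F) = 0) --> chr m u t = 1}" by auto
 qed
qed

section \<open>Actions locally modelled on the standard one\<close>

definition stretch :: "real => real => complex => complex"
 where "stretch e c z = stretch_factor e c (cmod z) *\<^sub>R z"

definition shrink :: "real => real => complex => complex"
 where "shrink e c w = shrink_factor e c (cmod w) *\<^sub>R w"

lemma stretch_mult: "cmod s = 1 ==> stretch e c (s * z) = s * stretch e c z"
 by (simp add: stretch_def norm_mult)

lemma stretch_homeomorphic:
 assumes "0 < e" "c = 0 \<or> e \<le> c"
 shows "homeomorphic_maps (top_of_set {z. \<bar>cmod z - c\<bar> < e}) (top_of_set {w. c = 0 \<or> w \<noteq> 0}) (stretch e c) (shrink e c)"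
proof -
 note f = stretch_factor[OF assms]
 have "continuous_on {z. \<bar>cmod z - c\<bar> < e} (stretch e c)" "continuous_on {w. c = 0 \<or> w \<noteq> 0} (shrink e c)"
  unfolding stretch_def shrink_def
  by (intro continuous_on_scaleR continuous_on_id continuous_on_compose2[OF f(2) continuous_on_norm_id]
    continuous_on_compose2[OF f(4) continuous_on_norm_id], force)+
 moreover have "z \<noteq> 0" if "\<bar>cmod z - c\<bar> < e" "c \<noteq> 0" for z using that assms by auto
 moreover have "shrink e c (stretch e c z) = z" "stretch e c z = 0 \<longleftrightarrow> z = 0" if "\<bar>cmod z - c\<bar> < e" for z
  using f(1)[OF norm_ge_zero that] by (auto simp: stretch_def shrink_def)
 moreover have "stretch e c (shrink e c w) = w" "\<bar>cmod (shrink e c w) - c\<bar> < e" if "c = 0 \<or> w \<noteq> 0" for w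
  using f(3)[OF norm_ge_zero, of w] that by (auto simp: stretch_def shrink_def)
 ultimately show ?thesis by (auto simp: homeomorphic_maps_def)
qed

lemma unit_orthant: "csg k (unit_vec ` {..<k}) = {u \<in> lat k. \<forall>l. 0 \<le> u l}" (is "?S = _")
 and toric_cone_unit: "toric_cone k (unit_vec ` {..<k})"
proof -
 show "?S = {u \<in> lat k. \<forall>l. 0 \<le> u l}"
  by (auto simp: csg_def dot_unit_vec_right lat_def) (metis lessThan_iff linorder_not_less order_refl)
 show "toric_cone k (unit_vec ` {..<k})"
 proof
  show "\<exists>u\<in>lat k. \<forall>g\<in>unit_vec ` {..<k}. 0 < dot k u g"
   by (intro bexI[of _ "%l. if l < k then 1 else 0"]) (auto simp: dot_unit_vec_right lat_def)
 qed (auto simp: dot_unit_vec_right lat_def fun_eq_iff, metis dot_unit_vec_right imageI lessThan_iff leI)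
qed

text \<open>For small \<open>e\<close> a product of discs where \<open>c j = 0\<close>, of annuli
  elsewhere, and of a torus: the shape of small invariant neighbourhoods in the standard
  model.\<close>

definition polyannulus :: "nat => nat => real => (nat => real) => cvec set"
 where "polyannulus n k e c = {y \<in> standard_model n k. \<forall>j<n. \<bar>cmod (y j) - c j\<bar> < e}"

text \<open>Annuli are stretched radially to punctured planes and discs to planes. The permutation
  \<open>P\<close> puts the coordinates in the order of the model: annuli, circles, discs. The disc
  factor is a space of homomorphisms because on the free monoid of the orthant these are the same as
  their values at the unit vectors.\<close>

lemma polyannulus_chart:
 assumes e: "0 < e" and c: "\<And>j. j < n ==> c j = 0 \<or> e \<le> c j"
 obtains i P f where "i \<le> n" "bij_betw P {..<n + k} {..<n + k}"
  "homeomorphic_map (top_of_set (polyannulus n k e c)) (model_top i k (csg (n - i) (unit_vec ` {..<n - i}))) f"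
  "\<And>y. y \<in> polyannulus n k e c ==> (\<And>j. j < n ==> c j = 0 ==> y j = 0) ==>
   snd (f y) = apex (csg (n - i) (unit_vec ` {..<n - i}))"
  "\<And>t y. t \<in> Torus (n + k) ==> y \<in> polyannulus n k e c ==> f (coord_mult t y) =
   model_act i k (n - i) (csg (n - i) (unit_vec ` {..<n - i})) (split_torus (n + k) (i + k) (unit_vec \<circ> P) t) (f y)"
proof -
 let ?A = "filter (%j. c j \<noteq> 0) [0..<n]" and ?Z = "filter (%j. c j = 0) [0..<n]"
 let ?L = "?A @ [n..<n + k] @ ?Z" and ?B = "polyannulus n k e c"
 define i k' P where "i = length ?A" and "k' = length ?Z" and "P = (!) ?L"
 have n: "n = i + k'" "n - i = k'" using sum_length_filter_compl[of "%j. c j \<noteq> 0" "[0..<n]"] by (auto simp: i_def k'_def)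
 have P: "bij_betw P {..<n + k} {..<n + k}"
  unfolding P_def using n by (intro bij_betw_nth) (auto simp: i_def k'_def)
 have Pi: "P j < n \<and> c (P j) \<noteq> 0" if "j < i" for j
  using nth_mem[of j ?A] that by (auto simp: P_def nth_append i_def)
 have Pk: "P (i + j) = n + j" if "j < k" for j using that by (simp add: P_def nth_append i_def)
 have Pz: "P (i + k + l) < n \<and> c (P (i + k + l)) = 0" if "l < k'" for l
  using nth_mem[of l ?Z] that by (auto simp: P_def nth_append i_def k'_def)
 define R where "R = inv_into {..<n + k} P"
 have RP: "R (P j) = j" if "j < n + k" for j using that bij_betw_inv_into_left[OF P] by (simp add: R_def)
 have PR: "P (R j) = j" "R j < n + k" if "j < n + k" for j
  using that bij_betw_inv_into_right[OF P] bij_betwE[OF bij_betw_inv_into[OF P]] by (auto simp: R_def)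
 let ?S = "csg k' (unit_vec ` {..<k'})"
 let ?Y = "model_top i k ?S"
 define f where "f y = (((%j. if j < i then stretch e (c (P j)) (y (P j)) else 1), (%j. if j < k then y (n + j) else 1)),
  (\<lambda>u\<in>?S. \<Prod>l<k'. stretch e 0 (y (P (i + k + l))) ^ nat (u l)))" for y
 define f' where "f' p = (%j. if j < n + k then
   if R j < i then shrink e (c j) (fst (fst p) (R j)) else if R j < i + k then snd (fst p) (R j - i)
   else shrink e 0 (snd p (unit_vec (R j - i - k))) else 1)" for p
 have h: "homeomorphic_maps (top_of_set {z. \<bar>cmod z - c j\<bar> < e}) (top_of_set {w. c j = 0 \<or> w \<noteq> 0}) (stretch e (c j)) (shrink e (c j))"
  if "j < n" for j using stretch_homeomorphic[OF e c[OF that]] .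
 have st: "c j \<noteq> 0 ==> stretch e (c j) z \<noteq> 0" "shrink e (c j) (stretch e (c j) z) = z" if "j < n" "\<bar>cmod z - c j\<bar> < e" for j z
  using h[OF that(1)] that by (auto simp: homeomorphic_maps_def)
 have sh: "\<bar>cmod (shrink e (c j) w) - c j\<bar> < e" "stretch e (c j) (shrink e (c j) w) = w" if "j < n" "c j = 0 \<or> w \<noteq> 0" for j w
  using h[OF that(1)] that by (auto simp: homeomorphic_maps_def)
 have cst: "continuous_on {z. \<bar>cmod z - c j\<bar> < e} (stretch e (c j))" "continuous_on {w. c j = 0 \<or> w \<noteq> 0} (shrink e (c j))" if "j < n" for j
  using h[OF that] by (auto simp: homeomorphic_maps_def)
 have S: "unit_vec l \<in> ?S" if "l < k'" for l using unit_vec_in_lat[OF that] unfolding unit_orthant by (simp add: unit_vec_def)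
 have B: "\<bar>cmod (y j) - c j\<bar> < e" if "y \<in> ?B" "j < n" for y j using that by (simp add: polyannulus_def)
 have M: "y \<in> standard_model n k" if "y \<in> ?B" for y using that by (simp add: polyannulus_def)
 have fin: "f y \<in> topspace ?Y" if y: "y \<in> ?B" for y
 proof -
  have "(\<lambda>u\<in>?S. \<Prod>l<k'. stretch e 0 (y (P (i + k + l))) ^ nat (u l)) \<in> hom_pts ?S"
   by (rule hom_ptsI) (auto , auto simp: unit_orthant nat_add_distrib power_add prod.distrib)
  thus ?thesis using Pi st[OF _ B[OF y]] M[OF y]
   by (auto simp: f_def topspace_model_top in_Cstar_power_iff in_torus_iff standard_model_def)
 qed
 have "R j < i ==> c j \<noteq> 0" "i \<le> R j ==> R j < i + k ==> j = n + (R j - i)" "i + k \<le> R j ==> c j = 0 \<and> j < n" "R j < i ==> j < n"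
  if "j < n + k" for j
  using Pi[of "R j"] Pk[of "R j - i"] Pz[of "R j - i - k"] PR[OF that] n by auto
 note R = this
 have f'in: "f' p \<in> ?B" if p: "p \<in> topspace ?Y" for p
 proof -
  have "\<bar>cmod (f' p j) - c j\<bar> < e" if j: "j < n" for j
   using R[of j] sh[OF j] p j by (cases "R j < i"; cases "R j < i + k") (auto simp: f'_def topspace_model_top in_Cstar_power_iff)
  moreover have "f' p \<in> standard_model n k"
   using R(3,4) p by (fastforce simp: f'_def standard_model_def topspace_model_top in_torus_iff)
  ultimately show ?thesis by (simp add: polyannulus_def)
 qed
 have 1: "f' (f y) = y" if y: "y \<in> ?B" for y
 proof
  fix j
  consider "j < n + k" "R j < i" | "j < n + k" "i \<le> R j" "R j < i + k" | "j < n + k" "i + k \<le> R j" | "n + k \<le> j" by linarith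
  thus "f' (f y) j = y j"
  proof cases
   case 3
   let ?l = "R j - i - k"
   have l: "?l < k'" "P (i + k + ?l) = j" using PR[OF 3(1)] 3 n by auto
   have "(\<Prod>l<k'. stretch e 0 (y (P (i + k + l))) ^ nat (unit_vec ?l l)) = stretch e 0 (y j)"
    using l by (simp add: unit_vec_def if_distrib cong: if_cong)
   thus ?thesis using 3 R st(2)[OF _ B[OF y], of j] S[OF l(1)] by (simp add: f'_def f_def)
  qed (use R PR st(2)[OF _ B[OF y]] M[OF y] in \<open>auto simp: f'_def f_def standard_model_def\<close>)
 qed
 have 2: "f (f' p) = p" if p: "p \<in> topspace ?Y" for p
 proof -
  have p': "fst (fst p) \<in> Cstar_power i" "snd (fst p) \<in> Torus k" "snd p \<in> hom_pts ?S"
   using p by (auto simp: topspace_model_top)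
  have "stretch e (c (P j)) (f' p (P j)) = fst (fst p) j" if "j < i" for j
   using RP Pi[OF that] sh that p' n by (simp add: f'_def in_Cstar_power_iff)
  moreover have "f' p (n + j) = snd (fst p) j" if "j < k" for j
   using RP[of "i + j"] Pk that n by (simp add: f'_def)
  moreover have "(\<Prod>l<k'. stretch e 0 (f' p (P (i + k + l))) ^ nat (u l)) = snd p u" if u: "u \<in> ?S" for u
  proof -
   have "stretch e 0 (f' p (P (i + k + l))) = snd p (unit_vec l)" if "l < k'" for l
    using RP Pz[OF that] sh[of "P (i + k + l)"] that n by (simp add: f'_def)
   moreover have "u = (%i. \<Sum>l<k'. int (nat (u l)) * unit_vec l i)"
    using u unfolding unit_orthant by (auto simp: lat_def unit_vec_def if_distrib cong: if_cong)
   ultimately show ?thesis using hom_comb[OF p'(3) finite_lessThan S, of k' "%l. l" "%l. nat (u l)"] by simp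
  qed
  ultimately show ?thesis using p' hom_ptsD[OF p'(3)]
   by (auto simp: f_def prod_eq_iff fun_eq_iff in_Cstar_power_iff in_torus_iff extensional_def)
 qed
 have cy: "continuous_map (top_of_set ?B) euclidean (%y. y j)" for j
  by (simp add: continuous_on_subset[OF continuous_on_product_coordinates])
 have cs: "continuous_map (top_of_set ?B) euclidean (%y. stretch e (c j) (y j))" if "j < n" for j
  by (rule continuous_map_compose_on[OF cy cst(1)[OF that]]) (use B[OF _ that] in auto)
 have "continuous_map (top_of_set ?B) ?Y f"
  unfolding continuous_map_into_model_iff continuous_map_into_Cstar_iff continuous_map_into_torus_iff continuous_map_into_hom_iff
 proof (intro conjI ballI allI impI)
  fix u assume u: "u \<in> ?S"
  have "continuous_map (top_of_set ?B) euclidean (%y. stretch e 0 (y (P (i + k + l))) ^ nat (u l))" if "l < k'" for l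
   using cs[of "P (i + k + l)"] Pz[OF that] by (auto intro: continuous_on_power)
  hence "continuous_map (top_of_set ?B) euclidean (%y. \<Prod>l<k'. stretch e 0 (y (P (i + k + l))) ^ nat (u l))"
   by (intro continuous_map_prod) auto
  thus "continuous_map (top_of_set ?B) euclidean (%y. snd (f y) u)" by (simp add: f_def)
 qed (use fin cy cs Pi in \<open>auto simp: f_def topspace_model_top\<close>)
 moreover have "continuous_map ?Y (top_of_set ?B) f'"
  unfolding continuous_map_in_subtopology continuous_map_into_fun_iff
 proof (intro conjI allI)
  fix j
  consider "j < n + k" "R j < i" | "j < n + k" "i \<le> R j" "R j < i + k" | "j < n + k" "i + k \<le> R j" | "n + k \<le> j" by linarith
  thus "continuous_map ?Y euclidean (%p. f' p j)"
  proof cases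
   case 1
   show ?thesis unfolding f'_def using 1 R(4)
    by (simp, intro continuous_map_compose_on[OF continuous_map_Cstar_proj[OF continuous_map_model_proj(1)] cst(2)])
     (auto simp: topspace_model_top in_Cstar_power_iff)
  next
   case 3
   have l: "R j - (i + k) < k'" using PR[OF 3(1)] 3 n by auto
   show ?thesis unfolding f'_def using 3 R(3) cst[of j]
    by (auto intro!: continuous_map_compose_on[OF continuous_map_hom_evalI[OF continuous_map_model_proj(3) S[OF l]], of UNIV])
  qed (use continuous_map_torus_proj[OF continuous_map_model_proj(2)] in \<open>auto simp: f'_def\<close>)
 qed (use f'in in auto)
 ultimately have "homeomorphic_maps (top_of_set ?B) ?Y f f'" using 1 2 by (simp add: homeomorphic_maps_def)
 hence hm: "homeomorphic_map (top_of_set ?B) ?Y f" by (rule homeomorphic_maps_imp_map)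
 show ?thesis
 proof (rule that[of i P f, unfolded n(2)])
  show "snd (f y) = apex ?S" if y: "y \<in> ?B" "\<And>j. j < n ==> c j = 0 ==> y j = 0" for y
  proof -
   have "(\<Prod>l<k'. stretch e 0 (y (P (i + k + l))) ^ nat (u l)) = (if u = 0 then 1 else 0)" if u: "u \<in> ?S" for u
   proof (cases "u = 0")
    case False
    then obtain l where "l < k'" "0 < u l" using u by (auto simp: unit_orthant lat_def fun_eq_iff) (metis leI order_less_le)
    moreover from this have "y (P (i + k + l)) = 0" using y Pz by blast
    ultimately show ?thesis by (intro trans[OF prod_zero]) (auto simp: stretch_def)
   qed simp
   thus ?thesis by (auto simp: f_def apex_def)
  qed
  fix t y assume t: "t \<in> Torus (n + k)" and y: "y \<in> ?B"
  have nt: "cmod (t j) = 1" if "j < n + k" for j using t that by (simp add: in_torus_iff)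
  have Pn: "P j < n + k" if "j < n + k" for j using bij_betwE[OF P] that by auto
  have "(\<Prod>l<k'. (t (P (i + k + l)) * stretch e 0 (y (P (i + k + l)))) ^ nat (u l)) =
   chr k' u (%l. if l < k' then t (P (i + k + l)) else 1) * (\<Prod>l<k'. stretch e 0 (y (P (i + k + l))) ^ nat (u l))" if "u \<in> ?S" for u
   unfolding chr_def prod.distrib[symmetric] using that by (intro prod.cong) (auto simp: unit_orthant power_mult_distrib power_int_def)
  thus "f (coord_mult t y) = model_act i k k' ?S (split_torus (n + k) (i + k) (unit_vec \<circ> P) t) (f y)"
   using n Pn nt Pk
   by (auto simp: f_def model_act_def split_torus_def coord_mult_def stretch_mult chr_unit_vec hom_act_def cong: if_cong)
 qed (use n P hm in auto)
qed

lemma top_group_iso_comp: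
 assumes "h \<in> top_group_iso G H" "F \<in> top_group_iso H K"
 shows "F \<circ> h \<in> top_group_iso G K"
 using assms homeomorphic_map_compose iso_set_trans by (fastforce simp: top_group_iso_def)

lemma openin_product_box:
 fixes V :: "(nat => 'b::metric_space) set"
 assumes "openin (top_of_set S) V" "z \<in> V"
 obtains c where "0 < c" "\<And>y. y \<in> S ==> (\<And>j. j < n ==> dist (y j) (z j) < c) ==> (\<And>j. n \<le> j ==> y j = z j) ==> y \<in> V"
proof -
 obtain T where T: "open T" "V = S \<inter> T" using assms unfolding openin_open by blast
 hence "openin (product_topology (%_. euclidean) (UNIV :: nat set)) T" by (simp add: euclidean_product_topology)
 then obtain X where X: "\<And>j. open (X j)" "z \<in> PiE UNIV X" "PiE UNIV X \<subseteq> T"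
  unfolding openin_product_topology_alt using T assms by force
 have "\<exists>e>0. ball (z j) e \<subseteq> X j" for j using X open_contains_ball by blast
 then obtain e where e: "\<And>j. 0 < e j" "\<And>j. ball (z j) (e j) \<subseteq> X j" by metis
 let ?e = "Min (insert 1 (e ` {..<n}))"
 show ?thesis
 proof (rule that[of ?e])
  fix y assume y: "y \<in> S" "\<And>j. j < n ==> dist (y j) (z j) < ?e" "\<And>j. n \<le> j ==> y j = z j"
  have "dist (y j) (z j) < e j" for j
   using y(2) y(3) e by (cases "j < n") auto
  hence "y \<in> PiE UNIV X" using e by (auto simp: dist_commute subset_iff)
  thus "y \<in> V" using X T y by auto
 qed (use e(1) in auto)
qed

text \<open>A torus-invariant set contains with \<open>y\<close> all points whose coordinates have the same moduli.\<close>

lemma polyannulus_neighbourhood: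
 assumes V: "openin (top_of_set (standard_model n k)) V" "T_invariant (n + k) coord_mult V" and z: "z \<in> V"
 obtains e where "0 < e" "\<And>j. j < n ==> z j = 0 \<or> e \<le> cmod (z j)"
  "polyannulus n k e (%j. cmod (z j)) \<subseteq> V"
proof -
 let ?M = "standard_model n k"
 have VM: "V \<subseteq> ?M" using openin_subset[OF V(1)] by simp
 \<comment> \<open>Coordinates are replaced by their moduli, and by 1 on the circles. Invariance of
   \<open>V\<close> allows this, and closeness of moduli turns into closeness of points.\<close>
 define nr where "nr y j = (if j < n then complex_of_real (cmod (y j)) else 1)" for y :: cvec and j
 have M: "nr y \<in> ?M" for y by (simp add: nr_def standard_model_def)
 have nr: "nr y \<in> V \<longleftrightarrow> y \<in> V" if y: "y \<in> ?M" for y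
 proof -
  let ?t = "%j. if y j = 0 then 1 else sgn (y j)"
  have t: "?t \<in> Torus (n + k)" using y by (auto simp: in_torus_iff standard_model_def norm_sgn)
  have u: "y j \<noteq> 0" "sgn (y j) = y j" if "n \<le> j" for j
   using y that by (cases "j < n + k"; force simp: standard_model_def sgn_eq)+
  have "coord_mult ?t (nr y) = y" using u by (auto simp: coord_mult_def nr_def sgn_eq)
  moreover have "coord_mult (%j. inverse (?t j)) y = nr y" using u by (auto simp: coord_mult_def nr_def sgn_eq)
  ultimately show ?thesis using V t torus_inverse unfolding T_invariant_def by metis
 qed
 obtain d where d: "0 < d" "\<And>y. y \<in> ?M ==> (\<And>j. j < n ==> dist (y j) (nr z j) < d) ==> (\<And>j. n \<le> j ==> y j = nr z j) ==> y \<in> V"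
  using openin_product_box[OF V(1), of "nr z" n] nr z VM by blast
 let ?e = "Min (insert d ((%j. cmod (z j)) ` {j. j < n \<and> z j \<noteq> 0}))"
 show ?thesis
 proof (rule that[of ?e])
  show "polyannulus n k ?e (%j. cmod (z j)) \<subseteq> V"
  proof
   fix y assume y: "y \<in> polyannulus n k ?e (%j. cmod (z j))"
   have "nr y \<in> V"
    using y by (intro d M) (auto simp: polyannulus_def nr_def dist_norm of_real_diff[symmetric] simp del: of_real_diff)
   thus "y \<in> V" using nr y by (simp add: polyannulus_def)
  qed
  show "z j = 0 \<or> ?e \<le> cmod (z j)" if "j < n" for j using that by cases (auto)
 qed (use d(1) in auto)
qed

text \<open>The given local homeomorphism is restricted to the preimage of a polyannulus about the
  image of \<open>x\<close>; the automorphism of the torus in the weak equivariance is absorbed into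
  the splitting.\<close>

lemma locally_modelled_chart:
 assumes U: "openin X U" "x \<in> U" "T_invariant (n + k) act U"
  and V: "openin (top_of_set (standard_model n k)) V" "T_invariant (n + k) coord_mult V"
  and h: "homeomorphic_map (subtopology X U) (subtopology (top_of_set (standard_model n k)) V) h"
  and w: "weakly_equivariant (n + k) act coord_mult U h"
 shows "charted n (n + k) X act x"
proof -
 let ?T = "Torus (n + k)" and ?M = "standard_model n k" and ?c = "%j. cmod (h x j)"
 obtain p where p: "p \<in> top_group_iso (torus (n + k)) (torus (n + k))"
  and heq: "\<And>t y. t \<in> ?T ==> y \<in> U ==> h (act t y) = coord_mult (p t) (h y)"
  using w unfolding weakly_equivariant_def by blast
 have pT: "p t \<in> ?T" if "t \<in> ?T" for t using bij_betwE[OF top_group_isoD(3)[OF p]] that by blast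
 have VM: "V \<subseteq> ?M" using openin_subset[OF V(1)] by simp
 have hV: "h ` U = V" using homeomorphic_imp_surjective_map[OF h] openin_subset[OF U(1)] VM by auto
 have hx: "h x \<in> V" using hV U by blast
 obtain e where e: "0 < e" "\<And>j. j < n ==> h x j = 0 \<or> e \<le> ?c j" "polyannulus n k e ?c \<subseteq> V"
  using polyannulus_neighbourhood[OF V hx] by blast
 let ?B = "polyannulus n k e ?c"
 obtain i P f where i: "i \<le> n" and P: "bij_betw P {..<n + k} {..<n + k}"
  and f: "homeomorphic_map (top_of_set ?B) (model_top i k (csg (n - i) (unit_vec ` {..<n - i}))) f"
   "\<And>y. y \<in> ?B ==> (\<And>j. j < n ==> ?c j = 0 ==> y j = 0) ==> snd (f y) = apex (csg (n - i) (unit_vec ` {..<n - i}))"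
   "\<And>t y. t \<in> ?T ==> y \<in> ?B ==> f (coord_mult t y) =
    model_act i k (n - i) (csg (n - i) (unit_vec ` {..<n - i})) (split_torus (n + k) (i + k) (unit_vec \<circ> P) t) (f y)"
  by (rule polyannulus_chart[OF e(1), of n ?c k]) (use e in auto)
 define U' where "U' = {y \<in> U. h y \<in> ?B}"
 have "openin (top_of_set ?M) ?B"
 proof -
  have "open (\<Inter>j\<in>{..<n}. {y :: cvec. \<bar>cmod (y j) - ?c j\<bar> < e})"
   by (intro ballI open_Collect_less continuous_intros) auto
  moreover have "?B = ?M \<inter> (\<Inter>j\<in>{..<n}. {y. \<bar>cmod (y j) - ?c j\<bar> < e})" by (auto simp: polyannulus_def)
  ultimately show ?thesis by auto
 qed
 hence "openin (subtopology (top_of_set ?M) V) ?B" using openin_subtopology_Int2 e by (metis Int_absorb1)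
 from openin_continuous_map_preimage[OF homeomorphic_imp_continuous_map[OF h] this]
 have U': "openin X U'" using openin_subset[OF U(1)] U(1) openin_trans_full by (auto simp: U'_def Int_absorb1 Collect_conj_eq)
 have "h ` (topspace (subtopology X U) \<inter> U') = topspace (subtopology (top_of_set ?M) V) \<inter> ?B"
  using hV VM openin_subset[OF U(1)] by (auto simp: U'_def)
 hence "homeomorphic_map (subtopology X U') (top_of_set ?B) h"
  using homeomorphic_map_subtopologies[OF h] e VM
  by (simp add: subtopology_subtopology Int_absorb1 U'_def Collect_conj_eq) (metis Int_absorb1 Int_lower1)
 from homeomorphic_map_compose[OF this f(1)]
 have hom: "homeomorphic_map (subtopology X U') (model_top i k (csg (n - i) (unit_vec ` {..<n - i}))) (f \<circ> h)" .
 have "coord_mult t y \<in> ?B" if "t \<in> ?T" "y \<in> ?B" for t y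
  using that by (auto simp: polyannulus_def standard_model_def coord_mult_def in_torus_iff norm_mult)
 hence inv: "act t y \<in> U'" if "t \<in> ?T" "y \<in> U'" for t y
  using that U heq pT by (simp add: U'_def T_invariant_def)
 have xB: "h x \<in> ?B" using hx VM e by (auto simp: polyannulus_def)
 have "toric_chart n (n + k) X act x i (unit_vec ` {..<n - i}) U'
  (split_torus (n + k) (i + k) (unit_vec \<circ> P) \<circ> p) (f \<circ> h)"
  unfolding toric_chart_def T_invariant_def
  using i toric_cone_unit U' U xB inv hom f(2) heq f(3)[OF pT]
   top_group_iso_comp[OF p split_torus_iso[OF unimod_permute[OF unimod_unit P], of "i + k"]]
  by (auto simp: U'_def)
 thus ?thesis by blast
qed

lemma locally_modelled_toric_like:
 assumes "locally_modelled n k X A act" "torus_action (n + k) X act" "compact_space X" "Hausdorff_space X"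
  "second_countable X" "topspace X \<noteq> {}"
 shows "toric_like n (n + k) X act"
proof -
 have "charted n (n + k) X act x" if x: "x \<in> topspace X" for x
  using assms x locally_modelled_chart unfolding locally_modelled_def diffeo_on_def by metis
 thus ?thesis using assms by (simp add: toric_like_def)
qed

text \<open>The orbit map of a compact group is closed with compact fibres, so compactness descends from the polytope.\<close>

lemma compact_over_polytope:
 assumes act: "torus_action (n + k) X act" and H: "Hausdorff_space X" and P: "simple_polytope n P"
  and o: "orbit_space_polytope n k X act P"
 shows "compact_space X \<and> topspace X \<noteq> {}"
proof -
 let ?T = "Torus (n + k)"
 obtain r where q: "quotient_map X (top_of_set P) r"
  and fib: "\<And>x y. x \<in> topspace X ==> y \<in> topspace X ==> r x = r y \<longleftrightarrow> y \<in> T_orbit (n + k) act x"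
  using o unfolding orbit_space_polytope_def by blast
 have poly: "polytope P" "P \<noteq> {}" using P by (auto simp: simple_polytope_def)
 have sur: "r ` topspace X = P" using quotient_imp_surjective_map[OF q] by simp
 have orb: "{y \<in> topspace X. r y = r x} = (%t. act t x) ` ?T" if "x \<in> topspace X" for x
  using fib[OF that] torus_action_closed[OF act _ that] unfolding orbit_conv_image by force
 have Tc: "compact_space (torus_top (n + k))" using compact_torus by (simp add: compact_space_subtopology)
 have "proper_map X (top_of_set P) r"
  unfolding proper_map_def closed_map_def
 proof (intro conjI allI impI ballI)
  fix C assume C: "closedin X C"
  have CX: "C \<subseteq> topspace X" using closedin_subset[OF C] .
  \<comment> \<open>The pairs \<open>(t, x)\<close> with \<open>act t x\<close> in \<open>C\<close>;
    projecting along the compact torus gives the saturation of \<open>C\<close>, which is therefore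
    closed.\<close>
  let ?R = "{p \<in> topspace (prod_topology (torus_top (n + k)) X). (%(t, x). act t x) p \<in> C}"
  have "closedin (prod_topology (torus_top (n + k)) X) ?R"
   using closedin_continuous_map_preimage[OF torus_action_continuous[OF act] C] .
  hence "closedin X (snd ` ?R)" using closed_map_snd[OF Tc] by (auto simp: closed_map_def)
  moreover have "snd ` ?R = {x \<in> topspace X. r x \<in> r ` C}"
  proof (intro equalityI subsetI)
   fix x assume "x \<in> snd ` ?R"
   then obtain t where t: "t \<in> ?T" "x \<in> topspace X" "act t x \<in> C" by auto
   hence "r (act t x) = r x" using orb by blast
   thus "x \<in> {x \<in> topspace X. r x \<in> r ` C}" using t imageI[OF t(3), of r] by simp
  next
   fix x assume "x \<in> {x \<in> topspace X. r x \<in> r ` C}"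
   then obtain y where "y \<in> C" "r y = r x" "x \<in> topspace X" by auto
   moreover from this obtain t where "t \<in> ?T" "y = act t x" using orb CX by blast
   ultimately show "x \<in> snd ` ?R" by force
  qed
  ultimately have "closedin X {x \<in> topspace X. r x \<in> r ` C}" by simp
  moreover have "r ` C \<subseteq> P" using CX sur by blast
  ultimately show "closedin (top_of_set P) (r ` C)" using q unfolding quotient_map_closedin by simp
 next
  fix p assume "p \<in> topspace (top_of_set P)"
  then obtain x where x: "x \<in> topspace X" "r x = p" using sur by auto
  have "continuous_map (torus_top (n + k)) X (%t. act t x)"
   using torus_action_continuous_compose[OF act continuous_map_id[unfolded id_def]] x by simp
  thus "compactin X {y \<in> topspace X. r y = p}" using image_compactin Tc orb[OF x(1)] x(2) by (metis compact_space_def topspace_euclidean_subtopology)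
 qed
 hence "compact_space X"
  by (rule compact_space_proper_map_preimage) (use sur poly in \<open>auto simp: compact_space_subtopology polytope_imp_compact\<close>)
 thus ?thesis using sur poly by auto
qed

section \<open>Rational cones and separation\<close>

definition embed :: "nat => (nat => 'a::euclidean_space) => ivec => 'a"
 where "embed n e u = (\<Sum>i<n. of_int (u i) *\<^sub>R e i)"

lemma cone_hull_minimal: "convex_cone C ==> (\<And>g. g \<in> G ==> g \<in> C) ==> x \<in> convex_cone hull G ==> x \<in> C"
 using hull_minimal[of G C convex_cone] by auto

lemma embed_add: "embed n e (u + v) = embed n e u + embed n e v"
 by (simp add: embed_def scaleR_add_left sum.distrib)

lemma frame_inner: "coordinate_frame n e ==> i < n ==> j < n ==> inner (e i) (e j) = (if i = j then 1 else 0)"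
 unfolding coordinate_frame_def by (metis image_subset_iff inj_on_eq_iff inner_Basis lessThan_iff)

lemma span_frame:
 assumes "coordinate_frame n e" "x \<in> span (e ` {..<n})"
 shows "x = (\<Sum>i<n. inner x (e i) *\<^sub>R e i)"
 using assms(2)
proof (induction rule: span_induct)
 case base
 show ?case
  by (simp add: subspace_def inner_left_distrib scaleR_add_left sum.distrib)
   (metis (no_types, lifting) scaleR_scaleR scaleR_sum_right sum.cong)
next
 case (step x)
 thus ?case using frame_inner[OF assms(1)] by (auto simp: if_distrib[of "%c. c *\<^sub>R _"] cong: if_cong)
qed

lemma inner_embed: "coordinate_frame n e ==> i < n ==> inner (embed n e u) (e i) = of_int (u i)"
 using frame_inner[of n e] by (simp add: embed_def inner_sum_left if_distrib[of "%c. _ * c"] cong: if_cong)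

lemma inner_embed_embed: "coordinate_frame n e ==> inner (embed n e u) (embed n e v) = of_int (dot n u v)"
 unfolding embed_def[of n e v] by (simp add: inner_sum_right inner_embed dot_def mult.commute)

lemma embed_span: "embed n e u \<in> span (e ` {..<n})"
 unfolding embed_def by (intro span_sum span_mul span_base) auto

lemma lattice_points_eq:
 assumes "coordinate_frame n e"
 shows "lattice_points n e = embed n e ` lat n"
proof (intro equalityI subsetI)
 fix x assume x: "x \<in> lattice_points n e"
 let ?u = "%i. if i < n then \<lfloor>inner x (e i)\<rfloor> else 0"
 have "x = embed n e ?u" using x x span_frame[OF assms, of x] unfolding embed_def lattice_points_def by (simp add: lattice_points_def)
 thus "x \<in> embed n e ` lat n" by (auto simp: lat_def)
qed (use inner_embed[OF assms] embed_span in \<open>auto simp: lattice_points_def\<close>)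

lemma lattice_points_combination:
 assumes "coordinate_frame n e" "g \<in> lattice_points n e" "h \<in> lattice_points n e" "h' \<in> lattice_points n e"
 shows "inner g h *\<^sub>R h' - inner g h' *\<^sub>R h \<in> lattice_points n e"
proof -
 obtain u v v' where [simp]: "g = embed n e u" "h = embed n e v" "h' = embed n e v'" and l: "v \<in> lat n" "v' \<in> lat n"
  using assms unfolding lattice_points_eq[OF assms(1)] by blast
 have "inner g h *\<^sub>R h' - inner g h' *\<^sub>R h = embed n e ((%i. dot n u v * v' i) - (%i. dot n u v' * v i))"
  by (simp add: inner_embed_embed[OF assms(1)]) (simp add: embed_def scaleR_left_diff_distrib sum_subtractf scaleR_sum_right)
 thus ?thesis using l unfolding lattice_points_eq[OF assms(1)] by simp
qed

text \<open>Fourier-Motzkin elimination on generators: those on the non-negative side are kept, and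
  each pair of a positive and a negative generator contributes its combination on the hyperplane.
  The coefficients are integers, so rationality is preserved.\<close>

lemma rational_cone_Int_halfspace:
 assumes e: "coordinate_frame n e" and \<sigma>: "rational_cone n e \<sigma>" and g: "g \<in> lattice_points n e"
 shows "rational_cone n e {x \<in> \<sigma>. 0 \<le> inner g x}"
proof -
 obtain G where G: "finite G" "G \<subseteq> lattice_points n e" "\<sigma> = convex_cone hull G" using \<sigma> by (auto simp: rational_cone_def)
 define A where "A s = {h \<in> G. sgn (inner g h) = s}" for s :: real
 let ?f = "%p m. inner g p *\<^sub>R m - inner g m *\<^sub>R p"
 define H where "H = A 0 \<union> A 1 \<union> (%(p, m). ?f p m) ` (A 1 \<times> A (- 1))"
 have "G = A 0 \<union> (A 1 \<union> A (- 1))" by (auto simp: A_def sgn_if)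
 hence sumx: "\<exists>z p m. x = z + (p + m) \<and> z \<in> convex_cone hull A 0 \<and> p \<in> convex_cone hull A 1 \<and> m \<in> convex_cone hull A (- 1)"
  if "x \<in> \<sigma>" for x using that unfolding G by (force simp: convex_cone_hull_Un)
 have "H \<subseteq> {x \<in> \<sigma>. 0 \<le> inner g x}"
 proof -
  have "inner g p *\<^sub>R m + (- inner g m) *\<^sub>R p \<in> \<sigma>" if "p \<in> A 1" "m \<in> A (- 1)" for p m
   unfolding G by (intro convex_cone_hull_add convex_cone_hull_mul hull_inc) (use that in \<open>auto simp: A_def sgn_if split: if_splits\<close>)
  thus ?thesis using hull_inc unfolding G
   by (auto simp: H_def A_def inner_diff_right sgn_if)
 qed
 moreover have "convex_cone {x \<in> \<sigma>. 0 \<le> inner g x}"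
  using convex_cone_convex_cone_hull convex_cone_halfspace_ge[of g] unfolding G convex_cone_iff by blast
 ultimately have 1: "convex_cone hull H \<subseteq> {x \<in> \<sigma>. 0 \<le> inner g x}" by (rule hull_minimal)
 \<comment> \<open>Both sets are convex cones, so that membership of \<open>?f p m\<close> in the
   new cone can be reduced to generators, one argument at a time.\<close>
 have cc: "convex_cone {m. inner g p *\<^sub>R m - inner g m *\<^sub>R p \<in> convex_cone hull H}"
  "convex_cone {m. inner g m *\<^sub>R p - inner g p *\<^sub>R m \<in> convex_cone hull H}" for p
 proof -
  have "inner g p *\<^sub>R (m + m') - inner g (m + m') *\<^sub>R p = ?f p m + ?f p m'" "inner g (m + m') *\<^sub>R p - inner g p *\<^sub>R (m + m') = ?f m p + ?f m' p"
   "inner g p *\<^sub>R (c *\<^sub>R m) - inner g (c *\<^sub>R m) *\<^sub>R p = c *\<^sub>R ?f p m" "inner g (c *\<^sub>R m) *\<^sub>R p - inner g p *\<^sub>R (c *\<^sub>R m) = c *\<^sub>R ?f m p" for m m' c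
   by (simp_all add: algebra_simps)
  thus "convex_cone {m. inner g p *\<^sub>R m - inner g m *\<^sub>R p \<in> convex_cone hull H}"
   "convex_cone {m. inner g m *\<^sub>R p - inner g p *\<^sub>R m \<in> convex_cone hull H}"
   by (auto simp: convex_cone_iff convex_cone_hull_contains_0 intro!: convex_cone_hull_add convex_cone_hull_mul)
 qed
 have "?f p m \<in> convex_cone hull H" if "p \<in> convex_cone hull A 1" "m \<in> convex_cone hull A (- 1)" for p m
 proof -
  have "m \<in> {m. ?f p m \<in> convex_cone hull H}" if "p \<in> A 1" for p
   by (rule cone_hull_minimal[OF cc(1) _ \<open>m \<in> _\<close>]) (use that in \<open>force simp: H_def intro: hull_inc\<close>)
  hence "p \<in> {p. ?f p m \<in> convex_cone hull H}" by (intro cone_hull_minimal[OF cc(2) _ that(1)]) auto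
  thus ?thesis by simp
 qed
 note key = this
 have AH: "convex_cone hull A 0 \<subseteq> convex_cone hull H" "convex_cone hull A 1 \<subseteq> convex_cone hull H"
  by (rule hull_mono; auto simp: H_def)+
 have z0: "inner g z = 0" if "z \<in> convex_cone hull A 0" for z
  using cone_hull_minimal[of "{x. inner g x = 0}", OF _ _ that] by (auto simp: convex_cone_iff inner_add_right A_def sgn_0_0)
 have pm: "p = 0 \<or> 0 < s * inner g p" if "p \<in> convex_cone hull A s" "s = 1 \<or> s = - 1" for p s
 proof -
  have "c *\<^sub>R q = 0 \<or> 0 < s * inner g (c *\<^sub>R q)" if "0 < s * inner g q" "0 \<le> c" for c q
   using that by cases (auto simp: mult.left_commute)
  hence "convex_cone {p. p = 0 \<or> 0 < s * inner g p}"
   by (auto simp: convex_cone_iff inner_add_right distrib_left)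
  moreover have "q \<in> {p. p = 0 \<or> 0 < s * inner g p}" if "q \<in> A s" for q
   using that \<open>s = 1 \<or> s = - 1\<close> by (auto simp: A_def sgn_if split: if_splits)
  ultimately show ?thesis using cone_hull_minimal[OF _ _ that(1)] by blast
 qed
 have 2: "x \<in> convex_cone hull H" if x: "x \<in> \<sigma>" "0 \<le> inner g x" for x
 proof -
  obtain z p m where s: "x = z + (p + m)" "z \<in> convex_cone hull A 0" "p \<in> convex_cone hull A 1" "m \<in> convex_cone hull A (- 1)"
   using sumx[OF x(1)] by blast
  have gx: "0 \<le> inner g p + inner g m" using x s z0 by (simp add: inner_add_right)
  show ?thesis
  proof (cases "inner g p = 0")
   case True
   thus ?thesis using pm[OF s(3)] pm[OF s(4)] gx s AH by auto
  next
   case False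
   hence pos: "0 < inner g p" using pm[OF s(3)] by auto
   have c: "0 \<le> 1 + inner g m / inner g p" using gx pos by (simp add: field_simps)
   \<comment> \<open>Part of \<open>p\<close> is spent on compensating \<open>m\<close>; the
     multiple of \<open>p\<close> that remains is non-negative because \<open>x\<close> lies in the
     half space.\<close>
   have "x = z + ((1 + inner g m / inner g p) *\<^sub>R p + (1 / inner g p) *\<^sub>R ?f p m)" using pos s(1) by (simp add: scaleR_diff_right scaleR_add_left)
   moreover have "\<dots> \<in> convex_cone hull H"
    using s AH key c pos by (intro convex_cone_hull_add convex_cone_hull_mul) auto
   ultimately show ?thesis by simp
  qed
 qed
 have "H \<subseteq> lattice_points n e" using G lattice_points_combination[OF e g] by (auto simp: H_def A_def)
 moreover have "finite H" using G by (auto simp: H_def A_def)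
 ultimately show ?thesis unfolding rational_cone_def using 1 2 by auto
qed

text \<open>The span is itself generated as a cone by the frame vectors and their negatives, and
  each element of \<open>G\<close> cuts it by one half space.\<close>

lemma rational_dual_cone:
 assumes e: "coordinate_frame n e" and G: "finite G" "G \<subseteq> lattice_points n e"
 shows "rational_cone n e {x \<in> span (e ` {..<n}). \<forall>g\<in>G. 0 \<le> inner g x}"
 using G
proof (induction G)
 case empty
 let ?B = "e ` {..<n} \<union> uminus ` e ` {..<n}"
 have unit: "e i = embed n e (unit_vec i)" if "i < n" for i
  using that by (simp add: embed_def unit_vec_def if_distrib[of "%c. of_int c *\<^sub>R _"] cong: if_cong)
 have neg: "- e i = embed n e (- unit_vec i)" if "i < n" for i
  using unit[OF that] by (simp add: embed_def sum_negf)
 have "x \<in> convex_cone hull ?B" if x: "x \<in> span (e ` {..<n})" for x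
 proof -
  have "convex_cone hull ?B \<subseteq> uminus -` (convex_cone hull ?B)"
  proof (rule hull_minimal)
   show "convex_cone (uminus -` (convex_cone hull ?B))"
    using convex_cone_hull_contains_0 convex_cone_hull_add[of _ ?B] convex_cone_hull_mul[of _ ?B]
    by (force simp: convex_cone_iff scaleR_minus_right[symmetric] simp del: scaleR_minus_right)
  qed (auto intro!: hull_inc)
  hence "subspace (convex_cone hull ?B)"
   using subspace_convex_cone_symmetric convex_cone_convex_cone_hull by blast
  thus ?thesis using span_minimal x hull_subset[of ?B convex_cone] by auto
 qed
 moreover have "convex_cone hull ?B \<subseteq> span (e ` {..<n})"
  by (rule hull_minimal) (auto simp: convex_cone_span intro: span_base span_neg)
 moreover have "?B \<subseteq> lattice_points n e"
  unfolding lattice_points_eq[OF e] using unit neg unit_vec_in_lat by auto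
 ultimately show ?case unfolding rational_cone_def by (intro exI[of _ ?B]) auto
next
 case (insert g G)
 have "{x \<in> span (e ` {..<n}). \<forall>h\<in>insert g G. 0 \<le> inner h x} = {x \<in> {x \<in> span (e ` {..<n}). \<forall>g\<in>G. 0 \<le> inner g x}. 0 \<le> inner g x}" by auto
 thus ?case using rational_cone_Int_halfspace[OF e insert.IH, of g] insert.prems by simp
qed

text \<open>The dual of \<open>\<sigma> - \<tau>\<close> is finitely generated; the sum of its generators separates, because a point of \<open>\<sigma>\<close>
 annihilated by the whole dual cone has its negative in \<open>\<sigma> - \<tau>\<close>.\<close>

lemma rational_cone_separation:
 fixes e :: "nat => 'a::euclidean_space"
 assumes e: "coordinate_frame n e" and r: "rational_cone n e \<sigma>" "rational_cone n e \<tau>"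
  and f: "\<sigma> \<inter> \<tau> face_of \<sigma>" "\<sigma> \<inter> \<tau> face_of \<tau>"
 shows "\<exists>w\<in>lattice_points n e. (\<forall>x\<in>\<sigma>. 0 \<le> inner w x \<and> (inner w x = 0 --> x \<in> \<tau>)) \<and>
  (\<forall>x\<in>\<tau>. inner w x \<le> 0 \<and> (inner w x = 0 --> x \<in> \<sigma>))"
proof -
 let ?V = "span (e ` {..<n})"
 obtain G H where G: "finite G" "G \<subseteq> lattice_points n e" "\<sigma> = convex_cone hull G"
  and H: "finite H" "H \<subseteq> lattice_points n e" "\<tau> = convex_cone hull H" using r by (auto simp: rational_cone_def)
 define B where "B = G \<union> uminus ` H"
 define D where "D = {x \<in> ?V. \<forall>g\<in>B. 0 \<le> inner g x}"
 have lneg: "- x \<in> lattice_points n e" if "x \<in> lattice_points n e" for x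
  using that span_neg by (auto simp: lattice_points_def)
 have lV: "x \<in> ?V" if "x \<in> lattice_points n e" for x using that by (simp add: lattice_points_def)
 have BV: "B \<subseteq> lattice_points n e" "finite B" using G H lneg by (auto simp: B_def)
 obtain U where U: "finite U" "U \<subseteq> lattice_points n e" "D = convex_cone hull U"
  using rational_dual_cone[OF e BV(2,1)] unfolding D_def by (auto simp: rational_cone_def)
 define w where "w = \<Sum>U"
 have w: "w \<in> lattice_points n e"
  using U span_sum[of U "%x. x"] by (auto simp: w_def lattice_points_def inner_sum_left)
 have UD: "u \<in> D" if "u \<in> U" for u using U hull_inc[OF that] by simp
 have s0: "0 \<le> inner u x" if "u \<in> U" "x \<in> \<sigma>" for u x
  using cone_hull_minimal[OF convex_cone_halfspace_ge[of u] _ that(2)[unfolded G(3)]] UD[OF that(1)]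
  by (auto simp: D_def B_def inner_commute)
 have t0: "inner u x \<le> 0" if "u \<in> U" "x \<in> \<tau>" for u x
 proof -
  have "0 \<le> inner (- g) u" if "g \<in> H" for g using UD[OF \<open>u \<in> U\<close>] that unfolding D_def B_def by blast
  thus ?thesis
   using cone_hull_minimal[OF convex_cone_halfspace_le[of u] _ that(2)[unfolded H(3)]] by (auto simp: inner_commute)
 qed
 \<comment> \<open>A bipolar argument: were \<open>x\<close> outside the closed cone on
   \<open>B\<close>, a hyperplane separating it would define an element of the dual cone with
   negative pairing, although all generators of that cone annihilate \<open>x\<close>.\<close>
 have diff: "\<exists>s\<in>\<sigma>. \<exists>t\<in>\<tau>. x = s - t" if x: "x \<in> ?V" "\<And>u. u \<in> U ==> inner u x = 0" for x
 proof -
  have "x \<in> convex_cone hull B"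
  proof (rule ccontr)
   assume "x \<notin> convex_cone hull B"
   then obtain a b where ab: "inner a x < b" "\<And>y. y \<in> convex_cone hull B ==> b < inner a y"
    using separating_hyperplane_closed_point[OF convex_convex_cone_hull closed_convex_cone_hull[OF BV(2)]] by blast
   have b0: "b < 0" using ab(2)[OF convex_cone_hull_contains_0] by simp
   have pos: "0 \<le> inner a y" if "y \<in> convex_cone hull B" for y
   proof (rule ccontr)
    assume neg: "\<not> 0 \<le> inner a y"
    hence "0 \<le> b / inner a y" using b0 by (simp add: divide_nonpos_neg)
    from ab(2)[OF convex_cone_hull_mul[OF that this]] show False using neg by simp
   qed
   \<comment> \<open>The separating vector is projected to the span, which does not change its
     pairings there.\<close>
   define a' where "a' = (\<Sum>i<n. inner a (e i) *\<^sub>R e i)"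
   have a': "inner a' y = inner a y" if "y \<in> ?V" for y
    using arg_cong[OF span_frame[OF e that], of "inner a"] by (simp add: a'_def inner_sum_right inner_commute mult.commute)
   have "a' \<in> ?V" unfolding a'_def by (intro span_sum span_mul span_base) auto
   hence "a' \<in> convex_cone hull U" using a' pos lV BV(1) hull_inc[of _ B convex_cone] U(3) unfolding D_def by (auto simp: inner_commute[of _ a'] subset_iff)
   thus False using cone_hull_minimal[of "{u. inner u x = 0}" U a'] x(2) a'[OF x(1)] ab(1) b0 by (auto simp: convex_cone_iff inner_add_left)
  qed
  moreover have "convex_cone hull (uminus ` H) \<subseteq> uminus ` \<tau>"
   using convex_cone_linear_image[of \<tau> uminus] convex_cone_convex_cone_hull hull_inc[of _ H convex_cone]
   by (intro hull_minimal) (auto simp: H linear_uminus)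
  ultimately show ?thesis unfolding B_def convex_cone_hull_Un G(3) by fastforce
 qed
 have sum0: "inner u x = 0" if "u \<in> U" "inner w x = 0" "(\<forall>u\<in>U. 0 \<le> inner u x) \<or> (\<forall>u\<in>U. inner u x \<le> 0)" for u x
 proof -
  have "(\<Sum>u\<in>U. inner u x) = 0" "(\<Sum>u\<in>U. - inner u x) = 0" using that by (simp_all add: w_def inner_sum_left sum_negf)
  with that(3) show ?thesis using sum_nonneg_eq_0_iff[OF U(1), of "%u. inner u x"] sum_nonneg_eq_0_iff[OF U(1), of "%u. - inner u x"] that(1) by (elim disjE) simp_all
 qed
 have cone: "convex_cone \<sigma>" "convex_cone \<tau>" by (simp_all add: G H convex_cone_convex_cone_hull)
 have V: "x \<in> ?V" if "x \<in> \<sigma> \<or> x \<in> \<tau>" for x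
  using that cone_hull_minimal[OF convex_cone_span, of G] cone_hull_minimal[OF convex_cone_span, of H] G H lV by blast
 \<comment> \<open>A summand of an element of a face lies in the face, because the midpoint of the
   two summands is interior to their segment unless they coincide.\<close>
 have face: "x \<in> F" if "F face_of S" "convex_cone F" "convex_cone S" "x \<in> S" "y \<in> S" "x + y \<in> F" for F S x and y :: 'a
 proof -
  have h: "(1 / 2) *\<^sub>R (x + y) \<in> F" using convex_cone_scaleR[OF that(2) _ that(6), of "1 / 2"] by simp
  show ?thesis
  proof (cases "x = y")
   case True
   thus ?thesis using h by simp
  next
   case False
   hence "midpoint x y \<in> open_segment x y" by simp
   thus ?thesis using that h unfolding face_of_def midpoint_def by auto
  qed
 qed
 have cF: "convex_cone (\<sigma> \<inter> \<tau>)" using convex_cone_Inter[of "{\<sigma>, \<tau>}"] cone by auto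
 show ?thesis
 proof (intro bexI[OF _ w] conjI ballI impI)
  fix x assume x: "x \<in> \<sigma>"
  show "0 \<le> inner w x" using s0 x by (auto simp: w_def inner_sum_left intro!: sum_nonneg)
  assume "inner w x = 0"
  hence "inner u (- x) = 0" if "u \<in> U" for u using sum0[OF that, of x] s0 x by simp
  then obtain s t where st: "s \<in> \<sigma>" "t \<in> \<tau>" "- x = s - t" using diff V x span_neg by blast
  hence "x + s = t" by (metis diff_add_cancel minus_diff_eq uminus_add_conv_diff)
  thus "x \<in> \<tau>" using st x convex_cone_add[OF cone(1)] face[OF f(1) cF cone(1) x st(1)] by blast
 next
  fix x assume x: "x \<in> \<tau>"
  show "inner w x \<le> 0" using t0 x by (auto simp: w_def inner_sum_left intro!: sum_nonpos)
  assume "inner w x = 0"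
  hence "inner u x = 0" if "u \<in> U" for u using sum0[OF that, of x] t0 x by simp
  then obtain s t where st: "s \<in> \<sigma>" "t \<in> \<tau>" "x = s - t" using diff V x by blast
  thus "x \<in> \<sigma>" using x convex_cone_add[OF cone(2) x st(2)] face[OF f(2) cF cone(2) x st(2)] by auto
 qed
qed

section \<open>Gluing affine toric varieties\<close>

text \<open>In a localization centred at \<open>y\<close> the non-zero values are monomials, so
  their logarithmic moduli are linear in \<open>c\<close>. The sign is chosen so that a non-zero
  value is bounded by 1 exactly where the pairing with \<open>x\<close> is non-negative.\<close>

lemma hom_modulus_face:
 assumes G: "finite G" and y: "y \<in> hom_pts (csg k G)"
 shows "\<exists>H x. H \<subseteq> G \<and> (\<forall>c\<in>csg k G. (y c \<noteq> 0 \<longleftrightarrow> (\<forall>h\<in>H. dot k c h = 0)) \<and>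
  (y c \<noteq> 0 --> cmod (y c) = exp (- (\<Sum>i<k. of_int (c i) * x i))))"
proof -
 obtain H w b b' a where "localization k G H w b b' a" and yw: "y w \<noteq> 0"
  and F: "\<And>u h. u \<in> csg k G ==> y u \<noteq> 0 ==> h \<in> H ==> dot k u h = 0"
  using localization_at_point[OF G y] by metis
 then interpret L: localization k G H w b b' a by simp
 have yo: "y \<in> L.opn" using y yw by (simp add: L.opn_def)
 define z where "z = fst (L.loc y)"
 have z: "z \<in> Cstar_power a" using L.loc_in[OF yo] by (simp add: z_def)
 have loc: "L.loc y = (z, apex L.S')" using L.loc_apex[OF yo F] by (simp add: z_def prod_eq_iff)
 have zn: "z j \<noteq> 0" if "j < a" for j using z that by (auto simp: in_Cstar_power_iff)
 have yc: "y c = (if \<forall>h\<in>H. dot k c h = 0 then \<Prod>j<a. z j powi dot k c (b' j) else 0)" if c: "c \<in> csg k G" for c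
 proof (cases "\<forall>h\<in>H. dot k c h = 0")
  case True
  hence "L.proj c = 0" using L.kernel c by (auto simp: L.proj_def csg_def)
  moreover have "y c = L.unext z (apex L.S') c" using L.unloc_loc[OF yo] c loc by (auto simp: L.unloc_def)
  ultimately show ?thesis using True by (simp add: L.unext_def apex_def csg_closed)
 qed (use F[OF c] in auto)
 have "(\<Prod>j<a. z j powi dot k c (b' j)) \<noteq> 0" for c using zn by simp
 hence 1: "y c \<noteq> 0 \<longleftrightarrow> (\<forall>h\<in>H. dot k c h = 0)" if "c \<in> csg k G" for c unfolding yc[OF that] by auto
 have 2: "cmod (y c) = exp (- (\<Sum>i<k. of_int (c i) * (\<Sum>j<a. - ln (cmod (z j)) * of_int (b' j i))))"
  if c: "c \<in> csg k G" "y c \<noteq> 0" for c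
 proof -
  have "cmod (z j powi dot k c (b' j)) = exp (of_int (dot k c (b' j)) * ln (cmod (z j)))" if "j < a" for j
   using zn[OF that] by (simp add: norm_power_int exp_power_int[symmetric])
  hence "(\<Prod>j<a. cmod (z j powi dot k c (b' j))) = exp (\<Sum>j<a. of_int (dot k c (b' j)) * ln (cmod (z j)))"
   unfolding exp_sum[OF finite_lessThan] by simp
  moreover have "cmod (y c) = (\<Prod>j<a. cmod (z j powi dot k c (b' j)))" using yc[OF c(1)] c by (auto simp: prod_norm split: if_splits)
  ultimately have "cmod (y c) = exp (\<Sum>j<a. of_int (dot k c (b' j)) * ln (cmod (z j)))" by simp
  also have "(\<Sum>j<a. of_int (dot k c (b' j)) * ln (cmod (z j))) = - (\<Sum>i<k. of_int (c i) * (\<Sum>j<a. - ln (cmod (z j)) * of_int (b' j i)))"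
   unfolding dot_def of_int_sum sum_distrib_right sum_distrib_left by (subst sum.swap) (simp add: sum_negf mult_ac)
  finally show ?thesis .
 qed
 show ?thesis
  using L.H_sub 1 2 by (intro exI conjI ballI impI)
qed

text \<open>Here \<open>m = n\<close>, so the circle factor of the model is trivial and the
  localization at the point already has the shape of a chart.\<close>

lemma hom_chart:
 assumes G: "finite G" "\<exists>u\<in>lat n. \<forall>g\<in>G. 0 < dot n u g" and y: "y \<in> hom_pts (csg n G)"
 shows "\<exists>i G' U P f. toric_chart n n (hom_top (csg n G)) (hom_act n (csg n G)) y i G' U P f"
proof -
 obtain H w b b' a where "localization n G H w b b' a" and yw: "y w \<noteq> 0"
  and F: "\<And>u h. u \<in> csg n G ==> y u \<noteq> 0 ==> h \<in> H ==> dot n u h = 0"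
  using localization_at_point[OF G(1) y] by metis
 then interpret L: localization n G H w b b' a by simp
 have yo: "y \<in> L.opn" using y yw by (simp add: L.opn_def)
 let ?X = "subtopology (hom_top L.S) L.opn" and ?Y = "prod_topology (top_of_set (Cstar_power a)) (hom_top L.S')"
 define f where "f \<gamma> = ((fst (L.loc \<gamma>), %_::nat. 1::complex), snd (L.loc \<gamma>))" for \<gamma>
 have one: "u = (%_. 1)" if "u \<in> Torus 0" for u using that by (auto simp: in_torus_iff)
 have h: "homeomorphic_maps ?Y (model_top a 0 L.S') (%p. ((fst p, %_. 1), snd p)) (%p. (fst (fst p), snd p))"
  unfolding homeomorphic_maps_def continuous_map_into_model_iff
  using continuous_map_model_proj one torus_one_closed
  by (auto simp: topspace_model_top continuous_map_fst continuous_map_snd intro!: continuous_map_pairedI)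
 have "homeomorphic_map ?X (model_top a 0 L.S') ((%p. ((fst p, %_. 1), snd p)) \<circ> L.loc)"
  using homeomorphic_map_compose[OF homeomorphic_maps_imp_map[OF L.loc_homeomorphic] homeomorphic_maps_imp_map[OF h]] .
 hence hom: "homeomorphic_map ?X (model_top a 0 L.S') f" by (simp add: f_def[abs_def] o_def)
 have inv: "hom_act n L.S t \<gamma> \<in> L.opn" if "t \<in> Torus n" "\<gamma> \<in> L.opn" for t \<gamma>
  using that L.w hom_act_in_hom_pts chr_nonzero torus_nonzero by (auto simp: L.opn_def hom_act_def)
 have "f (hom_act n L.S t \<gamma>) = model_act a 0 (n - a) L.S' (split_torus n a b t) (f \<gamma>)" if "t \<in> Torus n" "\<gamma> \<in> L.opn" for t \<gamma>
  using L.loc_hom_act[OF that] L.loc_in[OF that(2)] by (auto simp: f_def model_act_def split_torus_def in_Cstar_power_iff)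
 hence "toric_chart n n (hom_top L.S) (hom_act n L.S) y a (L.quot ` H) L.opn (split_torus n a b) f"
  unfolding toric_chart_def T_invariant_def
  using L.toric_cone_quotient[OF G(2)] L.openin_opn yo inv hom L.a_le split_torus_iso[OF L.unimod L.a_le] L.loc_apex[OF yo F]
  by (auto simp: f_def)
 thus ?thesis by blast
qed

lemma toric_chart_open_embedding:
 assumes c: "toric_chart n m Y actY y i G U F f" and j: "continuous_map Y X j" "open_map Y X j" "inj_on j (topspace Y)"
  and y: "y \<in> topspace Y" and eq: "\<And>t y. t \<in> Torus m ==> y \<in> topspace Y ==> j (actY t y) = act t (j y)"
 shows "charted n m X act (j y)"
proof -
 let ?Z = "subtopology X (j ` topspace Y)"
 have o: "openin X (j ` topspace Y)" using j by (simp add: open_map_def)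
 have "embedding_map Y X j" using injective_open_imp_embedding_map[OF j(1,2,3)] .
 then obtain g where g: "homeomorphic_maps Y ?Z j g" using homeomorphic_map_maps unfolding embedding_map_def by blast
 have d: "toric_chart n m ?Z act (j y) i G (j ` U) F (f \<circ> g)"
  by (rule toric_chart_transport[OF c g]) (rule eq)
 hence "toric_chart n m X act (j y) i G (j ` U) F (f \<circ> g)" using openin_subset[of ?Z "j ` U"] d openin_trans_full[OF _ o] by (auto simp: toric_chart_def subtopology_subtopology Int_absorb1)
 thus ?thesis by blast
qed

text \<open>A complete fan reduced to integer data. \<open>D\<close> is the semigroup of the common
  face; \<open>sep\<close> presents it as the localization of one semigroup at a character
  \<open>w\<close> whose inverse lies in the other. \<open>complete\<close> is the dual form of
  covering: each real vector is non-negative on the semigroup of some cone.\<close>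

locale gluing =
 fixes n :: nat and \<Sigma> :: "'i set" and X :: "'x topology" and act :: "'x taction"
  and j :: "'i => mono => 'x" and G :: "'i => ivec set" and D :: "'i => 'i => ivec set"
 assumes fin: "finite \<Sigma>" "\<And>\<sigma>. \<sigma> \<in> \<Sigma> ==> finite (G \<sigma>)" and full: "\<And>\<sigma>. \<sigma> \<in> \<Sigma> ==> \<exists>u\<in>lat n. \<forall>g\<in>G \<sigma>. 0 < dot n u g"
  and act: "torus_action n X act"
  and openin_iff: "\<And>V. V \<subseteq> topspace X ==> openin X V \<longleftrightarrow>
   (\<forall>\<sigma>\<in>\<Sigma>. openin (hom_top (csg n (G \<sigma>))) {\<gamma> \<in> hom_pts (csg n (G \<sigma>)). j \<sigma> \<gamma> \<in> V})"
  and cover: "topspace X = (\<Union>\<sigma>\<in>\<Sigma>. j \<sigma> ` hom_pts (csg n (G \<sigma>)))"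
  and glue: "\<And>\<sigma> \<tau> \<gamma> \<gamma>'. \<sigma> \<in> \<Sigma> ==> \<tau> \<in> \<Sigma> ==> \<gamma> \<in> hom_pts (csg n (G \<sigma>)) ==> \<gamma>' \<in> hom_pts (csg n (G \<tau>)) ==>
   j \<sigma> \<gamma> = j \<tau> \<gamma>' \<longleftrightarrow> (\<exists>\<delta>\<in>hom_pts (D \<sigma> \<tau>). restrict \<delta> (csg n (G \<sigma>)) = \<gamma> \<and> restrict \<delta> (csg n (G \<tau>)) = \<gamma>')"
  and equi: "\<And>t \<sigma> \<gamma>. t \<in> Torus n ==> \<sigma> \<in> \<Sigma> ==> \<gamma> \<in> hom_pts (csg n (G \<sigma>)) ==> j \<sigma> (hom_act n (csg n (G \<sigma>)) t \<gamma>) = act t (j \<sigma> \<gamma>)"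
  and sep: "\<And>\<sigma> \<tau>. \<sigma> \<in> \<Sigma> ==> \<tau> \<in> \<Sigma> ==> \<exists>w. w \<in> csg n (G \<sigma>) \<and> - w \<in> csg n (G \<tau>) \<and> csg n (G \<tau>) \<subseteq> D \<sigma> \<tau> \<and>
   D \<sigma> \<tau> = csg n {g \<in> G \<sigma>. dot n w g = 0}"
  and complete: "\<And>x :: nat => real. \<exists>\<tau>\<in>\<Sigma>. \<forall>u\<in>csg n (G \<tau>). 0 \<le> (\<Sum>i<n. of_int (u i) * x i)"

context gluing
begin

abbreviation S where "S \<sigma> \<equiv> csg n (G \<sigma>)"

text \<open>The transition from chart \<open>s\<close> to chart \<open>t\<close> as a partial map:
  \<open>x\<close> is defined where \<open>w\<close> does not vanish, and \<open>N\<close> records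
  the exponents of the fractions that express it by evaluations.\<close>

definition trans :: "'i => 'i => ivec => _ => _ => bool"
 where "trans s t w x N \<longleftrightarrow> w \<in> S s \<and> - w \<in> S t \<and>
  (\<forall>\<gamma>\<in>hom_pts (S s). \<forall>\<gamma>'\<in>hom_pts (S t). j s \<gamma> = j t \<gamma>' \<longleftrightarrow> \<gamma> w \<noteq> 0 \<and> \<gamma>' = x \<gamma>) \<and>
  continuous_map (subtopology (hom_top (S s)) {\<gamma> \<in> hom_pts (S s). \<gamma> w \<noteq> 0}) (hom_top (S t)) x \<and>
  openin (hom_top (S s)) {\<gamma> \<in> hom_pts (S s). \<gamma> w \<noteq> 0} \<and>
  (\<forall>u\<in>S t. u + (%i. int (N u) * w i) \<in> S s \<and>
   (\<forall>\<gamma>\<in>hom_pts (S s). \<gamma> w \<noteq> 0 --> x \<gamma> u = \<gamma> (u + (%i. int (N u) * w i)) / \<gamma> w ^ N u))"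

lemma transD:
 assumes "trans s t w x N"
 shows "w \<in> S s" "- w \<in> S t"
  "g \<in> hom_pts (S s) ==> g' \<in> hom_pts (S t) ==> j s g = j t g' \<longleftrightarrow> g w \<noteq> 0 \<and> g' = x g"
  "g \<in> hom_pts (S s) ==> g w \<noteq> 0 ==> x g \<in> hom_pts (S t)"
  "u \<in> S t ==> u + (%i. int (N u) * w i) \<in> S s"
  "u \<in> S t ==> g \<in> hom_pts (S s) ==> g w \<noteq> 0 ==> x g u = g (u + (%i. int (N u) * w i)) / g w ^ N u"
 using assms unfolding trans_def by (auto simp: continuous_map_def)

text \<open>A homomorphism on the common semigroup is the unique extension of its restriction to
  \<open>S s\<close>, so the gluing relation is the graph of extending and then restricting to the
  other semigroup.\<close>

lemma transition:
 assumes st: "s \<in> \<Sigma>" "\<tau> \<in> \<Sigma>"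
 shows "\<exists>w \<xi> N. trans s \<tau> w \<xi> N"
proof -
 obtain w where w: "w \<in> S s" "- w \<in> S \<tau>" "S \<tau> \<subseteq> D s \<tau>" and D: "D s \<tau> = csg n {g \<in> G s. dot n w g = 0}"
  using sep[OF st] by blast
 let ?H = "{g \<in> G s. dot n w g = 0}"
 obtain b b' a where b: "unimod n b b'" "a \<le> n" "\<forall>u\<in>lat n. (\<forall>g\<in>?H. dot n u g = 0) \<longleftrightarrow> (\<forall>j<n. a \<le> j --> dot n u (b' j) = 0)"
  using adapted_basis[of ?H n] fin(2)[OF st(1)] by auto
 interpret L: localization n "G s" ?H w b b' a
  by unfold_locales (use b w fin(2)[OF st(1)] in \<open>auto simp: csg_def less_le\<close>)
 have opn: "L.opn = {y \<in> hom_pts (S s). y w \<noteq> 0}" by (simp add: L.opn_def)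
 define N where "N u = nat (\<Sum>g\<in>G s. \<bar>dot n u g\<bar>)" for u
 have \<tau>H: "u \<in> csg n ?H" if "u \<in> S \<tau>" for u using w D that by blast
 have sH: "u \<in> csg n ?H" if "u \<in> S s" for u using L.S_sub that .
 let ?\<xi> = "%y. restrict (L.ext y) (S \<tau>)"
 have ext: "restrict (L.ext y) (csg n ?H) \<in> hom_pts (csg n ?H)" if "y \<in> L.opn" for y
  by (intro hom_ptsI) (simp_all add: L.ext_zero[OF that] L.ext_add[OF that] csg_closed)
 have eq: "j s y = j \<tau> y' \<longleftrightarrow> y w \<noteq> 0 \<and> y' = ?\<xi> y" if g: "y \<in> hom_pts (S s)" "y' \<in> hom_pts (S \<tau>)" for y y'
  unfolding glue[OF st g] D
 proof
  assume "\<exists>d\<in>hom_pts (csg n ?H). restrict d (S s) = y \<and> restrict d (S \<tau>) = y'"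
  then obtain d where d: "d \<in> hom_pts (csg n ?H)" "restrict d (S s) = y" "restrict d (S \<tau>) = y'" by blast
  have w0: "y w \<noteq> 0" using hom_ptsD(1)[OF d(1)] hom_ptsD(2)[OF d(1) sH[OF w(1)] \<tau>H[OF w(2)]] d(2) w(1) by auto
  have "L.ext y u = d u" if "u \<in> csg n ?H" for u
   by (rule L.ext_eqI[of d y, OF _ _ w0 that]) (use hom_ptsD[OF d(1)] sH d in auto)
  thus "y w \<noteq> 0 \<and> y' = ?\<xi> y" using d(3) \<tau>H w0 by auto
 next
  assume h: "y w \<noteq> 0 \<and> y' = ?\<xi> y"
  hence o: "y \<in> L.opn" using g by (simp add: opn)
  have "restrict (restrict (L.ext y) (csg n ?H)) (S s) = y"
   using L.ext_self[OF o] sH hom_ptsD[OF g(1)] by (intro extensionalityI) auto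
  moreover have "restrict (restrict (L.ext y) (csg n ?H)) (S \<tau>) = y'" using h \<tau>H by auto
  ultimately show "\<exists>d\<in>hom_pts (csg n ?H). restrict d (S s) = y \<and> restrict d (S \<tau>) = y'" using ext[OF o] by blast
 qed
 have "continuous_map (subtopology (hom_top (S s)) L.opn) (hom_top (S \<tau>)) ?\<xi>"
  unfolding continuous_map_into_hom_iff
 proof (intro conjI ballI)
  fix y assume "y \<in> topspace (subtopology (hom_top (S s)) L.opn)"
  thus "?\<xi> y \<in> hom_pts (S \<tau>)" by (intro hom_ptsI) (simp_all add: L.ext_zero L.ext_add csg_closed \<tau>H)
 next
  fix u assume u: "u \<in> S \<tau>"
  have "continuous_map (subtopology (hom_top (S s)) L.opn) euclidean (%y. L.ext y u)"
   by (rule L.continuous_map_ext[OF _ _ \<tau>H[OF u]]) (auto simp: opn)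
  thus "continuous_map (subtopology (hom_top (S s)) L.opn) euclidean (%y. ?\<xi> y u)" by simp
 qed
 moreover have N: "u + (%i. int (N u) * w i) \<in> S s" if "u \<in> S \<tau>" for u by (rule L.scaled_in_S[OF \<tau>H[OF that]]) (simp add: N_def)
 moreover have "?\<xi> y u = y (u + (%i. int (N u) * w i)) / y w ^ N u" if "u \<in> S \<tau>" "y \<in> hom_pts (S s)" "y w \<noteq> 0" for u y
  using L.ext_scaled[OF _ \<tau>H N, of y u] that opn by simp
 ultimately have "trans s \<tau> w ?\<xi> N" unfolding trans_def using w eq L.openin_opn opn by simp
 thus ?thesis by blast
qed

lemma continuous_j: "s \<in> \<Sigma> ==> continuous_map (hom_top (S s)) X (j s)"
 unfolding continuous_map_def
proof (intro conjI allI impI)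
 fix U assume "s \<in> \<Sigma>" "openin X U"
 thus "openin (hom_top (S s)) {x \<in> topspace (hom_top (S s)). j s x \<in> U}"
  using openin_iff[OF openin_subset, of U] by simp
qed (use cover in auto)

text \<open>Seen in another chart, the image of \<open>V\<close> is the preimage of \<open>V\<close>
  under the transition map, whose domain is open.\<close>

lemma open_j:
 assumes s: "z \<in> \<Sigma>"
 shows "open_map (hom_top (S z)) X (j z)"
 unfolding open_map_def
proof (intro allI impI)
 fix V assume V: "openin (hom_top (S z)) V"
 have VS: "V \<subseteq> hom_pts (S z)" using openin_subset[OF V] by simp
 have "openin (hom_top (S r)) {g \<in> hom_pts (S r). j r g \<in> j z ` V}" if t: "r \<in> \<Sigma>" for r
 proof -
  obtain w x N where T: "trans r z w x N" using transition[OF t s] by blast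
  note c = T[unfolded trans_def, THEN conjunct2, THEN conjunct2, THEN conjunct2, THEN conjunct1]
  have o: "openin (hom_top (S r)) {g \<in> hom_pts (S r). g w \<noteq> 0}" using T by (simp add: trans_def)
  have "{g \<in> hom_pts (S r). j r g \<in> j z ` V} = {g \<in> topspace (subtopology (hom_top (S r)) {g \<in> hom_pts (S r). g w \<noteq> 0}). x g \<in> V}"
   using transD(3)[OF T] VS by force
  thus ?thesis using openin_continuous_map_preimage[OF c V] openin_trans_full[OF _ o] by simp
 qed
 moreover have "j z ` V \<subseteq> topspace X" using VS cover s by blast
 ultimately show "openin X (j z ` V)" using openin_iff by blast
qed

lemma inj_j: "s \<in> \<Sigma> ==> inj_on (j s) (hom_pts (S s))"
 by rule (metis glue)

text \<open>For \<open>x\<^sub>0\<close> with \<open>\<bar>\<gamma> u\<bar> = exp (- u x\<^sub>0)\<close> on the face where \<open>\<gamma>\<close> does not vanish and \<open>y\<close> in the interior of the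
 dual face, a cone containing \<open>x\<^sub>0 + t y\<close> for infinitely many \<open>t\<close> gives a chart in which the point is bounded by 1.\<close>

lemma compact: "compact_space X"
proof -
 define B where "B \<sigma> = {\<gamma> \<in> hom_pts (S \<sigma>). \<forall>u\<in>S \<sigma>. cmod (\<gamma> u) \<le> 1}" for \<sigma>
 have "compactin X (\<Union>\<sigma>\<in>\<Sigma>. j \<sigma> ` B \<sigma>)"
  using fin compactin_hom_bounded csg_closed
  by (intro compactin_Union) (auto simp: B_def intro!: image_compactin[OF _ continuous_j])
 moreover have "x \<in> (\<Union>\<sigma>\<in>\<Sigma>. j \<sigma> ` B \<sigma>)" if x: "x \<in> topspace X" for x
 proof -
  obtain \<sigma> \<gamma> where s: "\<sigma> \<in> \<Sigma>" "\<gamma> \<in> hom_pts (S \<sigma>)" "x = j \<sigma> \<gamma>" using x cover by blast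
  obtain H x0 where H: "H \<subseteq> G \<sigma>" and "\<forall>c\<in>S \<sigma>. (\<gamma> c \<noteq> 0 \<longleftrightarrow> (\<forall>h\<in>H. dot n c h = 0)) \<and>
    (\<gamma> c \<noteq> 0 --> cmod (\<gamma> c) = exp (- (\<Sum>i<n. of_int (c i) * x0 i)))"
   using hom_modulus_face[OF fin(2)[OF s(1)] s(2)] by blast
  hence nz: "\<And>c. c \<in> S \<sigma> ==> \<gamma> c \<noteq> 0 \<longleftrightarrow> (\<forall>h\<in>H. dot n c h = 0)"
   and md: "\<And>c. c \<in> S \<sigma> ==> \<gamma> c \<noteq> 0 ==> cmod (\<gamma> c) = exp (- (\<Sum>i<n. of_int (c i) * x0 i))" by auto
  have finH: "finite H" using H fin(2)[OF s(1)] finite_subset by blast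
  define P where "P u = (\<Sum>i<n. of_int (u i) * x0 i)" for u :: ivec
  \<comment> \<open>The pairing with the sum of the generators of the face of
    \<open>\<gamma>\<close>; on \<open>S \<sigma>\<close> it vanishes exactly where
    \<open>\<gamma>\<close> does not.\<close>
  define Q where "Q u = (\<Sum>h\<in>H. dot n u h)" for u
  have add: "P (u + v) = P u + P v" "Q (u + v) = Q u + Q v" "P (%i. int N * u i) = N * P u" "Q (%i. int N * u i) = N * Q u" for u v N
   by (simp_all add: P_def Q_def dot_add dot_scale sum.distrib distrib_right sum_distrib_left mult.assoc)
  have "\<exists>\<tau>\<in>\<Sigma>. \<forall>u\<in>S \<tau>. 0 \<le> P u + real t * of_int (Q u)" for t :: nat
  proof -
   have "(\<Sum>i<n. of_int (u i) * (x0 i + real t * of_int (\<Sum>h\<in>H. h i))) = P u + real t * of_int (Q u)" for u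
   using Q_def dot_def of_int_sum of_int_mult sum.swap add by (auto simp: mult.left_commute sum_distrib_left sum.distrib distrib_left P_def)
   thus ?thesis using complete[of "%i. x0 i + real t * of_int (\<Sum>h\<in>H. h i)"] by simp
  qed
  then obtain f where f: "\<And>t :: nat. f t \<in> \<Sigma> \<and> (\<forall>u\<in>S (f t). 0 \<le> P u + real t * of_int (Q u))" by metis
  have "finite (range f)" using f fin by (metis finite_subset image_subsetI)
  \<comment> \<open>By the pigeonhole principle one of the finitely many cones serves arbitrarily
    large \<open>t\<close>.\<close>
  then obtain t0 where inf: "infinite {t. f t = f t0}" using pigeonhole_infinite[of "UNIV :: nat set" f] by auto
  define \<tau> where "\<tau> = f t0"
  have t: "\<tau> \<in> \<Sigma>" using f by (simp add: \<tau>_def)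
  \<comment> \<open>Letting \<open>t\<close> grow along this cone shows that \<open>Q\<close> is
    non-negative on its semigroup, and that \<open>P\<close> is non-negative where \<open>Q\<close>
    vanishes.\<close>
  have PQ: "0 \<le> Q u" "Q u = 0 ==> 0 \<le> P u" if u: "u \<in> S \<tau>" for u
  proof -
   obtain t where t: "f t = \<tau>" "nat \<lceil>P u\<rceil> < t" using inf unfolding \<tau>_def infinite_nat_iff_unbounded by blast
   hence le: "0 \<le> P u + real t * of_int (Q u)" "P u < real t" using f u by auto linarith
   show "0 \<le> Q u"
   proof (rule ccontr)
    assume "\<not> 0 \<le> Q u"
    hence "real t * of_int (Q u) \<le> real t * (- 1)" by (intro mult_left_mono) auto
    thus False using le by simp
   qed
   show "0 \<le> P u" if "Q u = 0" using le that by simp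
  qed
  obtain w z N where T: "trans \<sigma> \<tau> w z N" using transition[OF s(1) t] by blast
  note w = transD(1,2)[OF T] and eq = transD(3)[OF T] and N = transD(5)[OF T] and z = transD(6)[OF T]
  have Q0: "Q c = 0 \<longleftrightarrow> \<gamma> c \<noteq> 0" if "c \<in> S \<sigma>" for c
   using nz that H finH sum_nonneg_eq_0_iff[of H "%h. dot n c h"] by (auto simp: Q_def csg_def subset_iff)
  have "0 \<le> Q w" using w H by (auto simp: Q_def csg_def intro!: sum_nonneg)
  moreover have "Q w + Q (- w) = 0" using add(2)[of w "- w"] by (simp add: Q_def)
  \<comment> \<open>\<open>w\<close> and its negative lie in the two semigroups, so
    \<open>Q w\<close> is squeezed to 0 and the point belongs to the overlap of the charts.\<close>
  ultimately have w0: "Q w = 0" "\<gamma> w \<noteq> 0" using PQ[OF w(2)] Q0[OF w(1)] by auto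
  have in_t: "z \<gamma> \<in> hom_pts (S \<tau>)" using transD(4)[OF T s(2)] w0 by blast
  have "cmod (z \<gamma> u) \<le> 1" if u: "u \<in> S \<tau>" for u
  proof -
   let ?v = "u + (%i. int (N u) * w i)"
   have Qv: "Q ?v = Q u" unfolding add w0 by simp
   show ?thesis
   proof (cases "Q u = 0")
    case True
    hence "\<gamma> ?v \<noteq> 0" using Q0[OF N[OF u]] Qv by metis
    hence "cmod (z \<gamma> u) = exp (- P ?v) / exp (- P w) ^ N u"
     using z[OF u s(2) w0(2)] md[OF N[OF u] \<open>\<gamma> ?v \<noteq> 0\<close>] md[OF w(1) w0(2)] by (simp only: norm_divide norm_power P_def)
    also have "\<dots> = exp (- P u)" unfolding add by (simp add: exp_of_nat_mult[symmetric] exp_diff[symmetric])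
    finally show ?thesis using PQ(2)[OF u True] by simp
   next
    case False
    hence "\<gamma> ?v = 0" using Q0[OF N[OF u]] Qv by metis
    thus ?thesis by (simp only: z[OF u s(2) w0(2)] div_0 norm_zero)
   qed
  qed
  thus ?thesis using in_t eq[OF s(2) in_t] w0(2) s(3) t by (auto simp: B_def)
 qed
 ultimately have "compactin X (\<Union>\<sigma>\<in>\<Sigma>. j \<sigma> ` B \<sigma>)" "topspace X = (\<Union>\<sigma>\<in>\<Sigma>. j \<sigma> ` B \<sigma>)"
  using compactin_subset_topspace by blast+
 thus ?thesis by (simp add: compact_space_def)
qed

text \<open>Uses a relation that holds for any two coordinate points representing the same point and
  fails for the given pair. Either \<open>w\<close> and its negative do not multiply to 1, or the
  transition is defined at \<open>g\<close> and some coordinate of its value differs from that of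
  \<open>g'\<close>. Written polynomially, the relation is continuous on the full product of the
  charts.\<close>

lemma separated:
 assumes xy: "x \<in> topspace X" "y \<in> topspace X" "x \<noteq> y"
 shows "\<exists>V W. openin X V \<and> openin X W \<and> x \<in> V \<and> y \<in> W \<and> disjnt V W"
proof -
 obtain c g r g' where s: "c \<in> \<Sigma>" "g \<in> hom_pts (S c)" "x = j c g" and t: "r \<in> \<Sigma>" "g' \<in> hom_pts (S r)" "y = j r g'"
  using xy cover by blast
 obtain w q N where T: "trans c r w q N" using transition[OF s(1) t(1)] by blast
 note w = transD(1,2)[OF T] and eq = transD(3)[OF T] and N = transD(5)[OF T] and q = transD(6)[OF T]
 have ww: "\<alpha> w * b (- w) = 1" if ab: "\<alpha> \<in> hom_pts (S c)" "b \<in> hom_pts (S r)" "j c \<alpha> = j r b" for \<alpha> b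
 proof -
  obtain e where d: "e \<in> hom_pts (D c r)" "restrict e (S c) = \<alpha>" "restrict e (S r) = b" using glue[OF s(1) t(1) ab(1,2)] ab by blast
  have "w \<in> D c r" "- w \<in> D c r" using sep[OF s(1) t(1)] w by (auto simp: csg_def)
  thus ?thesis using hom_ptsD(1,2)[OF d(1)] d w by force
 qed
 obtain v N' v' v'' where v: "v \<in> S c" "v' \<in> S r" "v'' \<in> S r" "g v * g' v' ^ N' \<noteq> g' v''"
  and v_eq: "\<And>\<alpha> b. \<alpha> \<in> hom_pts (S c) ==> b \<in> hom_pts (S r) ==> j c \<alpha> = j r b ==> \<alpha> v * b v' ^ N' = b v''"
 proof (cases "g w * g' (- w) = 1")
  case False
  show ?thesis by (rule that[of w "- w" 0 1]) (use w False ww csg_closed hom_ptsD t(2) in auto)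
 next
  case True
  hence w0: "g w \<noteq> 0" by auto
  have in_t: "q g \<in> hom_pts (S r)" using transD(4)[OF T s(2)] w0 by blast
  have "q g \<noteq> g'" using eq[OF s(2) t(2)] w0 xy s t by blast
  then obtain u where u: "u \<in> S r" "q g u \<noteq> g' u" using hom_pts_eqI[OF in_t t(2)] by blast
  have val: "q \<alpha> u = \<alpha> (u + (%i. int (N u) * w i)) * b (- w) ^ N u" if "\<alpha> \<in> hom_pts (S c)" "\<alpha> w * b (- w) = 1" for \<alpha> b
  proof -
   have "\<alpha> w \<noteq> 0" "b (- w) = 1 / \<alpha> w" using that by (auto simp: eq_divide_eq mult.commute)
   thus ?thesis using q[OF u(1) that(1)] by (simp add: power_divide)
  qed
  have vg: "g (u + (%i. int (N u) * w i)) * g' (- w) ^ N u \<noteq> g' u" using val s True u by metis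
  have "\<alpha> (u + (%i. int (N u) * w i)) * b (- w) ^ N u = b u"
   if ab: "\<alpha> \<in> hom_pts (S c)" "b \<in> hom_pts (S r)" "j c \<alpha> = j r b" for \<alpha> b
   using val ww ab eq by metis
  thus ?thesis by (intro that[of "u + (%i. int (N u) * w i)" "- w" u "N u", OF N[OF u(1)] w(2) u(1) vg])
 qed
 let ?Y = "prod_topology (hom_top (S c)) (hom_top (S r))"
 have ev: "continuous_map ?Y euclidean (%p. fst p u)" "continuous_map ?Y euclidean (%p. snd p u')" if "u \<in> S c" "u' \<in> S r" for u u'
  using continuous_map_hom_evalI[OF continuous_map_fst] continuous_map_hom_evalI[OF continuous_map_snd] that by auto
 have "continuous_map ?Y euclidean (%p. snd p v' ^ N')"
  using continuous_map_compose_on[OF ev(2)[OF v(1,2)], of UNIV "%z. z ^ N'"] by (simp add: continuous_intros)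
 hence "continuous_map ?Y euclidean (%p. fst p v * snd p v' ^ N' - snd p v'')"
  by (intro continuous_map_diff continuous_map_mult ev[OF v(1,2)] ev[OF v(1,3)])
 note cont = this
 define R where "R = {p \<in> topspace ?Y. fst p v * snd p v' ^ N' - snd p v'' \<in> - {0}}"
 have "openin ?Y R" unfolding R_def by (rule openin_continuous_map_preimage[OF cont]) (simp add: open_Compl)
 moreover have "(g, g') \<in> R" using s t v by (simp add: R_def)
 ultimately have "\<exists>A B. openin (hom_top (S c)) A \<and> openin (hom_top (S r)) B \<and> g \<in> A \<and> g' \<in> B \<and> A \<times> B \<subseteq> R"
  by (rule openin_prod_topology_alt[THEN iffD1, rule_format])
 then obtain A B where AB: "openin (hom_top (S c)) A" "openin (hom_top (S r)) B" "g \<in> A" "g' \<in> B" "A \<times> B \<subseteq> R" by blast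
 have "disjnt (j c ` A) (j r ` B)"
 proof (rule ccontr)
  assume "\<not> ?thesis"
  then obtain \<alpha> b where ab: "\<alpha> \<in> A" "b \<in> B" "j c \<alpha> = j r b" by (auto simp: disjnt_def)
  have "\<alpha> \<in> hom_pts (S c)" "b \<in> hom_pts (S r)" using ab AB(1,2)[THEN openin_subset] by auto
  from v_eq[OF this ab(3)] show False using subsetD[OF AB(5), of "(\<alpha>, b)"] ab by (simp add: R_def)
 qed
 thus ?thesis
  using open_j[OF s(1)] open_j[OF t(1)] AB s t unfolding open_map_def by auto
qed

lemma toric_like: "toric_like n n X act"
proof (rule toric_likeI[OF order_refl compact act])
 obtain t where "t \<in> \<Sigma>" using complete by blast
 moreover have "restrict (%_. 1) (S t) \<in> hom_pts (S t)" by (intro hom_ptsI) (auto simp: csg_closed)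
 ultimately show "topspace X \<noteq> {}" using cover by blast
 show "charted n n X act x" if x: "x \<in> topspace X" for x
 proof -
  obtain z g where s: "z \<in> \<Sigma>" "g \<in> hom_pts (S z)" "x = j z g" using x cover by blast
  obtain i G' U F f where "toric_chart n n (hom_top (S z)) (hom_act n (S z)) g i G' U F f"
   using hom_chart[OF fin(2)[OF s(1)] full[OF s(1)] s(2)] by blast
  from toric_chart_open_embedding[OF this continuous_j[OF s(1)] open_j[OF s(1)]] show ?thesis
   using inj_j s equi by simp
 qed
qed (rule disjI1, rule separated)

end

section \<open>Complete toric varieties\<close>

text \<open>The dual semigroup in integer coordinates, which removes the ambient Euclidean space
  from the gluing argument.\<close>

definition cdual :: "nat => (nat => 'a::euclidean_space) => 'a set => ivec set"
 where "cdual n e \<sigma> = {u \<in> lat n. \<forall>x\<in>\<sigma>. 0 \<le> inner (embed n e u) x}"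

lemma cdual_add: "0 \<in> cdual n e \<sigma>" "u \<in> cdual n e \<sigma> ==> v \<in> cdual n e \<sigma> ==> u + v \<in> cdual n e \<sigma>"
 by (auto simp: cdual_def embed_add inner_left_distrib) (simp add: embed_def)

lemma dual_semigroup_eq: "coordinate_frame n e ==> dual_semigroup n e s = embed n e ` cdual n e s"
 by (auto simp: dual_semigroup_def cdual_def lattice_points_eq)

lemma embed_inj: "coordinate_frame n e ==> u \<in> lat n ==> v \<in> lat n ==> embed n e u = embed n e v ==> u = v"
proof
 fix i assume a: "coordinate_frame n e" "u \<in> lat n" "v \<in> lat n" "embed n e u = embed n e v"
 thus "u i = v i" using inner_embed[OF a(1), of i u] inner_embed[OF a(1), of i v] by (cases "i < n") (auto simp: lat_def)
qed

lemma torus_character_embed: "coordinate_frame n e ==> torus_character n e (embed n e u) t = chr n u t"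
 by (simp add: torus_character_def chr_def inner_embed)

definition to_affine :: "nat => (nat => 'a::euclidean_space) => 'a set => mono => 'a => complex"
 where "to_affine n e s \<gamma> = (\<lambda>x\<in>dual_semigroup n e s. \<gamma> (inv_into (lat n) (embed n e) x))"

lemma coordinates_embed: "coordinate_frame n e ==> u \<in> cdual n e s ==> inv_into (lat n) (embed n e) (embed n e u) = u"
 using embed_inj[of n e] by (auto simp: inj_on_def cdual_def)

lemma to_affine_embed: "coordinate_frame n e ==> u \<in> cdual n e s ==> to_affine n e s g (embed n e u) = g u"
 by (simp add: to_affine_def dual_semigroup_eq coordinates_embed)

lemma affine_toric_coordinates:
 assumes e: "coordinate_frame n e"
 shows "homeomorphic_maps (hom_top (cdual n e \<sigma>)) (affine_toric_variety n e \<sigma>) (to_affine n e \<sigma>) (%y. \<lambda>u\<in>cdual n e \<sigma>. y (embed n e u))"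
proof -
 let ?C = "cdual n e \<sigma>" and ?D = "dual_semigroup n e \<sigma>" and ?A = "affine_toric_points n e \<sigma>"
 have D: "?D = embed n e ` ?C" by (rule dual_semigroup_eq[OF e])
 note ta = to_affine_embed[OF e] and z = cdual_add[where n = n and e = e and \<sigma> = \<sigma>]
 have e0: "embed n e 0 = 0" by (simp add: embed_def)
 have in1: "to_affine n e \<sigma> y \<in> ?A" if g: "y \<in> hom_pts ?C" for y
  unfolding affine_toric_points_def
  using hom_ptsD[OF g] ta[OF z(1)] e0 coordinates_embed[OF e, of _ \<sigma>] z(2)
  by (auto simp: embed_add[symmetric] to_affine_def D)
 have in2: "(\<lambda>u\<in>?C. y (embed n e u)) \<in> hom_pts ?C" if g: "y \<in> ?A" for y
  using g z e0 unfolding affine_toric_points_def D by (intro hom_ptsI) (auto simp: embed_add)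
 have tA: "topspace (affine_toric_variety n e \<sigma>) = ?A"
  by (auto simp: affine_toric_variety_def affine_toric_points_def PiE_def)
 show ?thesis
  unfolding homeomorphic_maps_def tA topspace_hom_top
 proof (intro conjI ballI)
  show "continuous_map (hom_top ?C) (affine_toric_variety n e \<sigma>) (to_affine n e \<sigma>)"
   unfolding affine_toric_variety_def continuous_map_in_subtopology continuous_map_componentwise
  proof (intro conjI ballI)
   fix x assume "x \<in> ?D"
   then obtain u where "u \<in> ?C" "x = embed n e u" unfolding D by blast
   thus "continuous_map (hom_top ?C) euclidean (%y. to_affine n e \<sigma> y x)" by (simp add: ta continuous_map_hom_eval)
  qed (use in1 in \<open>auto simp: to_affine_def\<close>)
  show "continuous_map (affine_toric_variety n e \<sigma>) (hom_top ?C) (%y. \<lambda>u\<in>?C. y (embed n e u))"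
   unfolding continuous_map_into_hom_iff tA
  proof (intro conjI ballI)
   fix u assume u: "u \<in> ?C"
   have "continuous_map (affine_toric_variety n e \<sigma>) euclidean (%y. y (embed n e u))"
    unfolding affine_toric_variety_def using u by (intro continuous_map_from_subtopology continuous_map_product_projection) (simp add: D)
   thus "continuous_map (affine_toric_variety n e \<sigma>) euclidean (%y. (\<lambda>u\<in>?C. y (embed n e u)) u)" by simp
  qed (rule in2)
  fix y assume g: "y \<in> hom_pts ?C"
  show "(\<lambda>u\<in>?C. to_affine n e \<sigma> y (embed n e u)) = y" using ta hom_ptsD[OF g] by (intro extensionalityI) auto
 next
  fix y assume "y \<in> ?A"
  hence "y \<in> extensional ?D" by (simp add: affine_toric_points_def)
  thus "to_affine n e \<sigma> (\<lambda>u\<in>?C. y (embed n e u)) = y"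
   by (intro extensionalityI) (auto simp: to_affine_def D coordinates_embed[OF e])
 qed
qed

text \<open>The face conditions of a fan enter as separating lattice vectors. For an abstract
  complete fan these come from duality of rational cones; for a normal fan they can be written down
  directly.\<close>

definition separated_fan :: "nat => (nat => 'a::euclidean_space) => 'a set set => bool"
 where "separated_fan n e \<Sigma> \<longleftrightarrow> finite \<Sigma> \<and> (\<forall>s\<in>\<Sigma>. rational_cone n e s \<and> strongly_convex_cone s) \<and> \<Union>\<Sigma> = span (e ` {..<n}) \<and>
  (\<forall>s\<in>\<Sigma>. \<forall>t\<in>\<Sigma>. \<exists>w\<in>lattice_points n e. (\<forall>x\<in>s. 0 \<le> inner w x \<and> (inner w x = 0 --> x \<in> t)) \<and>
   (\<forall>x\<in>t. inner w x \<le> 0 \<and> (inner w x = 0 --> x \<in> s)))"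

lemma complete_fan_separated: "coordinate_frame n e ==> complete_fan n e S ==> separated_fan n e S"
 unfolding separated_fan_def complete_fan_def fan_def
 by (elim conjE, intro conjI) (simp_all add: rational_cone_separation)

text \<open>Zero is discarded from the generators. Strong convexity makes the origin an extreme
  point; separating the cone from it gives a character positive on all remaining generators.\<close>

lemma rational_cone_generators:
 assumes e: "coordinate_frame n e" and \<sigma>: "rational_cone n e \<sigma>" "strongly_convex_cone \<sigma>"
 shows "\<exists>G. finite G \<and> G \<subseteq> lat n \<and> (\<forall>g\<in>G. embed n e g \<in> \<sigma>) \<and> cdual n e \<sigma> = csg n G \<and> (\<exists>u\<in>lat n. \<forall>g\<in>G. 0 < dot n u g)"
proof -
 obtain G0 where G0: "finite G0" "G0 \<subseteq> lattice_points n e" "\<sigma> = convex_cone hull G0" using \<sigma> by (auto simp: rational_cone_def)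
 define G where "G = {u \<in> lat n. embed n e u \<in> G0 \<and> u \<noteq> 0}"
 have "inj_on (embed n e) G" using embed_inj[OF e] by (auto simp: G_def inj_on_def)
 moreover have "finite (embed n e ` G)" using G0 by (auto simp: G_def elim!: rev_finite_subset)
 ultimately have fin: "finite G" by simp
 have G\<sigma>: "embed n e g \<in> \<sigma>" if "g \<in> G" for g using that hull_inc[of _ G0 convex_cone] by (simp add: G_def G0)
 have c: "0 \<le> inner (embed n e u) x" if u: "u \<in> csg n G" and x: "x \<in> \<sigma>" for u x
 proof -
  have "0 \<le> inner (embed n e u) g" if g: "g \<in> G0" for g
  proof -
   obtain v where v: "v \<in> lat n" "g = embed n e v" using g G0 lattice_points_eq[OF e] by blast
   thus ?thesis using u g by (cases "v = 0") (auto simp: inner_embed_embed[OF e] csg_def G_def)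
  qed
  thus ?thesis using cone_hull_minimal[OF convex_cone_halfspace_ge[of "embed n e u"] _ x[unfolded G0(3)]] by simp
 qed
 have cd: "cdual n e \<sigma> = csg n G"
  using c G\<sigma> inner_embed_embed[OF e] by (auto simp: cdual_def csg_def) (metis of_int_0_le_iff)
 have z: "0 \<in> \<sigma>" unfolding G0 by (rule convex_cone_hull_contains_0)
 have "0 extreme_point_of \<sigma>"
  unfolding extreme_point_of_def
 proof (intro conjI ballI notI)
  fix a b assume ab: "a \<in> \<sigma>" "b \<in> \<sigma>" "0 \<in> open_segment a b"
  then obtain u where u: "a \<noteq> b" "0 < u" "u < 1" "0 = (1 - u) *\<^sub>R a + u *\<^sub>R b" by (auto simp: in_segment)
  have "(1 - u) *\<^sub>R a \<in> \<sigma>" "u *\<^sub>R b \<in> \<sigma>" using ab u convex_cone_hull_mul[of _ G0] by (auto simp: G0)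
  moreover have "(1 - u) *\<^sub>R a = - (u *\<^sub>R b)" using u by (metis add_eq_0_iff2)
  ultimately have "(1 - u) *\<^sub>R a = 0" using \<sigma>(2) unfolding strongly_convex_cone_def by blast
  thus False using u by auto
 qed (rule z)
 hence "\<sigma> \<inter> {0} face_of \<sigma>" "\<sigma> \<inter> {0} face_of {0}" using z by (simp_all add: face_of_singleton)
 moreover have "rational_cone n e {0}" unfolding rational_cone_def by force
 ultimately obtain w where w: "w \<in> lattice_points n e" "\<And>x. x \<in> \<sigma> ==> 0 \<le> inner w x \<and> (inner w x = 0 --> x \<in> {0})"
  using rational_cone_separation[OF e \<sigma>(1)] by meson
 then obtain u where u: "u \<in> lat n" "w = embed n e u" using lattice_points_eq[OF e] by blast
 have "0 < dot n u g" if g: "g \<in> G" for g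
 proof -
  have "embed n e g \<noteq> 0" using embed_inj[OF e, of g 0] g by (auto simp: G_def) (simp add: embed_def)
  thus ?thesis using w(2)[OF G\<sigma>[OF g]] by (auto simp: u inner_embed_embed[OF e] )
 qed
 thus ?thesis using fin G\<sigma> cd u by (intro exI) (auto simp: G_def)
qed

lemma toric_variety_toric_like:
 fixes e :: "nat => 'a::euclidean_space"
 assumes e: "coordinate_frame n e" and S: "separated_fan n e S" and X: "toric_variety_of_fan n e S X act"
 shows "toric_like n n X act"
proof -
 have "\<forall>\<sigma>\<in>S. \<exists>G. finite G \<and> G \<subseteq> lat n \<and> (\<forall>g\<in>G. embed n e g \<in> \<sigma>) \<and> cdual n e \<sigma> = csg n G \<and> (\<exists>u\<in>lat n. \<forall>g\<in>G. 0 < dot n u g)"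
  using S rational_cone_generators[OF e] by (simp add: separated_fan_def)
 from bchoice[OF this] obtain G where "\<forall>\<sigma>\<in>S. finite (G \<sigma>) \<and> G \<sigma> \<subseteq> lat n \<and> (\<forall>g\<in>G \<sigma>. embed n e g \<in> \<sigma>) \<and>
  cdual n e \<sigma> = csg n (G \<sigma>) \<and> (\<exists>u\<in>lat n. \<forall>g\<in>G \<sigma>. 0 < dot n u g)" ..
 hence G: "\<And>\<sigma>. \<sigma> \<in> S ==> finite (G \<sigma>)" "\<And>\<sigma>. \<sigma> \<in> S ==> G \<sigma> \<subseteq> lat n"
  "\<And>\<sigma> g. \<sigma> \<in> S ==> g \<in> G \<sigma> ==> embed n e g \<in> \<sigma>" "\<And>\<sigma>. \<sigma> \<in> S ==> cdual n e \<sigma> = csg n (G \<sigma>)"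
  "\<And>\<sigma>. \<sigma> \<in> S ==> \<exists>u\<in>lat n. \<forall>g\<in>G \<sigma>. 0 < dot n u g" by auto
 let ?A = "affine_toric_variety n e" and ?P = "affine_toric_points n e" and ?C = "cdual n e" and ?t = "to_affine n e"
 obtain q where act: "torus_action n X act" and q: "quotient_map (sum_topology ?A S) X q"
  and glue: "\<And>\<sigma> r y y'. \<sigma> \<in> S ==> r \<in> S ==> y \<in> ?P \<sigma> ==> y' \<in> ?P r ==> q (\<sigma>, y) = q (r, y') \<longleftrightarrow>
   (\<exists>d\<in>?P (\<sigma> \<inter> r). restrict d (dual_semigroup n e \<sigma>) = y \<and> restrict d (dual_semigroup n e r) = y')"
  and equi: "\<And>t \<sigma> y. t \<in> Torus n ==> \<sigma> \<in> S ==> y \<in> ?P \<sigma> ==> q (\<sigma>, affine_toric_action n e \<sigma> t y) = act t (q (\<sigma>, y))"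
  using X unfolding toric_variety_of_fan_def by blast
 have tA: "topspace (?A \<sigma>) = ?P \<sigma>" for \<sigma> by (auto simp: affine_toric_variety_def affine_toric_points_def PiE_def)
 let ?u = "%\<sigma> y. \<lambda>u\<in>?C \<sigma>. y (embed n e u)"
 have cm: "continuous_map (hom_top (?C \<sigma>)) (?A \<sigma>) (?t \<sigma>)" "continuous_map (?A \<sigma>) (hom_top (?C \<sigma>)) (?u \<sigma>)"
  and tin: "y \<in> hom_pts (?C \<sigma>) ==> ?t \<sigma> y \<in> ?P \<sigma>" and uin: "d \<in> ?P \<sigma> ==> ?u \<sigma> d \<in> hom_pts (?C \<sigma>)"
  and tu: "d \<in> ?P \<sigma> ==> ?t \<sigma> (?u \<sigma> d) = d" for \<sigma> y d
  using affine_toric_coordinates[OF e, of \<sigma>] tA by (auto simp: homeomorphic_maps_def continuous_map_def)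
 have dual_mono: "?C \<sigma> \<subseteq> ?C (\<sigma> \<inter> r)" "?C r \<subseteq> ?C (\<sigma> \<inter> r)" for \<sigma> r by (auto simp: cdual_def)
 have restr: "restrict (?t p d) (dual_semigroup n e \<sigma>) = ?t \<sigma> y \<longleftrightarrow> restrict d (?C \<sigma>) = y"
  if "?C \<sigma> \<subseteq> ?C p" "y \<in> hom_pts (?C \<sigma>)" for p \<sigma> d y
 proof -
  have "restrict (?t p d) (dual_semigroup n e \<sigma>) = ?t \<sigma> y \<longleftrightarrow> (\<forall>u\<in>?C \<sigma>. ?t p d (embed n e u) = ?t \<sigma> y (embed n e u))"
  proof
   assume h: "restrict (?t p d) (dual_semigroup n e \<sigma>) = ?t \<sigma> y"
   show "\<forall>u\<in>?C \<sigma>. ?t p d (embed n e u) = ?t \<sigma> y (embed n e u)"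
    unfolding h[symmetric] by (simp add: dual_semigroup_eq[OF e])
  qed (auto simp: to_affine_def[of n e \<sigma>] dual_semigroup_eq[OF e] intro!: extensionalityI[of _ "dual_semigroup n e \<sigma>"])
  also have "\<dots> \<longleftrightarrow> (\<forall>u\<in>?C \<sigma>. d u = y u)" using to_affine_embed[OF e] that by (simp add: subset_iff)
  also have "\<dots> \<longleftrightarrow> restrict d (?C \<sigma>) = y" using hom_ptsD[OF that(2)] by (auto simp: extensional_def)
  finally show ?thesis .
 qed
 have sur: "topspace X = q ` (SIGMA \<sigma>:S. ?P \<sigma>)" using quotient_imp_surjective_map[OF q] tA by force
 interpret gluing n S X act "%\<sigma> y. q (\<sigma>, ?t \<sigma> y)" G "%\<sigma> r. ?C (\<sigma> \<inter> r)"
 proof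
  show "finite S" using S by (simp add: separated_fan_def)
  show "torus_action n X act" by (rule act)
  fix \<sigma> r assume s: "\<sigma> \<in> S"
  show "finite (G \<sigma>)" "\<exists>u\<in>lat n. \<forall>g\<in>G \<sigma>. 0 < dot n u g" using G s by auto
  assume t: "r \<in> S"
  obtain w where w: "w \<in> lattice_points n e" "\<And>x. x \<in> \<sigma> ==> 0 \<le> inner w x \<and> (inner w x = 0 --> x \<in> r)"
   "\<And>x. x \<in> r ==> inner w x \<le> 0 \<and> (inner w x = 0 --> x \<in> \<sigma>)" using S s t unfolding separated_fan_def by meson
  then obtain u where u: "u \<in> lat n" "w = embed n e u" using lattice_points_eq[OF e] by blast
  have uS: "u \<in> csg n (G \<sigma>)" "- u \<in> csg n (G r)"
   using w(2)[OF G(3)[OF s]] w(3)[OF G(3)[OF t]] u by (auto simp: csg_def inner_embed_embed[OF e] dot_uminus)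
  have "?C (\<sigma> \<inter> r) = csg n {g \<in> G \<sigma>. dot n u g = 0}"
  proof (intro equalityI subsetI)
   fix v assume v: "v \<in> ?C (\<sigma> \<inter> r)"
   have "0 \<le> dot n v g" if g: "g \<in> G \<sigma>" "dot n u g = 0" for g
   proof -
    have "embed n e g \<in> \<sigma> \<inter> r" using G(3)[OF s g(1)] w(2) g by (simp add: u inner_embed_embed[OF e])
    hence "0 \<le> inner (embed n e v) (embed n e g)" using v unfolding cdual_def by blast
    thus ?thesis by (simp add: inner_embed_embed[OF e])
   qed
   thus "v \<in> csg n {g \<in> G \<sigma>. dot n u g = 0}" using v by (simp add: csg_def cdual_def)
  next
   fix v assume v: "v \<in> csg n {g \<in> G \<sigma>. dot n u g = 0}"
   \<comment> \<open>A multiple of the separating character large enough to make \<open>v\<close>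
     non-negative on the generators outside the common face; on the intersection of the two cones
     that character is zero.\<close>
   define N where "N = (\<Sum>g\<in>G \<sigma>. \<bar>dot n v g\<bar>)"
   have "0 \<le> dot n (v + (%i. N * u i)) g" if g: "g \<in> G \<sigma>" for g
   proof (cases "dot n u g = 0")
    case False
    have N: "\<bar>dot n v g\<bar> \<le> N" unfolding N_def using G[OF s] g by (intro member_le_sum) auto
    have "1 \<le> dot n u g" using False uS g by (force simp: csg_def)
    hence "N * 1 \<le> N * dot n u g" using N by (intro mult_left_mono) auto
    thus ?thesis using N by (simp add: dot_add dot_scale)
   qed (use v g in \<open>simp add: csg_def dot_add dot_scale\<close>)
   hence "v + (%i. N * u i) \<in> ?C \<sigma>" unfolding G[OF s] using v u by (auto simp: csg_def)
   moreover have "embed n e (v + (%i. N * u i)) = embed n e v + of_int N *\<^sub>R w"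
    by (simp add: u embed_def scaleR_add_left sum.distrib scaleR_sum_right)
   ultimately have "0 \<le> inner (embed n e v) x + of_int N * inner w x" if "x \<in> \<sigma>" for x
    using that by (simp add: cdual_def inner_left_distrib)
   moreover have "inner w x = 0" if "x \<in> \<sigma> \<inter> r" for x using w(2,3)[of x] that by auto
   ultimately show "v \<in> ?C (\<sigma> \<inter> r)" using v by (fastforce simp: cdual_def csg_def)
  qed
  thus "\<exists>w. w \<in> csg n (G \<sigma>) \<and> - w \<in> csg n (G r) \<and> csg n (G r) \<subseteq> ?C (\<sigma> \<inter> r) \<and> ?C (\<sigma> \<inter> r) = csg n {g \<in> G \<sigma>. dot n w g = 0}"
   using uS dual_mono G[OF t] by blast
  fix y y' assume g: "y \<in> hom_pts (csg n (G \<sigma>))" "y' \<in> hom_pts (csg n (G r))"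
  hence g': "y \<in> hom_pts (?C \<sigma>)" "y' \<in> hom_pts (?C r)" using G s t by auto
  show "q (\<sigma>, ?t \<sigma> y) = q (r, ?t r y') \<longleftrightarrow>
    (\<exists>d\<in>hom_pts (?C (\<sigma> \<inter> r)). restrict d (csg n (G \<sigma>)) = y \<and> restrict d (csg n (G r)) = y')" using tin uin tu restr[OF dual_mono(1) g'(1)] restr[OF dual_mono(2) g'(2)] G(4)[OF s] G(4)[OF t] unfolding glue[OF s t tin[OF g'(1)] tin[OF g'(2)]] by metis
 next
  fix V assume V: "V \<subseteq> topspace X"
  have "openin (?A \<sigma>) {x \<in> ?P \<sigma>. q (\<sigma>, x) \<in> V} \<longleftrightarrow> openin (hom_top (?C \<sigma>)) {y \<in> hom_pts (?C \<sigma>). q (\<sigma>, ?t \<sigma> y) \<in> V}" for \<sigma>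
  proof
   assume "openin (?A \<sigma>) {x \<in> ?P \<sigma>. q (\<sigma>, x) \<in> V}"
   from openin_continuous_map_preimage[OF cm(1) this]
   show "openin (hom_top (?C \<sigma>)) {y \<in> hom_pts (?C \<sigma>). q (\<sigma>, ?t \<sigma> y) \<in> V}" by (rule back_subst) (auto simp: tin)
  next
   assume "openin (hom_top (?C \<sigma>)) {y \<in> hom_pts (?C \<sigma>). q (\<sigma>, ?t \<sigma> y) \<in> V}"
   from openin_continuous_map_preimage[OF cm(2) this]
   show "openin (?A \<sigma>) {x \<in> ?P \<sigma>. q (\<sigma>, x) \<in> V}" by (rule back_subst) (auto simp: tA uin tu)
  qed
  moreover have "openin X V \<longleftrightarrow> (\<forall>\<sigma>\<in>S. openin (?A \<sigma>) {x \<in> ?P \<sigma>. q (\<sigma>, x) \<in> V})"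
  proof -
   have "openin X V \<longleftrightarrow> openin (sum_topology ?A S) {z \<in> topspace (sum_topology ?A S). q z \<in> V}"
    using q V by (simp add: quotient_map_def)
   also have "\<dots> \<longleftrightarrow> (\<forall>\<sigma>\<in>S. openin (?A \<sigma>) {x. (\<sigma>, x) \<in> {z \<in> topspace (sum_topology ?A S). q z \<in> V}})"
    unfolding openin_sum_topology by auto
   also have "\<dots> \<longleftrightarrow> (\<forall>\<sigma>\<in>S. openin (?A \<sigma>) {x \<in> ?P \<sigma>. q (\<sigma>, x) \<in> V})"
    by (intro ball_cong) (auto simp: tA)
   finally show ?thesis .
  qed
  ultimately show "openin X V \<longleftrightarrow> (\<forall>\<sigma>\<in>S. openin (hom_top (csg n (G \<sigma>))) {y \<in> hom_pts (csg n (G \<sigma>)). q (\<sigma>, ?t \<sigma> y) \<in> V})"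
   using G by simp
 next
  have "?P \<sigma> = ?t \<sigma> ` hom_pts (?C \<sigma>)" for \<sigma>
  proof (intro equalityI subsetI)
   fix x assume x: "x \<in> ?P \<sigma>"
   show "x \<in> ?t \<sigma> ` hom_pts (?C \<sigma>)" using tu[OF x] uin[OF x] by force
  qed (use tin in auto)
  thus "topspace X = (\<Union>\<sigma>\<in>S. (%y. q (\<sigma>, ?t \<sigma> y)) ` hom_pts (csg n (G \<sigma>)))" unfolding sur using G by auto blast
 next
  fix t \<sigma> y assume t: "t \<in> Torus n" and s: "\<sigma> \<in> S" and g: "y \<in> hom_pts (csg n (G \<sigma>))"
  have "affine_toric_action n e \<sigma> t (?t \<sigma> y) = ?t \<sigma> (hom_act n (?C \<sigma>) t y)"
   unfolding affine_toric_action_def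
  proof (rule extensionalityI[of _ "dual_semigroup n e \<sigma>"])
   fix x assume x: "x \<in> dual_semigroup n e \<sigma>"
   then obtain u where "u \<in> ?C \<sigma>" "x = embed n e u" unfolding dual_semigroup_eq[OF e] by blast
   thus "(\<lambda>u\<in>dual_semigroup n e \<sigma>. torus_character n e u t * ?t \<sigma> y u) x = ?t \<sigma> (hom_act n (?C \<sigma>) t y) x"
    using x to_affine_embed[OF e] torus_character_embed[OF e] by (simp add: hom_act_def)
  qed (auto simp: to_affine_def)
  thus "q (\<sigma>, ?t \<sigma> (hom_act n (csg n (G \<sigma>)) t y)) = act t (q (\<sigma>, ?t \<sigma> y))"
   using equi[OF t s tin] g G[OF s] by metis
 next
  fix x :: "nat => real"
  have "(\<Sum>i<n. x i *\<^sub>R e i) \<in> span (e ` {..<n})" by (intro span_sum span_mul span_base) auto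
  hence "(\<Sum>i<n. x i *\<^sub>R e i) \<in> \<Union>S" using S by (simp add: separated_fan_def)
  then obtain r where t: "r \<in> S" "(\<Sum>i<n. x i *\<^sub>R e i) \<in> r" by blast
  have "0 \<le> (\<Sum>i<n. of_int (u i) * x i)" if "u \<in> csg n (G r)" for u
   using that t unfolding G(4)[OF t(1), symmetric] by (auto simp: cdual_def inner_sum_right inner_embed[OF e] mult.commute)
  thus "\<exists>r\<in>S. \<forall>u\<in>csg n (G r). 0 \<le> (\<Sum>i<n. of_int (u i) * x i)" using t by blast
 qed
 show ?thesis by (rule toric_like)
qed

text \<open>The cones of two faces are separated by the difference of the barycentres of their
  vertices, cleared of denominators. A vector in the cone of \<open>F\<close> is constant on
  \<open>F\<close> and no smaller elsewhere on \<open>P\<close>, so the pairing is a sum of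
  non-negative terms, vanishing only if the vector is also minimal on the other face.\<close>

lemma normal_fan_separated:
 fixes e :: "nat => 'a::euclidean_space"
 assumes e: "coordinate_frame n e" and P: "full_lattice_polytope n e P"
 shows "separated_fan n e (normal_fan n e P)"
proof -
 let ?V = "span (e ` {..<n})"
 have poly: "polytope P" "P \<subseteq> ?V" "aff_dim P = int n" and lat: "\<And>v. {v} face_of P ==> v \<in> lattice_points n e"
  using P by (auto simp: full_lattice_polytope_def)
 define N where "N F = {u \<in> ?V. \<forall>v\<in>F. \<forall>w\<in>P. inner u v \<le> inner u w}" for F
 define E where "E F = {v. v extreme_point_of F}" for F :: "'a set"
 let ?\<F> = "{F. F face_of P \<and> F \<noteq> {}}"
 have nf: "normal_fan n e P = N ` ?\<F>" by (auto simp: normal_fan_def N_def)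
 have P0: "P \<in> ?\<F>" using face_of_refl[OF polytope_imp_convex[OF poly(1)]] poly by auto
 have E: "finite (E F)" "F = convex hull E F" "E F \<subseteq> lattice_points n e" if F: "F \<in> ?\<F>" for F
 proof -
  have pF: "polytope F" using face_of_polytope_polytope[OF poly(1)] F by simp
  show "F = convex hull E F" unfolding E_def by (intro Krein_Milman_Minkowski polytope_imp_compact polytope_imp_convex pF)
  show "finite (E F)" using finite_polyhedron_extreme_points[OF polytope_imp_polyhedron[OF pF]] by (simp add: E_def)
  show "E F \<subseteq> lattice_points n e" using lat F face_of_trans by (auto simp: E_def face_of_singleton[symmetric])
 qed
 have E0: "E F \<noteq> {}" if F: "F \<in> ?\<F>" for F using E[OF F] F by auto
 have EF: "E F \<subseteq> F" for F by (auto simp: E_def extreme_point_of_def)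
 have NE: "u \<in> N F" if F: "F \<in> ?\<F>" and u: "u \<in> ?V" "\<And>v w. v \<in> E F ==> w \<in> E P ==> inner u v \<le> inner u w" for u F
 proof -
  have "inner u v \<le> inner u w" if v: "v \<in> F" and w: "w \<in> P" for v w
  proof -
   have "v \<in> {v. inner u v \<le> inner u w'}" if "w' \<in> E P" for w'
    using v E[OF F] hull_minimal[of "E F" "{v. inner u v \<le> inner u w'}" convex] u that convex_halfspace_le by blast
   thus ?thesis using w E(2)[OF P0] hull_minimal[of "E P" "{w. inner u v \<le> inner u w}" convex] convex_halfspace_ge by blast
  qed
  thus ?thesis using u by (simp add: N_def)
 qed
 have rat: "rational_cone n e (N F)" if F: "F \<in> ?\<F>" for F
 proof -
  define G where "G = (%(v, w). w - v) ` (E F \<times> E P)"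
  have "N F = {u \<in> ?V. \<forall>g\<in>G. 0 \<le> inner g u}"
  proof (intro equalityI subsetI)
   fix u assume "u \<in> N F"
   thus "u \<in> {u \<in> ?V. \<forall>g\<in>G. 0 \<le> inner g u}"
    using EF[of F] EF[of P] by (auto simp: N_def G_def inner_diff_left inner_commute[of _ u] )
  next
   fix u assume u: "u \<in> {u \<in> ?V. \<forall>g\<in>G. 0 \<le> inner g u}"
   hence "0 \<le> inner (w - v) u" if "v \<in> E F" "w \<in> E P" for v w using that by (auto simp: G_def)
   thus "u \<in> N F" using u by (intro NE[OF F]) (auto simp: inner_diff_left inner_commute[of u])
  qed
  moreover have "w - v \<in> lattice_points n e" if "w \<in> lattice_points n e" "v \<in> lattice_points n e" for v w
   using that by (auto simp: lattice_points_def inner_diff_left span_diff)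
  hence "G \<subseteq> lattice_points n e" using E(3)[OF F] E(3)[OF P0] by (auto simp: G_def)
  ultimately show ?thesis using rational_dual_cone[OF e, of G] E[OF F] E[OF P0] by (simp add: G_def)
 qed
 have strong: "strongly_convex_cone (N F)" if F: "F \<in> ?\<F>" for F
 proof -
  obtain v where v: "v \<in> F" "v \<in> P" using F face_of_imp_subset by blast
  have "aff_dim ?V = int n"
  proof -
   show ?thesis using e dim_span_eq_card_independent[OF independent_mono[OF independent_Basis, of "e ` {..<n}"]] by (auto simp: coordinate_frame_def card_image aff_dim_subspace)
  qed
  \<comment> \<open>Full dimension makes the affine hull the whole span, so that a vector of the
    span with constant pairing on \<open>P\<close> must be 0.\<close>
  hence hull: "affine hull P = ?V"
   using affine_dim_equal[of "affine hull P" ?V] hull_minimal[OF poly(2), of affine] v poly by (auto simp: subspace_imp_affine)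
  have "u = 0" if u: "u \<in> N F" "- u \<in> N F" for u
  proof -
   have "P \<subseteq> {x. inner u x = inner u v}" using u v by (force simp: N_def)
   hence s: "?V \<subseteq> {x. inner u x = inner u v}" unfolding hull[symmetric] by (intro hull_minimal affine_hyperplane)
   have "inner u 0 = inner u v" "inner u u = inner u v" using u(1) subsetD[OF s span_0] subsetD[OF s, of u] by (auto simp: N_def)
   thus ?thesis by simp
  qed
  moreover have "0 \<in> N F" by (simp add: N_def span_0)
  ultimately show ?thesis by (force simp: strongly_convex_cone_def)
 qed
 have sep1: "0 \<le> inner (real (card (E F)) *\<^sub>R \<Sum>(E F') - real (card (E F')) *\<^sub>R \<Sum>(E F)) x \<and>
   (inner (real (card (E F)) *\<^sub>R \<Sum>(E F') - real (card (E F')) *\<^sub>R \<Sum>(E F)) x = 0 --> x \<in> N F')"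
  if F: "F \<in> ?\<F>" "F' \<in> ?\<F>" and x: "x \<in> N F" for F F' x
 proof -
  obtain v where v: "v \<in> E F" using E0[OF F(1)] by blast
  have P': "w \<in> P" if "w \<in> E F'" for w using that EF F face_of_imp_subset by blast
  have vP: "f \<in> P" "f \<in> F" if "f \<in> E F" for f using that EF F face_of_imp_subset by blast+
  have eq: "inner f x = inner v x" if "f \<in> E F" for f
   using x vP[OF that] vP[OF v] by (intro antisym) (auto simp: N_def inner_commute)
  have le: "inner v x \<le> inner w x" if "w \<in> P" for w using x vP[OF v] that by (simp add: N_def inner_commute)
  have "inner (real (card (E F)) *\<^sub>R \<Sum>(E F') - real (card (E F')) *\<^sub>R \<Sum>(E F)) x = real (card (E F)) * (\<Sum>w\<in>E F'. inner w x - inner v x)"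
   using sum.cong[OF refl eq, of "E F" "%f. f"] by (simp add: inner_diff_left inner_sum_left sum_subtractf right_diff_distrib)
  moreover have "0 < card (E F)" using E0[OF F(1)] E[OF F(1)] by auto
  moreover have "0 \<le> (\<Sum>w\<in>E F'. inner w x - inner v x)" using le P' by (intro sum_nonneg) simp
  moreover have "x \<in> N F'" if "(\<Sum>w\<in>E F'. inner w x - inner v x) = 0"
  proof -
   have "inner w x - inner v x = 0" if "w \<in> E F'" for w
    using sum_nonneg_eq_0_iff[OF E(1)[OF F(2)], of "%w. inner w x - inner v x"] le P' \<open>_ = 0\<close> that by simp
   thus ?thesis using le EF x by (intro NE[OF F(2)]) (auto simp: inner_commute N_def)
  qed
  ultimately show ?thesis by simp
 qed
 have sep: "\<exists>w\<in>lattice_points n e. (\<forall>x\<in>N F. 0 \<le> inner w x \<and> (inner w x = 0 --> x \<in> N F')) \<and>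
   (\<forall>x\<in>N F'. inner w x \<le> 0 \<and> (inner w x = 0 --> x \<in> N F))" if F: "F \<in> ?\<F>" "F' \<in> ?\<F>" for F F'
 proof (intro bexI[of _ "real (card (E F)) *\<^sub>R \<Sum>(E F') - real (card (E F')) *\<^sub>R \<Sum>(E F)"] conjI ballI)
  fix x
  show "x \<in> N F ==> 0 \<le> inner (real (card (E F)) *\<^sub>R \<Sum>(E F') - real (card (E F')) *\<^sub>R \<Sum>(E F)) x"
   "x \<in> N F ==> inner (real (card (E F)) *\<^sub>R \<Sum>(E F') - real (card (E F')) *\<^sub>R \<Sum>(E F)) x = 0 --> x \<in> N F'"
   using sep1[OF F] by blast+
  show "x \<in> N F' ==> inner (real (card (E F)) *\<^sub>R \<Sum>(E F') - real (card (E F')) *\<^sub>R \<Sum>(E F)) x \<le> 0"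
   "x \<in> N F' ==> inner (real (card (E F)) *\<^sub>R \<Sum>(E F') - real (card (E F')) *\<^sub>R \<Sum>(E F)) x = 0 --> x \<in> N F"
   using sep1[OF F(2,1), of x] by (auto simp: inner_diff_left)
 next
  have s: "\<Sum>(E F) \<in> ?V \<and> (\<forall>i<n. inner (\<Sum>(E F)) (e i) \<in> \<int>)" if "F \<in> ?\<F>" for F
   using E[OF that] span_sum[of "E F" "%x. x"] by (auto simp: lattice_points_def subset_iff inner_sum_left)
  show "real (card (E F)) *\<^sub>R \<Sum>(E F') - real (card (E F')) *\<^sub>R \<Sum>(E F) \<in> lattice_points n e"
   using s[OF F(1)] s[OF F(2)] unfolding lattice_points_def
   by (auto simp: inner_diff_left intro!: span_diff span_mul)
 qed
 have "x \<in> \<Union>(N ` ?\<F>)" if x: "x \<in> ?V" for x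
 proof -
  obtain p where p: "p \<in> P" "\<And>w. w \<in> P ==> inner x p \<le> inner x w"
   using continuous_attains_inf[OF polytope_imp_compact[OF poly(1)] _ continuous_on_inner[OF continuous_on_const continuous_on_id], of x] P0 by blast
  \<comment> \<open>\<open>x\<close> belongs to the normal cone of the face on which it attains its
    minimum over \<open>P\<close>.\<close>
  let ?F = "P \<inter> {w. inner x w = inner x p}"
  have "?F \<in> ?\<F>" using face_of_Int_supporting_hyperplane_ge[OF polytope_imp_convex[OF poly(1)]] p(2) p(1) by auto
  moreover have "x \<in> N ?F" using x p by (auto simp: N_def)
  ultimately show ?thesis by blast
 qed
 hence "\<Union>(N ` ?\<F>) = ?V" by (auto simp: N_def)
 moreover have "finite ?\<F>" using finite_polytope_faces[OF poly(1)] by auto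
 ultimately show ?thesis unfolding separated_fan_def nf using rat strong sep by auto
qed

text \<open>All cases take \<open>l = 0\<close>. The second witness is the torus rank for toric
  varieties, \<open>T\<close>-manifolds and quasitoric spaces, and the dimension \<open>d\<close> of
  the polytope for moment-angle and locally \<open>k\<close>-standard manifolds, where
  \<open>m - d\<close> and \<open>k\<close> circle directions remain.\<close>

theorem theorem1p2:
  fixes X :: "'x topology" and act :: "'x taction" and A :: "'x chart set"
    and e :: "nat \<Rightarrow> 'a::euclidean_space" and \<Sigma> :: "'a set set" and Q :: "'a set"
    and P :: "'p::euclidean_space set" and \<mu> :: "'p set \<Rightarrow> nat \<Rightarrow> int" and F :: "nat \<Rightarrow> 'p set"
    and d m k :: nat
  shows
   "(complete_toric_variety d e \<Sigma> X act \<longrightarrow>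
       (\<exists>l n. locally_standard_T_pseudomanifold l n d X act)) \<and>
    (projective_toric_variety d e Q X act \<longrightarrow>
       (\<exists>l n. locally_standard_T_pseudomanifold l n d X act)) \<and>
    (locally_standard_T_manifold m X A act \<longrightarrow>
       (\<exists>l n. locally_standard_T_pseudomanifold l n m X act)) \<and>
    (locally_standard_torus_manifold m X A act \<longrightarrow>
       (\<exists>l n. locally_standard_T_pseudomanifold l n m X act)) \<and>
    (quasitoric_manifold d P X A act \<longrightarrow>
       (\<exists>l n. locally_standard_T_pseudomanifold l n d X act)) \<and>
    (quasitoric_orbifold d P \<mu> X act \<longrightarrow>
       (\<exists>l n. locally_standard_T_pseudomanifold l n d X act)) \<and>
    (moment_angle_manifold d m P F X act \<longrightarrow>
       (\<exists>l n. locally_standard_T_pseudomanifold l n m X act)) \<and>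
    (locally_k_standard_T_manifold d k P X A act \<longrightarrow>
       (\<exists>l n. locally_standard_T_pseudomanifold l n (d + k) X act))"
proof (intro conjI impI)
 have T: "\<exists>l n. locally_standard_T_pseudomanifold l n m X act" if "toric_like n m X act" for n m
  using toric_like_pseudomanifold[OF that] by blast
 have M: "\<exists>l n. locally_standard_T_pseudomanifold l n m X act"
  if "locally_standard_T_manifold m X A act" for m
  using that T locally_modelled_toric_like[of m 0 X A act]
  by (simp add: locally_standard_T_manifold_def smooth_manifold_def)
 \<comment> \<open>Quasitoric manifolds are the case of no circle directions. Compactness and
   nonemptiness are deduced from the orbit polytope.\<close>
 have K: "\<exists>l n. locally_standard_T_pseudomanifold l n (d + k) X act"
  if "torus_action (d + k) X act" "smooth_manifold j X A" "simple_polytope d P"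
   "locally_modelled d k X A act" "orbit_space_polytope d k X act P" for k j
 proof -
  have h: "Hausdorff_space X" "second_countable X" using that(2) by (auto simp: smooth_manifold_def)
  show ?thesis
   using T[OF locally_modelled_toric_like[OF that(4,1) _ h]]
    compact_over_polytope[OF that(1) h(1) that(3,5)] by blast
 qed
 show "\<exists>l n. locally_standard_T_pseudomanifold l n d X act" if "complete_toric_variety d e \<Sigma> X act"
  using that unfolding complete_toric_variety_def
  by (intro T[OF toric_variety_toric_like]) (auto intro: complete_fan_separated)
 show "\<exists>l n. locally_standard_T_pseudomanifold l n d X act" if "projective_toric_variety d e Q X act"
  using that unfolding projective_toric_variety_def
  by (intro T[OF toric_variety_toric_like]) (auto intro: normal_fan_separated)
 show "\<exists>l n. locally_standard_T_pseudomanifold l n m X act" if "locally_standard_T_manifold m X A act"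
  using M[OF that] .
 show "\<exists>l n. locally_standard_T_pseudomanifold l n m X act" if "locally_standard_torus_manifold m X A act"
  using M that unfolding locally_standard_torus_manifold_def by blast
 show "\<exists>l n. locally_standard_T_pseudomanifold l n d X act" if "quasitoric_manifold d P X A act"
  using that K[of 0] by (auto simp: quasitoric_manifold_def)
 show "\<exists>l n. locally_standard_T_pseudomanifold l n d X act" if "quasitoric_orbifold d P \<mu> X act"
  using T[OF quasitoric_orbifold_toric_like[OF that]] .
 show "\<exists>l n. locally_standard_T_pseudomanifold l n m X act" if "moment_angle_manifold d m P F X act"
  using T[OF moment_angle_manifold_toric_like[OF that]] .
 show "\<exists>l n. locally_standard_T_pseudomanifold l n (d + k) X act"
  if "locally_k_standard_T_manifold d k P X A act"
  using that K[of k] by (auto simp: locally_k_standard_T_manifold_def smooth_torus_action_def)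
qed

end
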